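(* Let $n\ge5$ and let $D$ be a bracket generating rank $2$ distribution with $5$-dimensional cube on an $n$-dimensional manifold $M$. At a generic point of $M_{n-5}$, the Tanaka symbol of the $(n-5)$th iterated Cartan prolongation $\mathrm{pr}^{n-5}D$ is isomorphic, as a graded Lie algebra, to $\mathfrak s^{(n-5),n}$.
   Context: Everything is real and smooth. The weak derived flag of a distribution $D$ is $D^{-1}=D$, $D^{-i}(q)=D^{-i+1}(q)+\{[V,W](q): W\in\Gamma(D), V\in\Gamma(D^{-i+1})\}$ ($D^0=0$). $D$ is bracket generating if $D^{-\mu}=TM$ for some $\mu$; it has $5$-dimensional cube if $\dim D^{-3}(q)=5$ for all $q$. The Tanaka symbol of $D$ at $q$ is $\mathfrak m(q)=\bigoplus_{i\ge1}D^{-i}(q)/D^{-i+1}(q)$ (the $i$-th summand in degree $-i$) with the graded Lie algebra structure induced by the bracket of vector fields. "At a generic point" means at every point of an open dense subset. Cartan prolongation: for a rank $2$ distribution $D$ on $M$, let $M_1=\mathbb PD$ with projection $p:\mathbb PD\to M$; $\mathrm{pr}D$ is the rank $2$ distribution on $M_1$ with $(\mathrm{pr}D)(q,\ell)=\{v\in T_{(q,\ell)}\mathbb PD:p_*v\in\ell\}$. Recursively $\mathrm{pr}^0D=D$, $M_0=M$, $M_i=\mathbb P(\mathrm{pr}^{i-1}D)$, $\mathrm{pr}^iD=\mathrm{pr}(\mathrm{pr}^{i-1}D)$. The Lie algebra $\mathfrak{gl}_2(\mathbb R)\rtimes\mathfrak{heis}_{2n-5}$: $\mathfrak{gl}_2(\mathbb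 R)$ has basis $Y,H,E,X$ with nontrivial brackets $[X,Y]=H$, $[H,X]=2X$, $[H,Y]=-2Y$ ($E$ central). $\mathfrak{heis}_{2n-5}$ has basis $\varepsilon_1,\dots,\varepsilon_{2n-6},\eta$ with nontrivial brackets $[\varepsilon_i,\varepsilon_{2n-5-i}]=(-1)^i\eta$, $1\le i\le 2n-6$. The action is: $[H,\varepsilon_i]=(2i+5-2n)\varepsilon_i$, $[H,\eta]=0$; $[E,\varepsilon_i]=\varepsilon_i$, $[E,\eta]=2\eta$; $[X,\varepsilon_i]=\varepsilon_{i+1}$ for $1\le i\le 2n-7$, $[X,\varepsilon_{2n-6}]=0$, $[X,\eta]=0$; $[Y,\varepsilon_1]=0$, $[Y,\varepsilon_i]=(i-1)(2n-5-i)\varepsilon_{i-1}$ for $2\le i\le 2n-6$, $[Y,\eta]=0$. For $0\le k\le n-4$, $\mathfrak s^{k,n}$ is the negative part of this Lie algebra with grading $\mathrm{wght}(Y)=1$, $\mathrm{wght}(H)=\mathrm{wght}(E)=0$, $\mathrm{wght}(X)=-1$, $\mathrm{wght}(\varepsilon_i)=n-4-k-i$, $\mathrm{wght}(\eta)=-3-2k$ (i.e. $\mathfrak s^{k,n}$ is spanned by $X$, $\eta$ and $\varepsilon_i$ with $i\ge n-3-k$). *)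

theory Defs
  imports "HOL-Analysis.Analysis" "HOL-Library.Function_Algebras" "HOL-Library.Equipollence"
begin

section \<open>Functions as a real vector space\<close>

instantiation "fun" :: (type, real_vector) real_vector
begin

definition "scaleR r f = (\<lambda>x. scaleR r (f x))"

instance
  by standard (simp_all add: scaleR_fun_def fun_eq_iff scaleR_add_right scaleR_add_left)

end


section \<open>Smooth manifolds\<close>

text \<open>The dimension of a manifold varies with the number of prolongations, so coordinates live in
  \<^const>\<open>Euclidean_space\<close> \<open>n\<close>, i.e. in sequences vanishing from index \<open>n\<close> on; the coordinates
  are numbered \<open>0, \<dots>, n - 1\<close>.\<close>

definition partial :: "nat \<Rightarrow> ((nat \<Rightarrow> real) \<Rightarrow> real) \<Rightarrow> (nat \<Rightarrow> real) \<Rightarrow> real" where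
  "partial i f x = deriv (\<lambda>t. f (x(i := t))) (x i)"

primrec C_k :: "nat \<Rightarrow> nat \<Rightarrow> (nat \<Rightarrow> real) set \<Rightarrow> ((nat \<Rightarrow> real) \<Rightarrow> real) \<Rightarrow> bool" where
  "C_k n 0 S f \<longleftrightarrow> continuous_map (subtopology (Euclidean_space n) S) euclideanreal f"
| "C_k n (Suc k) S f \<longleftrightarrow>
     continuous_map (subtopology (Euclidean_space n) S) euclideanreal f \<and>
     (\<forall>i<n. (\<forall>x\<in>S. (\<lambda>t. f (x(i := t))) differentiable (at (x i))) \<and> C_k n k S (partial i f))"

definition C_infinity :: "nat \<Rightarrow> (nat \<Rightarrow> real) set \<Rightarrow> ((nat \<Rightarrow> real) \<Rightarrow> real) \<Rightarrow> bool" where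
  "C_infinity n S f \<longleftrightarrow> (\<forall>k. C_k n k S f)"

type_synonym 'a chart = "'a set \<times> ('a \<Rightarrow> nat \<Rightarrow> real)"

record 'a mfd =
  mdim :: nat
  atlas :: "'a chart set"

definition points :: "'a mfd \<Rightarrow> 'a set" where
  "points M = (\<Union>(U, \<phi>)\<in>atlas M. U)"

definition mtop :: "'a mfd \<Rightarrow> 'a topology" where
  "mtop M = topology (\<lambda>S. S \<subseteq> points M \<and>
     (\<forall>(U, \<phi>)\<in>atlas M. openin (Euclidean_space (mdim M)) (\<phi> ` (S \<inter> U))))"

definition smooth_manifold :: "'a mfd \<Rightarrow> bool" where
  "smooth_manifold M \<longleftrightarrow>
     (\<forall>(U, \<phi>)\<in>atlas M. inj_on \<phi> U \<and> openin (Euclidean_space (mdim M)) (\<phi> ` U)) \<and>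
     (\<forall>(U, \<phi>)\<in>atlas M. \<forall>(V, \<psi>)\<in>atlas M.
        openin (Euclidean_space (mdim M)) (\<phi> ` (U \<inter> V)) \<and>
        (\<forall>j<mdim M. C_infinity (mdim M) (\<phi> ` (U \<inter> V)) (\<lambda>x. \<psi> (inv_into U \<phi> x) j))) \<and>
     Hausdorff_space (mtop M) \<and> second_countable (mtop M)"

definition smooth_on :: "'a mfd \<Rightarrow> 'a set \<Rightarrow> ('a \<Rightarrow> real) \<Rightarrow> bool" where
  "smooth_on M S f \<longleftrightarrow>
     (\<forall>(U, \<phi>)\<in>atlas M. C_infinity (mdim M) (\<phi> ` (S \<inter> U)) (\<lambda>x. f (inv_into U \<phi> x)))"

abbreviation smooth_fun :: "'a mfd \<Rightarrow> ('a \<Rightarrow> real) \<Rightarrow> bool" where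
  "smooth_fun M f \<equiv> smooth_on M (points M) f"


section \<open>Tangent vectors, vector fields and the Lie bracket\<close>

text \<open>Tangent vectors are derivations of the algebra of smooth functions. They are set to \<open>0\<close> on
  functions that are not smooth, so that equality of tangent vectors is equality of functionals.
  Smooth functions carry no condition outside \<^const>\<open>points\<close>; the Leibniz rule
  forces derivations to ignore the values there.\<close>

type_synonym 'a tvec = "('a \<Rightarrow> real) \<Rightarrow> real"

definition tangent_space :: "'a mfd \<Rightarrow> 'a \<Rightarrow> 'a tvec set" where
  "tangent_space M q = {v.
     (\<forall>f g. smooth_fun M f \<longrightarrow> smooth_fun M g \<longrightarrow> v (\<lambda>x. f x + g x) = v f + v g) \<and>
     (\<forall>c f. smooth_fun M f \<longrightarrow> v (\<lambda>x. c * f x) = c * v f) \<and>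
     (\<forall>f g. smooth_fun M f \<longrightarrow> smooth_fun M g \<longrightarrow>
        v (\<lambda>x. f x * g x) = f q * v g + g q * v f) \<and>
     (\<forall>f. \<not> smooth_fun M f \<longrightarrow> v f = 0)}"

definition pushforward :: "'b mfd \<Rightarrow> ('a \<Rightarrow> 'b) \<Rightarrow> 'a tvec \<Rightarrow> 'b tvec" where
  "pushforward N h v = (\<lambda>f. if smooth_fun N f then v (f \<circ> h) else 0)"

definition smooth_vf_on :: "'a mfd \<Rightarrow> 'a set \<Rightarrow> ('a \<Rightarrow> 'a tvec) \<Rightarrow> bool" where
  "smooth_vf_on M S V \<longleftrightarrow> (\<forall>q\<in>S. V q \<in> tangent_space M q) \<and>
     (\<forall>f. smooth_fun M f \<longrightarrow> smooth_on M S (\<lambda>q. V q f))"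

definition lie_bracket :: "('a \<Rightarrow> 'a tvec) \<Rightarrow> ('a \<Rightarrow> 'a tvec) \<Rightarrow> 'a \<Rightarrow> 'a tvec" where
  "lie_bracket V W q = (\<lambda>f. V q (\<lambda>x. W x f) - W q (\<lambda>x. V x f))"


section \<open>Distributions and the weak derived flag\<close>

text \<open>A \<open>'a dist\<close> is any assignment of a set of tangent vectors to each point; the members of the
  weak derived flag need not have constant rank.\<close>

type_synonym 'a dist = "'a \<Rightarrow> 'a tvec set"

definition sections :: "'a mfd \<Rightarrow> 'a dist \<Rightarrow> ('a \<Rightarrow> 'a tvec) set" where
  "sections M D = {V. smooth_vf_on M (points M) V \<and> (\<forall>q\<in>points M. V q \<in> D q)}"

definition local_frame ::
  "'a mfd \<Rightarrow> 'a dist \<Rightarrow> 'a set \<Rightarrow> ('a \<Rightarrow> 'a tvec) \<Rightarrow> ('a \<Rightarrow> 'a tvec) \<Rightarrow> bool" where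
  "local_frame M D S V W \<longleftrightarrow> openin (mtop M) S \<and> smooth_vf_on M S V \<and> smooth_vf_on M S W \<and>
     (\<forall>q\<in>S. D q = span {V q, W q} \<and> dim (D q) = 2)"

definition rank2_distribution :: "'a mfd \<Rightarrow> 'a dist \<Rightarrow> bool" where
  "rank2_distribution M D \<longleftrightarrow> (\<forall>q\<in>points M. \<exists>S V W. q \<in> S \<and> local_frame M D S V W)"

text \<open>\<open>weak_flag M D i\<close> is $D^{-i}$. The sum in the recursion is a sum of linear spaces, hence the
  span: the brackets at \<open>q\<close> alone need not be closed under addition.\<close>

fun weak_flag :: "'a mfd \<Rightarrow> 'a dist \<Rightarrow> nat \<Rightarrow> 'a dist" where
  "weak_flag M D 0 = (\<lambda>q. {0})"
| "weak_flag M D (Suc 0) = D"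
| "weak_flag M D (Suc (Suc i)) = (\<lambda>q. span (weak_flag M D (Suc i) q \<union>
     {lie_bracket V W q | V W. W \<in> sections M D \<and> V \<in> sections M (weak_flag M D (Suc i))}))"

definition bracket_generating :: "'a mfd \<Rightarrow> 'a dist \<Rightarrow> bool" where
  "bracket_generating M D \<longleftrightarrow> (\<exists>\<mu>. \<forall>q\<in>points M. weak_flag M D \<mu> q = tangent_space M q)"

definition five_dimensional_cube :: "'a mfd \<Rightarrow> 'a dist \<Rightarrow> bool" where
  "five_dimensional_cube M D \<longleftrightarrow> (\<forall>q\<in>points M. dim (weak_flag M D 3 q) = 5)"


section \<open>Graded Lie algebras and the Tanaka symbol\<close>

text \<open>Negatively graded algebras given by their homogeneous components: \<open>homog G i\<close> is the
  component of degree \<open>-i\<close>, only \<open>i \<ge> 1\<close> matters, and the operations on it carry its index.\<close>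

record 'v graded_alg =
  homog :: "nat \<Rightarrow> 'v set"
  hadd :: "nat \<Rightarrow> 'v \<Rightarrow> 'v \<Rightarrow> 'v"
  hscale :: "nat \<Rightarrow> real \<Rightarrow> 'v \<Rightarrow> 'v"
  hbracket :: "nat \<Rightarrow> nat \<Rightarrow> 'v \<Rightarrow> 'v \<Rightarrow> 'v"

definition graded_iso :: "'v graded_alg \<Rightarrow> 'w graded_alg \<Rightarrow> bool" where
  "graded_iso G H \<longleftrightarrow> (\<exists>F :: nat \<Rightarrow> 'v \<Rightarrow> 'w.
     (\<forall>i\<ge>1. bij_betw (F i) (homog G i) (homog H i) \<and>
        (\<forall>x\<in>homog G i. \<forall>y\<in>homog G i.
           hadd G i x y \<in> homog G i \<and> F i (hadd G i x y) = hadd H i (F i x) (F i y)) \<and>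
        (\<forall>c. \<forall>x\<in>homog G i.
           hscale G i c x \<in> homog G i \<and> F i (hscale G i c x) = hscale H i c (F i x))) \<and>
     (\<forall>i\<ge>1. \<forall>j\<ge>1. \<forall>x\<in>homog G i. \<forall>y\<in>homog G j.
        hbracket G i j x y \<in> homog G (i + j) \<and>
        F (i + j) (hbracket G i j x y) = hbracket H i j (F i x) (F j y)))"

text \<open>Elements of $D^{-i}(q)/D^{-i+1}(q)$ are cosets. The bracket of two cosets \<open>A\<close>, \<open>B\<close> is the
  union of the cosets of $[V,W](q)$ modulo $D^{-i-j+1}(q)$ over all sections \<open>V\<close>, \<open>W\<close> of $D^{-i}$,
  $D^{-j}$ extending \<open>A\<close>, \<open>B\<close>. This is the induced bracket when it is independent of the
  extensions; otherwise the union is not a coset and \<^const>\<open>graded_iso\<close> fails by its closure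
  clause.\<close>

definition tanaka_symbol :: "'a mfd \<Rightarrow> 'a dist \<Rightarrow> 'a \<Rightarrow> 'a tvec set graded_alg" where
  "tanaka_symbol M D q = \<lparr>
     homog = (\<lambda>i. {(+) v ` weak_flag M D (i - 1) q | v. v \<in> weak_flag M D i q}),
     hadd = (\<lambda>i A B. {a + b | a b. a \<in> A \<and> b \<in> B}),
     hscale = (\<lambda>i c A. {c *\<^sub>R a + u | a u. a \<in> A \<and> u \<in> weak_flag M D (i - 1) q}),
     hbracket = (\<lambda>i j A B. {lie_bracket V W q + u | V W u.
        V \<in> sections M (weak_flag M D i) \<and> V q \<in> A \<and>
        W \<in> sections M (weak_flag M D j) \<and> W q \<in> B \<and>
        u \<in> weak_flag M D (i + j - 1) q}) \<rparr>"


section \<open>Cartan prolongation\<close>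

text \<open>The charts of $\mathbb PD$: over a chart \<open>\<phi>\<close> of \<open>M\<close> and a local frame \<open>V, W\<close> of \<open>D\<close>, the line
  through \<open>V + tW\<close> at \<open>q\<close> has coordinates \<open>(\<phi>(q), t)\<close>. Exchanging \<open>V\<close> and \<open>W\<close> covers the line
  through \<open>W\<close>.\<close>

definition proj_bundle :: "'a mfd \<Rightarrow> 'a dist \<Rightarrow> ('a \<times> 'a tvec set) mfd" where
  "proj_bundle M D = \<lparr> mdim = mdim M + 1,
     atlas = {({(q, l). q \<in> U \<inter> S \<and> (\<exists>t. l = span {V q + t *\<^sub>R W q})},
               \<lambda>(q, l). (\<phi> q)(mdim M := (THE t. l = span {V q + t *\<^sub>R W q}))) | U \<phi> S V W.
              (U, \<phi>) \<in> atlas M \<and> local_frame M D S V W} \<rparr>"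

definition lifted_dist :: "'a mfd \<Rightarrow> 'a dist \<Rightarrow> ('a \<times> 'a tvec set) dist" where
  "lifted_dist M D = (\<lambda>(q, l).
     {v \<in> tangent_space (proj_bundle M D) (q, l). pushforward M fst v \<in> l})"

lemma points_proj_bundle:
  fixes M :: "'a mfd"
  assumes "rank2_distribution M D"
  shows "points (proj_bundle M D) =
    {(q, l). q \<in> points M \<and> l \<subseteq> D q \<and> subspace l \<and> dim l = 1}" (is "?L = ?R")
proof (intro equalityI subsetI)
  fix z assume "z \<in> ?L"
  then obtain U \<phi> S V W q l t where UP: "(U, \<phi>) \<in> atlas M" and fr: "local_frame M D S V W"
    and z: "z = (q, l)" and q: "q \<in> U" "q \<in> S" and l: "l = span {V q + t *\<^sub>R W q}"
    by (fastforce simp: points_def proj_bundle_def)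
  have D: "D q = span {V q, W q}" and d2: "dim (D q) = 2"
    using fr q by (auto simp: local_frame_def)
  have "V q + t *\<^sub>R W q \<in> D q"
    unfolding D by (intro span_add span_scale span_base) auto
  then have "l \<subseteq> D q"
    unfolding l using D by (metis empty_subsetI insert_subset span_minimal subspace_span)
  moreover have "V q + t *\<^sub>R W q \<noteq> 0"
  proof
    assume "V q + t *\<^sub>R W q = 0"
    then have "V q = (- t) *\<^sub>R W q" by (simp add: eq_neg_iff_add_eq_0)
    then have "V q \<in> span {W q}" by (metis span_base span_scale insertI1)
    then have "D q \<subseteq> span {W q}"
      unfolding D by (intro span_minimal) (auto intro: span_base)
    then have "dim (D q) \<le> card {W q}" by (intro dim_le_card) auto
    with d2 show False by simp
  qed
  then have "dim l = 1"
    unfolding l by (simp add: dim_eq_card_independent)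
  moreover have "q \<in> points M" using UP q by (auto simp: points_def)
  ultimately show "z \<in> ?R" by (simp add: z l)
next
  fix z assume "z \<in> ?R"
  then obtain q l where z: "z = (q, l)" and q: "q \<in> points M" and l: "l \<subseteq> D q" "subspace l" "dim l = 1"
    by blast
  obtain S V W where S: "q \<in> S" and fr: "local_frame M D S V W"
    using assms q by (auto simp: rank2_distribution_def)
  obtain U \<phi> where UP: "(U, \<phi>) \<in> atlas M" "q \<in> U" using q by (auto simp: points_def)
  have fr': "local_frame M D S W V"
    using fr by (auto simp: local_frame_def insert_commute)
  obtain B where B: "B \<subseteq> l" "independent B" "l \<subseteq> span B" "card B = 1"
    using basis_exists[of l] l by metis
  then obtain x where Bx: "B = {x}" using card_1_singletonE by blast
  have lx: "l = span {x}" using B Bx l by (metis span_minimal subset_antisym)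
  have x0: "x \<noteq> 0" using B Bx by auto
  have "x \<in> span {V q, W q}" using B Bx l fr S by (auto simp: local_frame_def)
  then obtain a b where x: "x = a *\<^sub>R V q + b *\<^sub>R W q"
    by (auto simp: span_breakdown_eq[of _ "V q"] span_singleton algebra_simps)
  have sc: "span {c *\<^sub>R y} = span {y}" if "c \<noteq> 0" for c :: real and y :: "'a tvec"
  proof
    show "span {c *\<^sub>R y} \<subseteq> span {y}"
      by (intro span_minimal subspace_span) (simp add: span_scale span_base)
    have "inverse c *\<^sub>R c *\<^sub>R y \<in> span {c *\<^sub>R y}"
      by (intro span_scale span_base) simp
    then show "span {y} \<subseteq> span {c *\<^sub>R y}"
      using that by (intro span_minimal subspace_span) simp
  qed
  have "\<exists>V W t. local_frame M D S V W \<and> l = span {V q + t *\<^sub>R W q}"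
  proof (cases "a = 0")
    case True
    then have "b \<noteq> 0" using x x0 by auto
    then have "l = span {W q + 0 *\<^sub>R V q}" using lx x True sc by simp
    then show ?thesis using fr' by blast
  next
    case False
    then have "x = a *\<^sub>R (V q + (b / a) *\<^sub>R W q)" using x by (simp add: scaleR_add_right)
    then have "l = span {V q + (b / a) *\<^sub>R W q}" using lx sc False by metis
    then show ?thesis using fr by blast
  qed
  then obtain V W t where "local_frame M D S V W" and "l = span {V q + t *\<^sub>R W q}"
    by blast
  with UP S show "z \<in> ?L"
    unfolding points_def proj_bundle_def z by auto blast
qed

text \<open>The points of $\mathbb PD$ have a larger type than those of \<open>M\<close>. To iterate, $\mathbb PD$ with
  its distribution is carried over to the point type of \<open>M\<close> along an injection, which exists because
  \<open>M\<close> already has the cardinality of the continuum at least; see \<open>ex_inj_proj_bundle\<close> below.\<close>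

definition copy_mfd :: "('b \<Rightarrow> 'a) \<Rightarrow> 'b mfd \<Rightarrow> 'a mfd" where
  "copy_mfd h N = \<lparr> mdim = mdim N,
     atlas = {(h ` U, \<phi> \<circ> inv_into (points N) h) | U \<phi>. (U, \<phi>) \<in> atlas N} \<rparr>"

definition copy_dist :: "('b \<Rightarrow> 'a) \<Rightarrow> 'b mfd \<Rightarrow> 'b dist \<Rightarrow> 'a dist" where
  "copy_dist h N E = (\<lambda>x. pushforward (copy_mfd h N) h ` E (inv_into (points N) h x))"

definition cartan_prolongation :: "'a mfd \<times> 'a dist \<Rightarrow> 'a mfd \<times> 'a dist" where
  "cartan_prolongation = (\<lambda>(M, D).
     let P = proj_bundle M D; h = (SOME h :: 'a \<times> 'a tvec set \<Rightarrow> 'a. inj_on h (points P))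
     in (copy_mfd h P, copy_dist h P (lifted_dist M D)))"

definition prolonged_mfd :: "nat \<Rightarrow> 'a mfd \<Rightarrow> 'a dist \<Rightarrow> 'a mfd" where
  "prolonged_mfd k M D = fst ((cartan_prolongation ^^ k) (M, D))"

definition prolonged_dist :: "nat \<Rightarrow> 'a mfd \<Rightarrow> 'a dist \<Rightarrow> 'a dist" where
  "prolonged_dist k M D = snd ((cartan_prolongation ^^ k) (M, D))"

lemma ex_inj_proj_bundle:
  fixes M :: "'a mfd"
  assumes M: "smooth_manifold M" "mdim M \<ge> 1" and D: "rank2_distribution M D"
  shows "\<exists>h :: 'a \<times> 'a tvec set \<Rightarrow> 'a. inj_on h (points (proj_bundle M D))"
proof (cases "points M = {}")
  case True
  then show ?thesis using points_proj_bundle[OF D] by auto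
next
  case False
  then obtain q0 U \<phi> where UP: "(U, \<phi>) \<in> atlas M" and q0: "q0 \<in> U"
    by (auto simp: points_def)
  let ?E = "Euclidean_space (mdim M)"
  have inj: "inj_on \<phi> U" and op: "openin ?E (\<phi> ` U)"
    using M UP by (auto simp: smooth_manifold_def)
  have x0: "\<phi> q0 \<in> topspace ?E" using op q0 by (meson imageI in_mono openin_subset)
  have c: "continuous_map euclideanreal ?E (\<lambda>t. (\<phi> q0)(0 := t))"
    using x0 M unfolding Euclidean_space_def continuous_map_in_subtopology
    by (auto simp: continuous_map_componentwise_UNIV topspace_Euclidean_space fun_upd_def)
  define T where "T = {t. (\<phi> q0)(0 := t) \<in> \<phi> ` U}"
  have "open T"
    using openin_continuous_map_preimage[OF c op] by (simp add: T_def)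
  moreover have "\<phi> q0 0 \<in> T" using q0 by (simp add: T_def)
  ultimately obtain e where e: "e > 0" "ball (\<phi> q0 0) e \<subseteq> T"
    by (meson open_contains_ball)
  have "(UNIV :: real set) \<lesssim> {\<phi> q0 0 - e <..< \<phi> q0 0 + e}"
    using open_interval_eqpoll_reals e by (simp add: eqpoll_imp_lepoll eqpoll_sym)
  also have "\<dots> \<lesssim> T"
    using e by (intro subset_imp_lepoll) (auto simp: dist_real_def abs_less_iff subset_iff)
  also have "T \<lesssim> points M"
  proof -
    define r where "r = (\<lambda>t. inv_into U \<phi> ((\<phi> q0)(0 := t)))"
    have r: "\<phi> (r t) = (\<phi> q0)(0 := t) \<and> r t \<in> U" if "t \<in> T" for t
      using that unfolding T_def r_def by (simp add: f_inv_into_f inv_into_into)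
    have "t = u" if "t \<in> T" "u \<in> T" "r t = r u" for t u
    proof -
      have "(\<phi> q0)(0 := t) = (\<phi> q0)(0 := u)" using r that by metis
      then show ?thesis by (metis fun_upd_same)
    qed
    then have "inj_on r T" by (intro inj_onI)
    moreover have "r ` T \<subseteq> points M"
      using r UP unfolding points_def by blast
    ultimately show ?thesis unfolding lepoll_def by blast
  qed
  finally have R: "(UNIV :: real set) \<lesssim> points M" .
  then have inf: "infinite (points M)"
    unfolding lepoll_def using inj_on_finite infinite_UNIV_char_0 by blast
  have sq: "points M \<times> points M \<lesssim> points M"
    unfolding lepoll_def card_of_ordLeq
    using card_of_Times_same_infinite[OF inf] ordIso_imp_ordLeq by blast
  have "\<exists>f. \<forall>q\<in>points M. D q = span {fst (f q), snd (f q)}"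
  proof (intro bchoice ballI)
    fix q assume "q \<in> points M"
    then obtain V W where "D q = span {V q, W q}"
      using D unfolding rank2_distribution_def local_frame_def by blast
    then show "\<exists>p. D q = span {fst p, snd p}"
      by (intro exI[of _ "(V q, W q)"]) simp
  qed
  then obtain f where f: "\<And>q. q \<in> points M \<Longrightarrow> D q = span {fst (f q), snd (f q)}"
    by blast
  have "\<exists>a b. l = span {a *\<^sub>R fst (f q) + b *\<^sub>R snd (f q)}"
    if z: "(q, l) \<in> points (proj_bundle M D)" for q l
  proof -
    have l: "l \<subseteq> D q" "subspace l" "dim l = 1"
      using z points_proj_bundle[OF D] by auto
    obtain B where B: "B \<subseteq> l" "independent B" "l \<subseteq> span B" "card B = 1"
      using basis_exists[of l] l by metis
    then obtain x where Bx: "B = {x}" using card_1_singletonE by blast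
    have lx: "l = span {x}" using B Bx l by (metis span_minimal subset_antisym)
    have "x \<in> span {fst (f q), snd (f q)}" using B Bx l f[of q] z points_proj_bundle[OF D] by auto
    then obtain a b where "x = a *\<^sub>R fst (f q) + b *\<^sub>R snd (f q)"
      by (auto simp: span_breakdown_eq[of _ "fst (f q)"] span_singleton algebra_simps)
    then show ?thesis using lx by blast
  qed
  then obtain a b where ab: "\<And>q l. (q, l) \<in> points (proj_bundle M D) \<Longrightarrow>
      l = span {a q l *\<^sub>R fst (f q) + b q l *\<^sub>R snd (f q)}" by metis
  have "points (proj_bundle M D) \<lesssim> points M \<times> (UNIV :: real set) \<times> (UNIV :: real set)"
  proof -
    have "l = l'" if "(q, l) \<in> points (proj_bundle M D)" "(q, l') \<in> points (proj_bundle M D)"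
      "a q l = a q l'" "b q l = b q l'" for q l l'
      using ab[OF that(1)] ab[OF that(2)] that(3,4) by simp
    then have "inj_on (\<lambda>(q, l). (q, a q l, b q l)) (points (proj_bundle M D))"
      by (auto simp: inj_on_def)
    moreover have "(\<lambda>(q, l). (q, a q l, b q l)) ` points (proj_bundle M D)
        \<subseteq> points M \<times> UNIV \<times> UNIV"
      using points_proj_bundle[OF D] by auto
    ultimately show ?thesis unfolding lepoll_def by blast
  qed
  also have "\<dots> \<lesssim> points M \<times> points M \<times> points M"
    using R by (intro times_lepoll_mono) auto
  also have "\<dots> \<lesssim> points M \<times> points M"
    using sq by (intro times_lepoll_mono) auto
  also note sq
  finally show ?thesis by (auto simp: lepoll_def)
qed


section \<open>The algebra $\mathfrak{gl}_2(\mathbb R)\rtimes\mathfrak{heis}_{2n-5}$ and its negative part\<close>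

datatype gen = gY | gH | gE | gX | Eps nat | Eta

definition gens :: "nat \<Rightarrow> gen set" where
  "gens n = {gY, gH, gE, gX, Eta} \<union> Eps ` {1..2 * n - 6}"

definition gv :: "gen \<Rightarrow> gen \<Rightarrow> real" where
  "gv a = (\<lambda>b. if b = a then 1 else 0)"

text \<open>The table of brackets of generators, in both orders; \<open>act\<close> gives $[A, \varepsilon_i]$ and
  $[A, \eta]$ for \<open>A\<close> in \<open>{gY, gH, gE, gX}\<close>.\<close>

fun act :: "nat \<Rightarrow> gen \<Rightarrow> gen \<Rightarrow> gen \<Rightarrow> real" where
  "act n gH (Eps i) = (2 * real i + 5 - 2 * real n) *\<^sub>R gv (Eps i)"
| "act n gE (Eps i) = gv (Eps i)"
| "act n gX (Eps i) = (if i \<le> 2 * n - 7 then gv (Eps (i + 1)) else 0)"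
| "act n gY (Eps i) =
     (if i \<ge> 2 then ((real i - 1) * (2 * real n - 5 - real i)) *\<^sub>R gv (Eps (i - 1)) else 0)"
| "act n gE Eta = 2 *\<^sub>R gv Eta"
| "act n _ _ = 0"

fun gen_bracket :: "nat \<Rightarrow> gen \<Rightarrow> gen \<Rightarrow> gen \<Rightarrow> real" where
  "gen_bracket n gX gY = gv gH"
| "gen_bracket n gY gX = - gv gH"
| "gen_bracket n gH gX = 2 *\<^sub>R gv gX"
| "gen_bracket n gX gH = - 2 *\<^sub>R gv gX"
| "gen_bracket n gH gY = - 2 *\<^sub>R gv gY"
| "gen_bracket n gY gH = 2 *\<^sub>R gv gY"
| "gen_bracket n (Eps i) (Eps j) = (if i + j = 2 * n - 5 then (- 1) ^ i *\<^sub>R gv Eta else 0)"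
| "gen_bracket n (Eps i) Eta = 0"
| "gen_bracket n Eta (Eps i) = 0"
| "gen_bracket n Eta Eta = 0"
| "gen_bracket n a (Eps i) = act n a (Eps i)"
| "gen_bracket n (Eps i) a = - act n a (Eps i)"
| "gen_bracket n a Eta = act n a Eta"
| "gen_bracket n Eta a = - act n a Eta"
| "gen_bracket n _ _ = 0"

definition gl2_heis_bracket :: "nat \<Rightarrow> (gen \<Rightarrow> real) \<Rightarrow> (gen \<Rightarrow> real) \<Rightarrow> gen \<Rightarrow> real" where
  "gl2_heis_bracket n u v = (\<Sum>a\<in>gens n. \<Sum>b\<in>gens n. (u a * v b) *\<^sub>R gen_bracket n a b)"

fun wght :: "nat \<Rightarrow> nat \<Rightarrow> gen \<Rightarrow> int" where
  "wght k n gY = 1"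
| "wght k n gH = 0"
| "wght k n gE = 0"
| "wght k n gX = - 1"
| "wght k n (Eps i) = int n - 4 - int k - int i"
| "wght k n Eta = - 3 - 2 * int k"

definition s_alg :: "nat \<Rightarrow> nat \<Rightarrow> (gen \<Rightarrow> real) graded_alg" where
  "s_alg k n = \<lparr>
     homog = (\<lambda>i. span (gv ` {a \<in> gens n. wght k n a = - int i})),
     hadd = (\<lambda>i. (+)),
     hscale = (\<lambda>i. (*\<^sub>R)),
     hbracket = (\<lambda>i j. gl2_heis_bracket n) \<rparr>"

end

theory Submission
  imports Defs "HOL-Computational_Algebra.Polynomial"
begin

text \<open>Locally \<open>D\<close> is spanned by two fields \<open>Z\<close>, \<open>A\<close>. If \<open>s\<close> is the coordinate of the line spanned by
  \<open>Z + s A\<close>, the prolongation is spanned by (lifts of) \<open>Z' = Z + s A\<close> and \<open>A' = d/ds\<close>, and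
  \<open>[A', Z'] = A\<close>. Hence \<open>ad(Z')^(i + 1) A' = - ad(Z)^i A\<close> as long as \<open>[A, ad(Z)^j A] = 0\<close> for
  \<open>j < i\<close>. By induction, after \<open>k\<close> prolongations, and off the lines spanned by \<open>A\<close>, one has a frame
  with \<open>[A, ad(Z)^i A] = 0\<close> for \<open>i \<le> 2 k\<close> and \<open>[A, ad(Z)^(2 k + 1) A] = \<eta>\<close>; by the Jacobi identity
  \<open>[ad(Z)^a A, ad(Z)^b A]\<close> is \<open>0\<close> for \<open>a + b \<le> 2 k\<close> and \<open>(- 1)^a \<eta>\<close> for \<open>a + b = 2 k + 1\<close>. These are
  the relations of $\mathfrak s^{k,n}$ under \<open>X = Z\<close>, $\varepsilon_{i+2}$ \<open>= ad(Z)^i A\<close>.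

  For \<open>k = n - 5\<close> the dimension of the manifold is the number \<open>2 k + 5\<close> of the fields \<open>Z\<close>, \<open>\<eta>\<close>,
  \<open>ad(Z)^i A\<close> with \<open>i \<le> 2 k + 2\<close>. Where they are independent they are a frame adapted to the weak
  derived flag, and the symbol is read off from their brackets. They cannot be dependent on a whole
  open set: the span of the first independent ones would contain \<open>[Z, \<eta>]\<close> and be involutive,
  against bracket generation.\<close>

section \<open>Calculus on coordinate spaces\<close>

text \<open>For \<open>k = 0\<close> the relations only say [A, A] = 0 and name [A, [Z, A]] as
  \<open>\<eta>\<close>; it is the 5-dimensional cube that makes \<open>Z\<close>, \<open>A\<close>,
  [Z, A], [Z, [Z, A]] and \<open>\<eta>\<close> independent on a nonempty open set. A prolongation
  raises the critical order \<open>2 * k + 1\<close> by 2: one step is the index shift, the other is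
  due to the fibre coordinate \<open>s\<close>, which enters the iterated brackets only one step
  later than expected, as the coefficient - s of \<open>\<eta>\<close>; differentiating it by
  \<open>s\<close> produces the new \<open>\<eta>\<close> with its sign. The dimension grows by only
  1, and so does the number \<open>k + 5\<close> of fields that the induction keeps independent. At
  the end \<open>k\<close> more are needed; they are won by genericity, and this costs one further
  relation in the induction: [ad(Z)^a A, \<eta>] = 0 for \<open>a < k\<close>. A technical obstacle
  shapes the first half. Tangent vectors are derivations of globally defined functions and the flag
  is built from global sections, whereas frames, coordinates and lifts are local. Bump functions,
  Hadamard's lemma and smooth coefficients relative to a local frame bridge this gap.\<close>

definition cube :: "nat \<Rightarrow> (nat \<Rightarrow> real) \<Rightarrow> real \<Rightarrow> (nat \<Rightarrow> real) set" where
  "cube n x e = {y. (\<forall>i\<ge>n. y i = 0) \<and> (\<forall>i<n. \<bar>y i - x i\<bar> < e)}"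

lemma open_fun_contains_cube:
  assumes "open U" "x \<in> U" "\<forall>i\<ge>n. x i = 0"
  shows "\<exists>e>0. cube n x e \<subseteq> U"
proof -
  obtain X where X: "x \<in> Pi\<^sub>E UNIV X" "\<And>i. open (X i)" "Pi\<^sub>E UNIV X \<subseteq> U"
    using product_topology_open_contains_basis[of "\<lambda>i. euclidean" UNIV U x] assms
    by (auto simp: euclidean_product_topology)
  have "\<forall>i. \<exists>e>0. ball (x i) e \<subseteq> X i"
    using X by (meson PiE_E UNIV_I open_contains_ball)
  then obtain d where d: "\<And>i. d i > 0" "\<And>i. ball (x i) (d i) \<subseteq> X i" by metis
  \<comment> \<open>Only the first \<open>n\<close> coordinates vary inside the cube, so a finite
    minimum suffices although the box has infinitely many factors. The element 1 keeps the set
    nonempty for \<open>n = 0\<close>.\<close>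
  define e where "e = Min (insert 1 (d ` {..<n}))"
  have e: "e > 0" "\<And>i. i < n \<Longrightarrow> e \<le> d i" using d by (auto simp: e_def)
  have "cube n x e \<subseteq> U"
  proof
    fix y assume y: "y \<in> cube n x e"
    have "y i \<in> X i" for i
    proof (cases "i < n")
      case True
      then have "y i \<in> ball (x i) (d i)"
        using y e(2)[OF True] by (auto simp: cube_def dist_real_def abs_minus_commute)
      then show ?thesis using d by blast
    next
      case False
      then have "y i = x i" using y assms by (auto simp: cube_def)
      then show ?thesis using X by auto
    qed
    then show "y \<in> U" using X by auto
  qed
  with e show ?thesis by blast
qed

lemma Euclidean_space_eq: "Euclidean_space n = top_of_set {x. \<forall>i\<ge>n. x i = 0}"
  by (simp add: Euclidean_space_def euclidean_product_topology)

lemma openin_cube: "openin (Euclidean_space n) (cube n x e)"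
proof -
  let ?X = "\<lambda>i. if i < n then ball (x i) e else UNIV"
  have "open (Pi\<^sub>E UNIV ?X)"
    by (rule open_PiE) (auto intro!: finite_subset[of _ "{..<n}"])
  moreover have "cube n x e = {x. \<forall>i\<ge>n. x i = 0} \<inter> Pi\<^sub>E UNIV ?X"
    by (auto simp: cube_def PiE_iff dist_real_def abs_minus_commute split: if_splits)
  ultimately show ?thesis unfolding Euclidean_space_eq by (simp only: openin_open_Int)
qed

lemma cube_self: "\<forall>i\<ge>n. x i = 0 \<Longrightarrow> e > 0 \<Longrightarrow> x \<in> cube n x e"
  by (auto simp: cube_def)

text \<open>Cubes serve as the only basic neighbourhoods, so that openness comes down to finitely
  many real inequalities. They are also convex, which Hadamard's lemma needs, and stable under
  moving single coordinates, which the chain rule needs.\<close>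

lemma openin_Euclidean_space_iff:
  "openin (Euclidean_space n) S \<longleftrightarrow>
    (\<forall>x\<in>S. (\<forall>i\<ge>n. x i = 0) \<and> (\<exists>e>0. cube n x e \<subseteq> S))" (is "_ = ?R")
proof
  assume L: "openin (Euclidean_space n) S"
  then obtain U where U: "open U" "S = {x. \<forall>i\<ge>n. x i = 0} \<inter> U"
    unfolding Euclidean_space_eq by (auto simp: openin_open)
  show ?R
  proof
    fix x assume x: "x \<in> S"
    then obtain e where "e > 0" "cube n x e \<subseteq> U"
      using open_fun_contains_cube[of U x n] U by auto
    moreover have "cube n x e \<subseteq> {x. \<forall>i\<ge>n. x i = 0}" by (auto simp: cube_def)
    ultimately show "(\<forall>i\<ge>n. x i = 0) \<and> (\<exists>e>0. cube n x e \<subseteq> S)" using x U by auto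
  qed
next
  assume R: ?R
  show "openin (Euclidean_space n) S"
  proof (subst openin_subopen, intro ballI)
    fix x assume "x \<in> S"
    then obtain e where "e > 0" "cube n x e \<subseteq> S" "\<forall>i\<ge>n. x i = 0" using R by blast
    then show "\<exists>T. openin (Euclidean_space n) T \<and> x \<in> T \<and> T \<subseteq> S"
      by (intro exI[of _ "cube n x e"] conjI openin_cube cube_self)
  qed
qed

lemma openin_E_zero: "openin (Euclidean_space n) S \<Longrightarrow> x \<in> S \<Longrightarrow> i \<ge> n \<Longrightarrow> x i = 0"
  by (auto simp: openin_Euclidean_space_iff)

lemma openin_E_cube:
  "openin (Euclidean_space n) S \<Longrightarrow> x \<in> S \<Longrightarrow> \<exists>e>0. cube n x e \<subseteq> S"
  by (auto simp: openin_Euclidean_space_iff)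

lemma continuous_map_E_iff:
  assumes "openin (Euclidean_space n) S"
  shows "continuous_map (subtopology (Euclidean_space n) S) euclidean f \<longleftrightarrow> continuous_on S f"
proof -
  have "subtopology (Euclidean_space n) S = top_of_set S"
    using openin_subset[OF assms]
    by (simp add: Euclidean_space_eq subtopology_subtopology Int_absorb1)
  then show ?thesis by simp
qed

lemma continuous_on_cube:
  fixes f :: "(nat \<Rightarrow> real) \<Rightarrow> real"
  assumes "openin (Euclidean_space n) S" "continuous_on S f" "x \<in> S" "\<epsilon> > 0"
  shows "\<exists>e>0. \<forall>y\<in>cube n x e. y \<in> S \<and> \<bar>f y - f x\<bar> < \<epsilon>"
proof -
  have "openin (top_of_set S) (S \<inter> f -` ball (f x) \<epsilon>)"
    using assms(2) by (intro continuous_openin_preimage_gen) auto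
  moreover have "top_of_set S = subtopology (Euclidean_space n) S"
    using openin_subset[OF assms(1)]
    by (simp add: Euclidean_space_eq subtopology_subtopology Int_absorb1)
  ultimately have "openin (Euclidean_space n) (S \<inter> f -` ball (f x) \<epsilon>)"
    using assms(1) by (metis openin_open_subtopology)
  from openin_E_cube[OF this, of x] assms show ?thesis
    by (auto simp: dist_real_def abs_minus_commute subset_iff)
qed

section \<open>Partial derivatives and functions of class \<open>C_k\<close> on open sets of
  coordinate space\<close>

lemma upd_in_open:
  assumes "openin (Euclidean_space n) S" "x \<in> S" "i < n"
  shows "\<forall>\<^sub>F t in nhds (x i). x(i := t) \<in> S"
proof -
  obtain e where e: "e > 0" "cube n x e \<subseteq> S" using openin_E_cube assms by metis
  have "x(i := t) \<in> S" if "dist t (x i) < e" for t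
    using that e assms openin_E_zero[OF assms(1,2)]
    by (intro subsetD[OF e(2)]) (auto simp: cube_def dist_real_def)
  then show ?thesis using e by (auto simp: eventually_nhds_metric)
qed

text \<open>\<open>partial\<close> is built on \<open>deriv\<close> and has some value even where no
  derivative exists. The relational form also asserts existence and fits the derivative rules of the
  library.\<close>

definition has_pd :: "nat \<Rightarrow> ((nat \<Rightarrow> real) \<Rightarrow> real) \<Rightarrow> (nat \<Rightarrow> real) \<Rightarrow> real \<Rightarrow> bool" where
  "has_pd i f x D \<longleftrightarrow> ((\<lambda>t. f (x(i := t))) has_field_derivative D) (at (x i))"

lemma partial_eq: "has_pd i f x D \<Longrightarrow> partial i f x = D"
  by (simp add: has_pd_def partial_def DERIV_imp_deriv)

lemma has_pd_cong:
  assumes "openin (Euclidean_space n) S" "x \<in> S" "i < n" "\<And>y. y \<in> S \<Longrightarrow> f y = g y"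
  shows "has_pd i f x D \<longleftrightarrow> has_pd i g x D"
  unfolding has_pd_def
  by (rule DERIV_cong_ev)
    (use upd_in_open[OF assms(1-3)] assms(4) in \<open>auto elim: eventually_mono\<close>)

lemma partial_cong:
  assumes "openin (Euclidean_space n) S" "x \<in> S" "i < n" "\<And>y. y \<in> S \<Longrightarrow> f y = g y"
  shows "partial i f x = partial i g x"
  unfolding partial_def
  by (rule deriv_cong_ev)
    (use upd_in_open[OF assms(1-3)] assms(4) in \<open>auto elim: eventually_mono\<close>)

lemma C_k_0: "openin (Euclidean_space n) S \<Longrightarrow> C_k n 0 S f \<longleftrightarrow> continuous_on S f"
  by (simp add: continuous_map_E_iff)

lemma C_k_Suc_iff:
  assumes "openin (Euclidean_space n) S"
  shows "C_k n (Suc k) S f \<longleftrightarrow> continuous_on S f \<and>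
    (\<forall>i<n. (\<forall>x\<in>S. has_pd i f x (partial i f x)) \<and> C_k n k S (partial i f))"
  using continuous_map_E_iff[OF assms, of f]
  by (auto simp: has_pd_def partial_def DERIV_deriv_iff_real_differentiable)

declare C_k.simps [simp del]

lemma C_k_continuous: "openin (Euclidean_space n) S \<Longrightarrow> C_k n k S f \<Longrightarrow> continuous_on S f"
  by (cases k) (auto simp: C_k_0 C_k_Suc_iff)

lemma C_k_cong:
  assumes "openin (Euclidean_space n) S"
  shows "(\<And>y. y \<in> S \<Longrightarrow> f y = g y) \<Longrightarrow> C_k n k S f \<Longrightarrow> C_k n k S g"
proof (induct k arbitrary: f g)
  case 0
  then show ?case using assms by (metis C_k_0 continuous_on_cong)
next
  case (Suc k)
  have p: "partial i f x = partial i g x" if "x \<in> S" "i < n" for i x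
    using partial_cong assms Suc.prems that by metis
  have "continuous_on S g" using Suc.prems assms by (metis C_k_Suc_iff continuous_on_cong)
  moreover have "C_k n k S (partial i g)" if "i < n" for i
  proof -
    have "C_k n k S (partial i f)" using Suc.prems(2) that assms by (simp add: C_k_Suc_iff)
    then show ?thesis by (rule Suc.hyps[rotated]) (rule p[OF _ that])
  qed
  moreover have "has_pd i g x (partial i g x)" if "x \<in> S" "i < n" for i x
  proof -
    have "has_pd i f x (partial i f x)" using Suc.prems(2) that assms by (simp add: C_k_Suc_iff)
    then show ?thesis unfolding p[OF that] using has_pd_cong[OF assms that, of f g] Suc.prems(1) by blast
  qed
  ultimately show ?case by (simp add: C_k_Suc_iff[OF assms])
qed

lemma C_k_SucI:
  assumes "openin (Euclidean_space n) S" "continuous_on S f"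
    "\<And>i x. i < n \<Longrightarrow> x \<in> S \<Longrightarrow> has_pd i f x (g i x)" "\<And>i. i < n \<Longrightarrow> C_k n k S (g i)"
  shows "C_k n (Suc k) S f"
proof -
  have p: "partial i f x = g i x" if "i < n" "x \<in> S" for i x
    using assms(3)[OF that] by (rule partial_eq)
  have "C_k n k S (partial i f)" if "i < n" for i
    by (rule C_k_cong[OF assms(1) _ assms(4)[OF that]]) (simp add: p that)
  then show ?thesis using assms p by (auto simp: C_k_Suc_iff)
qed

lemma C_k_SucD:
  assumes "openin (Euclidean_space n) S" "C_k n (Suc k) S f" "i < n"
  shows "C_k n k S (partial i f)" "x \<in> S \<Longrightarrow> has_pd i f x (partial i f x)"
  using assms by (auto simp: C_k_Suc_iff)

lemma C_k_mono:
  assumes "openin (Euclidean_space n) S" shows "C_k n (Suc k) S f \<Longrightarrow> C_k n k S f"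
proof (induct k arbitrary: f)
  case 0
  then show ?case using assms by (auto simp: C_k_0 C_k_Suc_iff)
next
  case (Suc k)
  then show ?case using assms by (subst C_k_Suc_iff) (auto simp: C_k_Suc_iff[of n S "Suc k"])
qed

lemma C_k_subset:
  assumes "openin (Euclidean_space n) S" "openin (Euclidean_space n) T" "T \<subseteq> S"
  shows "C_k n k S f \<Longrightarrow> C_k n k T f"
proof (induct k arbitrary: f)
  case 0
  then show ?case using assms by (auto simp: C_k_0 intro: continuous_on_subset)
next
  case (Suc k)
  then show ?case using assms by (auto simp: C_k_Suc_iff intro: continuous_on_subset)
qed

lemma continuous_on_local:
  fixes f :: "(nat \<Rightarrow> real) \<Rightarrow> real"
  assumes S: "openin (Euclidean_space n) S"
    and loc: "\<And>x. x \<in> S \<Longrightarrow> \<exists>T. openin (Euclidean_space n) T \<and> x \<in> T \<and> continuous_on (T \<inter> S) f"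
  shows "continuous_on S f"
proof -
  have "continuous (at x within S) f" if x: "x \<in> S" for x
  proof -
    obtain T where T: "openin (Euclidean_space n) T" "x \<in> T" "continuous_on (T \<inter> S) f"
      using loc[OF x] by blast
    obtain U where U: "open U" "T = {x. \<forall>i\<ge>n. x i = 0} \<inter> U"
      using T(1) unfolding Euclidean_space_eq by (auto simp: openin_open)
    have "at x within S = at x within (T \<inter> S)"
      by (rule at_within_nhd[of x U]) (use U T openin_E_zero[OF S] in auto)
    then show ?thesis using T x by (simp add: continuous_on_eq_continuous_within)
  qed
  then show ?thesis by (simp add: continuous_on_eq_continuous_within)
qed

lemma C_k_local:
  assumes S: "openin (Euclidean_space n) S"
  shows "(\<And>x. x \<in> S \<Longrightarrow> \<exists>T. openin (Euclidean_space n) T \<and> x \<in> T \<and> C_k n k (T \<inter> S) f) \<Longrightarrow>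
    C_k n k S f"
proof (induct k arbitrary: f)
  case 0
  have "continuous_on S f"
    by (rule continuous_on_local[OF S]) (use 0 S in \<open>meson C_k_continuous openin_Int\<close>)
  then show ?case using S by (simp add: C_k_0)
next
  case (Suc k)
  have "continuous_on S f"
    by (rule continuous_on_local[OF S]) (use Suc.prems S in \<open>meson C_k_continuous openin_Int\<close>)
  moreover have "C_k n k S (partial i f)" if "i < n" for i
  proof (rule Suc.hyps)
    fix x assume "x \<in> S"
    then obtain T where T: "openin (Euclidean_space n) T" "x \<in> T" "C_k n (Suc k) (T \<inter> S) f"
      using Suc.prems by blast
    then have "C_k n k (T \<inter> S) (partial i f)"
      using C_k_SucD(1)[OF openin_Int[OF T(1) S] T(3) that] by blast
    with T show "\<exists>T. openin (Euclidean_space n) T \<and> x \<in> T \<and> C_k n k (T \<inter> S) (partial i f)"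
      by blast
  qed
  moreover have "has_pd i f x (partial i f x)" if x: "i < n" "x \<in> S" for i x
  proof -
    obtain T where T: "openin (Euclidean_space n) T" "x \<in> T" "C_k n (Suc k) (T \<inter> S) f"
      using Suc.prems x by blast
    then show ?thesis using C_k_SucD(2)[OF openin_Int[OF T(1) S] T(3) x(1)] x by blast
  qed
  ultimately show ?case using S by (simp add: C_k_Suc_iff)
qed

lemma C_k_const: "openin (Euclidean_space n) S \<Longrightarrow> C_k n k S (\<lambda>x. c)"
proof (induct k arbitrary: c)
  case 0
  then show ?case by (simp add: C_k_0)
next
  case (Suc k)
  show ?case
    by (rule C_k_SucI[where g = "\<lambda>i x. 0"]) (use Suc in \<open>auto simp: has_pd_def\<close>)
qed

lemma C_k_add:
  assumes S: "openin (Euclidean_space n) S"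
  shows "C_k n k S f \<Longrightarrow> C_k n k S g \<Longrightarrow> C_k n k S (\<lambda>x. f x + g x)"
proof (induct k arbitrary: f g)
  case 0
  then show ?case using S by (auto simp: C_k_0 intro: continuous_intros)
next
  case (Suc k)
  show ?case
    by (rule C_k_SucI[where g = "\<lambda>i x. partial i f x + partial i g x", OF S])
      (use Suc in \<open>auto simp: C_k_Suc_iff[OF S] has_pd_def intro!: continuous_intros DERIV_add\<close>)
qed

lemma C_k_mult:
  assumes S: "openin (Euclidean_space n) S"
  shows "C_k n k S f \<Longrightarrow> C_k n k S g \<Longrightarrow> C_k n k S (\<lambda>x. f x * g x)"
proof (induct k arbitrary: f g)
  case 0
  then show ?case using S by (auto simp: C_k_0 intro: continuous_intros)
next
  case (Suc k)
  note m = C_k_mono[OF S]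
  show ?case
  proof (rule C_k_SucI[where g = "\<lambda>i x. partial i f x * g x + partial i g x * f x", OF S])
    show "continuous_on S (\<lambda>x. f x * g x)"
      using Suc.prems by (auto simp: C_k_Suc_iff[OF S] intro!: continuous_intros)
    show "has_pd i (\<lambda>x. f x * g x) x (partial i f x * g x + partial i g x * f x)"
      if "i < n" "x \<in> S" for i x
      using DERIV_mult[of "\<lambda>t. f (x(i := t))" _ "x i" UNIV "\<lambda>t. g (x(i := t))"]
        C_k_SucD(2)[OF S Suc.prems(1) that] C_k_SucD(2)[OF S Suc.prems(2) that]
      by (simp add: has_pd_def)
    show "C_k n k S (\<lambda>x. partial i f x * g x + partial i g x * f x)" if "i < n" for i
      using Suc.prems that m by (intro C_k_add[OF S] Suc.hyps) (auto simp: C_k_Suc_iff[OF S])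
  qed
qed

text \<open>The derivative of 1/f is - f'/f^2, a product in which 1/f itself recurs at the lower
  order. The induction hypothesis is applied to exactly that factor.\<close>

lemma C_k_inverse:
  assumes S: "openin (Euclidean_space n) S" and nz: "\<And>x. x \<in> S \<Longrightarrow> f x \<noteq> 0"
  shows "C_k n k S f \<Longrightarrow> C_k n k S (\<lambda>x. inverse (f x))"
proof (induct k)
  case 0
  then show ?case using S nz by (auto simp: C_k_0 intro: continuous_intros)
next
  case (Suc k)
  have IH: "C_k n k S (\<lambda>x. inverse (f x))" using Suc C_k_mono[OF S] by blast
  show ?case
  proof (rule C_k_SucI[where g = "\<lambda>i x. (-1) * (inverse (f x) * partial i f x * inverse (f x))", OF S])
    show "continuous_on S (\<lambda>x. inverse (f x))"
      using Suc.prems nz by (auto simp: C_k_Suc_iff[OF S] intro!: continuous_intros)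
    show "has_pd i (\<lambda>x. inverse (f x)) x ((-1) * (inverse (f x) * partial i f x * inverse (f x)))"
      if "i < n" "x \<in> S" for i x
      using DERIV_inverse'[of "\<lambda>t. f (x(i := t))" _ "x i" UNIV]
        C_k_SucD(2)[OF S Suc.prems(1) that] nz[OF that(2)]
      by (simp add: has_pd_def)
    show "C_k n k S (\<lambda>x. (-1) * (inverse (f x) * partial i f x * inverse (f x)))" if "i < n" for i
      using Suc.prems that IH by (intro C_k_mult[OF S] C_k_const[OF S]) (auto simp: C_k_Suc_iff[OF S])
  qed
qed

lemma C_k_sum:
  assumes S: "openin (Euclidean_space n) S"
  shows "(\<And>j. j \<in> J \<Longrightarrow> C_k n k S (f j)) \<Longrightarrow> C_k n k S (\<lambda>x. \<Sum>j\<in>J. f j x)"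
  by (induct J rule: infinite_finite_induct) (auto intro: C_k_const C_k_add S)

lemma C_k_prod:
  assumes S: "openin (Euclidean_space n) S"
  shows "(\<And>j. j \<in> J \<Longrightarrow> C_k n k S (f j)) \<Longrightarrow> C_k n k S (\<lambda>x. \<Prod>j\<in>J. f j x)"
  by (induct J rule: infinite_finite_induct) (auto intro: C_k_const C_k_mult S)

text \<open>The witness \<open>F m\<close> is the \<open>m\<close>-th derivative. A whole chain of
  derivatives is easy to exhibit for \<open>flat\<close>, where each derivative is again some
  \<open>flat p\<close>.\<close>

definition smooth1 :: "(real \<Rightarrow> real) \<Rightarrow> bool" where
  "smooth1 f \<longleftrightarrow> (\<exists>F. F 0 = f \<and> (\<forall>m t. (F m has_field_derivative F (Suc m) t) (at t)))"

lemma C_k_coord1: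
  assumes S: "openin (Euclidean_space n) S" and i: "i < n"
    and F: "\<And>m t. (F m has_field_derivative F (Suc m) t) (at t)"
  shows "C_k n k S (\<lambda>x. F m (x i))"
proof -
  have c: "continuous_on S (\<lambda>x. F m (x i))" for m
  proof (rule continuous_on_compose2[of UNIV "F m"])
    show "continuous_on UNIV (F m)" using F by (meson DERIV_continuous_on UNIV_I has_field_derivative_at_within)
    show "continuous_on S (\<lambda>x. x i)"
      by (rule continuous_on_subset[OF continuous_on_product_coordinates subset_UNIV])
  qed auto
  show ?thesis
  proof (induct k arbitrary: m)
    case 0
    show ?case using c S by (simp add: C_k_0)
  next
    case (Suc k)
    show ?case
    proof (rule C_k_SucI[where g = "\<lambda>j x. if j = i then F (Suc m) (x i) else 0", OF S c])
      show "has_pd j (\<lambda>x. F m (x i)) x (if j = i then F (Suc m) (x i) else 0)" for j x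
        using F[of m "x i"] by (auto simp: has_pd_def)
      show "C_k n k S (\<lambda>x. if j = i then F (Suc m) (x i) else 0)" for j
        using Suc C_k_const[OF S] by (cases "j = i") auto
    qed
  qed
qed

lemma smooth1_id: "smooth1 (\<lambda>x. x)"
  unfolding smooth1_def
  by (intro exI[of _ "\<lambda>m. if m = 0 then (\<lambda>x. x) else if m = 1 then (\<lambda>x. 1) else (\<lambda>x. 0)"]) auto

lemma C_infinity_coord1:
  "openin (Euclidean_space n) S \<Longrightarrow> i < n \<Longrightarrow> smooth1 f \<Longrightarrow> C_infinity n S (\<lambda>x. f (x i))"
  unfolding smooth1_def C_infinity_def using C_k_coord1 by metis

lemma C_infinity_coord: "openin (Euclidean_space n) S \<Longrightarrow> i < n \<Longrightarrow> C_infinity n S (\<lambda>x. x i)"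
  using C_infinity_coord1[OF _ _ smooth1_id] by simp

lemma mvt_segment:
  fixes F :: "real \<Rightarrow> real"
  assumes "\<And>r. r \<in> closed_segment a b \<Longrightarrow> (F has_field_derivative F' r) (at r)"
  shows "\<exists>r\<in>closed_segment a b. F b - F a = F' r * (b - a)"
proof (cases a b rule: linorder_cases)
  case less
  then obtain z where "a < z" "z < b" "F b - F a = (b - a) * F' z"
    using MVT2[of a b F F'] assms by (auto simp: closed_segment_eq_real_ivl)
  then show ?thesis using less
    by (intro bexI[of _ z]) (auto simp: closed_segment_eq_real_ivl mult.commute)
next
  case greater
  then obtain z where "b < z" "z < a" "F a - F b = (a - b) * F' z"
    using MVT2[of b a F F'] assms by (auto simp: closed_segment_eq_real_ivl)
  then show ?thesis using greater
    by (intro bexI[of _ z]) (auto simp: closed_segment_eq_real_ivl algebra_simps)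
qed auto

text \<open>The curve is only assumed differentiable at \<open>t0\<close>. The increment of
  \<open>f\<close> is telescoped over the coordinates; each summand changes one coordinate, so the
  one-variable mean value theorem gives a value of \<open>partial j f\<close> at an intermediate
  point, and continuity of that partial derivative gives the limit.\<close>

lemma C_1_chain:
  assumes S: "openin (Euclidean_space n) S" and f: "C_k n (Suc 0) S f"
    and d: "\<And>j. j < n \<Longrightarrow> ((\<lambda>t. \<gamma> t j) has_field_derivative d j) (at t0)"
    and z: "\<And>t j. j \<ge> n \<Longrightarrow> \<gamma> t j = 0" and x: "\<gamma> t0 \<in> S"
  shows "((\<lambda>t. f (\<gamma> t)) has_field_derivative (\<Sum>j<n. partial j f (\<gamma> t0) * d j)) (at t0)"
proof -
  define x where "x = \<gamma> t0"
  \<comment> \<open>The first \<open>j\<close> coordinates have already moved to those of the curve,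
    the others still sit at the base point; consecutive \<open>h j t\<close> differ in coordinate
    \<open>j\<close> only.\<close>
  define h where "h = (\<lambda>j t i. if i < j then \<gamma> t i else x i)"
  have h0: "h 0 t = x" for t by (simp add: h_def)
  have hn: "h n t = \<gamma> t" for t using z by (auto simp: h_def x_def fun_eq_iff)
  have xS: "x \<in> S" using assms by (simp add: x_def)
  have x0: "\<And>i. i \<ge> n \<Longrightarrow> x i = 0" using z by (simp add: x_def)
  obtain e where e: "e > 0" "cube n x e \<subseteq> S" using openin_E_cube[OF S xS] by auto
  have ev: "\<forall>\<^sub>F t in at t0. \<forall>i\<in>{..<n}. \<bar>\<gamma> t i - x i\<bar> < r" if "r > 0" for r
  proof (rule eventually_ball_finite)
    show "\<forall>i\<in>{..<n}. \<forall>\<^sub>F t in at t0. \<bar>\<gamma> t i - x i\<bar> < r"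
    proof
      fix i assume "i \<in> {..<n}"
      then have "isCont (\<lambda>t. \<gamma> t i) t0" using d DERIV_isCont by auto
      then have "((\<lambda>t. \<gamma> t i) \<longlongrightarrow> x i) (at t0)" by (simp add: isCont_def x_def)
      then show "\<forall>\<^sub>F t in at t0. \<bar>\<gamma> t i - x i\<bar> < r"
        using that by (auto dest!: tendstoD[of _ _ _ r] simp: dist_real_def)
    qed
  qed simp
  have key: "((\<lambda>t. f (h (Suc j) t) - f (h j t)) has_field_derivative partial j f x * d j) (at t0)"
    if j: "j < n" for j
  proof -
    have "\<exists>\<xi>. (\<forall>i\<ge>n. \<xi> i = 0) \<and> (\<forall>i<n. \<bar>\<xi> i - x i\<bar> \<le> \<bar>\<gamma> t i - x i\<bar>) \<and>
        f (h (Suc j) t) - f (h j t) = partial j f \<xi> * (\<gamma> t j - x j)"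
      if t: "\<forall>i\<in>{..<n}. \<bar>\<gamma> t i - x i\<bar> < e" for t
    proof -
      let ?F = "\<lambda>r. f ((h j t)(j := r))"
      have in1: "(h j t)(j := r) \<in> S" "\<bar>r - x j\<bar> \<le> \<bar>\<gamma> t j - x j\<bar>"
        if r: "r \<in> closed_segment (x j) (\<gamma> t j)" for r
      proof -
        show "\<bar>r - x j\<bar> \<le> \<bar>\<gamma> t j - x j\<bar>" using r by (auto simp: closed_segment_eq_real_ivl split: if_splits)
        then have "\<bar>((h j t)(j := r)) i - x i\<bar> < e" if "i < n" for i
          using t j e(1) that by (cases "i = j") (auto simp: h_def intro: le_less_trans)
        then have "(h j t)(j := r) \<in> cube n x e"
          using j x0 by (auto simp: cube_def h_def)
        then show "(h j t)(j := r) \<in> S" using e by auto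
      qed
      have "\<exists>r\<in>closed_segment (x j) (\<gamma> t j).
          ?F (\<gamma> t j) - ?F (x j) = partial j f ((h j t)(j := r)) * (\<gamma> t j - x j)"
      proof (rule mvt_segment)
        fix r assume "r \<in> closed_segment (x j) (\<gamma> t j)"
        from C_k_SucD(2)[OF S f j in1(1)[OF this]]
        show "(?F has_field_derivative partial j f ((h j t)(j := r))) (at r)"
          by (simp add: has_pd_def)
      qed
      then obtain r where r: "r \<in> closed_segment (x j) (\<gamma> t j)"
        "?F (\<gamma> t j) - ?F (x j) = partial j f ((h j t)(j := r)) * (\<gamma> t j - x j)" by blast
      have "h (Suc j) t = (h j t)(j := \<gamma> t j)" "h j t = (h j t)(j := x j)"
        by (auto simp: h_def fun_eq_iff)
      with r in1(2)[OF r(1)] x0 j show ?thesis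
        by (intro exI[of _ "(h j t)(j := r)"]) (auto simp: h_def)
    qed
    then obtain \<xi> where \<xi>: "\<And>t. \<forall>i\<in>{..<n}. \<bar>\<gamma> t i - x i\<bar> < e \<Longrightarrow>
        (\<forall>i\<ge>n. \<xi> t i = 0) \<and> (\<forall>i<n. \<bar>\<xi> t i - x i\<bar> \<le> \<bar>\<gamma> t i - x i\<bar>) \<and>
        f (h (Suc j) t) - f (h j t) = partial j f (\<xi> t) * (\<gamma> t j - x j)" by metis
    have pc: "continuous_on S (partial j f)" using C_k_SucD(1)[OF S f j] S by (simp add: C_k_0)
    have "((\<lambda>t. partial j f (\<xi> t)) \<longlongrightarrow> partial j f x) (at t0)"
    proof (rule tendstoI)
      fix \<epsilon> :: real assume "\<epsilon> > 0"
      then obtain r where r: "r > 0" "\<And>y. y \<in> cube n x r \<Longrightarrow> \<bar>partial j f y - partial j f x\<bar> < \<epsilon>"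
        using continuous_on_cube[OF S pc xS] by blast
      show "\<forall>\<^sub>F t in at t0. dist (partial j f (\<xi> t)) (partial j f x) < \<epsilon>"
        using ev[OF r(1)] ev[OF e(1)]
      proof eventually_elim
        case (elim t)
        then have "\<xi> t \<in> cube n x r" using \<xi>[of t] unfolding cube_def
          by (smt (verit) lessThan_iff mem_Collect_eq)
        then show ?case using r by (simp add: dist_real_def)
      qed
    qed
    moreover have "((\<lambda>t. (\<gamma> t j - x j) / (t - t0)) \<longlongrightarrow> d j) (at t0)"
      using d[OF j] by (simp add: has_field_derivative_iff x_def)
    ultimately have "((\<lambda>t. partial j f (\<xi> t) * ((\<gamma> t j - x j) / (t - t0))) \<longlongrightarrow> partial j f x * d j) (at t0)"
      by (rule tendsto_mult)
    moreover have "\<forall>\<^sub>F t in at t0. partial j f (\<xi> t) * ((\<gamma> t j - x j) / (t - t0)) =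
        (f (h (Suc j) t) - f (h j t)) / (t - t0)"
      using ev[OF e(1)] by eventually_elim (use \<xi> in auto)
    ultimately have "((\<lambda>t. (f (h (Suc j) t) - f (h j t)) / (t - t0)) \<longlongrightarrow> partial j f x * d j) (at t0)"
      using Lim_transform_eventually by fast
    moreover have "h j t0 = x" for j by (auto simp: h_def x_def)
    ultimately show ?thesis by (simp add: has_field_derivative_iff)
  qed
  have E: "(\<lambda>t. f (\<gamma> t)) = (\<lambda>t. (\<Sum>j<n. f (h (Suc j) t) - f (h j t)) + f x)"
    using sum_lessThan_telescope[of "\<lambda>j. f (h j t)" n for t] by (simp add: h0 hn)
  have "((\<lambda>t. (\<Sum>j<n. f (h (Suc j) t) - f (h j t)) + f x) has_field_derivative
      (\<Sum>j<n. partial j f x * d j)) (at t0)"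
    by (rule DERIV_cong[OF DERIV_add[OF DERIV_sum DERIV_const]]) (use key in auto)
  then show ?thesis unfolding E x_def[symmetric] .
qed

text \<open>Padding by 0 from index \<open>m\<close> on places the tuple in
  \<open>Euclidean_space m\<close>, whose points are sequences.\<close>

definition tuple :: "nat \<Rightarrow> (nat \<Rightarrow> 'b \<Rightarrow> real) \<Rightarrow> 'b \<Rightarrow> nat \<Rightarrow> real" where
  "tuple m g x = (\<lambda>j. if j < m then g j x else 0)"

text \<open>The induction on \<open>k\<close> leaves \<open>f\<close> arbitrary: the chain rule
  replaces \<open>f\<close> by its partial derivatives, while the inner functions \<open>g j\<close>
  stay the same and are merely weakened by one order.\<close>

lemma C_k_comp:
  assumes S: "openin (Euclidean_space n) S" and T: "openin (Euclidean_space m) T"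
    and sub: "\<And>x. x \<in> S \<Longrightarrow> tuple m g x \<in> T"
  shows "C_k m k T f \<Longrightarrow> (\<And>j. j < m \<Longrightarrow> C_k n k S (g j)) \<Longrightarrow> C_k n k S (\<lambda>x. f (tuple m g x))"
proof -
  have cont: "continuous_on S (\<lambda>x. f (tuple m g x))"
    if "continuous_on T f" "\<And>j. j < m \<Longrightarrow> continuous_on S (g j)" for f
  proof (rule continuous_on_compose2[OF that(1)])
    show "continuous_on S (tuple m g)"
    proof (rule continuous_on_coordinatewise_then_product)
      show "continuous_on S (\<lambda>x. tuple m g x i)" for i
        using that(2) by (cases "i < m") (auto simp: tuple_def)
    qed
  qed (use sub in auto)
  show "C_k m k T f \<Longrightarrow> (\<And>j. j < m \<Longrightarrow> C_k n k S (g j)) \<Longrightarrow> C_k n k S (\<lambda>x. f (tuple m g x))"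
  proof (induct k arbitrary: f)
    case 0
    then show ?case using cont[of f] S T by (simp add: C_k_0)
  next
    case (Suc k)
    show ?case
    proof (rule C_k_SucI[where g = "\<lambda>i x. \<Sum>j<m. partial j f (tuple m g x) * partial i (g j) x", OF S])
      show "continuous_on S (\<lambda>x. f (tuple m g x))"
        using cont[of f] Suc.prems C_k_continuous S T by blast
      show "has_pd i (\<lambda>x. f (tuple m g x)) x (\<Sum>j<m. partial j f (tuple m g x) * partial i (g j) x)"
        if i: "i < n" and x: "x \<in> S" for i x
      proof -
        have "((\<lambda>t. tuple m g (x(i := t)) j) has_field_derivative partial i (g j) x) (at (x i))"
          if "j < m" for j
          using C_k_SucD(2)[OF S Suc.prems(2)[OF that] i x] that by (simp add: tuple_def has_pd_def)
        moreover have "C_k m (Suc 0) T f"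
          using Suc.prems(1) by (induct k) (auto dest: C_k_mono[OF T])
        ultimately show ?thesis
          using C_1_chain[OF T, of f "\<lambda>t. tuple m g (x(i := t))" "\<lambda>j. partial i (g j) x" "x i"] sub[OF x]
          unfolding has_pd_def by (simp add: tuple_def)
      qed
      show "C_k n k S (\<lambda>x. \<Sum>j<m. partial j f (tuple m g x) * partial i (g j) x)" if i: "i < n" for i
      proof (intro C_k_sum[OF S] C_k_mult[OF S] Suc.hyps)
        fix j assume "j \<in> {..<m}"
        then have j: "j < m" by simp
        show "C_k m k T (partial j f)" using C_k_SucD(1)[OF T Suc.prems(1) j] .
        show "C_k n k S (partial i (g j))" using C_k_SucD(1)[OF S Suc.prems(2)[OF j] i] .
        show "C_k n k S (g j')" if "j' < m" for j'
          using C_k_mono[OF S] Suc.prems(2)[OF that] by blast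
      qed
    qed
  qed
qed

lemma C_infinity_comp:
  assumes "openin (Euclidean_space n) S" "openin (Euclidean_space m) T"
    "\<And>x. x \<in> S \<Longrightarrow> tuple m g x \<in> T" "C_infinity m T f" "\<And>j. j < m \<Longrightarrow> C_infinity n S (g j)"
  shows "C_infinity n S (\<lambda>x. f (tuple m g x))"
  using assms C_k_comp unfolding C_infinity_def by blast

lemma C_infinity_cong:
  "openin (Euclidean_space n) S \<Longrightarrow> (\<And>y. y \<in> S \<Longrightarrow> f y = g y) \<Longrightarrow> C_infinity n S f \<longleftrightarrow> C_infinity n S g"
  unfolding C_infinity_def using C_k_cong[of n S f g] C_k_cong[of n S g f] by auto

lemma C_infinity_subset:
  "openin (Euclidean_space n) S \<Longrightarrow> openin (Euclidean_space n) T \<Longrightarrow> T \<subseteq> S \<Longrightarrow>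
    C_infinity n S f \<Longrightarrow> C_infinity n T f"
  unfolding C_infinity_def using C_k_subset by blast

lemma C_infinity_local:
  assumes "openin (Euclidean_space n) S"
    "\<And>x. x \<in> S \<Longrightarrow> \<exists>T. openin (Euclidean_space n) T \<and> x \<in> T \<and> C_infinity n (T \<inter> S) f"
  shows "C_infinity n S f"
  unfolding C_infinity_def
proof
  fix k show "C_k n k S f"
    by (rule C_k_local[OF assms(1)]) (use assms(2) in \<open>unfold C_infinity_def, blast\<close>)
qed

lemma C_infinity_const: "openin (Euclidean_space n) S \<Longrightarrow> C_infinity n S (\<lambda>x. c)"
  and C_infinity_add: "openin (Euclidean_space n) S \<Longrightarrow> C_infinity n S f \<Longrightarrow> C_infinity n S g \<Longrightarrow>
    C_infinity n S (\<lambda>x. f x + g x)"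
  and C_infinity_mult: "openin (Euclidean_space n) S \<Longrightarrow> C_infinity n S f \<Longrightarrow> C_infinity n S g \<Longrightarrow>
    C_infinity n S (\<lambda>x. f x * g x)"
  and C_infinity_inverse: "openin (Euclidean_space n) S \<Longrightarrow> (\<And>x. x \<in> S \<Longrightarrow> f x \<noteq> 0) \<Longrightarrow>
    C_infinity n S f \<Longrightarrow> C_infinity n S (\<lambda>x. inverse (f x))"
  by (auto simp: C_infinity_def C_k_const C_k_add C_k_mult C_k_inverse)

lemma C_infinity_prod: "openin (Euclidean_space n) S \<Longrightarrow> (\<And>j. j \<in> J \<Longrightarrow> C_infinity n S (g j)) \<Longrightarrow>
    C_infinity n S (\<lambda>x. \<Prod>j\<in>J. g j x)"
  by (auto simp: C_infinity_def C_k_prod)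

lemma C_infinity_partial:
  "openin (Euclidean_space n) S \<Longrightarrow> C_infinity n S f \<Longrightarrow> i < n \<Longrightarrow> C_infinity n S (partial i f)"
  unfolding C_infinity_def using C_k_SucD(1) by blast

lemma C_infinity_has_pd:
  "openin (Euclidean_space n) S \<Longrightarrow> C_infinity n S f \<Longrightarrow> i < n \<Longrightarrow> x \<in> S \<Longrightarrow>
    has_pd i f x (partial i f x)"
  unfolding C_infinity_def using C_k_SucD(2) by blast

section \<open>Hadamard's lemma, by integration along segments\<close>

definition seg :: "(nat \<Rightarrow> real) \<Rightarrow> (nat \<Rightarrow> real) \<Rightarrow> real \<Rightarrow> nat \<Rightarrow> real" where
  "seg a x t = (\<lambda>i. a i + t * (x i - a i))"

lemma seg_in_cube:
  assumes "\<forall>i\<ge>n. a i = 0" "x \<in> cube n a e" "0 \<le> t" "t \<le> 1"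
  shows "seg a x t \<in> cube n a e"
proof -
  have "\<bar>t * (x i - a i)\<bar> < e" if "i < n" for i
  proof -
    have "\<bar>t\<bar> * \<bar>x i - a i\<bar> \<le> 1 * \<bar>x i - a i\<bar>"
      using assms by (intro mult_right_mono) auto
    then show ?thesis using assms(2) that by (auto simp: cube_def abs_mult)
  qed
  then show ?thesis using assms by (auto simp: seg_def cube_def)
qed

text \<open>The endpoint is parametrised by a map \<open>g\<close>, so that one statement serves
  when it ranges over the cube, when only one of its coordinates moves, and when it is
  fixed.\<close>

lemma continuous_on_seg:
  fixes f :: "(nat \<Rightarrow> real) \<Rightarrow> real" and g :: "'b::topological_space \<Rightarrow> nat \<Rightarrow> real"
  assumes a: "\<forall>i\<ge>n. a i = 0" and f: "continuous_on (cube n a e) f"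
    and g: "\<And>i. continuous_on X (\<lambda>y. g y i)" "\<And>y. y \<in> X \<Longrightarrow> g y \<in> cube n a e"
  shows "continuous_on (X \<times> {0..1}) (\<lambda>z. snd z ^ m * f (seg a (g (fst z)) (snd z)))"
proof -
  have "continuous_on (X \<times> {0..1}) (\<lambda>z. f (seg a (g (fst z)) (snd z)))"
  proof (rule continuous_on_compose2[OF f])
    show "continuous_on (X \<times> {0..1}) (\<lambda>z. seg a (g (fst z)) (snd z))"
    proof (rule continuous_on_coordinatewise_then_product)
      fix i
      have "continuous_on (X \<times> {0..1}) (\<lambda>z. g (fst z) i)"
        by (rule continuous_on_compose2[OF g(1)]) (auto intro: continuous_intros)
      then show "continuous_on (X \<times> {0..1}) (\<lambda>z. seg a (g (fst z)) (snd z) i)"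
        unfolding seg_def by (intro continuous_intros)
    qed
    show "(\<lambda>z. seg a (g (fst z)) (snd z)) ` (X \<times> {0..1}) \<subseteq> cube n a e"
      using g seg_in_cube[OF a] by auto
  qed
  then show ?thesis by (intro continuous_intros)
qed

text \<open>Differentiation under the integral in direction \<open>i\<close> brings down the factor
  \<open>t\<close>, because the segment moves with speed \<open>t\<close> when its endpoint moves.
  The weight \<open>t ^ m\<close> is there to absorb these factors in the induction on
  \<open>k\<close>.\<close>

lemma C_k_segment_integral:
  assumes a: "\<forall>i\<ge>n. a i = 0"
  shows "C_k n k (cube n a e) f \<Longrightarrow>
    C_k n k (cube n a e) (\<lambda>x. integral {0..1} (\<lambda>t. t ^ m * f (seg a x t)))"
proof -
  let ?B = "cube n a e"
  have B: "openin (Euclidean_space n) ?B" by (rule openin_cube)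
  have cont: "continuous_on ?B (\<lambda>x. integral {0..1} (\<lambda>t. t ^ m * f (seg a x t)))"
    if "continuous_on ?B f" for m f
  proof -
    have "continuous_on (?B \<times> {0..1}) (\<lambda>z. snd z ^ m * f (seg a (fst z) (snd z)))"
      by (rule continuous_on_seg[OF a that, of _ "\<lambda>x. x"])
        (auto intro: continuous_on_subset[OF continuous_on_product_coordinates])
    then show ?thesis
      using integral_continuous_on_param[of ?B "0::real" 1 "\<lambda>x t. t ^ m * f (seg a x t)"]
      by (simp add: split_beta)
  qed
  show "C_k n k ?B f \<Longrightarrow> C_k n k ?B (\<lambda>x. integral {0..1} (\<lambda>t. t ^ m * f (seg a x t)))"
  proof (induct k arbitrary: f m)
    case 0
    then show ?case using cont[of f m] B by (simp add: C_k_0)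
  next
    case (Suc k)
    have fc: "continuous_on ?B f" using C_k_continuous[OF B Suc.prems] .
    show ?case
    proof (rule C_k_SucI[where g = "\<lambda>i x. integral {0..1} (\<lambda>t. t ^ Suc m * partial i f (seg a x t))", OF B])
      show "continuous_on ?B (\<lambda>x. integral {0..1} (\<lambda>t. t ^ m * f (seg a x t)))"
        by (rule cont[OF fc])
      show "C_k n k ?B (\<lambda>x. integral {0..1} (\<lambda>t. t ^ Suc m * partial i f (seg a x t)))"
        if "i < n" for i
        by (rule Suc.hyps[OF C_k_SucD(1)[OF B Suc.prems that]])
      fix i x assume i: "i < n" and x: "x \<in> ?B"
      define U where "U = {a i - e <..< a i + e}"
      have U: "x(i := s) \<in> ?B" if "s \<in> U" for s
        using x that i a by (auto simp: U_def cube_def)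
      have xU: "x i \<in> U" using x i by (auto simp: U_def cube_def)
      have pc: "continuous_on ?B (partial i f)"
        using C_k_continuous[OF B C_k_SucD(1)[OF B Suc.prems i]] .
      have ci: "continuous_on U (\<lambda>s. (x(i := s)) j)" for j
        by (cases "j = i") (auto intro: continuous_intros)
      have "((\<lambda>s. integral (cbox 0 1) (\<lambda>t. t ^ m * f (seg a (x(i := s)) t))) has_field_derivative
          integral (cbox 0 1) (\<lambda>t. t ^ Suc m * partial i f (seg a (x(i := x i)) t))) (at (x i) within U)"
      proof (rule leibniz_rule_field_derivative)
        fix s t :: real assume s: "s \<in> U" and t: "t \<in> cbox 0 1"
        let ?y = "seg a (x(i := s)) t"
        have y: "?y \<in> ?B" using seg_in_cube[OF a U[OF s]] t by auto
        have "((\<lambda>r. f (?y(i := r))) has_field_derivative partial i f ?y) (at (?y i))"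
          using C_k_SucD(2)[OF B Suc.prems i y] by (simp add: has_pd_def)
        moreover have "((\<lambda>s. a i + t * (s - a i)) has_field_derivative t) (at s)"
          by (auto intro!: derivative_eq_intros)
        ultimately have "((\<lambda>s. f (?y(i := a i + t * (s - a i)))) has_field_derivative partial i f ?y * t) (at s)"
          using DERIV_chain2[of "\<lambda>r. f (?y(i := r))" "partial i f ?y" "\<lambda>s. a i + t * (s - a i)" s t UNIV]
          by (simp add: seg_def)
        moreover have "?y(i := a i + t * (s' - a i)) = seg a (x(i := s')) t" for s'
          by (auto simp: seg_def fun_eq_iff)
        ultimately have "((\<lambda>s. f (seg a (x(i := s)) t)) has_field_derivative partial i f ?y * t) (at s)"
          by simp
        from DERIV_cmult[OF this, of "t ^ m"]
        show "((\<lambda>s. t ^ m * f (seg a (x(i := s)) t)) has_field_derivative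
            t ^ Suc m * partial i f ?y) (at s within U)"
          by (simp add: has_field_derivative_at_within ac_simps)
      next
        fix s assume s: "s \<in> U"
        have "continuous_on ({s} \<times> {0..1}) (\<lambda>z. snd z ^ m * f (seg a (x(i := fst z)) (snd z)))"
          by (rule continuous_on_seg[OF a fc, of _ "\<lambda>s. x(i := s)"]) (use U s in auto)
        then have "continuous_on {0..1} (\<lambda>t. (\<lambda>z. snd z ^ m * f (seg a (x(i := fst z)) (snd z))) (s, t))"
          by (rule continuous_on_compose2) (auto intro!: continuous_intros)
        then show "(\<lambda>t. t ^ m * f (seg a (x(i := s)) t)) integrable_on cbox 0 1"
          by (simp add: integrable_continuous_real)
      next
        have "continuous_on (U \<times> {0..1}) (\<lambda>z. snd z ^ Suc m * partial i f (seg a (x(i := fst z)) (snd z)))"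
          by (rule continuous_on_seg[OF a pc ci U])
        then show "continuous_on (U \<times> cbox 0 1) (\<lambda>(s, t). t ^ Suc m * partial i f (seg a (x(i := s)) t))"
          by (simp add: split_beta)
      qed (use xU in \<open>auto simp: U_def\<close>)
      moreover have "at (x i) within U = at (x i)" by (rule at_within_open) (use xU in \<open>auto simp: U_def\<close>)
      ultimately show "has_pd i (\<lambda>x. integral {0..1} (\<lambda>t. t ^ m * f (seg a x t))) x
          (integral {0..1} (\<lambda>t. t ^ Suc m * partial i f (seg a x t)))"
        by (simp add: has_pd_def)
    qed
  qed
qed

text \<open>The fundamental theorem of calculus along the segment from \<open>a\<close> to
  \<open>x\<close> writes f x - f a as the integral of the sum of (x i - a i) times the partial
  derivatives, and the \<open>g i\<close> are the integrals left over. At \<open>x = a\<close> the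
  segment is constant, hence the value of \<open>g i\<close> there.\<close>

lemma hadamard:
  assumes a: "\<forall>i\<ge>n. a i = 0" and e: "e > 0" and f: "C_infinity n (cube n a e) f"
  obtains g where "\<And>i. i < n \<Longrightarrow> C_infinity n (cube n a e) (g i)"
    "\<And>i. i < n \<Longrightarrow> g i a = partial i f a"
    "\<And>x. x \<in> cube n a e \<Longrightarrow> f x = f a + (\<Sum>i<n. (x i - a i) * g i x)"
proof -
  let ?B = "cube n a e"
  have B: "openin (Euclidean_space n) ?B" by (rule openin_cube)
  define g where "g = (\<lambda>i x. integral {0..1} (\<lambda>t. t ^ 0 * partial i f (seg a x t)))"
  have g1: "C_infinity n ?B (g i)" if "i < n" for i
    unfolding C_infinity_def g_def
    using C_k_segment_integral[OF a] C_infinity_partial[OF B f that] unfolding C_infinity_def by blast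
  have g2: "g i a = partial i f a" for i
    by (simp add: g_def seg_def)
  have g3: "f x = f a + (\<Sum>i<n. (x i - a i) * g i x)" if x: "x \<in> ?B" for x
  proof -
    have x0: "\<forall>i\<ge>n. x i = 0" using x by (auto simp: cube_def)
    have d: "((\<lambda>t. f (seg a x t)) has_field_derivative
        (\<Sum>j<n. partial j f (seg a x t) * (x j - a j))) (at t)" if t: "t \<in> {0..1}" for t
    proof (rule C_1_chain[OF B])
      show "C_k n (Suc 0) ?B f" using f by (simp add: C_infinity_def)
      show "((\<lambda>t. seg a x t j) has_field_derivative (x j - a j)) (at t)" for j
        unfolding seg_def by (auto intro!: derivative_eq_intros)
      show "seg a x t \<in> ?B" using seg_in_cube[OF a x] t by auto
      show "seg a x t j = 0" if "j \<ge> n" for t j using that a x0 by (simp add: seg_def)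
    qed
    have "((\<lambda>t. \<Sum>j<n. partial j f (seg a x t) * (x j - a j)) has_integral
        (f (seg a x 1) - f (seg a x 0))) {0..1}"
      by (rule fundamental_theorem_of_calculus)
        (use d in \<open>auto simp: has_real_derivative_iff_has_vector_derivative[symmetric]
          intro: has_field_derivative_at_within\<close>)
    moreover have "((\<lambda>t. \<Sum>j<n. partial j f (seg a x t) * (x j - a j)) has_integral
        (\<Sum>j<n. g j x * (x j - a j))) {0..1}"
    proof (intro has_integral_sum has_integral_mult_left)
      fix j assume "j \<in> {..<n}"
      then have "continuous_on ?B (partial j f)"
        using C_infinity_partial[OF B f] C_k_continuous[OF B] unfolding C_infinity_def by blast
      then have "continuous_on ({x} \<times> {0..1}) (\<lambda>z. snd z ^ 0 * partial j f (seg a (fst z) (snd z)))"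
        by (rule continuous_on_seg[OF a, of _ _ _ "\<lambda>x. x"]) (use x in auto)
      then have "continuous_on {0..1} (\<lambda>t. (\<lambda>z. snd z ^ 0 * partial j f (seg a (fst z) (snd z))) (x, t))"
        by (rule continuous_on_compose2) (auto intro!: continuous_intros)
      then show "((\<lambda>t. partial j f (seg a x t)) has_integral g j x) {0..1}"
        by (simp add: g_def integrable_continuous_real integrable_integral)
    qed simp
    ultimately have "f (seg a x 1) - f (seg a x 0) = (\<Sum>j<n. g j x * (x j - a j))"
      using has_integral_unique by blast
    then show ?thesis by (simp add: seg_def mult.commute)
  qed
  show ?thesis by (rule that[of g]) (use g1 g2 g3 in auto)
qed

text \<open>The functions below are closed under differentiation, so \<open>exp (- 1 / x)\<close> extended
  by \<open>0\<close> is smooth.\<close>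

definition flat :: "real poly \<Rightarrow> real \<Rightarrow> real" where
  "flat p x = (if x > 0 then poly p (1 / x) * exp (- (1 / x)) else 0)"

lemma poly_exp_tendsto: "((\<lambda>y. poly p y * exp (- y)) \<longlongrightarrow> 0) at_top" for p :: "real poly"
proof -
  have "((\<lambda>y::real. coeff p i * (y ^ i / exp y)) \<longlongrightarrow> coeff p i * 0) at_top" for i
    by (intro tendsto_mult tendsto_const tendsto_power_div_exp_0)
  then have "((\<lambda>y. \<Sum>i\<le>degree p. coeff p i * (y ^ i / exp y)) \<longlongrightarrow> (\<Sum>i\<le>degree p. 0)) at_top"
    by (intro tendsto_sum) simp
  then show ?thesis
    by (simp add: poly_altdef sum_distrib_right exp_minus divide_inverse mult.assoc)
qed

text \<open>With u = 1/x one has d/dx = - u^2 d/du, so p(u) exp(- u) has derivative u^2 (p - p')(u)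
  exp(- u); the polynomial [:0, 0, 1:] is u^2. At 0 the right difference quotient is u p(u) exp(-
  u), which tends to 0 as u grows.\<close>

lemma flat_DERIV: "(flat p has_field_derivative flat ([:0, 0, 1:] * (p - pderiv p)) x) (at x)"
proof (cases x "0 :: real" rule: linorder_cases)
  case less
  have "((\<lambda>_. 0) has_field_derivative 0) (at x)" by simp
  moreover have "\<forall>\<^sub>F y in nhds x. flat p y = 0"
    using eventually_nhds_in_open[of "{..<0}" x] less
    by (auto elim!: eventually_mono simp: flat_def)
  ultimately show ?thesis using less DERIV_cong_ev[OF refl, of "flat p" "\<lambda>_. 0"]
    by (simp add: flat_def)
next
  case greater
  have "((\<lambda>x. poly p (1 / x) * exp (- (1 / x))) has_field_derivative
      poly ([:0, 0, 1:] * (p - pderiv p)) (1 / x) * exp (- (1 / x))) (at x)"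
    using greater
    by (auto intro!: derivative_eq_intros DERIV_chain2[OF poly_DERIV] simp: field_simps power2_eq_square)
  moreover have "\<forall>\<^sub>F y in nhds x. flat p y = poly p (1 / y) * exp (- (1 / y))"
    using eventually_nhds_in_open[of "{0<..}" x] greater
    by (auto elim!: eventually_mono simp: flat_def)
  ultimately show ?thesis
    using greater DERIV_cong_ev[OF refl, of "flat p" "\<lambda>x. poly p (1 / x) * exp (- (1 / x))"]
    by (simp add: flat_def)
next
  case equal
  have "((\<lambda>h. flat p h / h) \<longlongrightarrow> 0) (at_left 0)"
    by (rule Lim_transform_eventually[of "\<lambda>_. 0"])
      (auto simp: flat_def eventually_at_left_field intro!: exI[of _ "-1"])
  moreover have "((\<lambda>h. flat p h / h) \<longlongrightarrow> 0) (at_right 0)"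
  proof (rule Lim_transform_eventually)
    show "((\<lambda>h. poly (pCons 0 p) (inverse h) * exp (- inverse h)) \<longlongrightarrow> 0) (at_right 0)"
      by (rule filterlim_compose[OF poly_exp_tendsto filterlim_inverse_at_top_right])
    show "\<forall>\<^sub>F h in at_right 0. poly (pCons 0 p) (inverse h) * exp (- inverse h) = flat p h / h"
      by (auto simp: flat_def eventually_at_right_field field_simps intro!: exI[of _ 1])
  qed
  ultimately have "((\<lambda>h. flat p h / h) \<longlongrightarrow> 0) (at 0)"
    by (simp add: filterlim_split_at)
  then show ?thesis using equal by (simp add: DERIV_def flat_def)
qed

lemma smooth1_flat: "smooth1 (flat p)"
  unfolding smooth1_def
  by (rule exI[of _ "\<lambda>m. flat (((\<lambda>p. [:0, 0, 1:] * (p - pderiv p)) ^^ m) p)"])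
    (use flat_DERIV in auto)

lemma bump_coord:
  assumes e: "e > 0"
  obtains \<beta> where "\<And>n S i. openin (Euclidean_space n) S \<Longrightarrow> i < n \<Longrightarrow> C_infinity n S (\<lambda>x. \<beta> (x i - a i :: real))"
    "\<And>u. \<bar>u\<bar> < e / 2 \<Longrightarrow> \<beta> u = 1" "\<And>u. \<bar>u\<bar> \<ge> 3 / 4 * e \<Longrightarrow> \<beta> u = 0"
proof -
  let ?E = "flat 1"
  \<comment> \<open>Both cut-offs depend on the square of 2 u / e and so are smooth at 0.
    \<open>A\<close> lives where the square is below 2 and \<open>B\<close> where it exceeds 1, so
    their sum never vanishes; the quotient is 1 up to e / 2, and 0 from 3 / 4 * e on because (3 /
    2)^2 exceeds 2.\<close>
  define A where "A = (\<lambda>u. ?E (2 - (2 * u / e)\<^sup>2))"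
  define B where "B = (\<lambda>u. ?E ((2 * u / e)\<^sup>2 - 1))"
  have E: "?E x \<ge> 0" "?E x > 0 \<longleftrightarrow> x > 0" for x by (auto simp: flat_def)
  have pos: "A u + B u > 0" for u
  proof (cases "2 - (2 * u / e)\<^sup>2 > 0")
    case True then have "A u > 0" by (simp add: A_def E)
    then show ?thesis using E(1) by (simp add: B_def add_pos_nonneg)
  next
    case False then have "B u > 0" by (simp add: B_def E)
    then show ?thesis using E(1) by (simp add: A_def add_nonneg_pos)
  qed
  define \<beta> where "\<beta> = (\<lambda>u. A u * inverse (A u + B u))"
  \<comment> \<open>A function of one real variable is regarded as a function on
    \<open>Euclidean_space 1\<close>, to which the general composition lemma applies.\<close>
  have comp: "C_infinity n S (\<lambda>x. ?E (g x))"
    if S: "openin (Euclidean_space n) S" and g: "C_infinity n S g" for n S g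
  proof -
    have T: "openin (Euclidean_space 1) (topspace (Euclidean_space 1))" by simp
    have "C_infinity n S (\<lambda>x. (\<lambda>y. ?E (y 0)) (tuple 1 (\<lambda>_. g) x))"
      by (rule C_infinity_comp[OF S T _ C_infinity_coord1[OF T _ smooth1_flat]])
        (auto simp: tuple_def topspace_Euclidean_space g)
    then show ?thesis by (simp add: tuple_def)
  qed
  show ?thesis
  proof (rule that[of \<beta>])
    fix n S i assume S: "openin (Euclidean_space n) S" and i: "i < n"
    note c = C_infinity_const[OF S] C_infinity_mult[OF S] C_infinity_add[OF S]
    have sq: "(2 * (x i - a i) / e)\<^sup>2 = (2 / e * (x i + - a i)) * (2 / e * (x i + - a i))" for x :: "nat \<Rightarrow> real"
      by (simp add: power2_eq_square)
    have q: "C_infinity n S (\<lambda>x. 2 / e * (x i + - a i))"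
      by (intro c C_infinity_coord[OF S i])
    have "C_infinity n S (\<lambda>x. 2 + (-1) * ((2 / e * (x i + - a i)) * (2 / e * (x i + - a i))))"
      by (intro c q)
    from comp[OF S this] have A: "C_infinity n S (\<lambda>x. A (x i - a i))"
      unfolding A_def sq by simp
    have "C_infinity n S (\<lambda>x. ((2 / e * (x i + - a i)) * (2 / e * (x i + - a i))) + - 1)"
      by (intro c q)
    from comp[OF S this] have B: "C_infinity n S (\<lambda>x. B (x i - a i))"
      unfolding B_def sq by simp
    show "C_infinity n S (\<lambda>x. \<beta> (x i - a i))"
      unfolding \<beta>_def by (intro c C_infinity_inverse[OF S] A B) (use pos in \<open>metis less_irrefl\<close>)
  next
    fix u :: real assume u: "\<bar>u\<bar> < e / 2"
    have "(2 * u / e)\<^sup>2 < 1" using u e by (subst abs_square_less_1) (auto simp: field_simps)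
    then have "B u = 0" by (simp add: B_def flat_def)
    then show "\<beta> u = 1" using pos[of u] by (simp add: \<beta>_def)
  next
    fix u :: real assume u: "\<bar>u\<bar> \<ge> 3 / 4 * e"
    have "(3 / 2)\<^sup>2 \<le> \<bar>2 * u / e\<bar>\<^sup>2" using u e by (intro power_mono) (auto simp: field_simps)
    then have "A u = 0" by (simp add: A_def flat_def power2_eq_square)
    then show "\<beta> u = 0" by (simp add: \<beta>_def)
  qed
qed

text \<open>The room between 3 / 4 * e and e is essential: the function is supported in a closed box
  inside the open cube, and this makes its extension by 0 to a manifold smooth.\<close>

lemma bump_cube:
  assumes e: "e > 0"
  obtains \<beta> where "\<And>S. openin (Euclidean_space n) S \<Longrightarrow> C_infinity n S \<beta>"
    "\<And>x. x \<in> cube n a (e / 2) \<Longrightarrow> \<beta> x = 1" "\<And>x i. i < n \<Longrightarrow> \<bar>x i - a i\<bar> \<ge> 3 / 4 * e \<Longrightarrow> \<beta> x = 0"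
proof -
  obtain b where b: "\<And>n S i. openin (Euclidean_space n) S \<Longrightarrow> i < n \<Longrightarrow> C_infinity n S (\<lambda>x. b (x i - a i))"
    "\<And>u. \<bar>u\<bar> < e / 2 \<Longrightarrow> b u = 1" "\<And>u. \<bar>u\<bar> \<ge> 3 / 4 * e \<Longrightarrow> b u = 0"
    using bump_coord[OF e, of a] by metis
  show ?thesis
  proof (rule that[of "\<lambda>x. \<Prod>i<n. b (x i - a i)"])
    show "C_infinity n S (\<lambda>x. \<Prod>i<n. b (x i - a i))" if "openin (Euclidean_space n) S" for S
      by (rule C_infinity_prod[OF that]) (use b that in auto)
    show "(\<Prod>i<n. b (x i - a i)) = 1" if "x \<in> cube n a (e / 2)" for x
      using that b by (auto simp: cube_def intro: prod.neutral)
    show "(\<Prod>i<n. b (x i - a i)) = 0" if "i < n" "\<bar>x i - a i\<bar> \<ge> 3 / 4 * e" for x i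
      by (rule prod_zero) (use that b(3)[of "x i - a i"] in auto)
  qed
qed

lemma openin_E_preimage:
  assumes A: "openin (Euclidean_space n) A" and T: "openin (Euclidean_space m) T"
    and G: "\<And>j. j < m \<Longrightarrow> continuous_on A (\<lambda>y. G y j)" "\<And>y j. y \<in> A \<Longrightarrow> j \<ge> m \<Longrightarrow> G y j = 0"
  shows "openin (Euclidean_space n) {y \<in> A. G y \<in> T}"
proof -
  obtain U where U: "open U" "T = {x. \<forall>i\<ge>m. x i = 0} \<inter> U"
    using T unfolding Euclidean_space_eq by (auto simp: openin_open)
  have "continuous_on A (\<lambda>y. G y j)" for j
    using G by (cases "j < m") (auto cong: continuous_on_cong)
  then have "continuous_on A G" by (rule continuous_on_coordinatewise_then_product)
  then have "openin (top_of_set A) (A \<inter> G -` U)" using U by (simp add: continuous_openin_preimage_gen)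
  moreover have "top_of_set A = subtopology (Euclidean_space n) A"
    using openin_subset[OF A]
    by (simp add: Euclidean_space_eq subtopology_subtopology Int_absorb1)
  moreover have "A \<inter> G -` U = {y \<in> A. G y \<in> T}" using U G by auto
  ultimately show ?thesis using A by (metis openin_open_subtopology)
qed

section \<open>Manifolds\<close>

text \<open>The separation and countability axioms are left out because, for a prolongation, they
  are proved only after its topology and charts have been studied by means of the lemmas of this
  locale.\<close>

locale premanifold =
  fixes M :: "'a mfd"
  assumes charts: "\<forall>(U, \<phi>)\<in>atlas M. inj_on \<phi> U \<and> openin (Euclidean_space (mdim M)) (\<phi> ` U)"
    and transitions: "\<forall>(U, \<phi>)\<in>atlas M. \<forall>(V, \<psi>)\<in>atlas M.
        openin (Euclidean_space (mdim M)) (\<phi> ` (U \<inter> V)) \<and>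
        (\<forall>j<mdim M. C_infinity (mdim M) (\<phi> ` (U \<inter> V)) (\<lambda>x. \<psi> (inv_into U \<phi> x) j))"
begin

abbreviation n :: nat where "n \<equiv> mdim M"
abbreviation E :: "(nat \<Rightarrow> real) topology" where "E \<equiv> Euclidean_space n"
abbreviation opn :: "'a set \<Rightarrow> bool" where "opn \<equiv> openin (mtop M)"

lemma chart_inj: "(U, \<phi>) \<in> atlas M \<Longrightarrow> inj_on \<phi> U"
  and chart_open: "(U, \<phi>) \<in> atlas M \<Longrightarrow> openin E (\<phi> ` U)"
  using charts by auto

lemma chart_zero: "(U, \<phi>) \<in> atlas M \<Longrightarrow> q \<in> U \<Longrightarrow> j \<ge> n \<Longrightarrow> \<phi> q j = 0"
  using chart_open openin_E_zero by blast

lemma chart_inv [simp]: "(U, \<phi>) \<in> atlas M \<Longrightarrow> q \<in> U \<Longrightarrow> inv_into U \<phi> (\<phi> q) = q"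
  using chart_inj by simp

lemma chart_trans:
  assumes "(U, \<phi>) \<in> atlas M" "(V, \<psi>) \<in> atlas M"
  shows "openin E (\<phi> ` (U \<inter> V))"
    "j < n \<Longrightarrow> C_infinity n (\<phi> ` (U \<inter> V)) (\<lambda>x. \<psi> (inv_into U \<phi> x) j)"
  using transitions assms by fast+

text \<open>\<open>mtop\<close> is built with \<open>topology\<close>, which returns the given
  predicate only if that predicate is a topology. Closure under intersections needs the injectivity
  of the charts.\<close>

lemma openin_mtop:
  "opn S \<longleftrightarrow> S \<subseteq> points M \<and> (\<forall>(U, \<phi>)\<in>atlas M. openin E (\<phi> ` (S \<inter> U)))"
proof -
  let ?P = "\<lambda>S. S \<subseteq> points M \<and> (\<forall>(U, \<phi>)\<in>atlas M. openin E (\<phi> ` (S \<inter> U)))"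
  have "istopology ?P"
    unfolding istopology_def
  proof (intro conjI allI impI)
    fix S T assume ST: "?P S" "?P T"
    have "\<phi> ` (S \<inter> T \<inter> U) = \<phi> ` (S \<inter> U) \<inter> \<phi> ` (T \<inter> U)" if "(U, \<phi>) \<in> atlas M" for U \<phi>
      using inj_on_image_Int[OF chart_inj[OF that], of "S \<inter> U" "T \<inter> U"]
      by (simp add: Int_ac)
    then show "\<forall>(U, \<phi>)\<in>atlas M. openin E (\<phi> ` (S \<inter> T \<inter> U))"
      using ST by (auto intro!: openin_Int)
    show "S \<inter> T \<subseteq> points M" using ST by auto
  next
    fix K assume K: "\<forall>S\<in>K. ?P S"
    show "\<Union>K \<subseteq> points M" using K by auto
    have "\<phi> ` (\<Union>K \<inter> U) = (\<Union>S\<in>K. \<phi> ` (S \<inter> U))" for \<phi> :: "'a \<Rightarrow> nat \<Rightarrow> real" and U by auto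
    then show "\<forall>(U, \<phi>)\<in>atlas M. openin E (\<phi> ` (\<Union>K \<inter> U))"
      using K by (auto intro!: openin_Union)
  qed
  then have "openin (topology ?P) = ?P" by (rule topology_inverse')
  then show ?thesis by (simp add: mtop_def)
qed

lemma opn_chart: "(U, \<phi>) \<in> atlas M \<Longrightarrow> opn U"
  unfolding openin_mtop using chart_trans(1) by (auto simp: points_def Int_commute)

lemma opn_points: "opn (points M)"
  unfolding openin_mtop using chart_open
  by (auto simp: points_def Int_absorb1 Sup_upper Int_Un_distrib2 UN_upper
      split: prod.splits intro!: back_subst[of "openin E", OF chart_open] arg_cong[of _ _ "image _"])

lemma topspace_mtop [simp]: "topspace (mtop M) = points M"
  using opn_points openin_mtop openin_topspace openin_subset by (metis subset_antisym)

lemma opn_sub: "opn S \<Longrightarrow> S \<subseteq> points M"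
  by (simp add: openin_mtop)

lemma opn_image: "opn S \<Longrightarrow> (U, \<phi>) \<in> atlas M \<Longrightarrow> openin E (\<phi> ` (S \<inter> U))"
  by (auto simp: openin_mtop)

lemma point_chart: "q \<in> points M \<Longrightarrow> \<exists>U \<phi>. (U, \<phi>) \<in> atlas M \<and> q \<in> U"
  by (auto simp: points_def)

lemma openin_trans_preimage:
  assumes "(U, \<phi>) \<in> atlas M" "(V, \<psi>) \<in> atlas M" "openin E T"
  shows "openin E (\<psi> ` {q \<in> U \<inter> V. \<phi> q \<in> T})"
proof -
  have eq: "\<psi> ` {q \<in> U \<inter> V. \<phi> q \<in> T} = {y \<in> \<psi> ` (V \<inter> U). \<phi> (inv_into V \<psi> y) \<in> T}"
    using assms by (auto simp: image_iff Bex_def)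
  have VU: "openin E (\<psi> ` (V \<inter> U))" using chart_trans(1) assms by blast
  show ?thesis unfolding eq
  proof (rule openin_E_preimage[OF VU assms(3)])
    show "continuous_on (\<psi> ` (V \<inter> U)) (\<lambda>y. \<phi> (inv_into V \<psi> y) j)" if "j < n" for j
      using chart_trans(2)[OF assms(2,1) that] VU unfolding C_infinity_def by (meson C_k_continuous)
    show "\<phi> (inv_into V \<psi> y) j = 0" if "y \<in> \<psi> ` (V \<inter> U)" "j \<ge> n" for y j
      using that assms chart_zero by auto
  qed
qed

lemma opn_chart_preimage:
  assumes "(U, \<phi>) \<in> atlas M" "openin E T"
  shows "opn {q \<in> U. \<phi> q \<in> T}"
proof -
  have "{q \<in> U. \<phi> q \<in> T} \<inter> V = {q \<in> U \<inter> V. \<phi> q \<in> T}" for V by auto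
  then show ?thesis
    using assms openin_trans_preimage[OF assms(1) _ assms(2)]
    by (auto simp: openin_mtop points_def)
qed

lemma opn_cube:
  assumes "opn S" "(U, \<phi>) \<in> atlas M" "q \<in> S" "q \<in> U"
  obtains e where "e > 0" "cube n (\<phi> q) e \<subseteq> \<phi> ` (S \<inter> U)"
    "opn {p \<in> U. \<phi> p \<in> cube n (\<phi> q) e}" "{p \<in> U. \<phi> p \<in> cube n (\<phi> q) e} \<subseteq> S"
    "\<phi> ` {p \<in> U. \<phi> p \<in> cube n (\<phi> q) e} = cube n (\<phi> q) e"
proof -
  obtain e where e: "e > 0" "cube n (\<phi> q) e \<subseteq> \<phi> ` (S \<inter> U)"
    using openin_E_cube[OF opn_image[OF assms(1,2)], of "\<phi> q"] assms by auto
  show ?thesis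
  proof (rule that[OF e])
    show "opn {p \<in> U. \<phi> p \<in> cube n (\<phi> q) e}"
      by (rule opn_chart_preimage[OF assms(2) openin_cube])
    show "{p \<in> U. \<phi> p \<in> cube n (\<phi> q) e} \<subseteq> S"
      using e(2) inj_onD[OF chart_inj[OF assms(2)]] by blast
    show "\<phi> ` {p \<in> U. \<phi> p \<in> cube n (\<phi> q) e} = cube n (\<phi> q) e"
      using e(2) by auto
  qed
qed

lemma smooth_onD:
  "smooth_on M S f \<Longrightarrow> (U, \<phi>) \<in> atlas M \<Longrightarrow> C_infinity n (\<phi> ` (S \<inter> U)) (\<lambda>x. f (inv_into U \<phi> x))"
  by (auto simp: smooth_on_def)

text \<open>The definition tests smoothness in every chart. Composing with the transition maps shows
  that one chart around each point is enough.\<close>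

lemma smooth_onI:
  assumes S: "opn S"
    and loc: "\<And>q. q \<in> S \<Longrightarrow> \<exists>U \<phi> O'. (U, \<phi>) \<in> atlas M \<and> opn O' \<and> q \<in> O' \<and> O' \<subseteq> U \<and>
      C_infinity n (\<phi> ` O') (\<lambda>x. f (inv_into U \<phi> x))"
  shows "smooth_on M S f"
  unfolding smooth_on_def
proof clarify
  fix V \<psi> assume V: "(V, \<psi>) \<in> atlas M"
  show "C_infinity n (\<psi> ` (S \<inter> V)) (\<lambda>x. f (inv_into V \<psi> x))"
  proof (rule C_infinity_local[OF opn_image[OF S V]])
    fix x assume "x \<in> \<psi> ` (S \<inter> V)"
    then obtain q where q: "x = \<psi> q" "q \<in> S" "q \<in> V" by auto
    obtain U \<phi> O' where U: "(U, \<phi>) \<in> atlas M" and O': "opn O'" "q \<in> O'" "O' \<subseteq> U"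
      and C: "C_infinity n (\<phi> ` O') (\<lambda>x. f (inv_into U \<phi> x))" using loc[OF q(2)] by blast
    let ?T = "\<psi> ` (O' \<inter> V)"
    have T: "openin E ?T" by (rule opn_image[OF O'(1) V])
    have T': "openin E (\<phi> ` O')" using opn_image[OF O'(1) U] O' by (simp add: Int_absorb2)
    have tup: "tuple n (\<lambda>j y. \<phi> (inv_into V \<psi> y) j) (\<psi> p) = \<phi> p" if "p \<in> O'" "p \<in> V" for p
      using that V U O' chart_zero[OF U] by (auto simp: tuple_def fun_eq_iff)
    have "C_infinity n ?T (\<lambda>y. f (inv_into U \<phi> (tuple n (\<lambda>j y. \<phi> (inv_into V \<psi> y) j) y)))"
    proof (rule C_infinity_comp[OF T T' _ C])
      show "tuple n (\<lambda>j y. \<phi> (inv_into V \<psi> y) j) y \<in> \<phi> ` O'" if "y \<in> ?T" for y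
        using that tup by auto
      show "C_infinity n ?T (\<lambda>y. \<phi> (inv_into V \<psi> y) j)" if "j < n" for j
        by (rule C_infinity_subset[OF chart_trans(1)[OF V U] T _ chart_trans(2)[OF V U that]])
          (use O' in auto)
    qed
    then have "C_infinity n ?T (\<lambda>y. f (inv_into V \<psi> y))"
      by (subst C_infinity_cong[OF T]) (use tup U V O' in auto)
    then have "C_infinity n (?T \<inter> \<psi> ` (S \<inter> V)) (\<lambda>y. f (inv_into V \<psi> y))"
      using C_infinity_subset[OF T openin_Int[OF T opn_image[OF S V]]] by auto
    then show "\<exists>T. openin E T \<and> x \<in> T \<and> C_infinity n (T \<inter> \<psi> ` (S \<inter> V)) (\<lambda>x. f (inv_into V \<psi> x))"
      using T q O' by blast
  qed
qed

lemma smooth_on_subset: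
  assumes "smooth_on M S f" "opn S" "opn T" "T \<subseteq> S"
  shows "smooth_on M T f"
  unfolding smooth_on_def
proof clarify
  fix V \<psi> assume V: "(V, \<psi>) \<in> atlas M"
  show "C_infinity n (\<psi> ` (T \<inter> V)) (\<lambda>x. f (inv_into V \<psi> x))"
    by (rule C_infinity_subset[OF opn_image[OF assms(2) V] opn_image[OF assms(3) V] _ smooth_onD[OF assms(1) V]])
      (use assms in auto)
qed

lemma smooth_on_local:
  assumes S: "opn S" and loc: "\<And>q. q \<in> S \<Longrightarrow> \<exists>O'. opn O' \<and> q \<in> O' \<and> smooth_on M O' f"
  shows "smooth_on M S f"
proof (rule smooth_onI[OF S])
  fix q assume q: "q \<in> S"
  obtain O' where O': "opn O'" "q \<in> O'" "smooth_on M O' f" using loc[OF q] by blast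
  obtain U \<phi> where U: "(U, \<phi>) \<in> atlas M" "q \<in> U" using q S opn_sub point_chart by blast
  show "\<exists>U \<phi> O'. (U, \<phi>) \<in> atlas M \<and> opn O' \<and> q \<in> O' \<and> O' \<subseteq> U \<and>
      C_infinity n (\<phi> ` O') (\<lambda>x. f (inv_into U \<phi> x))"
    using U O' opn_chart smooth_onD by (intro exI[of _ U] exI[of _ \<phi>] exI[of _ "O' \<inter> U"]) auto
qed

lemma smooth_on_cong:
  assumes "opn S" "\<And>x. x \<in> S \<Longrightarrow> f x = g x"
  shows "smooth_on M S f \<longleftrightarrow> smooth_on M S g"
proof -
  have "C_infinity n (\<phi> ` (S \<inter> U)) (\<lambda>x. f (inv_into U \<phi> x)) \<longleftrightarrow>
      C_infinity n (\<phi> ` (S \<inter> U)) (\<lambda>x. g (inv_into U \<phi> x))" if "(U, \<phi>) \<in> atlas M" for U \<phi>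
    by (rule C_infinity_cong[OF opn_image[OF assms(1) that]]) (use assms that in auto)
  then show ?thesis unfolding smooth_on_def by auto
qed

lemma smooth_on_const: "opn S \<Longrightarrow> smooth_on M S (\<lambda>x. c)"
  and smooth_on_add: "opn S \<Longrightarrow> smooth_on M S f \<Longrightarrow> smooth_on M S g \<Longrightarrow> smooth_on M S (\<lambda>x. f x + g x)"
  and smooth_on_mult: "opn S \<Longrightarrow> smooth_on M S f \<Longrightarrow> smooth_on M S g \<Longrightarrow> smooth_on M S (\<lambda>x. f x * g x)"
  using opn_image unfolding smooth_on_def
  by (auto intro: C_infinity_const C_infinity_add C_infinity_mult split: prod.splits)

lemma smooth_on_cmult: "opn S \<Longrightarrow> smooth_on M S f \<Longrightarrow> smooth_on M S (\<lambda>x. c * f x)"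
  by (intro smooth_on_mult smooth_on_const)

lemma smooth_on_diff: "opn S \<Longrightarrow> smooth_on M S f \<Longrightarrow> smooth_on M S g \<Longrightarrow> smooth_on M S (\<lambda>x. f x - g x)"
  using smooth_on_add[of S f "\<lambda>x. - 1 * g x"] smooth_on_cmult[of S g "- 1"] by simp

lemma smooth_on_inverse:
  assumes "opn S" "\<And>x. x \<in> S \<Longrightarrow> f x \<noteq> 0" "smooth_on M S f"
  shows "smooth_on M S (\<lambda>x. inverse (f x))"
  unfolding smooth_on_def
proof clarify
  fix V \<psi> assume V: "(V, \<psi>) \<in> atlas M"
  show "C_infinity n (\<psi> ` (S \<inter> V)) (\<lambda>x. inverse (f (inv_into V \<psi> x)))"
    by (rule C_infinity_inverse[OF opn_image[OF assms(1) V] _ smooth_onD[OF assms(3) V]])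
      (use assms V in auto)
qed

lemma smooth_on_sum:
  "opn S \<Longrightarrow> (\<And>j. j \<in> J \<Longrightarrow> smooth_on M S (f j)) \<Longrightarrow> smooth_on M S (\<lambda>x. \<Sum>j\<in>J. f j x)"
  by (induct J rule: infinite_finite_induct) (auto intro: smooth_on_const smooth_on_add)

lemma smooth_on_comp:
  assumes S: "opn S" and T: "openin (Euclidean_space m) T" "C_infinity m T G"
    and g: "\<And>j. j < m \<Longrightarrow> smooth_on M S (g j)" "\<And>q. q \<in> S \<Longrightarrow> tuple m g q \<in> T"
  shows "smooth_on M S (\<lambda>q. G (tuple m g q))"
  unfolding smooth_on_def
proof clarify
  fix U \<phi> assume U: "(U, \<phi>) \<in> atlas M"
  have tup: "tuple m g (inv_into U \<phi> x) = tuple m (\<lambda>j x. g j (inv_into U \<phi> x)) x" for x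
    by (auto simp: tuple_def)
  show "C_infinity n (\<phi> ` (S \<inter> U)) (\<lambda>x. G (tuple m g (inv_into U \<phi> x)))"
    unfolding tup
    by (rule C_infinity_comp[OF opn_image[OF S U] T(1) _ T(2) smooth_onD[OF g(1) U]])
      (use g(2) U in \<open>auto simp: tup[symmetric]\<close>)
qed

lemma smooth_on_coord:
  assumes "(U, \<phi>) \<in> atlas M" "i < n"
  shows "smooth_on M U (\<lambda>q. \<phi> q i)"
proof (rule smooth_onI[OF opn_chart[OF assms(1)]])
  fix q assume q: "q \<in> U"
  have "C_infinity n (\<phi> ` U) (\<lambda>x. \<phi> (inv_into U \<phi> x) i)"
    using C_infinity_coord[OF chart_open[OF assms(1)] assms(2)]
    by (subst C_infinity_cong[OF chart_open[OF assms(1)], of _ "\<lambda>x. x i"]) (use assms in auto)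
  then show "\<exists>Ua \<phi>' O'. (Ua, \<phi>') \<in> atlas M \<and> opn O' \<and> q \<in> O' \<and> O' \<subseteq> Ua \<and>
      C_infinity n (\<phi>' ` O') (\<lambda>x. \<phi> (inv_into Ua \<phi>' x) i)"
    using assms q opn_chart by blast
qed

lemma smooth_on_chart_fun:
  assumes U: "(U, \<phi>) \<in> atlas M" and T: "openin E T" "C_infinity n T G"
  shows "smooth_on M {q \<in> U. \<phi> q \<in> T} (\<lambda>q. G (\<phi> q))"
proof -
  let ?S = "{q \<in> U. \<phi> q \<in> T}"
  have S: "opn ?S" using opn_chart_preimage U T by blast
  have tup: "tuple n (\<lambda>j q. \<phi> q j) q = \<phi> q" if "q \<in> U" for q
    using chart_zero[OF U that] by (auto simp: tuple_def fun_eq_iff)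
  have "smooth_on M ?S (\<lambda>q. G (tuple n (\<lambda>j q. \<phi> q j) q))"
  proof (rule smooth_on_comp[OF S T])
    show "smooth_on M ?S (\<lambda>q. \<phi> q j)" if "j < n" for j
      by (rule smooth_on_subset[OF smooth_on_coord[OF U that] opn_chart[OF U] S]) auto
  qed (use tup in auto)
  then show ?thesis by (subst smooth_on_cong[OF S, of _ "\<lambda>q. G (tuple n (\<lambda>j q. \<phi> q j) q)"]) (use tup in auto)
qed

end

locale manifold = premanifold +
  assumes hausdorff: "Hausdorff_space (mtop M)" and sec_countable: "second_countable (mtop M)"

lemma manifold_iff: "manifold M \<longleftrightarrow> smooth_manifold M"
  unfolding manifold_def premanifold_def manifold_axioms_def smooth_manifold_def by blast

context manifold
begin

text \<open>The place where the Hausdorff property is indispensable: the support, a compact set in a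
  chart, is closed in the whole manifold, so its complement is open and the extension by 0 is smooth
  there. The last clause is the form used later: multiplying by \<open>b\<close> turns any function
  smooth on \<open>S\<close> into a global one.\<close>

lemma bump:
  assumes S: "opn S" and q: "q \<in> S"
  obtains b W where "opn W" "q \<in> W" "W \<subseteq> S" "\<And>x. x \<in> W \<Longrightarrow> b x = 1" "smooth_fun M b"
    "\<And>x. x \<notin> S \<Longrightarrow> b x = 0"
    "\<And>f. smooth_on M S f \<Longrightarrow> smooth_fun M (\<lambda>x. if x \<in> S then b x * f x else 0)"
proof -
  obtain U \<phi> where U: "(U, \<phi>) \<in> atlas M" and qU: "q \<in> U" using q S opn_sub point_chart by blast
  obtain e where e: "e > 0" and im: "cube n (\<phi> q) e \<subseteq> \<phi> ` (S \<inter> U)"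
    and C: "opn {p \<in> U. \<phi> p \<in> cube n (\<phi> q) e}" "{p \<in> U. \<phi> p \<in> cube n (\<phi> q) e} \<subseteq> S"
    by (rule opn_cube[OF S U q qU]) blast
  let ?C = "{p \<in> U. \<phi> p \<in> cube n (\<phi> q) e}"
  obtain \<beta> where \<beta>: "\<And>S. openin E S \<Longrightarrow> C_infinity n S \<beta>"
    "\<And>x. x \<in> cube n (\<phi> q) (e / 2) \<Longrightarrow> \<beta> x = 1"
    "\<And>x i. i < n \<Longrightarrow> \<bar>x i - \<phi> q i\<bar> \<ge> 3 / 4 * e \<Longrightarrow> \<beta> x = 0"
    by (rule bump_cube[OF e, of n "\<phi> q"]) blast
  define b where "b = (\<lambda>x. if x \<in> ?C then \<beta> (\<phi> x) else 0)"
  \<comment> \<open>The closed box of half-width 3 / 4 * e, outside of which the bump vanishes. It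
    is rewritten as a product of compact intervals and singletons, so that Tychonoff's theorem gives
    compactness in sequence space.\<close>
  define Kc where "Kc = {y. \<forall>i. if i < n then \<bar>y i - \<phi> q i\<bar> \<le> 3 / 4 * e else y i = 0}"
  have Kc: "Kc = (\<Pi>\<^sub>E i\<in>UNIV. if i < n then {\<phi> q i - 3 / 4 * e .. \<phi> q i + 3 / 4 * e} else {0})"
  proof -
    have "y i \<in> (if i < n then {\<phi> q i - 3 / 4 * e .. \<phi> q i + 3 / 4 * e} else {0}) \<longleftrightarrow>
        (if i < n then \<bar>y i - \<phi> q i\<bar> \<le> 3 / 4 * e else y i = 0)" for y i
      unfolding abs_le_iff by (cases "i < n") (simp_all only: if_True if_False atLeastAtMost_iff singleton_iff, linarith)
    then show ?thesis by (simp only: Kc_def PiE_UNIV_domain Pi_def) simp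
  qed
  have sub: "Kc \<subseteq> cube n (\<phi> q) e"
  proof
    fix y assume y: "y \<in> Kc"
    have "\<bar>y i - \<phi> q i\<bar> < e" if "i < n" for i
    proof -
      have "\<bar>y i - \<phi> q i\<bar> \<le> 3 / 4 * e" using y unfolding Kc_def mem_Collect_eq by (elim allE[of _ i]) (simp only: that if_True)
      then show ?thesis using e by simp
    qed
    moreover have "y i = 0" if "i \<ge> n" for i using y that by (simp add: Kc_def)
    ultimately show "y \<in> cube n (\<phi> q) e" by (simp add: cube_def)
  qed
  have "compactin (powertop_real UNIV) Kc"
    unfolding Kc compactin_PiE by (simp add: compactin_euclidean_iff)
  moreover have "Kc \<subseteq> {x. \<forall>i\<ge>n. x i = 0}" using sub unfolding cube_def by blast
  ultimately have "compactin E Kc"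
    unfolding Euclidean_space_def compactin_subtopology by blast
  moreover have cont: "continuous_map (subtopology E (\<phi> ` U)) (mtop M) (inv_into U \<phi>)"
    unfolding continuous_map_alt
  proof (intro conjI allI impI)
    fix V assume V: "opn V"
    have eq: "inv_into U \<phi> -` V \<inter> topspace (subtopology E (\<phi> ` U)) = \<phi> ` (V \<inter> U)"
      using openin_subset[OF chart_open[OF U]] U by auto
    show "openin (subtopology E (\<phi> ` U)) (inv_into U \<phi> -` V \<inter> topspace (subtopology E (\<phi> ` U)))"
      unfolding eq using opn_image[OF V U]
      by (simp add: openin_open_subtopology[OF chart_open[OF U]] image_mono)
  next
    show "inv_into U \<phi> \<in> topspace (subtopology E (\<phi> ` U)) \<rightarrow> topspace (mtop M)"
      using U by (auto simp: points_def)
  qed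
  moreover have "Kc \<subseteq> \<phi> ` U" using sub im by auto
  ultimately have "compactin (mtop M) (inv_into U \<phi> ` Kc)"
    by (intro image_compactin[OF _ cont]) (auto simp: compactin_subtopology)
  then have closed: "closedin (mtop M) (inv_into U \<phi> ` Kc)"
    using hausdorff compactin_imp_closedin by blast
  have K: "inv_into U \<phi> ` Kc = {p \<in> U. \<phi> p \<in> Kc}"
  proof -
    have "inv_into U \<phi> y \<in> U \<and> \<phi> (inv_into U \<phi> y) = y" if "y \<in> Kc" for y
      using that \<open>Kc \<subseteq> \<phi> ` U\<close> by (meson f_inv_into_f inv_into_into subsetD)
    moreover have "p \<in> inv_into U \<phi> ` Kc" if "p \<in> U" "\<phi> p \<in> Kc" for p
      using that U by (metis chart_inv imageI)
    ultimately show ?thesis by auto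
  qed
  have O2: "opn (points M - {p \<in> U. \<phi> p \<in> Kc})"
    using closed unfolding K closedin_def by auto
  have b0: "b x = 0" if "x \<notin> {p \<in> U. \<phi> p \<in> Kc}" for x
  proof (cases "x \<in> ?C")
    case True
    then have x: "x \<in> U" "\<forall>i\<ge>n. \<phi> x i = 0" by (auto simp: cube_def)
    have "\<phi> x \<in> Kc" if "\<And>i. i < n \<Longrightarrow> \<bar>\<phi> x i - \<phi> q i\<bar> \<le> 3 / 4 * e"
      unfolding Kc_def mem_Collect_eq using that x(2) by (metis not_less)
    then have "\<exists>i<n. \<bar>\<phi> x i - \<phi> q i\<bar> \<ge> 3 / 4 * e"
      using \<open>x \<notin> _\<close> x(1) by (metis (mono_tags, lifting) linear mem_Collect_eq)
    then show ?thesis using \<beta>(3) by (auto simp: b_def)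
  qed (auto simp: b_def)
  have sm: "smooth_fun M (\<lambda>x. if x \<in> S then b x * f x else 0)" if f: "smooth_on M S f" for f
  proof (rule smooth_on_local[OF opn_points])
    fix x assume x: "x \<in> points M"
    show "\<exists>O'. opn O' \<and> x \<in> O' \<and> smooth_on M O' (\<lambda>x. if x \<in> S then b x * f x else 0)"
    proof (cases "x \<in> {p \<in> U. \<phi> p \<in> Kc}")
      case True
      have "smooth_on M ?C (\<lambda>x. \<beta> (\<phi> x) * f x)"
        by (intro smooth_on_mult C(1) smooth_on_chart_fun[OF U openin_cube] \<beta>(1)[OF openin_cube]
            smooth_on_subset[OF f S C])
      then have "smooth_on M ?C (\<lambda>x. if x \<in> S then b x * f x else 0)"
        by (subst smooth_on_cong[OF C(1), of _ "\<lambda>x. \<beta> (\<phi> x) * f x"])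
          (use C(2) in \<open>auto simp: b_def\<close>)
      then show ?thesis using C(1) True sub by blast
    next
      case False
      have "smooth_on M (points M - {p \<in> U. \<phi> p \<in> Kc}) (\<lambda>x. if x \<in> S then b x * f x else 0)"
        by (subst smooth_on_cong[OF O2, of _ "\<lambda>x. 0"])
          (use b0 in \<open>auto simp: smooth_on_const[OF O2]\<close>)
      then show ?thesis using O2 x False by blast
    qed
  qed
  have bS: "b x = 0" if "x \<notin> S" for x using that C(2) by (auto simp: b_def)
  have z: "\<forall>i\<ge>n. \<phi> q i = 0" using chart_zero[OF U qU] by simp
  have half: "cube n (\<phi> q) (e / 2) \<subseteq> cube n (\<phi> q) e" using e by (force simp: cube_def)
  show ?thesis
  proof (rule that[of "{p \<in> U. \<phi> p \<in> cube n (\<phi> q) (e / 2)}" b])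
    show "opn {p \<in> U. \<phi> p \<in> cube n (\<phi> q) (e / 2)}"
      by (rule opn_chart_preimage[OF U openin_cube])
    show "smooth_fun M b"
    proof -
      have "(\<lambda>x. if x \<in> S then b x * 1 else 0) = b" using bS by auto
      then show ?thesis using sm[OF smooth_on_const[OF S, of 1]] by simp
    qed
    show "b x = 1" if "x \<in> {p \<in> U. \<phi> p \<in> cube n (\<phi> q) (e / 2)}" for x
      using that half \<beta>(2) by (auto simp: b_def)
  qed (use qU cube_self[OF z] e C(2) half bS sm in auto)
qed

lemma smooth_extend:
  assumes S: "opn S" "q \<in> S" "smooth_on M S f"
  obtains F W where "smooth_fun M F" "opn W" "q \<in> W" "W \<subseteq> S" "\<And>x. x \<in> W \<Longrightarrow> F x = f x"
proof -
  obtain b W where b: "opn W" "q \<in> W" "W \<subseteq> S" "\<And>x. x \<in> W \<Longrightarrow> b x = 1"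
    "smooth_fun M (\<lambda>x. if x \<in> S then b x * f x else 0)"
    using S(3) by (rule_tac bump[OF S(1,2)]) blast
  show ?thesis by (rule that[OF b(5) b(1-3)]) (use b in auto)
qed

end

section \<open>Finite families of vectors\<close>

text \<open>Independence of an indexed family rather than of a set: repetitions count as dependence,
  and sums run over fixed generators even though the vectors vary with the point of the
  manifold.\<close>

definition fam_indep :: "'i set \<Rightarrow> ('i \<Rightarrow> 'b::real_vector) \<Rightarrow> bool" where
  "fam_indep I v \<longleftrightarrow> (\<forall>c. (\<Sum>i\<in>I. c i *\<^sub>R v i) = 0 \<longrightarrow> (\<forall>i\<in>I. c i = 0))"

lemma in_span_image:
  assumes "finite I"
  shows "x \<in> span (v ` I) \<longleftrightarrow> (\<exists>c. x = (\<Sum>i\<in>I. c i *\<^sub>R v i))"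
proof
  let ?S = "{x. \<exists>c. x = (\<Sum>i\<in>I. c i *\<^sub>R v i)}"
  have "subspace ?S"
  proof (rule subspaceI)
    show "0 \<in> ?S" by (auto intro!: exI[of _ "\<lambda>_. 0"])
    show "x + y \<in> ?S" if xy: "x \<in> ?S" "y \<in> ?S" for x y
    proof -
      obtain c d where "x = (\<Sum>i\<in>I. c i *\<^sub>R v i)" "y = (\<Sum>i\<in>I. d i *\<^sub>R v i)" using xy by auto
      then show ?thesis
        by (auto intro!: exI[of _ "\<lambda>i. c i + d i"] simp: scaleR_add_left sum.distrib)
    qed
    show "k *\<^sub>R x \<in> ?S" if x: "x \<in> ?S" for k x
    proof -
      obtain c where "x = (\<Sum>i\<in>I. c i *\<^sub>R v i)" using x by auto
      then show ?thesis
        by (auto intro!: exI[of _ "\<lambda>i. k * c i"] simp: scaleR_sum_right)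
    qed
  qed
  moreover have "v ` I \<subseteq> ?S"
  proof clarify
    fix i assume "i \<in> I"
    then have "v i = (\<Sum>j\<in>I. (if j = i then 1 else 0) *\<^sub>R v j)"
      using assms by (simp add: if_distrib[of "\<lambda>c. c *\<^sub>R _"] sum.delta cong: if_cong)
    then show "\<exists>c. v i = (\<Sum>i\<in>I. c i *\<^sub>R v i)"
      by (intro exI[of _ "\<lambda>j. if j = i then 1 else 0"])
  qed
  ultimately have "span (v ` I) \<subseteq> ?S" by (intro span_minimal)
  then show "x \<in> span (v ` I) \<Longrightarrow> \<exists>c. x = (\<Sum>i\<in>I. c i *\<^sub>R v i)" by auto
  show "\<exists>c. x = (\<Sum>i\<in>I. c i *\<^sub>R v i) \<Longrightarrow> x \<in> span (v ` I)"
    by (elim exE, simp, intro span_sum span_scale span_base imageI)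
qed

lemma sum_in_span: "(\<Sum>i\<in>I. c i *\<^sub>R v i) \<in> span (v ` I)"
  by (intro span_sum span_scale span_base imageI)

lemma in_spanI: "x = (\<Sum>i\<in>I. c i *\<^sub>R v i) \<Longrightarrow> x \<in> span (v ` I)"
  by (simp only: sum_in_span)

lemma fam_indep_subset: "finite J \<Longrightarrow> I \<subseteq> J \<Longrightarrow> fam_indep J v \<Longrightarrow> fam_indep I v"
  unfolding fam_indep_def
proof (intro allI impI ballI)
  fix c i assume *: "finite J" "I \<subseteq> J" "\<forall>c. (\<Sum>i\<in>J. c i *\<^sub>R v i) = 0 \<longrightarrow> (\<forall>i\<in>J. c i = 0)"
    "(\<Sum>i\<in>I. c i *\<^sub>R v i) = 0" "i \<in> I"
  have "(\<Sum>i\<in>J. (if i \<in> I then c i else 0) *\<^sub>R v i) = (\<Sum>i\<in>I. c i *\<^sub>R v i)"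
    by (rule sum.mono_neutral_cong_right) (use *(1,2) in auto)
  then have "(\<Sum>i\<in>J. (if i \<in> I then c i else 0) *\<^sub>R v i) = 0" using *(4) by (rule trans)
  then have "\<forall>i\<in>J. (if i \<in> I then c i else 0) = 0" by (rule *(3)[rule_format, THEN ballI])
  then show "c i = 0" using *(2,5) by (auto dest: bspec[of _ _ i])
qed

lemma fam_indep_delta:
  assumes "fam_indep I v" "finite I" "i \<in> I" "j \<in> I" "v i = v j" shows "i = j"
proof (rule ccontr)
  assume ij: "i \<noteq> j"
  define c where "c = (\<lambda>k. if k = i then 1 else if k = j then - 1 else (0::real))"
  have "(\<Sum>k\<in>I. c k *\<^sub>R v k) = (\<Sum>k\<in>{i, j}. c k *\<^sub>R v k)"
    by (rule sum.mono_neutral_right) (use assms(2-4) in \<open>auto simp: c_def\<close>)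
  also have "\<dots> = 0" using ij assms(5) by (simp add: c_def)
  finally have "c i = 0" using assms(1,3) unfolding fam_indep_def by blast
  then show False by (simp add: c_def)
qed

lemma fam_indep_dim:
  assumes "finite I" "fam_indep I v"
  shows "inj_on v I" "independent (v ` I)" "dim (span (v ` I)) = card I"
proof -
  show inj: "inj_on v I" using fam_indep_delta assms by (auto intro!: inj_onI)
  show ind: "independent (v ` I)"
  proof
    assume "dependent (v ` I)"
    then obtain u where u: "\<exists>w\<in>v ` I. u w \<noteq> 0" "(\<Sum>w\<in>v ` I. u w *\<^sub>R w) = 0"
      using assms(1) by (auto simp: dependent_finite)
    then have "(\<Sum>i\<in>I. u (v i) *\<^sub>R v i) = 0" using inj by (simp add: sum.reindex)
    then have "\<forall>i\<in>I. u (v i) = 0" using assms(2)[unfolded fam_indep_def, rule_format, of "\<lambda>i. u (v i)"] by blast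
    then show False using u by auto
  qed
  show "dim (span (v ` I)) = card I"
    using ind inj by (simp add: dim_eq_card_independent card_image)
qed

lemma fam_indep_if_dim:
  assumes "finite I" "card I \<le> dim (span (v ` I))"
  shows "fam_indep I v"
  unfolding fam_indep_def
proof (intro allI impI ballI, rule ccontr)
  fix c k assume c: "(\<Sum>i\<in>I. c i *\<^sub>R v i) = 0" and k: "k \<in> I" "c k \<noteq> 0"
  have ck: "c k *\<^sub>R v k = (\<Sum>i\<in>I - {k}. (- c i) *\<^sub>R v i)"
    using c k assms by (simp add: sum.remove eq_neg_iff_add_eq_0 sum_negf)
  have "v k = (1 / c k) *\<^sub>R (c k *\<^sub>R v k)" using k by simp
  also have "\<dots> = (\<Sum>i\<in>I - {k}. ((1 / c k) * (- c i)) *\<^sub>R v i)"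
    unfolding ck scaleR_sum_right scaleR_scaleR ..
  also have "\<dots> \<in> span (v ` (I - {k}))" by (rule sum_in_span)
  finally have "v k \<in> span (v ` (I - {k}))" .
  then have "v ` I \<subseteq> span (v ` (I - {k}))" by (auto intro: span_base)
  then have "span (v ` I) \<subseteq> span (v ` (I - {k}))" by (intro span_minimal) auto
  then have "dim (span (v ` I)) \<le> card (v ` (I - {k}))" using assms by (intro dim_le_card) auto
  also have "\<dots> \<le> card (I - {k})" using assms by (intro card_image_le) auto
  also have "\<dots> < card I" using assms k by (intro card_Diff1_less)
  finally show False using assms by simp
qed

text \<open>An independent family inside the span of a family that is not larger forces both to be
  bases of the same space. Independence is thereby carried from one family to another without
  determinants.\<close>

lemma fam_indep_span_trans:
  assumes "finite I" "fam_indep I v" "v ` I \<subseteq> span (w ` J)" "finite J" "card J \<le> card I"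
  shows "fam_indep J w" "span (w ` J) \<subseteq> span (v ` I)"
proof -
  have c: "card (v ` I) = card I" using fam_indep_dim(1)[OF assms(1,2)] by (rule card_image)
  show s: "span (w ` J) \<subseteq> span (v ` I)"
  proof (rule span_minimal)
    show "w ` J \<subseteq> span (v ` I)"
    proof (rule ccontr)
      assume "\<not> w ` J \<subseteq> span (v ` I)"
      then obtain x where x: "x \<in> w ` J" "x \<notin> span (v ` I)" by auto
      then have "independent (insert x (v ` I))"
        using fam_indep_dim(2)[OF assms(1,2)] by (simp add: independent_insert)
      then have "card (insert x (v ` I)) \<le> card (w ` J)"
        using independent_span_bound[of "w ` J" "insert x (v ` I)"] x assms by (auto intro: span_base)
      also have "\<dots> \<le> card I" using card_image_le[OF assms(4), of w] assms by simp
      finally show False using x assms c by (metis card_insert_disjoint finite_imageI not_less_eq_eq order_refl span_base)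
    qed
  qed auto
  have "span (v ` I) \<subseteq> span (w ` J)" using assms(3) by (intro span_minimal) auto
  then have "span (w ` J) = span (v ` I)" using s by blast
  then show "fam_indep J w"
    using fam_indep_dim(3)[OF assms(1,2)] assms by (intro fam_indep_if_dim) auto
qed

lemma sum_apply: "(\<Sum>i\<in>I. F i) x = (\<Sum>i\<in>I. F i x)" for F :: "'i \<Rightarrow> 'b \<Rightarrow> 'c::comm_monoid_add"
  by (induct I rule: infinite_finite_induct) (auto simp: zero_fun_def plus_fun_def)

lemma fun_arith [simp]:
  "(f + g) x = f x + g x" "(0 :: 'b \<Rightarrow> 'c::real_vector) x = 0" "(- f) x = - f x" "(f - g) x = f x - g x"
  "(c *\<^sub>R f) x = c *\<^sub>R f x" for f g :: "'b \<Rightarrow> 'c::real_vector"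
  by (auto simp: plus_fun_def zero_fun_def fun_Compl_def fun_diff_def scaleR_fun_def)


section \<open>Tangent vectors\<close>

context manifold
begin

abbreviation T :: "'a \<Rightarrow> 'a tvec set" where "T \<equiv> tangent_space M"
abbreviation vf :: "('a \<Rightarrow> 'a tvec) \<Rightarrow> bool" where "vf \<equiv> smooth_vf_on M (points M)"

lemma tv_add: "v \<in> T q \<Longrightarrow> smooth_fun M f \<Longrightarrow> smooth_fun M g \<Longrightarrow> v (\<lambda>x. f x + g x) = v f + v g"
  and tv_cmult: "v \<in> T q \<Longrightarrow> smooth_fun M f \<Longrightarrow> v (\<lambda>x. c * f x) = c * v f"
  and tv_mult: "v \<in> T q \<Longrightarrow> smooth_fun M f \<Longrightarrow> smooth_fun M g \<Longrightarrow> v (\<lambda>x. f x * g x) = f q * v g + g q * v f"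
  and tv_nonsmooth: "v \<in> T q \<Longrightarrow> \<not> smooth_fun M f \<Longrightarrow> v f = 0"
  by (auto simp: tangent_space_def)

lemmas sm_const = smooth_on_const[OF opn_points]
lemmas sm_add = smooth_on_add[OF opn_points]
lemmas sm_mult = smooth_on_mult[OF opn_points]
lemmas sm_cmult = smooth_on_cmult[OF opn_points]
lemmas sm_diff = smooth_on_diff[OF opn_points]
lemmas sm_sum = smooth_on_sum[OF opn_points]

lemma tv_diff: "v \<in> T q \<Longrightarrow> smooth_fun M f \<Longrightarrow> smooth_fun M g \<Longrightarrow> v (\<lambda>x. f x - g x) = v f - v g"
  using tv_add[of v q f "\<lambda>x. - 1 * g x"] tv_cmult[of v q g "- 1"] sm_cmult[of g "- 1"] by simp

lemma subspace_T: "subspace (T q)"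
  by (rule subspaceI) (auto simp: tangent_space_def algebra_simps)

lemma tv_const: assumes "v \<in> T q" shows "v (\<lambda>x. c) = 0"
proof -
  have "v (\<lambda>x. 1 * 1) = 1 * v (\<lambda>x. 1) + 1 * v (\<lambda>x. 1)"
    using tv_mult[OF assms sm_const sm_const, of 1 1] by simp
  then show ?thesis using tv_cmult[OF assms sm_const, of c 1] by simp
qed

lemma zero_on_smooth: "(\<And>x. x \<in> points M \<Longrightarrow> f x = 0) \<Longrightarrow> smooth_fun M f"
  using smooth_on_cong[OF opn_points, of f "\<lambda>x. 0"] sm_const by simp

text \<open>The indicator of the complement of \<open>points M\<close> counts as smooth. A function
  vanishing on \<open>points M\<close> equals its product with that indicator, and both factors are
  0 at \<open>q\<close>, so the Leibniz rule gives 0.\<close>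

lemma tv_zero_on:
  assumes "v \<in> T q" "q \<in> points M" "\<And>x. x \<in> points M \<Longrightarrow> f x = 0" shows "v f = 0"
proof -
  let ?h = "\<lambda>x. if x \<in> points M then 0 else 1"
  have "v (\<lambda>x. f x * ?h x) = f q * v ?h + ?h q * v f"
    by (rule tv_mult) (use assms zero_on_smooth in auto)
  moreover have "(\<lambda>x. f x * ?h x) = f" using assms by auto
  ultimately show ?thesis using assms by simp
qed

text \<open>With a bump \<open>b\<close> at \<open>q\<close> inside \<open>S\<close>, the product b
  (f - g) vanishes on all of \<open>points M\<close>, while the Leibniz rule evaluates it to v f - v
  g since b q = 1 and f q = g q.\<close>

lemma tv_local:
  assumes v: "v \<in> T q" and S: "opn S" "q \<in> S" and fg: "smooth_fun M f" "smooth_fun M g"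
    "\<And>x. x \<in> S \<Longrightarrow> f x = g x"
  shows "v f = v g"
proof -
  have q: "q \<in> points M" using S opn_sub by auto
  obtain b W where b: "q \<in> W" "\<And>x. x \<in> W \<Longrightarrow> b x = 1" "smooth_fun M b" "\<And>x. x \<notin> S \<Longrightarrow> b x = 0"
    by (rule bump[OF S]) blast
  have "v (\<lambda>x. b x * (f x - g x)) = 0"
    by (rule tv_zero_on[OF v q]) (use b fg in force)
  moreover have "v (\<lambda>x. b x * (f x - g x)) = b q * v (\<lambda>x. f x - g x) + (f q - g q) * v b"
    by (rule tv_mult[OF v b(3) sm_diff[OF fg(1,2)]])
  ultimately show ?thesis using b S fg tv_diff[OF v fg(1,2)] by simp
qed

lemma tv_sum:
  "v \<in> T q \<Longrightarrow> (\<And>j. j \<in> J \<Longrightarrow> smooth_fun M (f j)) \<Longrightarrow> v (\<lambda>x. \<Sum>j\<in>J. f j x) = (\<Sum>j\<in>J. v (f j))"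
proof (induct J rule: infinite_finite_induct)
  case (insert j J)
  then show ?case using tv_add[OF insert.prems(1), of "f j" "\<lambda>x. \<Sum>j\<in>J. f j x"] sm_sum[of J f] by simp
qed (auto simp: tv_const)

definition cpart :: "'a set \<Rightarrow> ('a \<Rightarrow> nat \<Rightarrow> real) \<Rightarrow> 'a \<Rightarrow> nat \<Rightarrow> 'a tvec" where
  "cpart U \<phi> q i = (\<lambda>f. if smooth_fun M f then partial i (\<lambda>x. f (inv_into U \<phi> x)) (\<phi> q) else 0)"

lemma chart_has_pd:
  assumes U: "(U, \<phi>) \<in> atlas M" "q \<in> U" "i < n" and f: "smooth_fun M f"
  shows "has_pd i (\<lambda>x. f (inv_into U \<phi> x)) (\<phi> q) (partial i (\<lambda>x. f (inv_into U \<phi> x)) (\<phi> q))"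
proof -
  have "points M \<inter> U = U" using U by (auto simp: points_def)
  then show ?thesis
    using C_infinity_has_pd[OF chart_open[OF U(1)] _ U(3)] smooth_onD[OF f U(1)] U by auto
qed

lemma cpart_T:
  assumes U: "(U, \<phi>) \<in> atlas M" "q \<in> U" "i < n"
  shows "cpart U \<phi> q i \<in> T q"
proof -
  note pd = chart_has_pd[OF U, unfolded has_pd_def]
  have u: "(\<phi> q)(i := \<phi> q i) = \<phi> q" by simp
  have 1: "partial i (\<lambda>x. f (inv_into U \<phi> x) + g (inv_into U \<phi> x)) (\<phi> q) =
      partial i (\<lambda>x. f (inv_into U \<phi> x)) (\<phi> q) + partial i (\<lambda>x. g (inv_into U \<phi> x)) (\<phi> q)"
    if "smooth_fun M f" "smooth_fun M g" for f g
    by (rule partial_eq, unfold has_pd_def, rule DERIV_add[OF pd[OF that(1)] pd[OF that(2)]])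
  have 2: "partial i (\<lambda>x. f (inv_into U \<phi> x) * g (inv_into U \<phi> x)) (\<phi> q) =
      f q * partial i (\<lambda>x. g (inv_into U \<phi> x)) (\<phi> q) + g q * partial i (\<lambda>x. f (inv_into U \<phi> x)) (\<phi> q)"
    if "smooth_fun M f" "smooth_fun M g" for f g
    using partial_eq[of i "\<lambda>x. f (inv_into U \<phi> x) * g (inv_into U \<phi> x)" "\<phi> q", unfolded has_pd_def,
        OF DERIV_mult[OF pd[OF that(1)] pd[OF that(2)]]] U by (simp add: mult.commute)
  have 3: "partial i (\<lambda>x. c * f (inv_into U \<phi> x)) (\<phi> q) = c * partial i (\<lambda>x. f (inv_into U \<phi> x)) (\<phi> q)"
    if "smooth_fun M f" for f c
    by (rule partial_eq, unfold has_pd_def, rule DERIV_cmult[OF pd[OF that(1)]])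
  show ?thesis
    using 1 2 3 by (simp add: tangent_space_def cpart_def sm_add sm_mult sm_cmult)
qed

text \<open>Tangent vectors act on global functions, coordinates are only local; the extensions make
  it possible to speak of the coordinates of a tangent vector.\<close>

lemma coords_extend:
  assumes U: "(U, \<phi>) \<in> atlas M" "q \<in> U" and S: "opn S" "q \<in> S"
  obtains X W where "opn W" "q \<in> W" "W \<subseteq> U \<inter> S" "\<And>i. i < n \<Longrightarrow> smooth_fun M (X i)"
    "\<And>i x. x \<in> W \<Longrightarrow> X i x = \<phi> x i"
proof -
  obtain b W where b: "opn W" "q \<in> W" "W \<subseteq> U \<inter> S" "\<And>x. x \<in> W \<Longrightarrow> b x = 1"
    "\<And>f. smooth_on M (U \<inter> S) f \<Longrightarrow> smooth_fun M (\<lambda>x. if x \<in> U \<inter> S then b x * f x else 0)"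
    by (rule bump[OF openin_Int[OF opn_chart[OF U(1)] S(1)]]) (use U S in auto)
  show ?thesis
    by (rule that[OF b(1-3), of "\<lambda>i x. if x \<in> U \<inter> S then b x * \<phi> x i else 0"],
        rule b(5), rule smooth_on_subset[OF smooth_on_coord[OF U(1)] opn_chart[OF U(1)]])
      (use b U S opn_chart in auto)
qed

lemma cpart_coord:
  assumes U: "(U, \<phi>) \<in> atlas M" "q \<in> U" "i < n" and W: "opn W" "q \<in> W" "W \<subseteq> U"
    and X: "smooth_fun M X" "\<And>x. x \<in> W \<Longrightarrow> X x = \<phi> x j"
  shows "cpart U \<phi> q i X = (if i = j then 1 else 0)"
proof -
  have WU: "openin E (\<phi> ` W)" using opn_image[OF W(1) U(1)] W(3) by (simp add: Int_absorb2)
  have "has_pd i (\<lambda>x. x j) (\<phi> q) (if i = j then 1 else 0)" by (auto simp: has_pd_def)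
  then have "has_pd i (\<lambda>x. X (inv_into U \<phi> x)) (\<phi> q) (if i = j then 1 else 0)"
    by (subst has_pd_cong[OF WU _ U(3), of _ _ "\<lambda>x. x j"]) (use X W U in auto)
  then show ?thesis using X by (simp add: cpart_def partial_eq)
qed

text \<open>Near \<open>q\<close>, Hadamard's lemma writes \<open>f\<close> as f q plus a sum of
  products (X i - \<phi> q i) G i. The first factor vanishes at \<open>q\<close>, so the Leibniz
  rule leaves v (X i) times the partial derivative of \<open>f\<close>.\<close>

lemma tv_expand:
  assumes v: "v \<in> T q" and U: "(U, \<phi>) \<in> atlas M" "q \<in> U" and W: "opn W" "q \<in> W" "W \<subseteq> U"
    and X: "\<And>i. i < n \<Longrightarrow> smooth_fun M (X i)" "\<And>i x. i < n \<Longrightarrow> x \<in> W \<Longrightarrow> X i x = \<phi> x i"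
  shows "v = (\<Sum>i<n. v (X i) *\<^sub>R cpart U \<phi> q i)"
proof
  fix f
  show "v f = (\<Sum>i<n. v (X i) *\<^sub>R cpart U \<phi> q i) f"
  proof (cases "smooth_fun M f")
    case False
    then show ?thesis using tv_nonsmooth[OF v] by (simp add: sum_apply cpart_def)
  next
    case f: True
    have z: "\<forall>i\<ge>n. \<phi> q i = 0" using chart_zero[OF U] by simp
    have q: "q \<in> points M" using W opn_sub by auto
    obtain e where e: "e > 0" and C: "opn {p \<in> U. \<phi> p \<in> cube n (\<phi> q) e}"
      "{p \<in> U. \<phi> p \<in> cube n (\<phi> q) e} \<subseteq> W" "cube n (\<phi> q) e \<subseteq> \<phi> ` (W \<inter> U)"
      by (rule opn_cube[OF W(1) U(1) W(2) U(2)]) blast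
    let ?C = "{p \<in> U. \<phi> p \<in> cube n (\<phi> q) e}"
    have CU: "cube n (\<phi> q) e \<subseteq> \<phi> ` (points M \<inter> U)" using C(3) opn_sub[OF W(1)] by auto
    have "C_infinity n (cube n (\<phi> q) e) (\<lambda>x. f (inv_into U \<phi> x))"
      using C_infinity_subset[OF opn_image[OF opn_points U(1)] openin_cube CU smooth_onD[OF f U(1)]] .
    then obtain g where g: "\<And>i. i < n \<Longrightarrow> C_infinity n (cube n (\<phi> q) e) (g i)"
      "\<And>i. i < n \<Longrightarrow> g i (\<phi> q) = partial i (\<lambda>x. f (inv_into U \<phi> x)) (\<phi> q)"
      "\<And>x. x \<in> cube n (\<phi> q) e \<Longrightarrow> f (inv_into U \<phi> x) = f (inv_into U \<phi> (\<phi> q)) +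
          (\<Sum>i<n. (x i - \<phi> q i) * g i x)"
      by (rule hadamard[OF z e]) blast
    have qC: "q \<in> ?C" using U cube_self[OF z e] by auto
    obtain b W' where b: "opn W'" "q \<in> W'" "W' \<subseteq> ?C" "\<And>x. x \<in> W' \<Longrightarrow> b x = 1"
      "\<And>f. smooth_on M ?C f \<Longrightarrow> smooth_fun M (\<lambda>x. if x \<in> ?C then b x * f x else 0)"
      by (rule bump[OF C(1) qC]) blast
    define G where "G = (\<lambda>i x. if x \<in> ?C then b x * g i (\<phi> x) else 0)"
    have G: "smooth_fun M (G i)" if "i < n" for i
      unfolding G_def by (rule b(5)[OF smooth_on_chart_fun[OF U(1) openin_cube g(1)[OF that]]])
    have sXG: "smooth_fun M (\<lambda>x. (X i x - \<phi> q i) * G i x)" if "i < n" for i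
      by (intro sm_mult sm_diff sm_const X G that)
    have "v f = v (\<lambda>x. f q + (\<Sum>i<n. (X i x - \<phi> q i) * G i x))"
    proof (rule tv_local[OF v b(1,2) f])
      show "smooth_fun M (\<lambda>x. f q + (\<Sum>i<n. (X i x - \<phi> q i) * G i x))"
        by (intro sm_add sm_const sm_sum sXG) auto
      fix x assume x: "x \<in> W'"
      then have xC: "x \<in> ?C" "x \<in> W" using b C by auto
      then have "f x = f q + (\<Sum>i<n. (\<phi> x i - \<phi> q i) * g i (\<phi> x))"
        using g(3)[of "\<phi> x"] U by simp
      also have "\<dots> = f q + (\<Sum>i<n. (X i x - \<phi> q i) * G i x)"
        using xC x b(4) X(2) by (simp add: G_def)
      finally show "f x = f q + (\<Sum>i<n. (X i x - \<phi> q i) * G i x)" .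
    qed
    also have "\<dots> = (\<Sum>i<n. v (\<lambda>x. (X i x - \<phi> q i) * G i x))"
      by (subst tv_add[OF v sm_const], intro sm_sum sXG, simp, subst tv_sum[OF v])
        (use sXG in \<open>auto simp: tv_const[OF v]\<close>)
    also have "\<dots> = (\<Sum>i<n. v (X i) * partial i (\<lambda>x. f (inv_into U \<phi> x)) (\<phi> q))"
    proof (rule sum.cong[OF refl])
      fix i assume "i \<in> {..<n}"
      then have i: "i < n" by simp
      have "v (\<lambda>x. (X i x - \<phi> q i) * G i x) =
          (X i q - \<phi> q i) * v (G i) + G i q * v (\<lambda>x. X i x - \<phi> q i)"
        by (rule tv_mult[OF v sm_diff[OF X(1)[OF i] sm_const] G[OF i]])
      moreover have "v (\<lambda>x. X i x - \<phi> q i) = v (X i)"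
        using tv_diff[OF v X(1)[OF i] sm_const] tv_const[OF v] by simp
      moreover have "G i q = partial i (\<lambda>x. f (inv_into U \<phi> x)) (\<phi> q)"
        using qC b(2,4) g(2)[OF i] by (simp add: G_def)
      ultimately show "v (\<lambda>x. (X i x - \<phi> q i) * G i x) = v (X i) * partial i (\<lambda>x. f (inv_into U \<phi> x)) (\<phi> q)"
        using X(2)[OF i W(2)] by simp
    qed
    finally show ?thesis using f by (simp add: sum_apply cpart_def)
  qed
qed

lemma tangent_basis:
  assumes U: "(U, \<phi>) \<in> atlas M" "q \<in> U"
  shows "fam_indep {..<n} (cpart U \<phi> q)" "T q = span (cpart U \<phi> q ` {..<n})"
proof -
  have q: "q \<in> points M" using U by (auto simp: points_def)
  obtain X W where W: "opn W" "q \<in> W" "W \<subseteq> U" and X: "\<And>i. i < n \<Longrightarrow> smooth_fun M (X i)"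
    "\<And>i x. x \<in> W \<Longrightarrow> X i x = \<phi> x i"
    by (rule coords_extend[OF U opn_points q]) blast
  show "fam_indep {..<n} (cpart U \<phi> q)"
    unfolding fam_indep_def
  proof (intro allI impI ballI)
    fix c j assume c: "(\<Sum>i<n. c i *\<^sub>R cpart U \<phi> q i) = 0" and j: "j \<in> {..<n}"
    have "0 = (\<Sum>i<n. c i *\<^sub>R cpart U \<phi> q i) (X j)" by (simp add: c)
    also have "\<dots> = (\<Sum>i<n. c i * cpart U \<phi> q i (X j))" by (simp add: sum_apply)
    also have "\<dots> = (\<Sum>i<n. if i = j then c i else 0)"
      using j by (intro sum.cong[OF refl]) (auto simp: cpart_coord[OF U _ W X(1) X(2)])
    also have "\<dots> = c j" using j by simp
    finally show "c j = 0" by simp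
  qed
  show "T q = span (cpart U \<phi> q ` {..<n})"
  proof
    show "T q \<subseteq> span (cpart U \<phi> q ` {..<n})"
    proof
      fix v assume v: "v \<in> T q"
      then show "v \<in> span (cpart U \<phi> q ` {..<n})"
        using tv_expand[OF v U W X(1) X(2)] by (subst in_span_image) auto
    qed
    show "span (cpart U \<phi> q ` {..<n}) \<subseteq> T q"
      by (rule span_minimal[OF _ subspace_T]) (use cpart_T[OF U] in auto)
  qed
qed

lemma indep_spans_T:
  assumes q: "q \<in> points M" and I: "finite I" "fam_indep I v" "card I = n" and v: "\<And>i. i \<in> I \<Longrightarrow> v i \<in> T q"
  shows "span (v ` I) = T q"
proof
  obtain U \<phi> where U: "(U, \<phi>) \<in> atlas M" "q \<in> U" using point_chart q by blast
  have "v ` I \<subseteq> span (cpart U \<phi> q ` {..<n})" using v tangent_basis(2)[OF U] by auto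
  from fam_indep_span_trans(2)[OF I(1,2) this] show "T q \<subseteq> span (v ` I)"
    using tangent_basis(2)[OF U] I by simp
  show "span (v ` I) \<subseteq> T q" by (rule span_minimal[OF _ subspace_T]) (use v in auto)
qed

lemma indep_card_le:
  assumes q: "q \<in> points M" and I: "finite I" "fam_indep I v" and v: "\<And>i. i \<in> I \<Longrightarrow> v i \<in> T q"
  shows "card I \<le> n"
proof -
  obtain U \<phi> where U: "(U, \<phi>) \<in> atlas M" "q \<in> U" using point_chart q by blast
  have s: "v ` I \<subseteq> span (cpart U \<phi> q ` {..<n})" using v tangent_basis(2)[OF U] by auto
  have "card (v ` I) \<le> card (cpart U \<phi> q ` {..<n})"
    using independent_span_bound[OF _ fam_indep_dim(2)[OF I] s] by auto
  also have "\<dots> \<le> n" using card_image_le[of "{..<n}" "cpart U \<phi> q"] by simp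
  finally show ?thesis using fam_indep_dim(1)[OF I] by (simp add: card_image)
qed


section \<open>Vector fields\<close>

lemma vf_T: "vf V \<Longrightarrow> q \<in> points M \<Longrightarrow> V q \<in> T q"
  and vf_smooth: "vf V \<Longrightarrow> smooth_fun M f \<Longrightarrow> smooth_fun M (\<lambda>x. V x f)"
  by (auto simp: smooth_vf_on_def)

lemma vf_add: "vf V \<Longrightarrow> vf W \<Longrightarrow> vf (\<lambda>x. V x + W x)"
  by (auto simp: smooth_vf_on_def sm_add intro: subspace_add[OF subspace_T])

lemma vf_scale: "smooth_fun M g \<Longrightarrow> vf V \<Longrightarrow> vf (\<lambda>x. g x *\<^sub>R V x)"
  by (auto simp: smooth_vf_on_def sm_mult intro: subspace_scale[OF subspace_T])

lemma vf_zero: "vf (\<lambda>x. 0)"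
  by (auto simp: smooth_vf_on_def sm_const intro: subspace_0[OF subspace_T])

lemma vf_sum: "(\<And>i. i \<in> I \<Longrightarrow> vf (V i)) \<Longrightarrow> vf (\<lambda>x. \<Sum>i\<in>I. V i x)"
  by (induct I rule: infinite_finite_induct) (auto simp: vf_zero vf_add)

lemma vf_comb: "(\<And>i. i \<in> I \<Longrightarrow> smooth_fun M (g i)) \<Longrightarrow> (\<And>i. i \<in> I \<Longrightarrow> vf (V i)) \<Longrightarrow>
    vf (\<lambda>x. \<Sum>i\<in>I. g i x *\<^sub>R V i x)"
  by (intro vf_sum vf_scale) auto

lemma vf_nonsmooth: "vf V \<Longrightarrow> x \<in> points M \<Longrightarrow> \<not> smooth_fun M f \<Longrightarrow> V x f = 0"
  using vf_T tv_nonsmooth by blast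

text \<open>V (W (f g)) contains the mixed terms V f W g and V g W f. They are symmetric in the two
  fields and cancel in the commutator, which leaves the Leibniz rule.\<close>

lemma br_T:
  assumes V: "vf V" and W: "vf W" and q: "q \<in> points M"
  shows "lie_bracket V W q \<in> T q"
proof -
  note Vq = vf_T[OF V q] and Wq = vf_T[OF W q]
  note s = vf_smooth[OF V] vf_smooth[OF W]
  note cong = tv_local[OF _ opn_points q]
  \<comment> \<open>The fields are controlled only on \<open>points M\<close>, so the inner
    functions need not agree everywhere; locality with the open set \<open>points M\<close> replaces
    one by the other.\<close>
  have c: "v (\<lambda>x. F x) = v (\<lambda>x. G x)"
    if "v \<in> T q" "\<And>x. x \<in> points M \<Longrightarrow> F x = G x" "smooth_fun M G" for v F G
    using cong[OF that(1), of F G] that smooth_on_cong[OF opn_points, of F G] by auto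
  have A: "V q (\<lambda>x. W x (\<lambda>y. f y + g y)) = V q (\<lambda>x. W x f) + V q (\<lambda>x. W x g)"
    if "vf V" "vf W" "smooth_fun M f" "smooth_fun M g" for V W f g
  proof -
    have "V q (\<lambda>x. W x (\<lambda>y. f y + g y)) = V q (\<lambda>x. W x f + W x g)"
      by (rule c[OF vf_T[OF that(1) q]]) (use that vf_smooth sm_add in \<open>auto intro: tv_add vf_T\<close>)
    then show ?thesis using tv_add[OF vf_T[OF that(1) q]] vf_smooth that by simp
  qed
  have B: "V q (\<lambda>x. W x (\<lambda>y. k * f y)) = k * V q (\<lambda>x. W x f)"
    if "vf V" "vf W" "smooth_fun M f" for V W f k
  proof -
    have "V q (\<lambda>x. W x (\<lambda>y. k * f y)) = V q (\<lambda>x. k * W x f)"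
      by (rule c[OF vf_T[OF that(1) q]]) (use that vf_smooth sm_cmult in \<open>auto intro: tv_cmult vf_T\<close>)
    then show ?thesis using tv_cmult[OF vf_T[OF that(1) q]] vf_smooth that by simp
  qed
  have C: "V q (\<lambda>x. W x (\<lambda>y. f y * g y)) =
      f q * V q (\<lambda>x. W x g) + V q f * W q g + g q * V q (\<lambda>x. W x f) + V q g * W q f"
    if VW: "vf V" "vf W" and f: "smooth_fun M f" "smooth_fun M g" for V W f g
  proof -
    have "V q (\<lambda>x. W x (\<lambda>y. f y * g y)) = V q (\<lambda>x. f x * W x g + g x * W x f)"
      by (rule c[OF vf_T[OF VW(1) q]])
        (use VW f vf_smooth sm_add sm_mult in \<open>auto intro: tv_mult vf_T\<close>)
    also have "\<dots> = V q (\<lambda>x. f x * W x g) + V q (\<lambda>x. g x * W x f)"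
      by (rule tv_add[OF vf_T[OF VW(1) q]]) (use VW f vf_smooth sm_mult in auto)
    finally show ?thesis
      using tv_mult[OF vf_T[OF VW(1) q] f(1) vf_smooth[OF VW(2) f(2)]]
        tv_mult[OF vf_T[OF VW(1) q] f(2) vf_smooth[OF VW(2) f(1)]] by (simp add: mult.commute)
  qed
  have D: "V q (\<lambda>x. W x f) = 0" if "vf V" "vf W" "\<not> smooth_fun M f" for V W f
    by (rule tv_zero_on[OF vf_T[OF that(1) q] q]) (use that vf_nonsmooth in auto)
  show ?thesis
    unfolding tangent_space_def lie_bracket_def
    by (simp add: A[OF V W] A[OF W V] B[OF V W] B[OF W V] C[OF V W] C[OF W V] D[OF V W] D[OF W V]
        algebra_simps)
qed

lemma vf_br:
  assumes "vf V" "vf W" shows "vf (lie_bracket V W)"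
  unfolding smooth_vf_on_def
proof (intro conjI ballI allI impI br_T assms)
  fix f assume f: "smooth_fun M f"
  show "smooth_fun M (\<lambda>x. lie_bracket V W x f)"
    unfolding lie_bracket_def
    by (rule sm_diff[OF vf_smooth[OF assms(1) vf_smooth[OF assms(2) f]]
          vf_smooth[OF assms(2) vf_smooth[OF assms(1) f]]])
qed

lemma br_antisym: "lie_bracket V W q = - lie_bracket W V q"
  by (auto simp: lie_bracket_def)

lemma tvec_eqI:
  assumes "v \<in> T q" "w \<in> T q" "\<And>f. smooth_fun M f \<Longrightarrow> v f = w f" shows "v = w"
  using assms tv_nonsmooth by (metis ext)

lemma br_add_right:
  assumes V: "vf V" and W: "vf W" "vf W'" and q: "q \<in> points M"
  shows "lie_bracket V (\<lambda>x. W x + W' x) q = lie_bracket V W q + lie_bracket V W' q"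
proof (rule tvec_eqI)
  show "lie_bracket V (\<lambda>x. W x + W' x) q \<in> T q" by (intro br_T V vf_add W q)
  show "lie_bracket V W q + lie_bracket V W' q \<in> T q"
    by (intro subspace_add[OF subspace_T] br_T V W q)
  show "lie_bracket V (\<lambda>x. W x + W' x) q f = (lie_bracket V W q + lie_bracket V W' q) f"
    if "smooth_fun M f" for f
    using tv_add[OF vf_T[OF V q] vf_smooth[OF W(1) that] vf_smooth[OF W(2) that]]
    by (simp add: lie_bracket_def)
qed

lemma br_scale_right:
  assumes V: "vf V" and W: "vf W" and g: "smooth_fun M g" and q: "q \<in> points M"
  shows "lie_bracket V (\<lambda>x. g x *\<^sub>R W x) q = g q *\<^sub>R lie_bracket V W q + V q g *\<^sub>R W q"
proof (rule tvec_eqI)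
  show "lie_bracket V (\<lambda>x. g x *\<^sub>R W x) q \<in> T q" by (intro br_T V vf_scale W g q)
  show "g q *\<^sub>R lie_bracket V W q + V q g *\<^sub>R W q \<in> T q"
    by (intro subspace_add[OF subspace_T] subspace_scale[OF subspace_T] br_T vf_T V W q)
  show "lie_bracket V (\<lambda>x. g x *\<^sub>R W x) q f = (g q *\<^sub>R lie_bracket V W q + V q g *\<^sub>R W q) f"
    if "smooth_fun M f" for f
    using tv_mult[OF vf_T[OF V q] g vf_smooth[OF W that]]
    by (simp add: lie_bracket_def algebra_simps)
qed

lemma br_zero_right: "vf V \<Longrightarrow> q \<in> points M \<Longrightarrow> lie_bracket V (\<lambda>x. 0) q = 0"
  using br_scale_right[of V "\<lambda>x. 0" "\<lambda>x. 0" q, OF _ vf_zero sm_const]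
  by (simp only: scaleR_zero_right scaleR_zero_left add_0_right)

lemma br_comb_right:
  assumes V: "vf V" and q: "q \<in> points M"
  shows "finite I \<Longrightarrow> (\<And>i. i \<in> I \<Longrightarrow> smooth_fun M (g i)) \<Longrightarrow> (\<And>i. i \<in> I \<Longrightarrow> vf (W i)) \<Longrightarrow>
    lie_bracket V (\<lambda>x. \<Sum>i\<in>I. g i x *\<^sub>R W i x) q =
      (\<Sum>i\<in>I. g i q *\<^sub>R lie_bracket V (W i) q + V q (g i) *\<^sub>R W i q)"
proof (induct I rule: finite_induct)
  case empty
  then show ?case using br_zero_right[OF V q] by (simp only: sum.empty)
next
  case (insert i I)
  have "lie_bracket V (\<lambda>x. g i x *\<^sub>R W i x + (\<Sum>i\<in>I. g i x *\<^sub>R W i x)) q =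
      lie_bracket V (\<lambda>x. g i x *\<^sub>R W i x) q + lie_bracket V (\<lambda>x. \<Sum>i\<in>I. g i x *\<^sub>R W i x) q"
    by (rule br_add_right[OF V vf_scale vf_comb q]) (use insert.prems in auto)
  moreover have "lie_bracket V (\<lambda>x. g i x *\<^sub>R W i x) q = g i q *\<^sub>R lie_bracket V (W i) q + V q (g i) *\<^sub>R W i q"
    by (rule br_scale_right[OF V _ _ q]) (use insert.prems in auto)
  moreover have "lie_bracket V (\<lambda>x. \<Sum>i\<in>I. g i x *\<^sub>R W i x) q =
      (\<Sum>i\<in>I. g i q *\<^sub>R lie_bracket V (W i) q + V q (g i) *\<^sub>R W i q)"
    by (rule insert.hyps(3)) (use insert.prems in auto)
  ultimately show ?case unfolding sum.insert[OF insert.hyps(1,2)] by (simp only:)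
qed

lemma br_local:
  assumes V: "vf V" "vf V'" and W: "vf W" "vf W'" and S: "opn S" "q \<in> S"
    and eq: "\<And>x. x \<in> S \<Longrightarrow> V x = V' x" "\<And>x. x \<in> S \<Longrightarrow> W x = W' x"
  shows "lie_bracket V W q = lie_bracket V' W' q"
proof -
  have q: "q \<in> points M" using S opn_sub by auto
  show ?thesis
  proof (rule tvec_eqI[OF br_T[OF V(1) W(1) q] br_T[OF V(2) W(2) q]])
    fix f assume f: "smooth_fun M f"
    have "V q (\<lambda>x. W x f) = V q (\<lambda>x. W' x f)"
      by (rule tv_local[OF vf_T[OF V(1) q] S]) (use f W vf_smooth eq in auto)
    moreover have "W q (\<lambda>x. V x f) = W q (\<lambda>x. V' x f)"
      by (rule tv_local[OF vf_T[OF W(1) q] S]) (use f V vf_smooth eq in auto)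
    ultimately show "lie_bracket V W q f = lie_bracket V' W' q f"
      using eq S by (simp add: lie_bracket_def)
  qed
qed

lemma jacobi:
  assumes Z: "vf Z" and V: "vf V" and W: "vf W" and q: "q \<in> points M"
  shows "lie_bracket Z (lie_bracket V W) q =
    lie_bracket (lie_bracket Z V) W q + lie_bracket V (lie_bracket Z W) q"
proof (rule tvec_eqI)
  show "lie_bracket Z (lie_bracket V W) q \<in> T q" by (intro br_T vf_br Z V W q)
  show "lie_bracket (lie_bracket Z V) W q + lie_bracket V (lie_bracket Z W) q \<in> T q"
    by (intro subspace_add[OF subspace_T] br_T vf_br Z V W q)
  fix f assume f: "smooth_fun M f"
  have d: "A q (\<lambda>x. B x (\<lambda>y. C y f) - C x (\<lambda>y. B y f)) = A q (\<lambda>x. B x (\<lambda>y. C y f)) - A q (\<lambda>x. C x (\<lambda>y. B y f))"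
    if "vf A" "vf B" "vf C" for A B C
    by (rule tv_diff[OF vf_T[OF that(1) q]]) (use that vf_smooth f in auto)
  show "lie_bracket Z (lie_bracket V W) q f =
      (lie_bracket (lie_bracket Z V) W q + lie_bracket V (lie_bracket Z W) q) f"
    by (simp add: lie_bracket_def d Z V W)
qed

section \<open>From local to global fields, and smooth coefficients relative to a frame\<close>

lemma vf_restrict: "vf V \<Longrightarrow> opn S \<Longrightarrow> smooth_vf_on M S V"
  using smooth_on_subset[OF _ opn_points] opn_sub unfolding smooth_vf_on_def by blast

text \<open>All fields are multiplied by one common bump, so they agree with the originals on one
  common neighbourhood. The last clause, that every value is 0 or a multiple of the old one, keeps
  the new fields inside any family of linear subspaces that contained the old ones.\<close>

lemma globalize_family:
  assumes V: "\<And>i. i \<in> I \<Longrightarrow> smooth_vf_on M S (V i)" and S: "opn S" "q \<in> S"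
  obtains V' W where "\<And>i. i \<in> I \<Longrightarrow> vf (V' i)" "opn W" "q \<in> W" "W \<subseteq> S"
    "\<And>i x. x \<in> W \<Longrightarrow> V' i x = V i x"
    "\<And>i x. V' i x = 0 \<or> (x \<in> S \<and> (\<exists>c. V' i x = c *\<^sub>R V i x))"
proof -
  obtain b W where b: "opn W" "q \<in> W" "W \<subseteq> S" "\<And>x. x \<in> W \<Longrightarrow> b x = 1"
    "\<And>f. smooth_on M S f \<Longrightarrow> smooth_fun M (\<lambda>x. if x \<in> S then b x * f x else 0)"
    by (rule bump[OF S]) blast
  define V' where "V' = (\<lambda>i x. if x \<in> S then b x *\<^sub>R V i x else 0)"
  have "vf (V' i)" if i: "i \<in> I" for i
    unfolding smooth_vf_on_def
  proof (intro conjI ballI allI impI)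
    show "V' i x \<in> T x" for x
      using V[OF i] subspace_scale[OF subspace_T] subspace_0[OF subspace_T]
      by (auto simp: V'_def smooth_vf_on_def)
    fix f assume "smooth_fun M f"
    then have "smooth_on M S (\<lambda>x. V i x f)" using V[OF i] by (auto simp: smooth_vf_on_def)
    moreover have "(\<lambda>x. V' i x f) = (\<lambda>x. if x \<in> S then b x * V i x f else 0)" by (auto simp: V'_def)
    ultimately show "smooth_fun M (\<lambda>x. V' i x f)" using b(5) by simp
  qed
  then show ?thesis by (rule that[OF _ b(1-3)]) (use b in \<open>auto simp: V'_def\<close>)
qed

lemma globalize:
  assumes V: "smooth_vf_on M S V" and S: "opn S" "q \<in> S"
  obtains V' W where "vf V'" "opn W" "q \<in> W" "W \<subseteq> S" "\<And>x. x \<in> W \<Longrightarrow> V' x = V x"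
    "\<And>x. V' x = 0 \<or> (x \<in> S \<and> (\<exists>c. V' x = c *\<^sub>R V x))"
proof -
  obtain V' W where *: "\<And>i. i \<in> {()} \<Longrightarrow> vf (V' i)" "opn W" "q \<in> W" "W \<subseteq> S"
    "\<And>i x. x \<in> W \<Longrightarrow> V' i x = V x"
    "\<And>i x. V' i x = 0 \<or> (x \<in> S \<and> (\<exists>c. V' i x = c *\<^sub>R V x))"
    by (rule globalize_family[of "{()}" S "\<lambda>_. V", OF V S]) blast
  show ?thesis by (rule that[of "V' ()" W]) (simp_all add: *)
qed

lemma cpart_smooth:
  assumes U: "(U, \<phi>) \<in> atlas M" "i < n"
  shows "smooth_vf_on M U (\<lambda>q. cpart U \<phi> q i)"
  unfolding smooth_vf_on_def
proof (intro conjI ballI allI impI cpart_T U)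
  fix f assume f: "smooth_fun M f"
  have PU: "points M \<inter> U = U" using U by (auto simp: points_def)
  have "C_infinity n (\<phi> ` U) (partial i (\<lambda>x. f (inv_into U \<phi> x)))"
    using C_infinity_partial[OF chart_open[OF U(1)] _ U(2)] smooth_onD[OF f U(1)] PU by auto
  from smooth_on_chart_fun[OF U(1) chart_open[OF U(1)] this]
  have "smooth_on M {q \<in> U. \<phi> q \<in> \<phi> ` U} (\<lambda>q. partial i (\<lambda>x. f (inv_into U \<phi> x)) (\<phi> q))" .
  moreover have "{q \<in> U. \<phi> q \<in> \<phi> ` U} = U" by auto
  ultimately show "smooth_on M U (\<lambda>q. cpart U \<phi> q i f)" using f by (simp add: cpart_def)
qed

text \<open>The identity holds on \<open>S\<close> only, but the coefficients are global smooth
  functions, because brackets differentiate them and tangent vectors act on global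
  functions.\<close>

definition comb :: "'i set \<Rightarrow> ('i \<Rightarrow> 'a \<Rightarrow> 'a tvec) \<Rightarrow> 'a set \<Rightarrow> ('a \<Rightarrow> 'a tvec) \<Rightarrow> bool" where
  "comb I V S W \<longleftrightarrow> (\<exists>a. (\<forall>i\<in>I. smooth_fun M (a i)) \<and> (\<forall>x\<in>S. W x = (\<Sum>i\<in>I. a i x *\<^sub>R V i x)))"

lemma comb_add: "comb I V S W \<Longrightarrow> comb I V S W' \<Longrightarrow> comb I V S (\<lambda>x. W x + W' x)"
  unfolding comb_def
proof (elim exE conjE)
  fix a b assume "\<forall>i\<in>I. smooth_fun M (a i)" "\<forall>x\<in>S. W x = (\<Sum>i\<in>I. a i x *\<^sub>R V i x)"
    "\<forall>i\<in>I. smooth_fun M (b i)" "\<forall>x\<in>S. W' x = (\<Sum>i\<in>I. b i x *\<^sub>R V i x)"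
  then show "\<exists>a. (\<forall>i\<in>I. smooth_fun M (a i)) \<and> (\<forall>x\<in>S. W x + W' x = (\<Sum>i\<in>I. a i x *\<^sub>R V i x))"
    by (intro exI[of _ "\<lambda>i x. a i x + b i x"]) (auto simp: sm_add scaleR_add_left sum.distrib)
qed

lemma comb_scale: "smooth_fun M g \<Longrightarrow> comb I V S W \<Longrightarrow> comb I V S (\<lambda>x. g x *\<^sub>R W x)"
  unfolding comb_def
proof (elim exE conjE)
  fix a assume "smooth_fun M g" "\<forall>i\<in>I. smooth_fun M (a i)" "\<forall>x\<in>S. W x = (\<Sum>i\<in>I. a i x *\<^sub>R V i x)"
  then show "\<exists>a. (\<forall>i\<in>I. smooth_fun M (a i)) \<and> (\<forall>x\<in>S. g x *\<^sub>R W x = (\<Sum>i\<in>I. a i x *\<^sub>R V i x))"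
    by (intro exI[of _ "\<lambda>i x. g x * a i x"]) (auto simp: sm_mult scaleR_sum_right)
qed

lemma comb_zero: "comb I V S (\<lambda>x. 0)"
  unfolding comb_def by (intro exI[of _ "\<lambda>i x. 0"]) (auto simp: sm_const)

lemma comb_sum: "(\<And>j. j \<in> J \<Longrightarrow> comb I V S (W j)) \<Longrightarrow> comb I V S (\<lambda>x. \<Sum>j\<in>J. W j x)"
  by (induct J rule: infinite_finite_induct) (auto simp: comb_zero comb_add)

lemma comb_self:
  assumes "finite I" "i \<in> I" shows "comb I V S (V i)"
  unfolding comb_def
  using assms
  by (intro exI[of _ "\<lambda>j x. if j = i then 1 else 0"])
    (auto simp: sm_const if_distrib[of "\<lambda>c. c *\<^sub>R _"] sum.delta cong: if_cong)

lemma comb_cong: "(\<And>x. x \<in> S \<Longrightarrow> W x = W' x) \<Longrightarrow> comb I V S W \<Longrightarrow> comb I V S W'"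
  unfolding comb_def by auto

lemma comb_subset: "S' \<subseteq> S \<Longrightarrow> comb I V S W \<Longrightarrow> comb I V S' W"
  unfolding comb_def by blast

lemma comb_trans:
  assumes "comb J W S X" "\<And>j. j \<in> J \<Longrightarrow> comb I V S (W j)" shows "comb I V S X"
proof -
  obtain a where a: "\<And>j. j \<in> J \<Longrightarrow> smooth_fun M (a j)" "\<And>x. x \<in> S \<Longrightarrow> X x = (\<Sum>j\<in>J. a j x *\<^sub>R W j x)"
    using assms(1) unfolding comb_def by auto
  show ?thesis
    by (rule comb_cong[of S "\<lambda>x. \<Sum>j\<in>J. a j x *\<^sub>R W j x"])
      (use a assms in \<open>auto intro!: comb_sum comb_scale\<close>)
qed

text \<open>Gram--Schmidt against functions: the fields \<open>V' i\<close> are dual to the differentials of the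
  functions \<open>g j\<close>. This replaces Cramer's rule.\<close>

lemma dual_frame:
  assumes q: "q \<in> points M"
  shows "finite I \<Longrightarrow> (\<And>i. i \<in> I \<Longrightarrow> vf (V i)) \<Longrightarrow> fam_indep I (\<lambda>i. V i q) \<Longrightarrow>
    \<exists>S g V'. opn S \<and> q \<in> S \<and> (\<forall>i\<in>I. smooth_fun M (g i) \<and> vf (V' i) \<and> comb I V S (V' i) \<and>
      (\<forall>x\<in>S. V i x \<in> span ((\<lambda>i. V' i x) ` I)) \<and>
      (\<forall>x\<in>S. \<forall>j\<in>I. V' i x (g j) = (if i = j then 1 else 0)))"
proof (induct I rule: finite_induct)
  case empty
  then show ?case using q opn_points by auto
next
  case (insert i0 I)
  have "fam_indep I (\<lambda>i. V i q)" 
    by (rule fam_indep_subset[OF _ _ insert.prems(2)]) (use insert.hyps(1,2) in auto)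
  with insert.hyps(3) insert.prems(1) have "\<exists>S g V'. opn S \<and> q \<in> S \<and> (\<forall>i\<in>I. smooth_fun M (g i) \<and>
      vf (V' i) \<and> comb I V S (V' i) \<and> (\<forall>x\<in>S. V i x \<in> span ((\<lambda>i. V' i x) ` I)) \<and>
      (\<forall>x\<in>S. \<forall>j\<in>I. V' i x (g j) = (if i = j then 1 else 0)))" by blast
  then obtain S g V' where S: "opn S" "q \<in> S" and P: "\<forall>i\<in>I. smooth_fun M (g i) \<and>
      vf (V' i) \<and> comb I V S (V' i) \<and> (\<forall>x\<in>S. V i x \<in> span ((\<lambda>i. V' i x) ` I)) \<and>
      (\<forall>x\<in>S. \<forall>j\<in>I. V' i x (g j) = (if i = j then 1 else 0))" by blast
  from P have g: "\<And>i. i \<in> I \<Longrightarrow> smooth_fun M (g i)" and V': "\<And>i. i \<in> I \<Longrightarrow> vf (V' i)"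
    and cb: "\<And>i. i \<in> I \<Longrightarrow> comb I V S (V' i)"
    and sp: "\<And>i x. i \<in> I \<Longrightarrow> x \<in> S \<Longrightarrow> V i x \<in> span ((\<lambda>i. V' i x) ` I)"
    and du: "\<And>i j x. i \<in> I \<Longrightarrow> j \<in> I \<Longrightarrow> x \<in> S \<Longrightarrow> V' i x (g j) = (if i = j then 1 else 0)"
    by blast+
  let ?I = "insert i0 I"
  have fin: "finite ?I" and i0: "i0 \<notin> I" using insert.hyps(1,2) by auto
  have Vi0: "vf (V i0)" using insert.prems by auto
  have cb': "comb ?I V S (V' i)" if "i \<in> I" for i
    by (rule comb_trans[OF cb[OF that]]) (use fin in \<open>auto intro: comb_self\<close>)
  \<comment> \<open>The part of the new field that annihilates all the functions \<open>g l\<close>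
    on \<open>S\<close>; it cannot vanish at \<open>q\<close>, since otherwise the new field would
    depend on the old ones there.\<close>
  define U where "U = (\<lambda>x. V i0 x + (\<Sum>l\<in>I. (- 1 * V i0 x (g l)) *\<^sub>R V' l x))"
  have sU: "smooth_fun M (\<lambda>x. - 1 * V i0 x (g l))" if "l \<in> I" for l
    by (intro sm_cmult vf_smooth[OF Vi0] g that)
  have U: "vf U" unfolding U_def by (intro vf_add Vi0 vf_comb sU V')
  have cU: "comb ?I V S U"
    unfolding U_def by (intro comb_add comb_self comb_sum comb_scale sU cb' fin insertI1)
  have "U q \<noteq> 0"
  proof
    assume 0: "U q = 0"
    have "(\<lambda>l. V' l q) ` I \<subseteq> span ((\<lambda>i. V i q) ` I)"
    proof clarify
      fix l assume "l \<in> I"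
      from cb[OF this] obtain a where "V' l q = (\<Sum>i\<in>I. a i q *\<^sub>R V i q)"
        unfolding comb_def using S(2) by blast
      then show "V' l q \<in> span ((\<lambda>i. V i q) ` I)" by (rule in_spanI)
    qed
    then have sub: "span ((\<lambda>l. V' l q) ` I) \<subseteq> span ((\<lambda>i. V i q) ` I)" by (intro span_minimal) auto
    have "V i0 q = (\<Sum>l\<in>I. V i0 q (g l) *\<^sub>R V' l q)" using 0 by (simp add: U_def sum_negf)
    then have "V i0 q \<in> span ((\<lambda>l. V' l q) ` I)" by (rule in_spanI)
    then have "V i0 q \<in> span ((\<lambda>i. V i q) ` I)" using sub by blast
    then obtain c where c: "V i0 q = (\<Sum>i\<in>I. c i *\<^sub>R V i q)"
      unfolding in_span_image[OF insert.hyps(1)] by blast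
    define d where "d = (\<lambda>i. if i = i0 then - 1 else c i)"
    have "(\<Sum>i\<in>I. d i *\<^sub>R V i q) = (\<Sum>i\<in>I. c i *\<^sub>R V i q)"
      using i0 by (intro sum.cong) (auto simp: d_def)
    then have "(\<Sum>i\<in>?I. d i *\<^sub>R V i q) = 0" using insert.hyps(1,2) c by (simp add: d_def)
    then have "d i0 = 0" using insert.prems(2) unfolding fam_indep_def by blast
    then show False by (simp add: d_def)
  qed
  \<comment> \<open>Being nonzero, the functional \<open>U q\<close> detects some function, and this
    function is automatically smooth because tangent vectors vanish on all others. It becomes the
    function dual to the new index.\<close>
  then obtain g0 where g0: "U q g0 \<noteq> 0" by (metis (no_types, lifting) ext fun_arith(2))
  have sg0: "smooth_fun M g0" using g0 vf_nonsmooth[OF U q] by blast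
  define S1 where "S1 = {x \<in> points M. U x g0 \<noteq> 0}"
  have su: "smooth_fun M (\<lambda>x. U x g0)" by (rule vf_smooth[OF U sg0])
  have S1: "opn S1"
    unfolding openin_mtop
  proof (intro conjI ballI, safe)
    show "\<And>x. x \<in> S1 \<Longrightarrow> x \<in> points M" by (auto simp: S1_def)
    fix C \<phi> assume C: "(C, \<phi>) \<in> atlas M"
    have CC: "points M \<inter> C = C" using C by (auto simp: points_def)
    have "continuous_on (\<phi> ` C) (\<lambda>y. U (inv_into C \<phi> y) g0)"
      using smooth_onD[OF su C] C_k_continuous[OF chart_open[OF C]] unfolding C_infinity_def CC by blast
    then have "openin (top_of_set (\<phi> ` C)) (\<phi> ` C \<inter> (\<lambda>y. U (inv_into C \<phi> y) g0) -` (- {0}))"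
      by (intro continuous_openin_preimage_gen) auto
    moreover have "top_of_set (\<phi> ` C) = subtopology E (\<phi> ` C)"
      using openin_subset[OF chart_open[OF C]]
      by (simp add: Euclidean_space_eq subtopology_subtopology Int_absorb1)
    moreover have "\<phi> ` C \<inter> (\<lambda>y. U (inv_into C \<phi> y) g0) -` (- {0}) = \<phi> ` (S1 \<inter> C)"
      using C CC by (auto simp: S1_def)
    ultimately show "openin E (\<phi> ` (S1 \<inter> C))"
      using chart_open[OF C] by (metis openin_open_subtopology)
  qed
  have qS1: "q \<in> S1" using g0 q by (simp add: S1_def)
  have "smooth_on M S1 (\<lambda>x. inverse (U x g0))"
    by (rule smooth_on_inverse[OF S1 _ smooth_on_subset[OF su opn_points S1]]) (auto simp: S1_def)
  then obtain r S2 where r: "smooth_fun M r" "opn S2" "q \<in> S2" "S2 \<subseteq> S1"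
    "\<And>x. x \<in> S2 \<Longrightarrow> r x = inverse (U x g0)"
    by (rule smooth_extend[OF S1 qS1]) blast
  have ru: "r x * U x g0 = 1" if "x \<in> S2" for x using r(4,5) that by (auto simp: S1_def)
  \<comment> \<open>\<open>U\<close> is normalised to have derivative 1 on \<open>g0\<close>, and
    its multiples clear the derivatives of \<open>g0\<close> along the old fields. Duality with the
    old functions survives because \<open>U\<close> annihilates them on \<open>S\<close>.\<close>
  define V'' where "V'' = (\<lambda>i x. if i = i0 then r x *\<^sub>R U x
    else V' i x + (- 1 * V' i x g0) *\<^sub>R (r x *\<^sub>R U x))"
  define g' where "g' = g(i0 := g0)"
  have sVg: "smooth_fun M (\<lambda>x. - 1 * V' i x g0)" if "i \<in> I" for i
    by (intro sm_cmult vf_smooth[OF V' sg0] that)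
  have Ug: "U x (g j) = 0" if x: "x \<in> S" and j: "j \<in> I" for x j
  proof -
    have "(\<Sum>l\<in>I. - 1 * V i0 x (g l) * V' l x (g j)) = (\<Sum>l\<in>I. if l = j then - 1 * V i0 x (g l) else 0)"
      using x j by (intro sum.cong) (auto simp: du)
    then show ?thesis using j insert.hyps(1) by (simp add: U_def sum_apply)
  qed
  show ?case
  proof (intro exI[of _ "S \<inter> S2"] exI[of _ g'] exI[of _ V''] conjI ballI)
    show "opn (S \<inter> S2)" using S r by auto
    show "q \<in> S \<inter> S2" using S r by auto
    fix i assume i: "i \<in> ?I"
    show "smooth_fun M (g' i)" using i g sg0 by (auto simp: g'_def)
    have rU: "vf (\<lambda>x. r x *\<^sub>R U x)" by (rule vf_scale[OF r(1) U])
    show "vf (V'' i)"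
    proof (cases "i = i0")
      case False
      then have "i \<in> I" using i by simp
      then have "vf (\<lambda>x. V' i x + (- 1 * V' i x g0) *\<^sub>R (r x *\<^sub>R U x))"
        by (intro vf_add vf_scale V' sVg rU)
      then show ?thesis using False by (simp add: V''_def)
    qed (use rU in \<open>simp add: V''_def\<close>)
    have crU: "comb ?I V S (\<lambda>x. r x *\<^sub>R U x)" by (rule comb_scale[OF r(1) cU])
    have "comb ?I V S (V'' i)"
    proof (cases "i = i0")
      case False
      then have "i \<in> I" using i by simp
      then have "comb ?I V S (\<lambda>x. V' i x + (- 1 * V' i x g0) *\<^sub>R (r x *\<^sub>R U x))"
        by (intro comb_add comb_scale cb' sVg crU) (auto intro: r cU)
      then show ?thesis using False by (simp add: V''_def)
    qed (use crU in \<open>simp add: V''_def\<close>)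
    then show "comb ?I V (S \<inter> S2) (V'' i)" by (rule comb_subset[rotated]) auto
    show "V'' i x (g' j) = (if i = j then 1 else 0)" if "x \<in> S \<inter> S2" "j \<in> ?I" for x j
      using that i i0 ru[of x] Ug[of x j] du[of i j x] by (auto simp: V''_def g'_def)
    fix x assume x: "x \<in> S \<inter> S2"
    let ?P = "span ((\<lambda>i. V'' i x) ` ?I)"
    have b0: "r x *\<^sub>R U x \<in> ?P" by (rule span_base) (auto simp: V''_def image_iff)
    have bI: "V' l x \<in> ?P" if "l \<in> I" for l
    proof -
      have "V'' l x \<in> ?P" by (rule span_base) (use that in auto)
      then have "V'' l x + V' l x g0 *\<^sub>R (r x *\<^sub>R U x) \<in> ?P" by (intro span_add span_scale b0)
      then show ?thesis using that i0 by (auto simp: V''_def algebra_simps split: if_splits)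
    qed
    show "V i x \<in> ?P"
    proof (cases "i = i0")
      case True
      have "U x g0 *\<^sub>R (r x *\<^sub>R U x) + (\<Sum>l\<in>I. V i0 x (g l) *\<^sub>R V' l x) \<in> ?P"
        by (intro span_add span_scale span_sum b0 bI)
      moreover have "U x g0 *\<^sub>R (r x *\<^sub>R U x) = U x" using ru[of x] x by (simp add: mult.commute)
      ultimately show ?thesis using True by (simp add: U_def sum_negf)
    next
      case False
      then have "V i x \<in> span ((\<lambda>i. V' i x) ` I)" using sp[of i x] i x by auto
      also have "\<dots> \<subseteq> ?P" by (rule span_minimal) (use bI in auto)
      finally show ?thesis .
    qed
  qed
qed

lemma dual_coeffs:
  assumes "finite I" "\<And>i j. i \<in> I \<Longrightarrow> j \<in> I \<Longrightarrow> v i (g j) = (if i = j then 1 else (0::real))"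
    "(w :: ('a \<Rightarrow> real) \<Rightarrow> real) \<in> span (v ` I)"
  shows "w = (\<Sum>i\<in>I. w (g i) *\<^sub>R v i)"
proof -
  obtain c where c: "w = (\<Sum>i\<in>I. c i *\<^sub>R v i)" using assms by (auto simp: in_span_image)
  have "w (g j) = c j" if "j \<in> I" for j
  proof -
    have "w (g j) = (\<Sum>i\<in>I. if i = j then c i else 0)"
      unfolding c sum_apply using that assms by (intro sum.cong) auto
    then show ?thesis using that assms by simp
  qed
  then have "(\<Sum>i\<in>I. w (g i) *\<^sub>R v i) = (\<Sum>i\<in>I. c i *\<^sub>R v i)" by (intro sum.cong) auto
  then show ?thesis using c by simp
qed

text \<open>Evaluation on the dual functions makes the \<open>V' i\<close> independent at every
  point of \<open>S\<close>. They lie in the span of the equally many \<open>V i\<close>, which are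
  therefore independent there as well.\<close>

lemma indep_near:
  assumes q: "q \<in> points M" and I: "finite I" "\<And>i. i \<in> I \<Longrightarrow> vf (V i)" "fam_indep I (\<lambda>i. V i q)"
  obtains S where "opn S" "q \<in> S" "\<And>x. x \<in> S \<Longrightarrow> fam_indep I (\<lambda>i. V i x)"
proof -
  obtain S g V' where S: "opn S" "q \<in> S"
    and P: "\<forall>i\<in>I. smooth_fun M (g i) \<and> vf (V' i) \<and> comb I V S (V' i) \<and>
      (\<forall>x\<in>S. V i x \<in> span ((\<lambda>i. V' i x) ` I)) \<and>
      (\<forall>x\<in>S. \<forall>j\<in>I. V' i x (g j) = (if i = j then 1 else 0))"
    using dual_frame[OF q I] by blast
  show ?thesis
  proof (rule that[OF S])
    fix x assume x: "x \<in> S"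
    have "fam_indep I (\<lambda>i. V' i x)"
      unfolding fam_indep_def
    proof (intro allI impI ballI)
      fix c j assume c: "(\<Sum>i\<in>I. c i *\<^sub>R V' i x) = 0" and j: "j \<in> I"
      have "0 = (\<Sum>i\<in>I. c i *\<^sub>R V' i x) (g j)" by (simp add: c)
      also have "\<dots> = (\<Sum>i\<in>I. if i = j then c i else 0)"
        unfolding sum_apply using P x j by (intro sum.cong) auto
      finally show "c j = 0" using j I by simp
    qed
    moreover have "(\<lambda>i. V' i x) ` I \<subseteq> span ((\<lambda>i. V i x) ` I)"
    proof clarify
      fix i assume "i \<in> I"
      then obtain a where "V' i x = (\<Sum>j\<in>I. a j x *\<^sub>R V j x)"
        using P x unfolding comb_def by blast
      then show "V' i x \<in> span ((\<lambda>i. V i x) ` I)" by (rule in_spanI)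
    qed
    ultimately show "fam_indep I (\<lambda>i. V i x)" using fam_indep_span_trans(1)[OF I(1) _ _ I(1)] by blast
  qed
qed

text \<open>Upgrades pointwise membership in the span to smooth coefficients. In the dual frame the
  coefficients of \<open>W\<close> are the functions W (g l), which are smooth without further
  work.\<close>

lemma span_comb:
  assumes I: "finite I" "\<And>i. i \<in> I \<Longrightarrow> vf (V i)" "fam_indep I (\<lambda>i. V i q)"
    and W: "vf W" "opn O'" "q \<in> O'" "\<And>x. x \<in> O' \<Longrightarrow> W x \<in> span ((\<lambda>i. V i x) ` I)"
  obtains S where "opn S" "q \<in> S" "S \<subseteq> O'" "comb I V S W"
proof -
  have q: "q \<in> points M" using W opn_sub by auto
  obtain S g V' where S: "opn S" "q \<in> S"
    and P: "\<forall>i\<in>I. smooth_fun M (g i) \<and> vf (V' i) \<and> comb I V S (V' i) \<and>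
      (\<forall>x\<in>S. V i x \<in> span ((\<lambda>i. V' i x) ` I)) \<and>
      (\<forall>x\<in>S. \<forall>j\<in>I. V' i x (g j) = (if i = j then 1 else 0))"
    using dual_frame[OF q I] by blast
  show ?thesis
  proof (rule that[of "S \<inter> O'"])
    have "comb I V (S \<inter> O') (\<lambda>x. \<Sum>l\<in>I. W x (g l) *\<^sub>R V' l x)"
    proof (intro comb_sum comb_scale)
      fix l assume l: "l \<in> I"
      show "smooth_fun M (\<lambda>x. W x (g l))" using vf_smooth[OF W(1)] P l by blast
      show "comb I V (S \<inter> O') (V' l)" by (rule comb_subset[of _ S]) (use P l in blast)+
    qed
    moreover have "(\<Sum>l\<in>I. W x (g l) *\<^sub>R V' l x) = W x" if x: "x \<in> S \<inter> O'" for x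
    proof (rule dual_coeffs[OF I(1), symmetric])
      have "(\<lambda>i. V i x) ` I \<subseteq> span ((\<lambda>i. V' i x) ` I)" using P x by auto
      then have "span ((\<lambda>i. V i x) ` I) \<subseteq> span ((\<lambda>i. V' i x) ` I)" by (intro span_minimal) auto
      then show "W x \<in> span ((\<lambda>i. V' i x) ` I)" using W(4) x by auto
    qed (use P x in auto)
    ultimately show "comb I V (S \<inter> O') W" by (rule comb_cong[rotated])
  qed (use S W in auto)
qed

end

section \<open>The projectivisation of a rank 2 distribution\<close>

lemma fam_indep_two:
  fixes v w :: "'b::real_vector"
  shows "dim (span {v, w}) = 2 \<longleftrightarrow> fam_indep UNIV (\<lambda>b. if b then v else w)"
proof -
  have im: "(\<lambda>b. if b then v else w) ` UNIV = {v, w}" by (auto simp: UNIV_bool)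
  show ?thesis
    using fam_indep_dim(3)[of "UNIV :: bool set" "\<lambda>b. if b then v else w"]
      fam_indep_if_dim[of "UNIV :: bool set" "\<lambda>b. if b then v else w"] unfolding im
    by (auto simp: card_UNIV_bool)
qed

lemma pair_unique:
  fixes v w :: "'b::real_vector"
  assumes "dim (span {v, w}) = 2" "a *\<^sub>R v + b *\<^sub>R w = c *\<^sub>R v + d *\<^sub>R w"
  shows "a = c" "b = d"
proof -
  have "(\<Sum>i\<in>UNIV. (if i then a - c else b - d) *\<^sub>R (if i then v else w)) = 0"
    using assms(2) by (simp add: UNIV_bool algebra_simps)
  then have "\<forall>i\<in>UNIV. (if i then a - c else b - d) = 0"
    using assms(1)[unfolded fam_indep_two fam_indep_def, rule_format, of "\<lambda>i. if i then a - c else b - d"]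
    by blast
  then have "(if True then a - c else b - d) = 0" "(if False then a - c else b - d) = 0" by blast+
  then show "a = c" "b = d" by auto
qed

lemma pair_span: "x \<in> span {v, w} \<longleftrightarrow> (\<exists>a b. x = a *\<^sub>R v + b *\<^sub>R w)" for v w :: "'b::real_vector"
proof
  assume "x \<in> span {v, w}"
  then obtain k j where "x - k *\<^sub>R v = j *\<^sub>R w"
    unfolding span_breakdown_eq[of _ v] span_singleton by auto
  then show "\<exists>a b. x = a *\<^sub>R v + b *\<^sub>R w"
    by (intro exI[of _ k] exI[of _ j]) (simp add: diff_eq_eq add.commute)
next
  show "\<exists>a b. x = a *\<^sub>R v + b *\<^sub>R w \<Longrightarrow> x \<in> span {v, w}"
    by (auto intro!: span_add span_scale intro: span_base)
qed

lemma span_scaled: "c \<noteq> 0 \<Longrightarrow> span {c *\<^sub>R x} = span {x}" for x :: "'b::real_vector"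
proof -
  assume c: "c \<noteq> 0"
  have "x = (1 / c) *\<^sub>R (c *\<^sub>R x)" using c by simp
  then have "x \<in> span {c *\<^sub>R x}" by (metis span_base span_scale singletonI)
  then have "span {x} \<subseteq> span {c *\<^sub>R x}" by (intro span_minimal) auto
  moreover have "span {c *\<^sub>R x} \<subseteq> span {x}" by (intro span_minimal) (auto intro: span_scale span_base)
  ultimately show ?thesis by blast
qed

lemma dim_one_span:
  fixes l :: "'b::real_vector set"
  assumes "subspace l" "dim l = 1" obtains x where "x \<noteq> 0" "l = span {x}"
proof -
  obtain B where B: "B \<subseteq> l" "independent B" "l \<subseteq> span B" "card B = 1"
    using basis_exists[of l] assms by metis
  then obtain x where Bx: "B = {x}" using card_1_singletonE by blast
  have "l = span {x}" using B Bx assms by (metis span_minimal subset_antisym)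
  moreover have "x \<noteq> 0" using B Bx by auto
  ultimately show ?thesis using that by blast
qed

lemma line_inj:
  fixes v w :: "'b::real_vector"
  assumes "dim (span {v, w}) = 2" "span {v + t *\<^sub>R w} = span {v + t' *\<^sub>R w}" shows "t = t'"
proof -
  have "v + t *\<^sub>R w \<in> span {v + t' *\<^sub>R w}" using assms(2) span_base by blast
  then obtain k where "v + t *\<^sub>R w = k *\<^sub>R (v + t' *\<^sub>R w)" by (auto simp: span_singleton)
  then have "1 *\<^sub>R v + t *\<^sub>R w = k *\<^sub>R v + (k * t') *\<^sub>R w" by (simp add: algebra_simps)
  from pair_unique[OF assms(1) this] show ?thesis by simp
qed

text \<open>The disjunct \<open>t = 0\<close> accounts for the zero vector, whose span is not a
  line. It lets the lemma be used before the generator is known to be nonzero.\<close>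

lemma line_not_second:
  fixes v w :: "'b::real_vector"
  assumes "dim (span {v, w}) = 2" shows "span {a *\<^sub>R v + t *\<^sub>R w} \<noteq> span {w} \<longleftrightarrow> a \<noteq> 0 \<or> t = 0"
proof -
  have w0: "w \<noteq> 0"
  proof
    assume "w = 0"
    then have "0 *\<^sub>R v + 1 *\<^sub>R w = 0 *\<^sub>R v + 0 *\<^sub>R w" by simp
    from pair_unique(2)[OF assms this] show False by simp
  qed
  show ?thesis
  proof (cases "a = 0")
    case True
    have "span {0} \<noteq> span {w}" using w0 by (metis span_0 span_base insert_iff span_empty
      span_insert_0 empty_iff)
    then show ?thesis using True span_scaled[of t w] by (cases "t = 0") auto
  next
    case False
    have "a *\<^sub>R v + t *\<^sub>R w \<notin> span {w}"
    proof
      assume "a *\<^sub>R v + t *\<^sub>R w \<in> span {w}"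
      then obtain k where "a *\<^sub>R v + t *\<^sub>R w = 0 *\<^sub>R v + k *\<^sub>R w" by (auto simp: span_singleton)
      from pair_unique(1)[OF assms this] False show False by simp
    qed
    then show ?thesis using False span_base by blast
  qed
qed

lemma line_ex:
  fixes v w :: "'b::real_vector"
  assumes "dim (span {v, w}) = 2" "l \<subseteq> span {v, w}" "subspace l" "dim l = 1" "l \<noteq> span {w}"
  shows "\<exists>t. l = span {v + t *\<^sub>R w}"
proof -
  obtain x where x: "x \<noteq> 0" "l = span {x}" using dim_one_span assms by metis
  then have "x \<in> span {v, w}" using assms(2) span_base by blast
  then obtain a b where ab: "x = a *\<^sub>R v + b *\<^sub>R w" by (auto simp: pair_span)
  have a: "a \<noteq> 0"
  proof
    assume "a = 0"
    then have xb: "x = b *\<^sub>R w" using ab by simp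
    then have "b \<noteq> 0" using x(1) by auto
    then show False using assms(5) x(2) xb span_scaled[of b w] by simp
  qed
  then have "x = a *\<^sub>R (v + (b / a) *\<^sub>R w)" using ab by (simp add: algebra_simps)
  then show ?thesis using x(2) a span_scaled by metis
qed

lemma line_props:
  fixes v w :: "'b::real_vector"
  assumes "dim (span {v, w}) = 2"
  shows "span {v + t *\<^sub>R w} \<subseteq> span {v, w}" "dim (span {v + t *\<^sub>R w}) = 1"
proof -
  show "span {v + t *\<^sub>R w} \<subseteq> span {v, w}"
    by (intro span_minimal) (auto intro!: span_add span_scale intro: span_base)
  have "v + t *\<^sub>R w \<noteq> 0"
  proof
    assume "v + t *\<^sub>R w = 0"
    then have "1 *\<^sub>R v + t *\<^sub>R w = 0 *\<^sub>R v + 0 *\<^sub>R w" by simp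
    from pair_unique(1)[OF assms this] show False by simp
  qed
  then show "dim (span {v + t *\<^sub>R w}) = 1" by (simp add: dim_eq_card_independent)
qed

lemma local_frameD:
  assumes "local_frame M D S V W" "q \<in> S"
  shows "D q = span {V q, W q}" "dim (span {V q, W q}) = 2"
  using assms unfolding local_frame_def by metis+

text \<open>The coefficients are first chosen pointwise. By uniqueness they coincide near each point
  with smooth coefficients obtained from a globalized copy of the frame, and smoothness is
  local.\<close>

lemma (in manifold) frame_coeffs:
  assumes fr: "local_frame M D S V W" and V': "smooth_vf_on M S' V'" "opn S'"
    and D: "\<And>q. q \<in> S \<inter> S' \<Longrightarrow> V' q \<in> D q"
  obtains a b where "smooth_on M (S \<inter> S') a" "smooth_on M (S \<inter> S') b"
    "\<And>q. q \<in> S \<inter> S' \<Longrightarrow> V' q = a q *\<^sub>R V q + b q *\<^sub>R W q"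
proof -
  have S: "opn S" and sV: "smooth_vf_on M S V" "smooth_vf_on M S W" using fr by (auto simp: local_frame_def)
  have "\<exists>a b. V' q = a *\<^sub>R V q + b *\<^sub>R W q" if "q \<in> S \<inter> S'" for q
    using D[OF that] local_frameD[OF fr] that by (auto simp: pair_span)
  then obtain a b where ab: "\<And>q. q \<in> S \<inter> S' \<Longrightarrow> V' q = a q *\<^sub>R V q + b q *\<^sub>R W q" by metis
  have SS: "opn (S \<inter> S')" using S V' by auto
  have loc: "\<exists>O'. opn O' \<and> q \<in> O' \<and> smooth_on M O' a \<and> smooth_on M O' b" if q: "q \<in> S \<inter> S'" for q
  proof -
    have qS: "q \<in> S" and qS': "q \<in> S'" using q by auto
    obtain G W0 where G: "\<And>i. i \<in> UNIV \<Longrightarrow> vf (G i)" "opn W0" "q \<in> W0" "W0 \<subseteq> S"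
      "\<And>i x. x \<in> W0 \<Longrightarrow> G i x = (if i then V x else W x)"
    proof (rule globalize_family[of UNIV S "\<lambda>i x. if i then V x else W x", OF _ S qS])
      show "smooth_vf_on M S (\<lambda>x. if i then V x else W x)" for i using sV by (cases i) auto
    qed blast
    obtain V1 W1 where V1: "vf V1" "opn W1" "q \<in> W1" "W1 \<subseteq> S'" "\<And>x. x \<in> W1 \<Longrightarrow> V1 x = V' x"
      by (rule globalize[OF V'(1,2) qS']) blast
    have ind: "fam_indep UNIV (\<lambda>i. G i q)"
      unfolding G(5)[OF G(3)] using local_frameD(2)[OF fr qS] by (rule iffD1[OF fam_indep_two])
    have im: "(\<lambda>i. G i x) ` UNIV = {V x, W x}" if "x \<in> W0" for x
      using G(5)[OF that] by (auto simp: UNIV_bool)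
    have sp: "V1 x \<in> span ((\<lambda>i. G i x) ` UNIV)" if "x \<in> W0 \<inter> W1" for x
      using that D[of x] V1(4,5) G(4) local_frameD(1)[OF fr, of x] im[of x] by auto
    obtain O1 where O1: "opn O1" "q \<in> O1" "O1 \<subseteq> W0 \<inter> W1" "comb UNIV G O1 V1"
      by (rule span_comb[of "UNIV :: bool set" G, OF _ G(1) ind V1(1) openin_Int[OF G(2) V1(2)] _ sp])
        (use G V1 in auto)
    obtain c where c: "\<And>i. smooth_fun M (c i)" "\<And>x. x \<in> O1 \<Longrightarrow> V1 x = (\<Sum>i\<in>UNIV. c i x *\<^sub>R G i x)"
      using O1(4) unfolding comb_def by auto
    have eq: "a x = c True x" "b x = c False x" if x: "x \<in> O1" for x
    proof -
      have xx: "x \<in> W0" "x \<in> W1" "x \<in> S \<inter> S'" using x O1(3) G(4) V1(4) by auto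
      have "a x *\<^sub>R V x + b x *\<^sub>R W x = c True x *\<^sub>R V x + c False x *\<^sub>R W x"
        using ab[OF xx(3)] V1(5)[OF xx(2)] c(2)[OF x] G(5)[OF xx(1)] by (simp add: UNIV_bool add.commute)
      from pair_unique[OF local_frameD(2)[OF fr] this] show "a x = c True x" "b x = c False x"
        using xx by auto
    qed
    have "smooth_on M O1 a" "smooth_on M O1 b"
      using smooth_on_cong[OF O1(1) eq(1)] smooth_on_cong[OF O1(1) eq(2)]
        smooth_on_subset[OF c(1) opn_points O1(1) opn_sub[OF O1(1)]] by auto
    then show ?thesis using O1 by blast
  qed
  show ?thesis
    by (rule that[OF _ _ ab]; (rule smooth_on_local[OF SS])?) (use loc in blast)+
qed

section \<open>Charts of the prolongation and their transition maps\<close>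

definition cyl :: "nat \<Rightarrow> (nat \<Rightarrow> real) set \<Rightarrow> (nat \<Rightarrow> real) set" where
  "cyl n A = {y. (\<forall>i\<ge>Suc n. y i = 0) \<and> y(n := 0) \<in> A}"

lemma openin_cyl:
  assumes A: "openin (Euclidean_space n) A" shows "openin (Euclidean_space (Suc n)) (cyl n A)"
  unfolding openin_Euclidean_space_iff
proof (intro ballI conjI)
  fix y assume y: "y \<in> cyl n A"
  then show "\<forall>i\<ge>Suc n. y i = 0" by (simp add: cyl_def)
  obtain e where e: "e > 0" "cube n (y(n := 0)) e \<subseteq> A" using openin_E_cube[OF A, of "y(n := 0)"] y unfolding cyl_def by blast
  have "cube (Suc n) y e \<subseteq> cyl n A"
  proof
    fix z assume z: "z \<in> cube (Suc n) y e"
    then have "z(n := 0) \<in> cube n (y(n := 0)) e" by (auto simp: cube_def)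
    then show "z \<in> cyl n A" using z e by (auto simp: cyl_def cube_def)
  qed
  then show "\<exists>e>0. cube (Suc n) y e \<subseteq> cyl n A" using e by blast
qed

lemma tuple_cyl: "y \<in> cyl n A \<Longrightarrow> tuple n (\<lambda>j y. y j) y = y(n := 0)"
  by (auto simp: tuple_def cyl_def fun_eq_iff)

lemma C_infinity_cyl:
  assumes A: "openin (Euclidean_space n) A" and f: "C_infinity n A f"
  shows "C_infinity (Suc n) (cyl n A) (\<lambda>y. f (y(n := 0)))"
proof -
  have "C_infinity (Suc n) (cyl n A) (\<lambda>y. f (tuple n (\<lambda>j y. y j) y))"
  proof (rule C_infinity_comp[OF openin_cyl[OF A] A _ f])
    show "tuple n (\<lambda>j y. y j) x \<in> A" if "x \<in> cyl n A" for x
      using that tuple_cyl[OF that] by (simp add: cyl_def)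
    show "C_infinity (Suc n) (cyl n A) (\<lambda>y. y j)" if "j < n" for j
      using C_infinity_coord[OF openin_cyl[OF A]] that by simp
  qed
  then show ?thesis by (subst C_infinity_cong[OF openin_cyl[OF A]]) (use tuple_cyl in auto)
qed

lemma openin_nonzero:
  fixes h :: "(nat \<Rightarrow> real) \<Rightarrow> real"
  assumes A: "openin (Euclidean_space n) A" and h: "C_infinity n A h"
  shows "openin (Euclidean_space n) {y \<in> A. h y \<noteq> 0}"
proof -
  have "continuous_on A h" using h C_k_continuous[OF A] unfolding C_infinity_def by blast
  then have "openin (top_of_set A) (A \<inter> h -` (- {0}))" by (intro continuous_openin_preimage_gen) auto
  moreover have "top_of_set A = subtopology (Euclidean_space n) A"
    using openin_subset[OF A] by (simp add: Euclidean_space_eq subtopology_subtopology Int_absorb1)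
  moreover have "A \<inter> h -` (- {0}) = {y \<in> A. h y \<noteq> 0}" by auto
  ultimately show ?thesis using A by (simp add: openin_open_subtopology)
qed

text \<open>\<open>N\<close> is a copy of $\mathbb PD$: a point \<open>x\<close> of \<open>N\<close> stands for the line \<open>lin x\<close> in the plane of
  \<open>D\<close> at \<open>\<pi> x\<close>.\<close>

locale prolongation = manifold M for M :: "'a mfd" +
  fixes D :: "'a dist" and N :: "'a mfd" and \<pi> :: "'a \<Rightarrow> 'a" and lin :: "'a \<Rightarrow> 'a tvec set"
  assumes rank2: "rank2_distribution M D"
    and bij: "bij_betw (\<lambda>x. (\<pi> x, lin x)) (points N)
      {(q, l). q \<in> points M \<and> l \<subseteq> D q \<and> subspace l \<and> dim l = 1}"
    and mdimN: "mdim N = Suc n"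
    and atlasN0: "atlas N = {({x \<in> points N. \<pi> x \<in> U \<inter> S \<and> (\<exists>t. lin x = span {V (\<pi> x) + t *\<^sub>R W (\<pi> x)})},
        \<lambda>x. (\<phi> (\<pi> x))(mdim M := THE t. lin x = span {V (\<pi> x) + t *\<^sub>R W (\<pi> x)})) | U \<phi> S V W.
      (U, \<phi>) \<in> atlas M \<and> local_frame M D S V W}"
begin

text \<open>\<open>dm\<close>, \<open>tc\<close> and \<open>cr\<close> are the domain, the fibre
  coordinate and the coordinate map of a chart of \<open>N\<close>. In each fibre the chart misses
  exactly the line spanned by \<open>W\<close>.\<close>

definition dm :: "'a set \<Rightarrow> 'a set \<Rightarrow> ('a \<Rightarrow> 'a tvec) \<Rightarrow> ('a \<Rightarrow> 'a tvec) \<Rightarrow> 'a set" where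
  "dm U S V W = {x \<in> points N. \<pi> x \<in> U \<inter> S \<and> (\<exists>t. lin x = span {V (\<pi> x) + t *\<^sub>R W (\<pi> x)})}"

definition tc :: "('a \<Rightarrow> 'a tvec) \<Rightarrow> ('a \<Rightarrow> 'a tvec) \<Rightarrow> 'a \<Rightarrow> real" where
  "tc V W x = (THE t. lin x = span {V (\<pi> x) + t *\<^sub>R W (\<pi> x)})"

definition cr :: "('a \<Rightarrow> nat \<Rightarrow> real) \<Rightarrow> ('a \<Rightarrow> 'a tvec) \<Rightarrow> ('a \<Rightarrow> 'a tvec) \<Rightarrow> 'a \<Rightarrow> nat \<Rightarrow> real" where
  "cr \<phi> V W = (\<lambda>x. (\<phi> (\<pi> x))(n := tc V W x))"

lemma atlasN: "atlas N = {(dm U S V W, cr \<phi> V W) | U \<phi> S V W. (U, \<phi>) \<in> atlas M \<and> local_frame M D S V W}"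
  unfolding atlasN0 dm_def cr_def tc_def by (rule refl)

lemma pt_inj: "x \<in> points N \<Longrightarrow> y \<in> points N \<Longrightarrow> \<pi> x = \<pi> y \<Longrightarrow> lin x = lin y \<Longrightarrow> x = y"
  using bij unfolding bij_betw_def inj_on_def by blast

lemma pt_ex: "q \<in> points M \<Longrightarrow> l \<subseteq> D q \<Longrightarrow> subspace l \<Longrightarrow> dim l = 1 \<Longrightarrow> \<exists>x\<in>points N. \<pi> x = q \<and> lin x = l"
proof -
  assume "q \<in> points M" "l \<subseteq> D q" "subspace l" "dim l = 1"
  then have "(q, l) \<in> (\<lambda>x. (\<pi> x, lin x)) ` points N" using bij unfolding bij_betw_def by blast
  then show ?thesis by auto
qed

lemma pt_props:
  assumes "x \<in> points N"
  shows "\<pi> x \<in> points M" "lin x \<subseteq> D (\<pi> x)" "subspace (lin x)" "dim (lin x) = 1"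
  using assms bij unfolding bij_betw_def by blast+

lemma dm_iff:
  assumes fr: "local_frame M D S V W"
  shows "x \<in> dm U S V W \<longleftrightarrow> x \<in> points N \<and> \<pi> x \<in> U \<and> \<pi> x \<in> S \<and> lin x \<noteq> span {W (\<pi> x)}"
proof (cases "x \<in> points N \<and> \<pi> x \<in> U \<and> \<pi> x \<in> S")
  case True
  note f = local_frameD[OF fr, of "\<pi> x"]
  have "(\<exists>t. lin x = span {V (\<pi> x) + t *\<^sub>R W (\<pi> x)}) \<longleftrightarrow> lin x \<noteq> span {W (\<pi> x)}"
    using line_ex[of "V (\<pi> x)" "W (\<pi> x)" "lin x"] line_not_second[of "V (\<pi> x)" "W (\<pi> x)" 1] f True pt_props[of x]
    by auto
  then show ?thesis using True by (simp add: dm_def)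
qed (auto simp: dm_def)

lemma tc_eq:
  assumes fr: "local_frame M D S V W" and x: "\<pi> x \<in> S" "lin x = span {V (\<pi> x) + t *\<^sub>R W (\<pi> x)}"
  shows "tc V W x = t"
  unfolding tc_def
proof (rule the_equality, rule x(2))
  fix t' assume "lin x = span {V (\<pi> x) + t' *\<^sub>R W (\<pi> x)}"
  from line_inj[OF local_frameD(2)[OF fr x(1)] trans[OF this[symmetric] x(2)]] show "t' = t" .
qed

lemma tc_line:
  assumes fr: "local_frame M D S V W" and x: "x \<in> dm U S V W"
  shows "lin x = span {V (\<pi> x) + tc V W x *\<^sub>R W (\<pi> x)}"
proof -
  obtain t where t: "lin x = span {V (\<pi> x) + t *\<^sub>R W (\<pi> x)}" "\<pi> x \<in> S" using x by (auto simp: dm_def)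
  then show ?thesis using tc_eq[OF fr t(2,1)] by simp
qed

lemma cr_zero:
  assumes "(U, \<phi>) \<in> atlas M" "x \<in> dm U S V W" shows "(cr \<phi> V W x)(n := 0) = \<phi> (\<pi> x)"
proof -
  have "\<phi> (\<pi> x) n = 0" using assms chart_zero by (auto simp: dm_def)
  then show ?thesis by (auto simp: cr_def)
qed

lemma cr_inj:
  assumes U: "(U, \<phi>) \<in> atlas M" and fr: "local_frame M D S V W" shows "inj_on (cr \<phi> V W) (dm U S V W)"
proof (rule inj_onI)
  fix x y assume xy: "x \<in> dm U S V W" "y \<in> dm U S V W" "cr \<phi> V W x = cr \<phi> V W y"
  have "\<phi> (\<pi> x) = \<phi> (\<pi> y)" using cr_zero[OF U] xy by metis
  then have p: "\<pi> x = \<pi> y" using chart_inj[OF U] xy by (auto simp: dm_def inj_on_def)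
  have "tc V W x = tc V W y" using fun_cong[OF xy(3), of n] by (simp add: cr_def)
  then have "lin x = lin y" using tc_line[OF fr] xy p by metis
  then show "x = y" using pt_inj p xy by (auto simp: dm_def)
qed

lemma cr_image:
  assumes U: "(U, \<phi>) \<in> atlas M" and fr: "local_frame M D S V W" and Q: "Q \<subseteq> U \<inter> S"
  shows "cr \<phi> V W ` {x \<in> dm U S V W. \<pi> x \<in> Q} = cyl n (\<phi> ` Q)"
proof (intro equalityI subsetI)
  fix y assume "y \<in> cr \<phi> V W ` {x \<in> dm U S V W. \<pi> x \<in> Q}"
  then obtain x where x: "x \<in> dm U S V W" "\<pi> x \<in> Q" "y = cr \<phi> V W x" by auto
  have "y i = 0" if "i \<ge> Suc n" for i using chart_zero[OF U] x that by (auto simp: cr_def dm_def)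
  then show "y \<in> cyl n (\<phi> ` Q)" using cr_zero[OF U x(1)] x by (auto simp: cyl_def)
next
  fix y assume y: "y \<in> cyl n (\<phi> ` Q)"
  then obtain q where q: "q \<in> Q" "y(n := 0) = \<phi> q" by (auto simp: cyl_def)
  have qq: "q \<in> U" "q \<in> S" "q \<in> points M" using q Q U by (auto simp: points_def)
  have "\<exists>x\<in>points N. \<pi> x = q \<and> lin x = span {V q + y n *\<^sub>R W q}"
    by (rule pt_ex[OF qq(3)]) (use line_props[OF local_frameD(2)[OF fr qq(2)]] local_frameD(1)[OF fr qq(2)] in auto)
  then obtain x where x: "x \<in> points N" "\<pi> x = q" "lin x = span {V q + y n *\<^sub>R W q}" by auto
  have xd: "x \<in> dm U S V W" using x qq by (auto simp: dm_def)
  have "tc V W x = y n" by (rule tc_eq[OF fr]) (use x qq in auto)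
  then have "cr \<phi> V W x i = y i" for i using fun_cong[OF q(2), of i] x by (cases "i = n") (simp_all add: cr_def)
  then have "cr \<phi> V W x = y" by (rule ext)
  then show "y \<in> cr \<phi> V W ` {x \<in> dm U S V W. \<pi> x \<in> Q}" using xd x q by auto
qed

lemma cr_image_dm:
  assumes U: "(U, \<phi>) \<in> atlas M" and fr: "local_frame M D S V W"
  shows "cr \<phi> V W ` dm U S V W = cyl n (\<phi> ` (U \<inter> S))"
proof -
  have "{x \<in> dm U S V W. \<pi> x \<in> U \<inter> S} = dm U S V W" by (auto simp: dm_def)
  then show ?thesis using cr_image[OF U fr, of "U \<inter> S"] by simp
qed

lemma cr_inv:
  assumes U: "(U, \<phi>) \<in> atlas M" and fr: "local_frame M D S V W" and y: "y \<in> cyl n (\<phi> ` (U \<inter> S))"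
  shows "inv_into (dm U S V W) (cr \<phi> V W) y \<in> dm U S V W"
    "\<pi> (inv_into (dm U S V W) (cr \<phi> V W) y) = inv_into U \<phi> (y(n := 0))"
    "tc V W (inv_into (dm U S V W) (cr \<phi> V W) y) = y n"
proof -
  let ?x = "inv_into (dm U S V W) (cr \<phi> V W) y"
  have yi: "y \<in> cr \<phi> V W ` dm U S V W" using y cr_image_dm[OF U fr] by simp
  show x: "?x \<in> dm U S V W" using inv_into_into[OF yi] .
  have c: "cr \<phi> V W ?x = y" using f_inv_into_f[OF yi] .
  have "\<phi> (\<pi> ?x) = y(n := 0)" using cr_zero[OF U x] c by simp
  moreover have "\<pi> ?x \<in> U" using x by (auto simp: dm_def)
  ultimately show "\<pi> ?x = inv_into U \<phi> (y(n := 0))" using chart_inv[OF U] by metis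
  have "cr \<phi> V W x n = tc V W x" for x by (simp add: cr_def)
  from this[of ?x] show "tc V W ?x = y n" unfolding c by simp
qed

lemma opn_frame: "local_frame M D S V W \<Longrightarrow> opn S"
  by (simp add: local_frame_def)

text \<open>If V = a V' + c W' and W = b V' + d W', the line with coordinate t has the new
  coordinate t' = (c + t d) / (a + t b). The transition maps are fractional linear in the fibre, and
  the charts overlap where the denominator, called \<open>h\<close>, does not vanish.\<close>

lemma transition_N:
  assumes U: "(U, \<phi>) \<in> atlas M" and fr: "local_frame M D S V W"
    and U': "(U', \<phi>') \<in> atlas M" and fr': "local_frame M D S' V' W'"
  shows "openin (Euclidean_space (Suc n)) (cr \<phi> V W ` (dm U S V W \<inter> dm U' S' V' W'))" (is ?G1)
    "j < Suc n \<Longrightarrow> C_infinity (Suc n) (cr \<phi> V W ` (dm U S V W \<inter> dm U' S' V' W'))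
       (\<lambda>y. cr \<phi>' V' W' (inv_into (dm U S V W) (cr \<phi> V W) y) j)"
proof -
  have S: "opn S" "opn S'" using opn_frame fr fr' by auto
  have sf: "smooth_vf_on M S V" "smooth_vf_on M S W" using fr by (auto simp: local_frame_def)
  have SS: "q \<in> S' \<inter> S \<Longrightarrow> V q \<in> D q" "q \<in> S' \<inter> S \<Longrightarrow> W q \<in> D q" for q
    using local_frameD(1)[OF fr, of q] span_base[of _ "{V q, W q}"] by auto
  obtain a c where ac: "smooth_on M (S' \<inter> S) a" "smooth_on M (S' \<inter> S) c"
    "\<And>q. q \<in> S' \<inter> S \<Longrightarrow> V q = a q *\<^sub>R V' q + c q *\<^sub>R W' q"
    by (rule frame_coeffs[OF fr' sf(1) S(1) SS(1)]) auto
  obtain b d where bd: "smooth_on M (S' \<inter> S) b" "smooth_on M (S' \<inter> S) d"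
    "\<And>q. q \<in> S' \<inter> S \<Longrightarrow> W q = b q *\<^sub>R V' q + d q *\<^sub>R W' q"
    by (rule frame_coeffs[OF fr' sf(2) S(1) SS(2)]) auto
  define Q where "Q = U \<inter> S \<inter> (U' \<inter> S')"
  have Q: "opn Q" "Q \<subseteq> U \<inter> S" "Q \<subseteq> S' \<inter> S" "Q \<subseteq> U'"
    using S opn_chart[OF U] opn_chart[OF U'] by (auto simp: Q_def)
  have QU: "Q \<inter> U = Q" using Q by auto
  have pQ: "openin E (\<phi> ` Q)" using opn_image[OF Q(1) U] QU by simp
  let ?C = "cyl n (\<phi> ` Q)"
  have C: "openin (Euclidean_space (Suc n)) ?C" by (rule openin_cyl[OF pQ])
  let ?p = "\<lambda>y. inv_into U \<phi> (y(n := 0))"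
  have sm: "C_infinity (Suc n) ?C (\<lambda>y. F (?p y))" if "smooth_on M O' F" "opn O'" "Q \<subseteq> O'" for F O'
  proof -
    have "smooth_on M Q F" using smooth_on_subset[OF that(1,2) Q(1) that(3)] .
    then have "C_infinity n (\<phi> ` Q) (\<lambda>x. F (inv_into U \<phi> x))" using smooth_onD[OF _ U, of Q F] QU by simp
    from C_infinity_cyl[OF pQ this] show ?thesis .
  qed
  define h where "h = (\<lambda>y. a (?p y) + y n * b (?p y))"
  have SS': "opn (S' \<inter> S)" using S by auto
  have yn: "C_infinity (Suc n) ?C (\<lambda>y. y n)" by (rule C_infinity_coord[OF C]) simp
  have hs: "C_infinity (Suc n) ?C h"
    unfolding h_def by (intro C_infinity_add[OF C] C_infinity_mult[OF C] yn sm[OF ac(1) SS' Q(3)] sm[OF bd(1) SS' Q(3)])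
  have pin: "?p y \<in> Q" if y: "y \<in> ?C" for y
  proof -
    obtain q where "q \<in> Q" "y(n := 0) = \<phi> q" using y by (auto simp: cyl_def)
    then show ?thesis using chart_inv[OF U, of q] Q(2) by auto
  qed
  have key: "V q + t *\<^sub>R W q = (a q + t * b q) *\<^sub>R V' q + (c q + t * d q) *\<^sub>R W' q" if "q \<in> Q" for q t
    using ac(3)[OF subsetD[OF Q(3) that]] bd(3)[OF subsetD[OF Q(3) that]] by (simp add: algebra_simps)
  have CS: "?C \<subseteq> cyl n (\<phi> ` (U \<inter> S))" using Q by (auto simp: cyl_def)
  let ?i = "inv_into (dm U S V W) (cr \<phi> V W)"
  have inv: "?i y \<in> dm U S V W" "\<pi> (?i y) = ?p y" "tc V W (?i y) = y n" if "y \<in> ?C" for y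
    using cr_inv[OF U fr, of y] that CS by auto
  have line: "lin (?i y) = span {h y *\<^sub>R V' (?p y) + (c (?p y) + y n * d (?p y)) *\<^sub>R W' (?p y)}" if y: "y \<in> ?C" for y
    using tc_line[OF fr inv(1)[OF y]] inv(2,3)[OF y] key[OF pin[OF y]] by (simp add: h_def)
  \<comment> \<open>Numerator and denominator have no common zero, for otherwise the point would
    stand for the zero space instead of a line.\<close>
  have nz: "h y \<noteq> 0 \<or> c (?p y) + y n * d (?p y) \<noteq> 0" if y: "y \<in> ?C" for y
  proof (rule ccontr)
    assume "\<not> ?thesis"
    then have "lin (?i y) = {0}" using line[OF y] by simp
    moreover have "dim (lin (?i y)) = 1" using pt_props(4)[of "?i y"] inv(1)[OF y] by (auto simp: dm_def)
    moreover have "dim ({0} :: 'a tvec set) \<le> card ({} :: 'a tvec set)" by (rule dim_le_card) auto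
    ultimately show False by simp
  qed
  have dmQ: "?i y \<in> dm U' S' V' W' \<longleftrightarrow> h y \<noteq> 0" if y: "y \<in> ?C" for y
    unfolding dm_iff[OF fr'] line[OF y] inv(2)[OF y]
    using line_not_second[OF local_frameD(2)[OF fr'], of "?p y" "h y"] pin[OF y] nz[OF y] inv(1)[OF y]
    by (auto simp: Q_def dm_def)
  have im: "cr \<phi> V W ` (dm U S V W \<inter> dm U' S' V' W') = {y \<in> ?C. h y \<noteq> 0}"
  proof (intro equalityI subsetI)
    fix y assume "y \<in> cr \<phi> V W ` (dm U S V W \<inter> dm U' S' V' W')"
    then obtain x where x: "x \<in> dm U S V W" "x \<in> dm U' S' V' W'" "y = cr \<phi> V W x" by auto
    have "\<pi> x \<in> Q" using x by (auto simp: dm_def Q_def)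
    then have yC: "y \<in> ?C" using cr_image[OF U fr, of Q] Q x by auto
    moreover have "?i y = x" using x inv_into_f_f[OF cr_inj[OF U fr]] by simp
    ultimately show "y \<in> {y \<in> ?C. h y \<noteq> 0}" using dmQ[OF yC] x(2) by simp
  next
    fix y assume y: "y \<in> {y \<in> ?C. h y \<noteq> 0}"
    then have "?i y \<in> dm U S V W \<inter> dm U' S' V' W'" using dmQ inv by auto
    moreover have "cr \<phi> V W (?i y) = y"
      using f_inv_into_f[of y "cr \<phi> V W" "dm U S V W"] y CS cr_image_dm[OF U fr] by auto
    ultimately show "y \<in> cr \<phi> V W ` (dm U S V W \<inter> dm U' S' V' W')" by force
  qed
  show G1: ?G1 unfolding im by (rule openin_nonzero[OF C hs])
  assume j: "j < Suc n"
  show "C_infinity (Suc n) (cr \<phi> V W ` (dm U S V W \<inter> dm U' S' V' W'))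
       (\<lambda>y. cr \<phi>' V' W' (?i y) j)"
  proof (cases "j < n")
    case True
    have "C_infinity (Suc n) ?C (\<lambda>y. \<phi>' (?p y) j)"
      by (rule sm[OF smooth_on_coord[OF U' True] opn_chart[OF U'] Q(4)])
    then have "C_infinity (Suc n) {y \<in> ?C. h y \<noteq> 0} (\<lambda>y. \<phi>' (?p y) j)"
      using C_infinity_subset[OF C G1[unfolded im]] by auto
    then show ?thesis unfolding im
      by (subst C_infinity_cong[OF G1[unfolded im], of _ "\<lambda>y. \<phi>' (?p y) j"])
        (use inv True in \<open>auto simp: cr_def\<close>)
  next
    case False
    then have jn: "j = n" using j by simp
    have "C_infinity (Suc n) {y \<in> ?C. h y \<noteq> 0} (\<lambda>y. (c (?p y) + y n * d (?p y)) * inverse (h y))"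
    proof (intro C_infinity_mult[OF G1[unfolded im]] C_infinity_inverse[OF G1[unfolded im]])
      have "C_infinity (Suc n) ?C (\<lambda>y. c (?p y) + y n * d (?p y))"
        by (intro C_infinity_add[OF C] C_infinity_mult[OF C] yn sm[OF ac(2) SS' Q(3)] sm[OF bd(2) SS' Q(3)])
      then show "C_infinity (Suc n) {y \<in> ?C. h y \<noteq> 0} (\<lambda>y. c (?p y) + y n * d (?p y))"
        using C_infinity_subset[OF C G1[unfolded im]] by auto
      show "C_infinity (Suc n) {y \<in> ?C. h y \<noteq> 0} h"
        using C_infinity_subset[OF C G1[unfolded im] _ hs] by auto
    qed auto
    moreover have "tc V' W' (?i y) = (c (?p y) + y n * d (?p y)) * inverse (h y)" if y: "y \<in> ?C" "h y \<noteq> 0" for y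
    proof (rule tc_eq[OF fr'])
      show "\<pi> (?i y) \<in> S'" using inv(2)[OF y(1)] pin[OF y(1)] by (auto simp: Q_def)
      let ?w = "V' (?p y) + ((c (?p y) + y n * d (?p y)) * inverse (h y)) *\<^sub>R W' (?p y)"
      have "h y *\<^sub>R V' (?p y) + (c (?p y) + y n * d (?p y)) *\<^sub>R W' (?p y) = h y *\<^sub>R ?w"
        using y(2) by (simp add: scaleR_add_right)
      then show "lin (?i y) = span {V' (\<pi> (?i y)) + ((c (?p y) + y n * d (?p y)) * inverse (h y)) *\<^sub>R W' (\<pi> (?i y))}"
        using line[OF y(1)] inv(2)[OF y(1)] span_scaled[OF y(2), of ?w] by simp
    qed
    ultimately show ?thesis unfolding im jn
      by (subst C_infinity_cong[OF G1[unfolded im], of _ "\<lambda>y. (c (?p y) + y n * d (?p y)) * inverse (h y)"])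
        (auto simp: cr_def)
  qed
qed

end

section \<open>The manifold axioms for the prolongation\<close>

sublocale prolongation \<subseteq> PN: premanifold N
proof
  show "\<forall>(U, \<phi>)\<in>atlas N. inj_on \<phi> U \<and> openin (Euclidean_space (mdim N)) (\<phi> ` U)"
    unfolding atlasN mdimN
  proof clarify
    fix U \<phi> S V W assume U: "(U, \<phi>) \<in> atlas M" and fr: "local_frame M D S V W"
    have "opn (U \<inter> S)" using opn_chart[OF U] opn_frame[OF fr] by auto
    then have "openin E (\<phi> ` (U \<inter> S))" using opn_image[OF _ U, of "U \<inter> S"] by (simp add: Int_ac)
    then show "inj_on (cr \<phi> V W) (dm U S V W) \<and>
        openin (Euclidean_space (Suc n)) (cr \<phi> V W ` dm U S V W)"
      unfolding cr_image_dm[OF U fr] by (intro conjI cr_inj[OF U fr] openin_cyl)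
  qed
  show "\<forall>(U, \<phi>)\<in>atlas N. \<forall>(V, \<psi>)\<in>atlas N.
      openin (Euclidean_space (mdim N)) (\<phi> ` (U \<inter> V)) \<and>
      (\<forall>j<mdim N. C_infinity (mdim N) (\<phi> ` (U \<inter> V)) (\<lambda>x. \<psi> (inv_into U \<phi> x) j))"
    unfolding atlasN mdimN using transition_N by auto
qed

context prolongation
begin

lemma atlas_mem: "(U, \<phi>) \<in> atlas M \<Longrightarrow> local_frame M D S V W \<Longrightarrow> (dm U S V W, cr \<phi> V W) \<in> atlas N"
  unfolding atlasN by blast

lemma opn_pullback:
  assumes O: "opn O'" shows "PN.opn {x \<in> points N. \<pi> x \<in> O'}"
  unfolding PN.openin_mtop mdimN
proof (intro conjI ballI)
  fix c assume "c \<in> atlas N"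
  then obtain U \<phi> S V W where U: "(U, \<phi>) \<in> atlas M" and fr: "local_frame M D S V W"
    and c: "c = (dm U S V W, cr \<phi> V W)" unfolding atlasN by blast
  let ?Q = "O' \<inter> S \<inter> U"
  have "{x \<in> points N. \<pi> x \<in> O'} \<inter> dm U S V W = {x \<in> dm U S V W. \<pi> x \<in> ?Q}"
    by (auto simp: dm_def)
  moreover have "cr \<phi> V W ` {x \<in> dm U S V W. \<pi> x \<in> ?Q} = cyl n (\<phi> ` ?Q)"
    by (rule cr_image[OF U fr]) auto
  moreover have "openin E (\<phi> ` ?Q)" using opn_image[OF openin_Int[OF O opn_frame[OF fr]] U] .
  ultimately show "case c of (U, \<phi>) \<Rightarrow> openin (Euclidean_space (Suc n)) (\<phi> ` ({x \<in> points N. \<pi> x \<in> O'} \<inter> U))"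
    using openin_cyl by (simp add: c)
qed auto

lemma smooth_pullback:
  assumes O: "opn O'" and f: "smooth_on M O' f"
  shows "smooth_on N {x \<in> points N. \<pi> x \<in> O'} (\<lambda>x. f (\<pi> x))"
  unfolding smooth_on_def mdimN
proof
  fix c assume "c \<in> atlas N"
  then obtain U \<phi> S V W where U: "(U, \<phi>) \<in> atlas M" and fr: "local_frame M D S V W"
    and c: "c = (dm U S V W, cr \<phi> V W)" unfolding atlasN by blast
  let ?Q = "O' \<inter> S \<inter> U"
  have 1: "{x \<in> points N. \<pi> x \<in> O'} \<inter> dm U S V W = {x \<in> dm U S V W. \<pi> x \<in> ?Q}"
    by (auto simp: dm_def)
  have 2: "cr \<phi> V W ` {x \<in> dm U S V W. \<pi> x \<in> ?Q} = cyl n (\<phi> ` ?Q)"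
    by (rule cr_image[OF U fr]) auto
  have OS: "opn (O' \<inter> S)" using openin_Int[OF O opn_frame[OF fr]] .
  have Q: "openin E (\<phi> ` ?Q)" using opn_image[OF OS U] .
  have "C_infinity n (\<phi> ` ?Q) (\<lambda>x. f (inv_into U \<phi> x))"
    using smooth_onD[OF smooth_on_subset[OF f O OS] U] by simp
  from C_infinity_cyl[OF Q this]
  have "C_infinity (Suc n) (cyl n (\<phi> ` ?Q)) (\<lambda>y. f (inv_into U \<phi> (y(n := 0))))" .
  moreover have "inv_into U \<phi> (y(n := 0)) = \<pi> (inv_into (dm U S V W) (cr \<phi> V W) y)"
    if "y \<in> cyl n (\<phi> ` ?Q)" for y
    by (rule cr_inv(2)[OF U fr, symmetric]) (use that in \<open>auto simp: cyl_def\<close>)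
  ultimately have "C_infinity (Suc n) (cyl n (\<phi> ` ?Q)) (\<lambda>y. f (\<pi> (inv_into (dm U S V W) (cr \<phi> V W) y)))"
    by (subst C_infinity_cong[OF openin_cyl[OF Q], of _ "\<lambda>y. f (inv_into U \<phi> (y(n := 0)))"]) auto
  then show "case c of (U, \<phi>) \<Rightarrow> C_infinity (Suc n) (\<phi> ` ({x \<in> points N. \<pi> x \<in> O'} \<inter> U)) (\<lambda>x. f (\<pi> (inv_into U \<phi> x)))"
    by (simp only: c prod.case 1 2)
qed

lemma frame_swap: "local_frame M D S V W \<Longrightarrow> local_frame M D S W V"
  by (auto simp: local_frame_def insert_commute)

lemma frame_add:
  assumes "local_frame M D S V W" shows "local_frame M D S V (\<lambda>q. V q + W q)"
proof -
  have S: "opn S" and V: "smooth_vf_on M S V" "smooth_vf_on M S W" using assms by (auto simp: local_frame_def)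
  have "span {v, v + w} = span {v, w}" for v w :: "'a tvec"
  proof (intro equalityI span_minimal)
    show "{v, v + w} \<subseteq> span {v, w}" by (auto intro!: span_add intro: span_base)
    have "v + w - v \<in> span {v, v + w}" by (intro span_diff span_base) auto
    then show "{v, w} \<subseteq> span {v, v + w}" by (auto intro: span_base)
  qed auto
  moreover have "smooth_vf_on M S (\<lambda>q. V q + W q)"
    using V subspace_add[OF subspace_T] smooth_on_add[OF S] by (auto simp: smooth_vf_on_def)
  ultimately show ?thesis using assms by (auto simp: local_frame_def)
qed

text \<open>The lines spanned by V, W and V + W are distinct, so two given lines leave one of them
  free, and the frame is changed to make that one the missing line. A single chart then contains two
  prescribed points of a fibre.\<close>

lemma frame_avoiding:
  assumes "q \<in> points M"
  obtains S V W where "q \<in> S" "local_frame M D S V W" "l1 \<noteq> span {W q}" "l2 \<noteq> span {W q}"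
proof -
  obtain S V W where S: "q \<in> S" and fr: "local_frame M D S V W"
    using rank2 assms unfolding rank2_distribution_def by blast
  have d: "dim (span {V q, W q}) = 2" "dim (span {W q, V q}) = 2"
    using local_frameD(2)[OF fr S] by (simp_all add: insert_commute)
  have gen: "(l1 \<noteq> b \<and> l2 \<noteq> b) \<or> (l1 \<noteq> a \<and> l2 \<noteq> a) \<or> (l1 \<noteq> c \<and> l2 \<noteq> c)"
    if "a \<noteq> b" "c \<noteq> b" "c \<noteq> a" for a b c :: "'a tvec set" using that by auto
  have "span {V q} \<noteq> span {W q}" "span {V q + W q} \<noteq> span {W q}" "span {V q + W q} \<noteq> span {V q}"
    using line_not_second[OF d(1), of 1 0] line_not_second[OF d(1), of 1 1] line_not_second[OF d(2), of 1 1]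
    by (simp_all add: add.commute)
  then consider "l1 \<noteq> span {W q}" "l2 \<noteq> span {W q}" | "l1 \<noteq> span {V q}" "l2 \<noteq> span {V q}"
    | "l1 \<noteq> span {V q + W q}" "l2 \<noteq> span {V q + W q}"
    using gen by blast
  then show ?thesis
    using that[OF S fr] that[OF S frame_swap[OF fr]] that[OF S frame_add[OF fr]] by cases auto
qed

text \<open>Points over different base points are separated downstairs. Two points of one fibre
  share a chart by \<open>frame_avoiding\<close> and are separated by their coordinates.\<close>

lemma hausdorff_N: "Hausdorff_space (mtop N)"
  unfolding Hausdorff_space_def PN.topspace_mtop
proof (intro allI impI, elim conjE)
  fix x y assume x: "x \<in> points N" and y: "y \<in> points N" and xy: "x \<noteq> y"
  show "\<exists>A B. PN.opn A \<and> PN.opn B \<and> x \<in> A \<and> y \<in> B \<and> disjnt A B"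
  proof (cases "\<pi> x = \<pi> y")
    case False
    then obtain A B where AB: "opn A" "opn B" "\<pi> x \<in> A" "\<pi> y \<in> B" "disjnt A B"
      using hausdorff pt_props(1)[OF x] pt_props(1)[OF y] unfolding Hausdorff_space_def topspace_mtop by blast
    show ?thesis
      by (rule exI[of _ "{x \<in> points N. \<pi> x \<in> A}"], rule exI[of _ "{x \<in> points N. \<pi> x \<in> B}"])
        (use AB x y opn_pullback in \<open>auto simp: disjnt_def\<close>)
  next
    case True
    obtain S V W where S: "\<pi> x \<in> S" and fr: "local_frame M D S V W"
      and l: "lin x \<noteq> span {W (\<pi> x)}" "lin y \<noteq> span {W (\<pi> x)}"
      by (rule frame_avoiding[OF pt_props(1)[OF x], of "lin x" "lin y"])
    obtain U \<phi> where U: "(U, \<phi>) \<in> atlas M" "\<pi> x \<in> U" using point_chart pt_props(1)[OF x] by blast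
    have d: "x \<in> dm U S V W" "y \<in> dm U S V W"
      unfolding dm_iff[OF fr] using x y l U S True by auto
    have "cr \<phi> V W x \<noteq> cr \<phi> V W y" using inj_onD[OF cr_inj[OF U(1) fr] _ d] xy by blast
    then obtain A B where AB: "open A" "open B" "cr \<phi> V W x \<in> A" "cr \<phi> V W y \<in> B" "A \<inter> B = {}"
      by (metis t2_space_class.hausdorff)
    let ?E = "{x :: nat \<Rightarrow> real. \<forall>i\<ge>mdim N. x i = 0}"
    have o: "openin (Euclidean_space (mdim N)) (?E \<inter> C)" if "open C" for C
      using that unfolding Euclidean_space_eq by (rule openin_open_Int)
    note at = atlas_mem[OF U(1) fr]
    have z: "cr \<phi> V W x \<in> ?E" "cr \<phi> V W y \<in> ?E" using PN.chart_zero[OF at] d by auto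
    show ?thesis
      by (rule exI[of _ "{z \<in> dm U S V W. cr \<phi> V W z \<in> ?E \<inter> A}"],
          rule exI[of _ "{z \<in> dm U S V W. cr \<phi> V W z \<in> ?E \<inter> B}"])
        (use PN.opn_chart_preimage[OF at o[OF AB(1)]] PN.opn_chart_preimage[OF at o[OF AB(2)]] AB z d
          in \<open>auto simp: disjnt_def\<close>)
  qed
qed

text \<open>A second countable space is Lindelof, so countably many pairs of a chart and a frame
  domain cover the base.\<close>

lemma countable_trivialisation:
  obtains C where "countable C" "\<And>U \<phi> S V W. (U, \<phi>, S, V, W) \<in> C \<Longrightarrow> (U, \<phi>) \<in> atlas M \<and> local_frame M D S V W"
    "points M \<subseteq> (\<Union>(U, \<phi>, S, V, W)\<in>C. U \<inter> S)"
proof -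
  let ?I = "{(U, \<phi>, S, V, W). (U, \<phi>) \<in> atlas M \<and> local_frame M D S V W}"
  let ?f = "\<lambda>(U, \<phi> :: 'a \<Rightarrow> nat \<Rightarrow> real, S, V :: 'a \<Rightarrow> 'a tvec, W :: 'a \<Rightarrow> 'a tvec). U \<inter> S"
  have "Lindelof_space (mtop M)" by (rule second_countable_imp_Lindelof_space[OF sec_countable])
  moreover have "\<forall>A\<in>?f ` ?I. opn A" using opn_chart opn_frame by auto
  moreover have "\<Union> (?f ` ?I) = topspace (mtop M)"
  proof (intro equalityI subsetI)
    fix q assume "q \<in> topspace (mtop M)"
    then have q: "q \<in> points M" by simp
    obtain U \<phi> where "(U, \<phi>) \<in> atlas M" "q \<in> U" using point_chart[OF q] by blast
    moreover obtain S V W where "q \<in> S" "local_frame M D S V W"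
      using rank2 q unfolding rank2_distribution_def by blast
    ultimately show "q \<in> \<Union> (?f ` ?I)" by (auto intro!: bexI[of _ "(U, \<phi>, S, V, W)"])
  next
    fix q assume "q \<in> \<Union> (?f ` ?I)"
    then show "q \<in> topspace (mtop M)" using opn_sub[OF opn_frame] by auto
  qed
  ultimately obtain \<V> where V: "countable \<V>" "\<V> \<subseteq> ?f ` ?I" "\<Union>\<V> = topspace (mtop M)"
    unfolding Lindelof_space_def by meson
  then obtain C where C: "countable C" "C \<subseteq> ?I" "\<V> = ?f ` C"
    using countable_subset_image[of \<V> ?f ?I] by auto
  show ?thesis by (rule that[OF C(1)]) (use C V in auto)
qed

text \<open>Over each of the countably many trivialising sets the two orders of the frame give two
  charts covering all lines. Preimages of a countable base of sequence space under these charts form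
  a countable base.\<close>

lemma second_countable_N: "second_countable (mtop N)"
proof -
  obtain C where C: "countable C" "\<And>U \<phi> S V W. (U, \<phi>, S, V, W) \<in> C \<Longrightarrow> (U, \<phi>) \<in> atlas M \<and> local_frame M D S V W"
    "points M \<subseteq> (\<Union>(U, \<phi>, S, V, W)\<in>C. U \<inter> S)"
    by (rule countable_trivialisation) blast
  obtain \<B> :: "(nat \<Rightarrow> real) set set" where \<B>: "countable \<B>" "\<And>B. B \<in> \<B> \<Longrightarrow> open B"
    "\<And>S. open S \<Longrightarrow> \<exists>U. U \<subseteq> \<B> \<and> S = \<Union>U"
    using univ_second_countable by metis
  let ?E = "{x :: nat \<Rightarrow> real. \<forall>i\<ge>mdim N. x i = 0}"
  define C2 where "C2 = (\<lambda>(U, \<phi>, S, V, W). (dm U S V W, cr \<phi> V W)) ` C \<union> (\<lambda>(U, \<phi>, S, V, W). (dm U S W V, cr \<phi> W V)) ` C"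
  have "countable C2" using C(1) by (simp add: C2_def)
  moreover have "C2 \<subseteq> atlas N"
  proof
    fix z assume "z \<in> C2"
    then obtain U \<phi> S V W where c: "(U, \<phi>, S, V, W) \<in> C"
      and z: "z = (dm U S V W, cr \<phi> V W) \<or> z = (dm U S W V, cr \<phi> W V)"
      unfolding C2_def by auto
    then show "z \<in> atlas N" using C(2)[OF c] atlas_mem frame_swap by metis
  qed
  ultimately have C2: "countable C2" "C2 \<subseteq> atlas N" by auto
  have cover: "\<exists>G g. (G, g) \<in> C2 \<and> x \<in> G" if x: "x \<in> points N" for x
  proof -
    obtain U \<phi> S V W where c: "(U, \<phi>, S, V, W) \<in> C" "\<pi> x \<in> U" "\<pi> x \<in> S" using C(3) pt_props(1)[OF x] by auto
    have fr: "local_frame M D S V W" using C(2)[OF c(1)] by simp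
    have "span {1 *\<^sub>R V (\<pi> x) + 0 *\<^sub>R W (\<pi> x)} \<noteq> span {W (\<pi> x)}"
      using line_not_second[OF local_frameD(2)[OF fr c(3)]] by blast
    then have "lin x \<noteq> span {W (\<pi> x)} \<or> lin x \<noteq> span {V (\<pi> x)}" by auto
    then have "x \<in> dm U S V W \<or> x \<in> dm U S W V"
      unfolding dm_iff[OF fr] dm_iff[OF frame_swap[OF fr]] using x c by auto
    moreover have "(dm U S V W, cr \<phi> V W) \<in> C2"
      unfolding C2_def by (rule UnI1, rule image_eqI[OF _ c(1)]) simp
    moreover have "(dm U S W V, cr \<phi> W V) \<in> C2"
      unfolding C2_def by (rule UnI2, rule image_eqI[OF _ c(1)]) simp
    ultimately show ?thesis by blast
  qed
  define base where "base = (\<lambda>((G, g), B). {x \<in> G. g x \<in> ?E \<inter> B}) ` (C2 \<times> \<B>)"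
  have "countable base" unfolding base_def using C2 \<B> by auto
  moreover have "PN.opn X" if X: "X \<in> base" for X
  proof -
    obtain G g B where b: "(G, g) \<in> C2" "B \<in> \<B>" "X = {x \<in> G. g x \<in> ?E \<inter> B}" using X by (auto simp: base_def)
    have "openin (Euclidean_space (mdim N)) (?E \<inter> B)"
      using \<B>(2)[OF b(2)] unfolding Euclidean_space_eq by (rule openin_open_Int)
    then show ?thesis unfolding b(3) by (rule PN.opn_chart_preimage[OF subsetD[OF C2(2) b(1)]])
  qed
  moreover have "\<exists>X\<in>base. x \<in> X \<and> X \<subseteq> A" if A: "PN.opn A" and x: "x \<in> A" for A x
  proof -
    have "x \<in> points N" using PN.opn_sub[OF A] x by auto
    then obtain G g where g: "(G, g) \<in> C2" "x \<in> G" using cover by blast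
    note at = subsetD[OF C2(2) g(1)]
    have "openin (Euclidean_space (mdim N)) (g ` (A \<inter> G))" by (rule PN.opn_image[OF A at])
    then obtain R where R: "open R" "g ` (A \<inter> G) = ?E \<inter> R" unfolding Euclidean_space_eq openin_open by auto
    obtain \<U> where U: "\<U> \<subseteq> \<B>" "R = \<Union>\<U>" using \<B>(3)[OF R(1)] by blast
    have gx: "g x \<in> ?E" "g x \<in> R" using R(2) x g by auto
    then obtain B where B: "B \<in> \<B>" "g x \<in> B" "B \<subseteq> R" using U by auto
    have s1: "{x \<in> G. g x \<in> ?E \<inter> B} \<subseteq> A"
    proof
      fix z assume z: "z \<in> {x \<in> G. g x \<in> ?E \<inter> B}"
      then have "g z \<in> g ` (A \<inter> G)" using R(2) B(3) by auto
      then show "z \<in> A" using z inj_onD[OF PN.chart_inj[OF at]] by blast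
    qed
    have s2: "{x \<in> G. g x \<in> ?E \<inter> B} \<in> base" unfolding base_def
      by (rule image_eqI[of _ _ "((G, g), B)"]) (use g(1) B(1) in simp_all)
    have s3: "x \<in> {x \<in> G. g x \<in> ?E \<inter> B}" using gx(1) B(2) g(2) by simp
    show ?thesis by (intro bexI[of _ "{x \<in> G. g x \<in> ?E \<inter> B}"] conjI s1 s2 s3)
  qed
  ultimately show ?thesis unfolding second_countable_def
    by (intro exI[of _ base] conjI ballI allI impI) (assumption | erule conjE | rule)+
qed

end

sublocale prolongation \<subseteq> MN: manifold N
  by unfold_locales (rule hausdorff_N second_countable_N)+

lemma (in manifold) coords_frame:
  assumes U: "(U, \<phi>) \<in> atlas M" "q \<in> U" and S: "opn S" "q \<in> S"
  obtains W X P where "opn W" "q \<in> W" "W \<subseteq> U \<inter> S" "\<And>i. i < n \<Longrightarrow> smooth_fun M (X i)"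
    "\<And>i x. x \<in> W \<Longrightarrow> X i x = \<phi> x i" "\<And>i. i < n \<Longrightarrow> vf (P i)"
    "\<And>i x. x \<in> W \<Longrightarrow> P i x = cpart U \<phi> x i"
proof -
  obtain X W1 where X: "opn W1" "q \<in> W1" "W1 \<subseteq> U \<inter> S" "\<And>i. i < n \<Longrightarrow> smooth_fun M (X i)"
    "\<And>i x. x \<in> W1 \<Longrightarrow> X i x = \<phi> x i"
    by (rule coords_extend[OF U S]) blast
  obtain P W2 where P: "\<And>i. i \<in> {..<n} \<Longrightarrow> vf (P i)" "opn W2" "q \<in> W2" "W2 \<subseteq> U"
    "\<And>i x. x \<in> W2 \<Longrightarrow> P i x = cpart U \<phi> x i"
    by (rule globalize_family[of "{..<n}" U "\<lambda>i x. cpart U \<phi> x i" q, OF _ opn_chart[OF U(1)] U(2)])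
      (use cpart_smooth[OF U(1)] in auto)
  show ?thesis
    by (rule that[of "W1 \<inter> W2" X P]) (use X P in auto)
qed

section \<open>Coordinate lifts and a frame of the lifted distribution\<close>

context prolongation
begin

lemma smooth_pull: "smooth_fun M f \<Longrightarrow> smooth_fun N (\<lambda>x. f (\<pi> x))"
proof -
  have "{x \<in> points N. \<pi> x \<in> points M} = points N" using pt_props(1) by auto
  then show "smooth_fun M f \<Longrightarrow> smooth_fun N (\<lambda>x. f (\<pi> x))" using smooth_pullback[OF opn_points] by simp
qed

lemma has_pd_pull:
  assumes U: "(U, \<phi>) \<in> atlas M" and fr: "local_frame M D S V W" and x: "x \<in> dm U S V W"
    and f: "smooth_fun M f"
  shows "i < n \<Longrightarrow> has_pd i (\<lambda>y. f (\<pi> (inv_into (dm U S V W) (cr \<phi> V W) y))) (cr \<phi> V W x)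
      (partial i (\<lambda>x. f (inv_into U \<phi> x)) (\<phi> (\<pi> x)))"
    "has_pd n (\<lambda>y. f (\<pi> (inv_into (dm U S V W) (cr \<phi> V W) y))) (cr \<phi> V W x) 0"
proof -
  let ?C = "cyl n (\<phi> ` (U \<inter> S))" and ?y = "cr \<phi> V W x" and ?g = "\<lambda>x. f (inv_into U \<phi> x)"
  have pU: "\<pi> x \<in> U" using x by (auto simp: dm_def)
  have C: "openin (Euclidean_space (Suc n)) ?C"
    using PN.chart_open[OF atlas_mem[OF U fr]] cr_image_dm[OF U fr] mdimN by simp
  have y: "?y \<in> ?C" using cr_image_dm[OF U fr] x by auto
  have eq: "f (\<pi> (inv_into (dm U S V W) (cr \<phi> V W) z)) = ?g (z(n := 0))" if "z \<in> ?C" for z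
    using cr_inv(2)[OF U fr that] by simp
  have y0: "?y(n := 0) = \<phi> (\<pi> x)" by (rule cr_zero[OF U x])
  show "has_pd i (\<lambda>y. f (\<pi> (inv_into (dm U S V W) (cr \<phi> V W) y))) ?y (partial i ?g (\<phi> (\<pi> x)))"
    if i: "i < n"
  proof -
    have "has_pd i (\<lambda>z. ?g (z(n := 0))) ?y (partial i ?g (\<phi> (\<pi> x)))"
    proof -
      have "(?y(i := t))(n := 0) = (\<phi> (\<pi> x))(i := t)" for t
        using i y0 by (metis fun_upd_twist nat_neq_iff)
      moreover have "?y i = \<phi> (\<pi> x) i" using i y0 by (metis fun_upd_other nat_neq_iff)
      ultimately show ?thesis using chart_has_pd[OF U pU i f] by (simp add: has_pd_def)
    qed
    then show ?thesis by (subst has_pd_cong[OF C y, of _ _ "\<lambda>z. ?g (z(n := 0))"]) (use i eq in auto)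
  qed
  have "has_pd n (\<lambda>z. ?g (z(n := 0))) ?y 0" by (simp add: has_pd_def)
  then show "has_pd n (\<lambda>y. f (\<pi> (inv_into (dm U S V W) (cr \<phi> V W) y))) ?y 0"
    by (subst has_pd_cong[OF C y, of _ _ "\<lambda>z. ?g (z(n := 0))"]) (use eq in auto)
qed

text \<open>Packages what is needed of the product coordinates, so that later computations never
  mention charts. The hypothesis on \<open>x0\<close> puts this point in the domain of the chart
  given by the frame \<open>V\<close>, \<open>W\<close>.\<close>

lemma lift_exists:
  assumes V: "vf V" "vf W" and S: "opn S" and fr: "\<And>p. p \<in> S \<Longrightarrow> D p = span {V p, W p}"
    "\<And>p. p \<in> S \<Longrightarrow> dim (D p) = 2"
    and x0: "x0 \<in> points N" "\<pi> x0 \<in> S" "lin x0 \<noteq> span {W (\<pi> x0)}"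
  obtains O' s T' L where "PN.opn O'" "x0 \<in> O'" "\<And>x. x \<in> O' \<Longrightarrow> \<pi> x \<in> S" "smooth_fun N s" "MN.vf T'"
    "\<And>F. vf F \<Longrightarrow> MN.vf (L F)"
    "\<And>x f. x \<in> O' \<Longrightarrow> smooth_fun M f \<Longrightarrow> T' x (\<lambda>z. f (\<pi> z)) = 0" "\<And>x. x \<in> O' \<Longrightarrow> T' x s = 1"
    "\<And>x F f. x \<in> O' \<Longrightarrow> vf F \<Longrightarrow> smooth_fun M f \<Longrightarrow> L F x (\<lambda>z. f (\<pi> z)) = F (\<pi> x) f"
    "\<And>x F. x \<in> O' \<Longrightarrow> vf F \<Longrightarrow> L F x s = 0"
    "\<And>x v v'. x \<in> O' \<Longrightarrow> v \<in> MN.T x \<Longrightarrow> v' \<in> MN.T x \<Longrightarrow> v s = v' s \<Longrightarrow>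
      (\<And>f. smooth_fun M f \<Longrightarrow> v (\<lambda>z. f (\<pi> z)) = v' (\<lambda>z. f (\<pi> z))) \<Longrightarrow> v = v'"
    "\<And>x. x \<in> O' \<Longrightarrow> lin x = span {V (\<pi> x) + s x *\<^sub>R W (\<pi> x)}"
proof -
  have lf: "local_frame M D S V W"
    using V S fr vf_restrict unfolding local_frame_def by blast
  obtain U \<phi> where U: "(U, \<phi>) \<in> atlas M" "\<pi> x0 \<in> U" using point_chart pt_props(1)[OF x0(1)] by blast
  obtain X Wm where X: "opn Wm" "\<pi> x0 \<in> Wm" "Wm \<subseteq> U \<inter> S" "\<And>i. i < n \<Longrightarrow> smooth_fun M (X i)"
    "\<And>i x. x \<in> Wm \<Longrightarrow> X i x = \<phi> x i"
    by (rule coords_extend[OF U S x0(2)]) blast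
  let ?d = "dm U S V W" and ?c = "cr \<phi> V W"
  note at = atlas_mem[OF U(1) lf]
  have xd: "x0 \<in> ?d" unfolding dm_iff[OF lf] using x0 U by blast
  obtain O' Y P where O': "PN.opn O'" "x0 \<in> O'" "O' \<subseteq> ?d \<inter> {x \<in> points N. \<pi> x \<in> Wm}"
    and Y: "\<And>i. i < mdim N \<Longrightarrow> smooth_fun N (Y i)" "\<And>i x. x \<in> O' \<Longrightarrow> Y i x = ?c x i"
    and P: "\<And>i. i < mdim N \<Longrightarrow> MN.vf (P i)" "\<And>i x. x \<in> O' \<Longrightarrow> P i x = MN.cpart ?d ?c x i"
    by (rule MN.coords_frame[OF at xd opn_pullback[OF X(1)]]) (use x0 X in auto)
  \<comment> \<open>The horizontal lift: it has the coordinates of \<open>F\<close> along the base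
    and no component along the fibre coordinate. Its coefficients are pulled back from
    \<open>M\<close>, hence constant on fibres.\<close>
  define L where "L = (\<lambda>F x. \<Sum>i<n. F (\<pi> x) (X i) *\<^sub>R P i x)"
  let ?s = "Y n"
  have cpull: "MN.cpart ?d ?c x i (\<lambda>z. f (\<pi> z)) = (if i < n then cpart U \<phi> (\<pi> x) i f else 0)"
    if "x \<in> O'" "smooth_fun M f" "i < Suc n" for x f i
  proof -
    have xd: "x \<in> ?d" using that O' by auto
    have "partial i (\<lambda>y. f (\<pi> (inv_into ?d ?c y))) (?c x) =
        (if i < n then partial i (\<lambda>x. f (inv_into U \<phi> x)) (\<phi> (\<pi> x)) else 0)"
      using has_pd_pull[OF U(1) lf xd that(2), THEN partial_eq] that(3) by (auto simp: less_Suc_eq)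
    then show ?thesis using smooth_pull[OF that(2)] that(2) by (simp add: MN.cpart_def cpart_def)
  qed
  have cs: "MN.cpart ?d ?c x i ?s = (if i = n then 1 else 0)" if "x \<in> O'" "i < Suc n" for x i
    by (rule MN.cpart_coord[OF at _ _ O'(1)]) (use that O' Y mdimN in auto)
  show ?thesis
  proof (rule that[of O' ?s "P n" L])
    show "PN.opn O'" "x0 \<in> O'" by (rule O')+
    show "\<pi> x \<in> S" if "x \<in> O'" for x using that O' by (auto simp: dm_def)
    show "smooth_fun N ?s" "MN.vf (P n)" using Y(1) P(1) mdimN by auto
    show "MN.vf (L F)" if "vf F" for F
      unfolding L_def
      by (rule MN.vf_comb) (use smooth_pull[OF vf_smooth[OF that X(4)]] P(1) mdimN in auto)
    show "P n x (\<lambda>z. f (\<pi> z)) = 0" if "x \<in> O'" "smooth_fun M f" for x f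
      using cpull[OF that, of n] P(2)[OF that(1)] by simp
    show "P n x ?s = 1" if "x \<in> O'" for x using cs[OF that, of n] P(2)[OF that] by simp
    show "L F x (\<lambda>z. f (\<pi> z)) = F (\<pi> x) f" if x: "x \<in> O'" and F: "vf F" and f: "smooth_fun M f" for x F f
    proof -
      have p: "\<pi> x \<in> Wm" "\<pi> x \<in> U" "\<pi> x \<in> points M" using x O' U by (auto simp: dm_def points_def)
      have "L F x (\<lambda>z. f (\<pi> z)) = (\<Sum>i<n. F (\<pi> x) (X i) * cpart U \<phi> (\<pi> x) i f)"
        using cpull[OF x f] P(2)[OF x] by (simp add: L_def sum_apply)
      also have "\<dots> = (\<Sum>i<n. F (\<pi> x) (X i) *\<^sub>R cpart U \<phi> (\<pi> x) i) f" by (simp add: sum_apply)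
      also have "(\<Sum>i<n. F (\<pi> x) (X i) *\<^sub>R cpart U \<phi> (\<pi> x) i) = F (\<pi> x)"
        by (rule tv_expand[OF vf_T[OF F p(3)] U(1) p(2) X(1) p(1) _ X(4,5), symmetric]) (use X in auto)
      finally show ?thesis .
    qed
    show "L F x ?s = 0" if "x \<in> O'" for x F
      using cs[OF that] P(2)[OF that] by (simp add: L_def sum_apply)
    show "v = v'" if x: "x \<in> O'" and v: "v \<in> MN.T x" "v' \<in> MN.T x" "v ?s = v' ?s"
      "\<And>f. smooth_fun M f \<Longrightarrow> v (\<lambda>z. f (\<pi> z)) = v' (\<lambda>z. f (\<pi> z))" for x v v'
    proof -
      \<comment> \<open>A full set of coordinate functions on \<open>N\<close>: those pulled back
        from \<open>M\<close>, and the fibre coordinate. A tangent vector is determined by its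
        values on them.\<close>
      define Z where "Z = (\<lambda>i. if i < n then (\<lambda>z. X i (\<pi> z)) else ?s)"
      have Z: "smooth_fun N (Z i)" if "i < mdim N" for i
        using that smooth_pull[OF X(4)] Y(1) mdimN by (auto simp: Z_def)
      have Z2: "Z i z = ?c z i" if "i < mdim N" "z \<in> O'" for i z
      proof (cases "i < n")
        case True
        have "\<pi> z \<in> Wm" using that O' by auto
        then show ?thesis using True X(5) by (simp add: Z_def cr_def)
      next
        case False
        then have "i = n" using that mdimN by simp
        then show ?thesis using Y(2)[OF that(2)] by (simp add: Z_def)
      qed
      have xd: "x \<in> ?d" "O' \<subseteq> ?d" using x O' by auto
      have "v (Z i) = v' (Z i)" if "i < mdim N" for i using v(3) v(4)[OF X(4)] by (auto simp: Z_def)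
      moreover have "v = (\<Sum>i<mdim N. v (Z i) *\<^sub>R MN.cpart ?d ?c x i)"
        by (rule MN.tv_expand[OF v(1) at xd(1) O'(1) x xd(2) Z Z2])
      moreover have "v' = (\<Sum>i<mdim N. v' (Z i) *\<^sub>R MN.cpart ?d ?c x i)"
        by (rule MN.tv_expand[OF v(2) at xd(1) O'(1) x xd(2) Z Z2])
      moreover have "(\<Sum>i<mdim N. v (Z i) *\<^sub>R MN.cpart ?d ?c x i) = (\<Sum>i<mdim N. v' (Z i) *\<^sub>R MN.cpart ?d ?c x i)"
        using calculation(1) by (intro sum.cong) auto
      ultimately show "v = v'" by argo
    qed
    show "lin x = span {V (\<pi> x) + ?s x *\<^sub>R W (\<pi> x)}" if "x \<in> O'" for x
      using tc_line[OF lf, of x U] that O' Y(2)[OF that, of n] by (auto simp: cr_def)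
  qed
qed

text \<open>The prolonged distribution described on the copy \<open>N\<close>, with
  \<open>\<pi>\<close> and \<open>lin\<close> in place of the projections of pairs.\<close>

definition lifted :: "'a \<Rightarrow> 'a tvec set" where
  "lifted x = {v \<in> MN.T x. pushforward M \<pi> v \<in> lin x}"

lemma subspace_lifted: "x \<in> points N \<Longrightarrow> subspace (lifted x)"
proof (rule subspaceI)
  assume x: "x \<in> points N"
  have *: "pushforward M \<pi> (v + w) = pushforward M \<pi> v + pushforward M \<pi> w"
    "pushforward M \<pi> (c *\<^sub>R v) = c *\<^sub>R pushforward M \<pi> v" "pushforward M \<pi> 0 = 0" for v w c
    by (auto simp: pushforward_def fun_eq_iff)
  note s = pt_props(3)[OF x]
  show "0 \<in> lifted x" using subspace_0[OF s] subspace_0[OF MN.subspace_T] by (simp add: lifted_def *)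
  show "v + w \<in> lifted x" if "v \<in> lifted x" "w \<in> lifted x" for v w
    using that subspace_add[OF s] subspace_add[OF MN.subspace_T] by (simp add: lifted_def *)
  show "c *\<^sub>R v \<in> lifted x" if "v \<in> lifted x" for c v
    using that subspace_scale[OF s] subspace_scale[OF MN.subspace_T] by (simp add: lifted_def *)
qed

text \<open>The two coefficients of a lifted vector can be read off: that of \<open>A\<close> from
  its pushforward, a multiple of the generator of the line, and that of \<open>B\<close>, which is
  vertical, from its value on \<open>s\<close>.\<close>

lemma lifted_span:
  assumes x: "x \<in> points N" and V: "V \<in> T (\<pi> x)" "W \<in> T (\<pi> x)"
    and A: "A \<in> MN.T x" "\<And>f. smooth_fun M f \<Longrightarrow> A (\<lambda>z. f (\<pi> z)) = V f + c * W f" "A s = 0"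
    and B: "B \<in> MN.T x" "\<And>f. smooth_fun M f \<Longrightarrow> B (\<lambda>z. f (\<pi> z)) = 0" "B s = 1"
    and det: "\<And>v v'. v \<in> MN.T x \<Longrightarrow> v' \<in> MN.T x \<Longrightarrow> v s = v' s \<Longrightarrow>
      (\<And>f. smooth_fun M f \<Longrightarrow> v (\<lambda>z. f (\<pi> z)) = v' (\<lambda>z. f (\<pi> z))) \<Longrightarrow> v = v'"
    and l: "lin x = span {V + c *\<^sub>R W}"
  shows "lifted x = span {A, B}" "dim (span {A, B}) = 2"
proof -
  let ?u = "V + c *\<^sub>R W"
  have u: "?u \<in> T (\<pi> x)" using V subspace_T by (simp add: subspace_add subspace_scale)
  have pA: "pushforward M \<pi> A = ?u"
    using A(2) tv_nonsmooth[OF u] by (auto simp: pushforward_def fun_eq_iff comp_def)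
  have pB: "pushforward M \<pi> B = 0"
    using B(2) by (auto simp: pushforward_def fun_eq_iff comp_def)
  have "A \<in> lifted x" using A(1) pA l by (simp add: lifted_def span_base)
  moreover have "B \<in> lifted x" using B(1) pB l by (simp add: lifted_def span_0)
  ultimately have "span {A, B} \<subseteq> lifted x" by (intro span_minimal subspace_lifted[OF x]) auto
  moreover have "v \<in> span {A, B}" if v: "v \<in> lifted x" for v
  proof -
    have "pushforward M \<pi> v \<in> span {?u}" using v l by (simp add: lifted_def)
    then obtain k where k: "pushforward M \<pi> v = k *\<^sub>R ?u" by (auto simp: span_singleton)
    have "v = k *\<^sub>R A + v s *\<^sub>R B"
    proof (rule det)
      show "v \<in> MN.T x" using v by (simp add: lifted_def)
      show "k *\<^sub>R A + v s *\<^sub>R B \<in> MN.T x"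
        by (intro subspace_add[OF MN.subspace_T] subspace_scale[OF MN.subspace_T] A B)
      show "v s = (k *\<^sub>R A + v s *\<^sub>R B) s" using A(3) B(3) by simp
      fix f assume f: "smooth_fun M f"
      have "v (\<lambda>z. f (\<pi> z)) = k * (V f + c * W f)"
        using fun_cong[OF k, of f] f by (simp add: pushforward_def comp_def)
      then show "v (\<lambda>z. f (\<pi> z)) = (k *\<^sub>R A + v s *\<^sub>R B) (\<lambda>z. f (\<pi> z))"
        using A(2)[OF f] B(2)[OF f] by simp
    qed
    then show ?thesis unfolding pair_span by blast
  qed
  ultimately show "lifted x = span {A, B}" by blast
  have u0: "?u \<noteq> 0"
  proof
    assume "?u = 0"
    then have "lin x = {0}" using l by simp
    moreover have "dim ({0} :: 'a tvec set) \<le> card ({} :: 'a tvec set)" by (rule dim_le_card) auto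
    ultimately show False using pt_props(4)[OF x] by simp
  qed
  show "dim (span {A, B}) = 2"
    unfolding fam_indep_two fam_indep_def
  proof (intro allI impI)
    fix k assume "(\<Sum>i\<in>UNIV. k i *\<^sub>R (if i then A else B)) = 0"
    then have z: "k False *\<^sub>R B + k True *\<^sub>R A = 0" by (simp add: UNIV_bool)
    from fun_cong[OF z, of s] have kF: "k False = 0" using A(3) B(3) by simp
    have "k True *\<^sub>R ?u = 0"
    proof
      fix f
      show "(k True *\<^sub>R ?u) f = 0 f"
      proof (cases "smooth_fun M f")
        case True
        then show ?thesis using fun_cong[OF z, of "\<lambda>z. f (\<pi> z)"] kF A(2) by simp
      next
        case False
        then show ?thesis using tv_nonsmooth[OF u] by simp
      qed
    qed
    then have "k True = 0" using u0 by simp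
    then show "\<forall>i\<in>UNIV. k i = 0" using kF by (auto simp: UNIV_bool)
  qed
qed

end

lemma collect5_cong:
  "(\<And>a b c d e. P a b c d e \<Longrightarrow> F a b c d e = G a b c d e) \<Longrightarrow>
    {F a b c d e | a b c d e. P a b c d e} = {G a b c d e | a b c d e. P a b c d e}"
  by (intro Collect_cong ex_cong1) auto

text \<open>\<open>cartan_prolongation\<close> copies the bundle along an arbitrarily chosen
  injection. The copy satisfies the locale \<open>prolongation\<close>, after which the injection is
  forgotten. The bound on the dimension guarantees, through \<open>ex_inj_proj_bundle\<close>, that
  an injection exists.\<close>

lemma copy_cartan:
  assumes M: "smooth_manifold M" "mdim M \<ge> 1" and D: "rank2_distribution M D"
  obtains \<pi> lin where "prolongation M D (fst (cartan_prolongation (M, D))) \<pi> lin"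
    "\<And>x. x \<in> points (fst (cartan_prolongation (M, D))) \<Longrightarrow> snd (cartan_prolongation (M, D)) x =
      {v \<in> tangent_space (fst (cartan_prolongation (M, D))) x. pushforward M \<pi> v \<in> lin x}"
proof -
  let ?P = "proj_bundle M D"
  define h where "h = (SOME h :: 'a \<times> 'a tvec set \<Rightarrow> 'a. inj_on h (points ?P))"
  have h: "inj_on h (points ?P)" unfolding h_def using ex_inj_proj_bundle[OF M D] by (rule someI_ex)
  define N where "N = copy_mfd h ?P"
  define E where "E = copy_dist h ?P (lifted_dist M D)"
  have NE: "cartan_prolongation (M, D) = (N, E)"
    by (simp add: cartan_prolongation_def Let_def h_def N_def E_def)
  define z where "z = inv_into (points ?P) h"
  define \<pi> where "\<pi> = (\<lambda>x. fst (z x))"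
  define lin where "lin = (\<lambda>x. snd (z x))"
  have pN: "points N = h ` points ?P"
    by (auto simp: N_def copy_mfd_def points_def)
  have zh: "z (h p) = p" if "p \<in> points ?P" for p using h that by (simp add: z_def)
  have hz: "h (z x) = x" "z x \<in> points ?P" if "x \<in> points N" for x
    using that zh unfolding pN by auto
  have sub: "U \<subseteq> points ?P" if "(U, \<phi>) \<in> atlas ?P" for U \<phi> using that by (auto simp: points_def)
  have aN: "atlas N = {(h ` U, \<phi> \<circ> z) | U \<phi>. (U, \<phi>) \<in> atlas ?P}"
    by (simp add: N_def copy_mfd_def z_def)
  have prol: "prolongation M D N \<pi> lin"
  proof (intro prolongation.intro prolongation_axioms.intro)
    show "manifold M" using M by (simp add: manifold_iff)
    show "rank2_distribution M D" by fact
    show "bij_betw (\<lambda>x. (\<pi> x, lin x)) (points N)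
      {(q, l). q \<in> points M \<and> l \<subseteq> D q \<and> subspace l \<and> dim l = 1}"
      unfolding \<pi>_def lin_def prod.collapse points_proj_bundle[OF D, symmetric] pN z_def
      by (rule bij_betw_inv_into[OF inj_on_imp_bij_betw[OF h]])
    show "mdim N = Suc (mdim M)" by (simp add: N_def copy_mfd_def proj_bundle_def)
    let ?A = "\<lambda>U S V W. {(q, l). q \<in> U \<inter> S \<and> (\<exists>t. l = span {V q + t *\<^sub>R W q})}"
    let ?f = "\<lambda>\<phi> V W (q, l). (\<phi> q)(mdim M := (THE t. l = span {V q + t *\<^sub>R W q}))"
    have aP: "atlas ?P = {(?A U S V W, ?f \<phi> V W) | U \<phi> S V W. (U, \<phi>) \<in> atlas M \<and> local_frame M D S V W}"
      by (simp add: proj_bundle_def)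
    have 1: "h ` ?A U S V W = {x \<in> points N. \<pi> x \<in> U \<inter> S \<and> (\<exists>t. lin x = span {V (\<pi> x) + t *\<^sub>R W (\<pi> x)})}"
      if "(U, \<phi>) \<in> atlas M" "local_frame M D S V W" for U \<phi> S V W
    proof -
      have s: "?A U S V W \<subseteq> points ?P" by (rule sub[of _ "?f \<phi> V W"]) (use that aP in blast)
      show ?thesis
      proof (intro equalityI subsetI)
        fix x assume "x \<in> h ` ?A U S V W"
        then obtain p where p: "p \<in> ?A U S V W" "x = h p" by auto
        then have pP: "p \<in> points ?P" using s by blast
        then have "z x = p" "x \<in> points N" unfolding p(2) pN using zh[OF pP] by simp_all
        then show "x \<in> {x \<in> points N. \<pi> x \<in> U \<inter> S \<and> (\<exists>t. lin x = span {V (\<pi> x) + t *\<^sub>R W (\<pi> x)})}"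
          using p by (auto simp: \<pi>_def lin_def)
      next
        fix x assume x: "x \<in> {x \<in> points N. \<pi> x \<in> U \<inter> S \<and> (\<exists>t. lin x = span {V (\<pi> x) + t *\<^sub>R W (\<pi> x)})}"
        then have "z x \<in> ?A U S V W" by (auto simp: \<pi>_def lin_def split_beta)
        then show "x \<in> h ` ?A U S V W" using hz(1)[of x] x by (metis (no_types, lifting) image_eqI mem_Collect_eq)
      qed
    qed
    have 2: "?f \<phi> V W \<circ> z = (\<lambda>x. (\<phi> (\<pi> x))(mdim M := THE t. lin x = span {V (\<pi> x) + t *\<^sub>R W (\<pi> x)}))"
      for \<phi> :: "'a \<Rightarrow> nat \<Rightarrow> real" and V W
      by (simp add: fun_eq_iff \<pi>_def lin_def split_beta)
    have "atlas N = {(h ` ?A U S V W, ?f \<phi> V W \<circ> z) | U \<phi> S V W. (U, \<phi>) \<in> atlas M \<and> local_frame M D S V W}"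
      unfolding aN aP by blast
    also have "\<dots> = {({x \<in> points N. \<pi> x \<in> U \<inter> S \<and> (\<exists>t. lin x = span {V (\<pi> x) + t *\<^sub>R W (\<pi> x)})},
        \<lambda>x. (\<phi> (\<pi> x))(mdim M := THE t. lin x = span {V (\<pi> x) + t *\<^sub>R W (\<pi> x)})) | U \<phi> S V W.
      (U, \<phi>) \<in> atlas M \<and> local_frame M D S V W}"
      unfolding 2 by (rule collect5_cong, elim conjE, rule arg_cong2[of _ _ _ _ Pair, OF 1 refl])
    finally show "atlas N = \<dots>" .
  qed
  interpret prolongation M D N \<pi> lin by (rule prol)
  have C: "C_infinity (mdim N) ((\<phi> \<circ> z) ` h ` U) (\<lambda>y. f (inv_into (h ` U) (\<phi> \<circ> z) y)) \<longleftrightarrow>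
      C_infinity (mdim N) (\<phi> ` U) (\<lambda>y. f (h (inv_into U \<phi> y)))" if U: "(U, \<phi>) \<in> atlas ?P" for U \<phi> f
  proof -
    have at: "(h ` U, \<phi> \<circ> z) \<in> atlas N" using U aN by blast
    have im: "(\<phi> \<circ> z) ` h ` U = \<phi> ` U" 
      unfolding image_image comp_def by (rule image_cong[OF refl]) (simp only: zh[OF subsetD[OF sub[OF U]]])
    have "inv_into (h ` U) (\<phi> \<circ> z) y = h (inv_into U \<phi> y)" if y: "y \<in> \<phi> ` U" for y
    proof -
      have i: "inv_into U \<phi> y \<in> U" "\<phi> (inv_into U \<phi> y) = y"
        using inv_into_into[OF y] f_inv_into_f[OF y] by auto
      then have "(\<phi> \<circ> z) (h (inv_into U \<phi> y)) = y" using zh[OF subsetD[OF sub[OF U] i(1)]] by simp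
      then show ?thesis using PN.chart_inv[OF at, of "h (inv_into U \<phi> y)"] i by auto
    qed
    then show ?thesis
      using C_infinity_cong[OF PN.chart_open[OF at], of "\<lambda>y. f (inv_into (h ` U) (\<phi> \<circ> z) y)"
        "\<lambda>y. f (h (inv_into U \<phi> y))"] unfolding im by simp
  qed
  have sm: "smooth_fun N f \<longleftrightarrow> smooth_fun ?P (\<lambda>p. f (h p))" for f
  proof -
    have a: "points N \<inter> h ` U = h ` U" "points ?P \<inter> U = U" if "(U, \<phi>) \<in> atlas ?P" for U \<phi>
      using sub[OF that] pN by auto
    have m: "mdim N = mdim ?P" by (simp add: N_def copy_mfd_def)
    have "smooth_fun N f \<longleftrightarrow> (\<forall>(U, \<phi>)\<in>atlas ?P.
        C_infinity (mdim N) ((\<phi> \<circ> z) ` h ` U) (\<lambda>y. f (inv_into (h ` U) (\<phi> \<circ> z) y)))"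
      unfolding smooth_on_def aN using a by (auto 0 4)
    also have "\<dots> \<longleftrightarrow> smooth_fun ?P (\<lambda>p. f (h p))"
      unfolding smooth_on_def using C a m by (intro ball_cong refl) auto
    finally show ?thesis .
  qed
  have smz: "smooth_fun ?P g \<longleftrightarrow> smooth_fun N (\<lambda>x. g (z x))" for g
  proof -
    have "C_infinity (mdim N) (\<phi> ` U) (\<lambda>y. g (inv_into U \<phi> y)) \<longleftrightarrow>
        C_infinity (mdim N) (\<phi> ` U) (\<lambda>y. g (z (h (inv_into U \<phi> y))))" if U: "(U, \<phi>) \<in> atlas ?P" for U \<phi>
    proof -
      have at: "(h ` U, \<phi> \<circ> z) \<in> atlas N" using U aN by blast
      have im: "(\<phi> \<circ> z) ` h ` U = \<phi> ` U" 
      unfolding image_image comp_def by (rule image_cong[OF refl]) (simp only: zh[OF subsetD[OF sub[OF U]]])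
      show ?thesis
        by (rule C_infinity_cong[OF PN.chart_open[OF at, unfolded im]])
          (simp only: zh[OF subsetD[OF sub[OF U] inv_into_into]])
    qed
    moreover have "points ?P \<inter> U = U" if "(U, \<phi>) \<in> atlas ?P" for U \<phi> using sub[OF that] by auto
    moreover have "mdim N = mdim ?P" by (simp add: N_def copy_mfd_def)
    ultimately have "smooth_fun ?P g \<longleftrightarrow> smooth_fun ?P (\<lambda>p. g (z (h p)))"
      unfolding smooth_on_def by (intro ball_cong refl) auto
    then show ?thesis using sm[of "\<lambda>x. g (z x)"] by simp
  qed
  \<comment> \<open>Repeats for the original bundle the argument with the indicator of the
    complement. Its points have another type, and only the copy is known to be a manifold, so
    smoothness is transferred by \<open>smz\<close> and the Leibniz rule is applied by hand.\<close>
  have ign: "v f = v g" if v: "v \<in> tangent_space ?P p" and p: "p \<in> points ?P" and f: "smooth_fun ?P f"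
    and fg: "\<And>p. p \<in> points ?P \<Longrightarrow> f p = g p" for v p f g
  proof -
    have s: "smooth_fun ?P k" if "\<And>p. p \<in> points ?P \<Longrightarrow> k p = l p" "smooth_fun ?P l" for k l
      using that(2) smooth_on_cong PN.smooth_on_cong[OF PN.opn_points, of "\<lambda>x. k (z x)" "\<lambda>x. l (z x)"]
        that(1) hz(2) unfolding smz by auto
    have g: "smooth_fun ?P g" by (rule s[OF _ f]) (use fg in auto)
    let ?i = "\<lambda>p. if p \<in> points ?P then 0 else (1 :: real)" and ?d = "\<lambda>p. g p + - 1 * f p"
    have c0: "smooth_fun ?P (\<lambda>p. 0)" unfolding smz by (rule MN.sm_const)
    have i: "smooth_fun ?P ?i" by (rule s[OF _ c0]) auto
    have d: "smooth_fun ?P ?d" by (rule s[OF _ c0]) (use fg in auto)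
    have f1: "smooth_fun ?P (\<lambda>p. - 1 * f p)" using f unfolding smz by (rule MN.sm_cmult)
    have di: "(\<lambda>p. ?d p * ?i p) = ?d" using fg by auto
    have "v (\<lambda>p. ?d p * ?i p) = ?d p * v ?i + ?i p * v ?d"
      using v d i unfolding tangent_space_def by blast
    then have "v ?d = 0" using p fg unfolding di by simp
    moreover have "v ?d = v g + v (\<lambda>p. - 1 * f p)" using v g f1 unfolding tangent_space_def by blast
    moreover have "v (\<lambda>p. - 1 * f p) = - 1 * v f" using v f unfolding tangent_space_def by blast
    ultimately show ?thesis by simp
  qed
  have push: "pushforward N h v \<in> tangent_space N x \<and> pushforward M \<pi> (pushforward N h v) = pushforward M fst v"
    if v: "v \<in> tangent_space ?P (z x)" and x: "x \<in> points N" for v x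
  proof
    show "pushforward N h v \<in> tangent_space N x"
      using v hz(1)[OF x] by (simp add: tangent_space_def pushforward_def comp_def sm[symmetric]
        MN.sm_add MN.sm_mult MN.sm_cmult)
    show "pushforward M \<pi> (pushforward N h v) = pushforward M fst v"
    proof
      fix f
      show "pushforward M \<pi> (pushforward N h v) f = pushforward M fst v f"
      proof (cases "smooth_fun M f")
        case True
        have "smooth_fun ?P (\<lambda>p. f (\<pi> (h p)))"
          using smooth_pull[OF True] sm[of "\<lambda>x. f (\<pi> x)"] by simp
        from ign[OF v hz(2)[OF x] this] have "v (\<lambda>p. f (\<pi> (h p))) = v (\<lambda>p. f (fst p))"
          by (simp add: \<pi>_def zh)
        then show ?thesis using True smooth_pull[OF True] by (simp add: pushforward_def comp_def)
      qed (simp add: pushforward_def)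
    qed
  qed
  have ex: "\<exists>v\<in>tangent_space ?P (z x). pushforward N h v = w"
    if w: "w \<in> tangent_space N x" and x: "x \<in> points N" for w x
  proof
    let ?v = "pushforward ?P z w"
    show "?v \<in> tangent_space ?P (z x)"
      using w by (simp add: tangent_space_def pushforward_def comp_def smz MN.sm_add MN.sm_mult MN.sm_cmult)
    show "pushforward N h ?v = w"
    proof
      fix f
      show "pushforward N h ?v f = w f"
      proof (cases "smooth_fun N f")
        case True
        have s2: "smooth_fun N (\<lambda>x. f (h (z x)))" using True sm smz[of "\<lambda>p. f (h p)"] by simp
        have "w (\<lambda>x. f (h (z x))) = w f"
          by (rule MN.tv_local[OF w PN.opn_points x s2 True]) (simp add: hz)
        then show ?thesis using True sm[of f] by (simp add: pushforward_def comp_def)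
      next
        case False
        then show ?thesis using MN.tv_nonsmooth[OF w] by (simp add: pushforward_def)
      qed
    qed
  qed
  have "E x = {v \<in> tangent_space N x. pushforward M \<pi> v \<in> lin x}" if x: "x \<in> points N" for x
  proof -
    have "E x = pushforward N h ` {v \<in> tangent_space ?P (z x). pushforward M fst v \<in> lin x}"
      by (simp add: E_def copy_dist_def lifted_dist_def N_def z_def lin_def split_beta)
    also have "\<dots> = {v \<in> tangent_space N x. pushforward M \<pi> v \<in> lin x}"
    proof (intro equalityI subsetI)
      fix w assume "w \<in> pushforward N h ` {v \<in> tangent_space ?P (z x). pushforward M fst v \<in> lin x}"
      then show "w \<in> {v \<in> tangent_space N x. pushforward M \<pi> v \<in> lin x}" using push[OF _ x] by auto
    next
      fix w assume w: "w \<in> {v \<in> tangent_space N x. pushforward M \<pi> v \<in> lin x}"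
      then obtain v where "v \<in> tangent_space ?P (z x)" "pushforward N h v = w" using ex[OF _ x] by blast
      then show "w \<in> pushforward N h ` {v \<in> tangent_space ?P (z x). pushforward M fst v \<in> lin x}"
        using push[OF _ x] w by force
    qed
    finally show ?thesis .
  qed
  then show ?thesis using that prol unfolding NE by auto
qed

section \<open>Adapted frames\<close>

text \<open>From here on tangent vectors are treated as elements of a vector space; evaluation on
  functions is unfolded only on request.\<close>

declare fun_arith [simp del] plus_fun_apply [simp del] zero_fun_apply [simp del]
  minus_apply [simp del] uminus_apply [simp del]

primrec adn :: "('a \<Rightarrow> 'a tvec) \<Rightarrow> ('a \<Rightarrow> 'a tvec) \<Rightarrow> nat \<Rightarrow> 'a \<Rightarrow> 'a tvec" where
  "adn Z T 0 = T"
| "adn Z T (Suc i) = lie_bracket Z (adn Z T i)"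

text \<open>Frames are indexed by the generators they correspond to in the symbol.\<close>

fun fr :: "('a \<Rightarrow> 'a tvec) \<Rightarrow> ('a \<Rightarrow> 'a tvec) \<Rightarrow> ('a \<Rightarrow> 'a tvec) \<Rightarrow> gen \<Rightarrow> 'a \<Rightarrow> 'a tvec" where
  "fr Z T \<eta> (Eps i) = adn Z T (i - 2)"
| "fr Z T \<eta> Eta = \<eta>"
| "fr Z T \<eta> _ = Z"

definition GI :: "nat \<Rightarrow> gen set" where
  "GI r = {gX, Eta} \<union> Eps ` {2..r + 2}"

lemma finite_GI [simp]: "finite (GI r)"
  by (simp add: GI_def)

lemma card_GI: "card (GI r) = r + 3"
proof -
  have "card (Eps ` {2..r + 2}) = r + 1" by (subst card_image) (auto simp: inj_on_def)
  moreover have "{gX, Eta} \<inter> Eps ` {2..r + 2} = {}" by auto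
  ultimately show ?thesis unfolding GI_def by (subst card_Un_disjoint) auto
qed

lemma GI_Suc: "GI (Suc r) = insert (Eps (r + 3)) (GI r)"
proof -
  have "{2..Suc r + 2} = insert (r + 3) {2..r + 2}" by auto
  then show ?thesis by (auto simp: GI_def)
qed

lemma Eps_GI: "i \<le> r \<Longrightarrow> Eps (i + 2) \<in> GI r" "gX \<in> GI r" "Eta \<in> GI r"
  by (auto simp: GI_def)

lemma GI_cases:
  assumes "g \<in> GI r"
  obtains "g = gX" | "g = Eta" | i where "g = Eps (i + 2)" "i \<le> r"
proof -
  have "\<exists>i. g = Eps (i + 2) \<and> i \<le> r" if g: "g \<in> Eps ` {2..r + 2}"
  proof -
    obtain j where "g = Eps j" "2 \<le> j" "j \<le> r + 2" using g by auto
    then show ?thesis by (intro exI[of _ "j - 2"]) auto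
  qed
  then show ?thesis using assms that unfolding GI_def by blast
qed

lemma fam_indep_insert:
  assumes I: "finite I" "i \<notin> I" "fam_indep I v" "v i \<notin> span (v ` I)"
  shows "fam_indep (insert i I) v"
  unfolding fam_indep_def
proof (intro allI impI)
  fix c assume "(\<Sum>j\<in>insert i I. c j *\<^sub>R v j) = 0"
  then have s: "c i *\<^sub>R v i + (\<Sum>j\<in>I. c j *\<^sub>R v j) = 0" using I by simp
  have ci: "c i = 0"
  proof (rule ccontr)
    assume ci: "c i \<noteq> 0"
    have "c i *\<^sub>R v i = - (\<Sum>j\<in>I. c j *\<^sub>R v j)" using s by (simp add: eq_neg_iff_add_eq_0)
    then have "(1 / c i) *\<^sub>R (c i *\<^sub>R v i) \<in> span (v ` I)"
      by (simp only:) (intro span_scale span_neg sum_in_span)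
    then show False using ci I by simp
  qed
  then have "(\<Sum>j\<in>I. c j *\<^sub>R v j) = 0" using s by simp
  then show "\<forall>j\<in>insert i I. c j = 0" using I(3) ci unfolding fam_indep_def by blast
qed

context manifold
begin

text \<open>The Lie algebra and module over smooth functions generated by two global fields. It
  stands in for the flag in the induction because it lifts to the prolongation term by term.\<close>

inductive liegen :: "('a \<Rightarrow> 'a tvec) \<Rightarrow> ('a \<Rightarrow> 'a tvec) \<Rightarrow> ('a \<Rightarrow> 'a tvec) \<Rightarrow> bool"
  for Z T where
  gen_Z: "liegen Z T Z"
| gen_T: "liegen Z T T"
| gen_add: "liegen Z T V \<Longrightarrow> liegen Z T W \<Longrightarrow> liegen Z T (\<lambda>x. V x + W x)"
| gen_scale: "smooth_fun M g \<Longrightarrow> liegen Z T V \<Longrightarrow> liegen Z T (\<lambda>x. g x *\<^sub>R V x)"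
| gen_br: "liegen Z T V \<Longrightarrow> liegen Z T W \<Longrightarrow> liegen Z T (lie_bracket V W)"

lemma liegen_vf: "liegen Z A V \<Longrightarrow> vf Z \<Longrightarrow> vf A \<Longrightarrow> vf V"
  by (induct rule: liegen.induct) (auto intro: vf_add vf_scale vf_br)

lemma liegen_sum:
  "finite I \<Longrightarrow> (\<And>i. i \<in> I \<Longrightarrow> liegen Z A (V i)) \<Longrightarrow> liegen Z A (\<lambda>x. \<Sum>i\<in>I. c i *\<^sub>R V i x)"
proof (induct I rule: finite_induct)
  case empty
  have "liegen Z A (\<lambda>x. 0 *\<^sub>R Z x)" by (intro gen_scale gen_Z sm_const)
  then show ?case by (simp only: sum.empty scaleR_zero_left)
next
  case (insert i I)
  have "liegen Z A (\<lambda>x. c i *\<^sub>R V i x + (\<Sum>i\<in>I. c i *\<^sub>R V i x))"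
    by (rule gen_add[OF gen_scale[OF sm_const insert.prems[OF insertI1]] insert.hyps(3)[OF insert.prems[OF insertI2]]])
  then show ?case unfolding sum.insert[OF insert.hyps(1,2)] .
qed

lemma vf_adn: "vf Z \<Longrightarrow> vf A \<Longrightarrow> vf (adn Z A i)"
  by (induct i) (auto intro: vf_br)

lemma vf_fr: "vf Z \<Longrightarrow> vf A \<Longrightarrow> vf \<eta> \<Longrightarrow> vf (fr Z A \<eta> g)"
  by (cases g) (auto intro: vf_adn)

text \<open>The derivatives of the coefficients occur only in front of the frame fields themselves.
  In a filtered setting these terms have lower order, which is why structure constants of the frame
  will suffice.\<close>

lemma bracket_expand:
  assumes I: "finite I" "finite J" and F: "\<And>i. i \<in> I \<Longrightarrow> vf (F i)" "\<And>j. j \<in> J \<Longrightarrow> vf (G j)"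
    and a: "\<And>i. i \<in> I \<Longrightarrow> smooth_fun M (a i)" "\<And>j. j \<in> J \<Longrightarrow> smooth_fun M (b j)"
    and V: "vf V" "vf W" and S: "opn S" "p \<in> S"
    and eq: "\<And>x. x \<in> S \<Longrightarrow> V x = (\<Sum>i\<in>I. a i x *\<^sub>R F i x)" "\<And>x. x \<in> S \<Longrightarrow> W x = (\<Sum>j\<in>J. b j x *\<^sub>R G j x)"
  shows "lie_bracket V W p = (\<Sum>i\<in>I. \<Sum>j\<in>J. (a i p * b j p) *\<^sub>R lie_bracket (F i) (G j) p)
    + (\<Sum>j\<in>J. V p (b j) *\<^sub>R G j p) - (\<Sum>i\<in>I. W p (a i) *\<^sub>R F i p)"
proof -
  have p: "p \<in> points M" using S opn_sub by auto
  have 1: "lie_bracket V W p = (\<Sum>j\<in>J. b j p *\<^sub>R lie_bracket V (G j) p + V p (b j) *\<^sub>R G j p)"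
    using br_local[OF V(1) V(1) V(2) vf_comb[OF a(2) F(2)] S refl eq(2)] br_comb_right[OF V(1) p I(2) a(2) F(2)]
    by simp
  have 2: "lie_bracket V (G j) p = (\<Sum>i\<in>I. a i p *\<^sub>R lie_bracket (F i) (G j) p) - (\<Sum>i\<in>I. G j p (a i) *\<^sub>R F i p)"
    if j: "j \<in> J" for j
  proof -
    have "lie_bracket (G j) V p = (\<Sum>i\<in>I. a i p *\<^sub>R lie_bracket (G j) (F i) p + G j p (a i) *\<^sub>R F i p)"
      using br_local[OF F(2)[OF j] F(2)[OF j] V(1) vf_comb[OF a(1) F(1)] S refl eq(1)]
        br_comb_right[OF F(2)[OF j] p I(1) a(1) F(1)] by simp
    then have "lie_bracket V (G j) p = - (\<Sum>i\<in>I. a i p *\<^sub>R lie_bracket (G j) (F i) p + G j p (a i) *\<^sub>R F i p)"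
      by (subst br_antisym) simp
    moreover have "lie_bracket (G j) (F i) p = - lie_bracket (F i) (G j) p" for i by (rule br_antisym)
    ultimately show ?thesis by (simp add: sum.distrib sum_negf sum_subtractf)
  qed
  have W: "W p (a i) = (\<Sum>j\<in>J. b j p * G j p (a i))" for i
    using eq(2)[OF S(2)] by (simp add: sum_apply fun_arith)
  have "lie_bracket V W p = (\<Sum>j\<in>J. b j p *\<^sub>R (\<Sum>i\<in>I. a i p *\<^sub>R lie_bracket (F i) (G j) p))
      - (\<Sum>j\<in>J. b j p *\<^sub>R (\<Sum>i\<in>I. G j p (a i) *\<^sub>R F i p)) + (\<Sum>j\<in>J. V p (b j) *\<^sub>R G j p)"
    unfolding 1 by (simp add: 2 sum.distrib sum_subtractf scaleR_diff_right)
  also have "(\<Sum>j\<in>J. b j p *\<^sub>R (\<Sum>i\<in>I. a i p *\<^sub>R lie_bracket (F i) (G j) p)) =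
      (\<Sum>i\<in>I. \<Sum>j\<in>J. (a i p * b j p) *\<^sub>R lie_bracket (F i) (G j) p)"
    by (subst sum.swap) (simp add: scaleR_sum_right mult.commute)
  also have "(\<Sum>j\<in>J. b j p *\<^sub>R (\<Sum>i\<in>I. G j p (a i) *\<^sub>R F i p)) = (\<Sum>i\<in>I. W p (a i) *\<^sub>R F i p)"
    by (simp add: scaleR_sum_right W scaleR_sum_left) (rule sum.swap)
  finally show ?thesis by (simp add: algebra_simps)
qed

text \<open>Reduces a bracket of arbitrary sections, known only by pointwise membership, to finitely
  many brackets of frame fields.\<close>

lemma bracket_in_span:
  assumes I: "finite I" "finite J" and F: "\<And>i. i \<in> I \<Longrightarrow> vf (F i)" "\<And>j. j \<in> J \<Longrightarrow> vf (G j)"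
    and ind: "fam_indep I (\<lambda>i. F i p)" "fam_indep J (\<lambda>j. G j p)"
    and V: "vf V" "vf W" and S: "opn S" "p \<in> S"
    and sp: "\<And>x. x \<in> S \<Longrightarrow> V x \<in> span ((\<lambda>i. F i x) ` I)" "\<And>x. x \<in> S \<Longrightarrow> W x \<in> span ((\<lambda>j. G j x) ` J)"
    and X: "subspace X" "\<And>i. i \<in> I \<Longrightarrow> F i p \<in> X" "\<And>j. j \<in> J \<Longrightarrow> G j p \<in> X"
      "\<And>i j. i \<in> I \<Longrightarrow> j \<in> J \<Longrightarrow> lie_bracket (F i) (G j) p \<in> X"
  shows "lie_bracket V W p \<in> X"
proof -
  obtain S1 where S1: "opn S1" "p \<in> S1" "S1 \<subseteq> S" "comb I F S1 V"
    by (rule span_comb[OF I(1) F(1) ind(1) V(1) S sp(1)])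
  obtain S2 where S2: "opn S2" "p \<in> S2" "S2 \<subseteq> S" "comb J G S2 W"
    by (rule span_comb[OF I(2) F(2) ind(2) V(2) S sp(2)])
  obtain a where a: "\<And>i. i \<in> I \<Longrightarrow> smooth_fun M (a i)" "\<And>x. x \<in> S1 \<Longrightarrow> V x = (\<Sum>i\<in>I. a i x *\<^sub>R F i x)"
    using S1(4) unfolding comb_def by blast
  obtain b where b: "\<And>j. j \<in> J \<Longrightarrow> smooth_fun M (b j)" "\<And>x. x \<in> S2 \<Longrightarrow> W x = (\<Sum>j\<in>J. b j x *\<^sub>R G j x)"
    using S2(4) unfolding comb_def by blast
  have "lie_bracket V W p = (\<Sum>i\<in>I. \<Sum>j\<in>J. (a i p * b j p) *\<^sub>R lie_bracket (F i) (G j) p)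
    + (\<Sum>j\<in>J. V p (b j) *\<^sub>R G j p) - (\<Sum>i\<in>I. W p (a i) *\<^sub>R F i p)"
    by (rule bracket_expand[where S = "S1 \<inter> S2", OF I F a(1) b(1) V]) (use S1 S2 a b in auto)
  also have "\<dots> \<in> X"
    by (intro subspace_diff subspace_add subspace_sum subspace_scale X)
  finally show ?thesis .
qed

text \<open>The induction carries two properties of a field: it takes values in the span, and its
  bracket with every field valued in the span stays there. The second yields the first for brackets,
  and by the Jacobi identity it is itself inherited by brackets. For \<open>Z\<close> and
  \<open>A\<close> it need only be checked on the frame fields.\<close>

lemma involutive:
  assumes I: "finite I" "\<And>i. i \<in> I \<Longrightarrow> vf (F i)" "\<And>x. x \<in> S \<Longrightarrow> fam_indep I (\<lambda>i. F i x)" and S: "opn S"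
    and Z: "vf Z" "vf A" "\<And>x. x \<in> S \<Longrightarrow> Z x \<in> span ((\<lambda>i. F i x) ` I)" "\<And>x. x \<in> S \<Longrightarrow> A x \<in> span ((\<lambda>i. F i x) ` I)"
    and inv: "\<And>x i. x \<in> S \<Longrightarrow> i \<in> I \<Longrightarrow> lie_bracket Z (F i) x \<in> span ((\<lambda>i. F i x) ` I)"
      "\<And>x i. x \<in> S \<Longrightarrow> i \<in> I \<Longrightarrow> lie_bracket A (F i) x \<in> span ((\<lambda>i. F i x) ` I)"
    and V: "liegen Z A V"
  shows "\<forall>x\<in>S. V x \<in> span ((\<lambda>i. F i x) ` I) \<and>
    (\<forall>U. vf U \<longrightarrow> (\<forall>y\<in>S. U y \<in> span ((\<lambda>i. F i y) ` I)) \<longrightarrow> lie_bracket V U x \<in> span ((\<lambda>i. F i x) ` I))"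
proof -
  have base: "lie_bracket B U x \<in> span ((\<lambda>i. F i x) ` I)"
    if B: "vf B" "\<And>x i. x \<in> S \<Longrightarrow> i \<in> I \<Longrightarrow> lie_bracket B (F i) x \<in> span ((\<lambda>i. F i x) ` I)"
      and U: "vf U" "\<forall>y\<in>S. U y \<in> span ((\<lambda>i. F i y) ` I)" and x: "x \<in> S" for B U x
  proof -
    have xp: "x \<in> points M" using opn_sub S x by auto
    obtain S1 where S1: "opn S1" "x \<in> S1" "S1 \<subseteq> S" "comb I F S1 U"
      by (rule span_comb[OF I(1,2) I(3)[OF x] U(1) S x]) (use U in auto)
    obtain a where a: "\<And>i. i \<in> I \<Longrightarrow> smooth_fun M (a i)" "\<And>y. y \<in> S1 \<Longrightarrow> U y = (\<Sum>i\<in>I. a i y *\<^sub>R F i y)"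
      using S1(4) unfolding comb_def by blast
    have "lie_bracket B U x = (\<Sum>i\<in>I. a i x *\<^sub>R lie_bracket B (F i) x + B x (a i) *\<^sub>R F i x)"
      using br_local[OF B(1) B(1) U(1) vf_comb[OF a(1) I(2)] S1(1,2) refl a(2)]
        br_comb_right[OF B(1) xp I(1) a(1) I(2)] by simp
    also have "\<dots> \<in> span ((\<lambda>i. F i x) ` I)"
      by (intro span_sum span_add span_scale B(2) x) (auto intro: span_base)
    finally show ?thesis .
  qed
  show ?thesis
    using V
  proof (induct rule: liegen.induct)
  case gen_Z
  show ?case using Z(3) base[OF Z(1) inv(1)] by blast
next
  case gen_T
  show ?case using Z(4) base[OF Z(2) inv(2)] by blast
next
  case (gen_add V W)
  have vV: "vf V" "vf W" using gen_add liegen_vf Z by auto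
  have "lie_bracket (\<lambda>x. V x + W x) U x = lie_bracket V U x + lie_bracket W U x"
    if "vf U" "x \<in> S" for U x
  proof -
    have xp: "x \<in> points M" using opn_sub S that by auto
    have "lie_bracket (\<lambda>x. V x + W x) U x = - (lie_bracket U V x + lie_bracket U W x)"
      by (subst br_antisym) (simp only: br_add_right[OF that(1) vV xp])
    also have "\<dots> = - lie_bracket U V x + - lie_bracket U W x" by (rule minus_add_distrib)
    finally show ?thesis unfolding br_antisym[of U, symmetric] br_antisym[of V U] br_antisym[of W U] .
  qed
  then show ?case using gen_add(2,4) by (simp add: span_add)
next
  case (gen_scale g V)
  have vV: "vf V" using gen_scale liegen_vf Z by auto
  have "lie_bracket (\<lambda>x. g x *\<^sub>R V x) U x = g x *\<^sub>R lie_bracket V U x - U x g *\<^sub>R V x"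
    if "vf U" "x \<in> S" for U x
  proof -
    have xp: "x \<in> points M" using opn_sub S that by auto
    show ?thesis
      unfolding br_antisym[of _ U] br_scale_right[OF that(1) vV gen_scale(1) xp] by simp
  qed
  then show ?case using gen_scale(3) by (simp add: span_diff span_scale)
next
  case (gen_br V W)
  have vV: "vf V" "vf W" using gen_br liegen_vf Z by auto
  show ?case
  proof (intro ballI conjI allI impI)
    fix x assume x: "x \<in> S"
    then show "lie_bracket V W x \<in> span ((\<lambda>i. F i x) ` I)" using gen_br(2,4) vV by blast
    fix U assume U: "vf U" "\<forall>y\<in>S. U y \<in> span ((\<lambda>i. F i y) ` I)"
    have xp: "x \<in> points M" using opn_sub S x by auto
    have a: "\<forall>y\<in>S. lie_bracket W U y \<in> span ((\<lambda>i. F i y) ` I)"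
      "\<forall>y\<in>S. lie_bracket V U y \<in> span ((\<lambda>i. F i y) ` I)" using gen_br(2,4) U by auto
    have "lie_bracket V (lie_bracket W U) x = lie_bracket (lie_bracket V W) U x + lie_bracket W (lie_bracket V U) x"
      by (rule jacobi[OF vV U(1) xp])
    moreover have "lie_bracket V (lie_bracket W U) x \<in> span ((\<lambda>i. F i x) ` I)"
      "lie_bracket W (lie_bracket V U) x \<in> span ((\<lambda>i. F i x) ` I)"
      using gen_br(2,4) x a vf_br[OF vV(1) U(1)] vf_br[OF vV(2) U(1)] by blast+
    ultimately show "lie_bracket (lie_bracket V W) U x \<in> span ((\<lambda>i. F i x) ` I)"
      by (metis add_diff_cancel_right' span_diff)
  qed
  qed
qed

text \<open>The invariant of the induction on the number \<open>k\<close> of prolongations. The last clause is the only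
  trace of bracket generation that is kept: asking it on a dense set of points makes it pass to the
  prolongation without control of the flag.\<close>

definition good :: "'a dist \<Rightarrow> nat \<Rightarrow> 'a set \<Rightarrow> ('a \<Rightarrow> 'a tvec) \<Rightarrow> ('a \<Rightarrow> 'a tvec) \<Rightarrow> ('a \<Rightarrow> 'a tvec) \<Rightarrow> bool" where
  "good D k S Z A \<eta> \<longleftrightarrow> opn S \<and> vf Z \<and> vf A \<and> vf \<eta> \<and>
    (\<forall>p\<in>S. D p = span {Z p, A p} \<and> dim (D p) = 2) \<and>
    (\<forall>p\<in>S. \<forall>i\<le>2 * k. lie_bracket A (adn Z A i) p = 0) \<and>
    (\<forall>p\<in>S. lie_bracket A (adn Z A (2 * k + 1)) p = \<eta> p) \<and>
    (\<forall>p\<in>S. \<forall>a<k. lie_bracket (adn Z A a) \<eta> p = 0) \<and>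
    (\<forall>p\<in>S. fam_indep (GI (k + 2)) (\<lambda>g. fr Z A \<eta> g p)) \<and>
    (\<forall>O'. opn O' \<longrightarrow> O' \<subseteq> S \<longrightarrow> O' \<noteq> {} \<longrightarrow> (\<exists>p\<in>O'. \<forall>v\<in>T p. \<exists>V. liegen Z A V \<and> V p = v))"

lemma goodD:
  assumes "good D k S Z A \<eta>"
  shows "opn S" "vf Z" "vf A" "vf \<eta>" "\<And>p. p \<in> S \<Longrightarrow> D p = span {Z p, A p}" "\<And>p. p \<in> S \<Longrightarrow> dim (D p) = 2"
    "\<And>p i. p \<in> S \<Longrightarrow> i \<le> 2 * k \<Longrightarrow> lie_bracket A (adn Z A i) p = 0"
    "\<And>p. p \<in> S \<Longrightarrow> lie_bracket A (adn Z A (2 * k + 1)) p = \<eta> p"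
    "\<And>p a. p \<in> S \<Longrightarrow> a < k \<Longrightarrow> lie_bracket (adn Z A a) \<eta> p = 0"
    "\<And>p. p \<in> S \<Longrightarrow> fam_indep (GI (k + 2)) (\<lambda>g. fr Z A \<eta> g p)"
    "\<And>O'. opn O' \<Longrightarrow> O' \<subseteq> S \<Longrightarrow> O' \<noteq> {} \<Longrightarrow> \<exists>p\<in>O'. \<forall>v\<in>T p. \<exists>V. liegen Z A V \<and> V p = v"
proof -
  note * = assms[unfolded good_def]
  show "opn S" "vf Z" "vf A" "vf \<eta>" "\<And>p. p \<in> S \<Longrightarrow> D p = span {Z p, A p}"
    "\<And>p i. p \<in> S \<Longrightarrow> i \<le> 2 * k \<Longrightarrow> lie_bracket A (adn Z A i) p = 0"
    "\<And>p. p \<in> S \<Longrightarrow> lie_bracket A (adn Z A (2 * k + 1)) p = \<eta> p"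
    "\<And>p a. p \<in> S \<Longrightarrow> a < k \<Longrightarrow> lie_bracket (adn Z A a) \<eta> p = 0"
    "\<And>p. p \<in> S \<Longrightarrow> fam_indep (GI (k + 2)) (\<lambda>g. fr Z A \<eta> g p)"
    by (simp_all only: *)
  show "dim (D p) = 2" if "p \<in> S" for p
    using *[THEN conjunct2, THEN conjunct2, THEN conjunct2, THEN conjunct2, THEN conjunct1] that by blast
  show "\<exists>p\<in>O'. \<forall>v\<in>T p. \<exists>V. liegen Z A V \<and> V p = v" if "opn O'" "O' \<subseteq> S" "O' \<noteq> {}" for O'
    using * that by presburger
qed

lemma good_subset:
  assumes "good D k S Z A \<eta>" "opn S'" "S' \<subseteq> S" shows "good D k S' Z A \<eta>"
proof -
  note G = goodD[OF assms(1)] and S' = subsetD[OF assms(3)]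
  show ?thesis
    unfolding good_def
    by (intro conjI ballI allI impI; (rule assms(2) G(2-4) | rule G(5-10)[OF S'], assumption+ |
          rule G(11)[OF _ subset_trans[OF _ assms(3)]], assumption+))
qed

lemma br_locally_zero:
  assumes "vf V" "vf W" "opn S" "p \<in> S" "\<And>x. x \<in> S \<Longrightarrow> W x = 0"
  shows "lie_bracket V W p = 0"
proof -
  have "lie_bracket V W p = lie_bracket V (\<lambda>x. 0) p"
    by (rule br_local[OF assms(1,1,2) vf_zero assms(3,4) refl assms(5)])
  then show ?thesis using br_zero_right[OF assms(1)] opn_sub[OF assms(3)] assms(4) by auto
qed

lemma br_scaled:
  assumes "vf V" "vf W" "vf W'" "opn S" "p \<in> S" "\<And>x. x \<in> S \<Longrightarrow> W x = c *\<^sub>R W' x"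
  shows "lie_bracket V W p = c *\<^sub>R lie_bracket V W' p"
proof -
  have p: "p \<in> points M" using opn_sub assms by auto
  have "lie_bracket V W p = lie_bracket V (\<lambda>x. c *\<^sub>R W' x) p"
    by (rule br_local[OF assms(1,1,2) vf_scale[OF sm_const assms(3)] assms(4,5) refl assms(6)])
  also have "\<dots> = c *\<^sub>R lie_bracket V W' p + V p (\<lambda>x. c) *\<^sub>R W' p"
    by (rule br_scale_right[OF assms(1,3) sm_const p])
  also have "V p (\<lambda>x. c) = 0" by (rule tv_const[OF vf_T[OF assms(1) p]])
  finally show ?thesis by (simp only: scaleR_zero_left add_0_right)
qed

lemma br_self: "lie_bracket V V p = 0"
  by (simp add: lie_bracket_def fun_eq_iff fun_arith)

text \<open>A bracket that vanishes on the open set \<open>S\<close> is also annihilated by ad(Z).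
  The Jacobi identity then moves one ad(Z) from the left argument to the right one with a change of
  sign, which reduces everything to a = 0.\<close>

lemma good_brackets:
  assumes g: "good D k S Z A \<eta>" and p: "p \<in> S"
  shows "a + b \<le> 2 * k \<Longrightarrow> lie_bracket (adn Z A a) (adn Z A b) p = 0"
    "a + b = 2 * k + 1 \<Longrightarrow> lie_bracket (adn Z A a) (adn Z A b) p = (- 1) ^ a *\<^sub>R \<eta> p"
proof -
  note G = goodD[OF g]
  have J: "lie_bracket Z (lie_bracket (adn Z A a) (adn Z A b)) p =
      lie_bracket (adn Z A (Suc a)) (adn Z A b) p + lie_bracket (adn Z A a) (adn Z A (Suc b)) p"
    if "p \<in> S" for a b p
    unfolding adn.simps
    by (rule jacobi[OF G(2) vf_adn[OF G(2,3)] vf_adn[OF G(2,3)] subsetD[OF opn_sub[OF G(1)] that]])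
  have "\<forall>b. \<forall>p\<in>S. (a + b \<le> 2 * k \<longrightarrow> lie_bracket (adn Z A a) (adn Z A b) p = 0) \<and>
      (a + b = 2 * k + 1 \<longrightarrow> lie_bracket (adn Z A a) (adn Z A b) p = (- 1) ^ a *\<^sub>R \<eta> p)" for a
  proof (induct a)
    case 0
    then show ?case using G(7,8) by auto
  next
    case (Suc a)
    have *: "lie_bracket (adn Z A (Suc a)) (adn Z A b) p = - lie_bracket (adn Z A a) (adn Z A (Suc b)) p"
      if "p \<in> S" "a + b \<le> 2 * k" for b p
    proof -
      have "lie_bracket Z (lie_bracket (adn Z A a) (adn Z A b)) p = 0"
        by (rule br_locally_zero[OF G(2) vf_br[OF vf_adn[OF G(2,3)] vf_adn[OF G(2,3)]] G(1) that(1)])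
          (use Suc that in blast)
      then show ?thesis using J[OF that(1), of a b] by (simp only: eq_neg_iff_add_eq_0)
    qed
    show ?case
    proof (intro allI ballI conjI impI)
      fix b p assume p: "p \<in> S"
      show "lie_bracket (adn Z A (Suc a)) (adn Z A b) p = 0" if "Suc a + b \<le> 2 * k"
      proof -
        have ab: "a + Suc b \<le> 2 * k" "a + b \<le> 2 * k" using that by auto
        then have "lie_bracket (adn Z A a) (adn Z A (Suc b)) p = 0" using Suc p by blast
        then show ?thesis unfolding *[OF p ab(2)] by (simp only: neg_equal_0_iff_equal)
      qed
      show "lie_bracket (adn Z A (Suc a)) (adn Z A b) p = (- 1) ^ Suc a *\<^sub>R \<eta> p" if "Suc a + b = 2 * k + 1"
      proof -
        have ab: "a + Suc b = 2 * k + 1" "a + b \<le> 2 * k" using that by auto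
        then have "lie_bracket (adn Z A a) (adn Z A (Suc b)) p = (- 1) ^ a *\<^sub>R \<eta> p" using Suc p by blast
        then show ?thesis unfolding *[OF p ab(2)] by simp
      qed
    qed
  qed
  then show "a + b \<le> 2 * k \<Longrightarrow> lie_bracket (adn Z A a) (adn Z A b) p = 0"
    "a + b = 2 * k + 1 \<Longrightarrow> lie_bracket (adn Z A a) (adn Z A b) p = (- 1) ^ a *\<^sub>R \<eta> p" using p by auto
qed

text \<open>The next order, a + b = 2 k + 2. Applying ad(Z) to the relations of order 2 k + 1 gives
  a recursion outwards from the middle bracket, which is 0 as the bracket of a field with itself;
  each step adds one more multiple of [Z, \<eta>], with alternating signs.\<close>

lemma good_bracket_next:
  assumes g: "good D k S Z A \<eta>" and p: "p \<in> S"
  shows "j \<le> k + 1 \<Longrightarrow> lie_bracket (adn Z A (k + 1 - j)) (adn Z A (k + 1 + j)) p =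
    ((- 1) ^ (k + 1 - j) * real j) *\<^sub>R lie_bracket Z \<eta> p"
proof (induct j)
  case 0
  then show ?case by (simp add: br_self)
next
  case (Suc j)
  note G = goodD[OF g]
  define a where "a = k - j"
  have a: "k + 1 - Suc j = a" "k + 1 - j = Suc a" "a + (k + 1 + j) = 2 * k + 1" using Suc.prems by (auto simp: a_def)
  have "lie_bracket Z (lie_bracket (adn Z A a) (adn Z A (k + 1 + j))) p = (- 1) ^ a *\<^sub>R lie_bracket Z \<eta> p"
    by (rule br_scaled[OF G(2) vf_br[OF vf_adn[OF G(2,3)] vf_adn[OF G(2,3)]] G(4) G(1) p])
      (rule good_brackets(2)[OF g _ a(3)])
  moreover have "lie_bracket Z (lie_bracket (adn Z A a) (adn Z A (k + 1 + j))) p =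
      lie_bracket (adn Z A (Suc a)) (adn Z A (k + 1 + j)) p + lie_bracket (adn Z A a) (adn Z A (Suc (k + 1 + j))) p"
    unfolding adn.simps
    by (rule jacobi[OF G(2) vf_adn[OF G(2,3)] vf_adn[OF G(2,3)] subsetD[OF opn_sub[OF G(1)] p]])
  moreover have "lie_bracket (adn Z A (Suc a)) (adn Z A (k + 1 + j)) p = ((- 1) ^ Suc a * real j) *\<^sub>R lie_bracket Z \<eta> p"
    unfolding a(2)[symmetric]
    by (rule trans[OF Suc.hyps]) (use Suc.prems a in \<open>simp_all del: adn.simps\<close>)
  ultimately have "lie_bracket (adn Z A a) (adn Z A (Suc (k + 1 + j))) p =
      (- 1) ^ a *\<^sub>R lie_bracket Z \<eta> p - ((- 1) ^ Suc a * real j) *\<^sub>R lie_bracket Z \<eta> p"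
    by (simp only: eq_diff_eq add.commute)
  also have "\<dots> = ((- 1) ^ a * real (Suc j)) *\<^sub>R lie_bracket Z \<eta> p"
    unfolding scaleR_left_diff_distrib[symmetric] by (simp add: algebra_simps)
  finally show ?case unfolding a(1) by simp
qed

lemma span_T_card:
  assumes p: "p \<in> points M" and I: "finite I" "T p \<subseteq> span (v ` I)" shows "n \<le> card I"
proof -
  obtain U \<phi> where U: "(U, \<phi>) \<in> atlas M" "p \<in> U" using point_chart p by blast
  note tb = tangent_basis[OF U]
  have "cpart U \<phi> p ` {..<n} \<subseteq> T p" unfolding tb(2) by (rule span_superset)
  then have "cpart U \<phi> p ` {..<n} \<subseteq> span (v ` I)" using I(2) by (rule subset_trans)
  then have "card (cpart U \<phi> p ` {..<n}) \<le> card (v ` I)"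
    using independent_span_bound[OF _ fam_indep_dim(2)[OF _ tb(1)]] I by auto
  then show ?thesis using card_image[OF fam_indep_dim(1)[OF _ tb(1)]] card_image_le[OF I(1), of v] by simp
qed

text \<open>If \<open>ad(Z)^(r + 1) A\<close> depends on the previous fields near a point, bracketing the dependence
  relation with \<open>ad(Z)^(2 k + 1 - r) A\<close> isolates \<open>[Z, \<eta>]\<close>.\<close>

lemma generic_frame:
  assumes g: "good D k S Z A \<eta>" and dimM: "n = 2 * k + 5" and ne: "S \<noteq> {}"
  obtains S' where "opn S'" "S' \<noteq> {}" "S' \<subseteq> S" "\<And>p. p \<in> S' \<Longrightarrow> fam_indep (GI (2 * k + 2)) (\<lambda>g. fr Z A \<eta> g p)"
proof -
  note G = goodD[OF g]
  let ?f = "\<lambda>p g. fr Z A \<eta> g p"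
  define R where "R r \<longleftrightarrow> (\<exists>p\<in>S. fam_indep (GI r) (?f p))" for r
  have vfr: "vf (fr Z A \<eta> g)" for g by (rule vf_fr[OF G(2-4)])
  have "R (2 * k + 2)"
  proof (rule ccontr)
    assume nR: "\<not> R (2 * k + 2)"
    have R0: "R (k + 2)" using ne G(10) by (auto simp: R_def)
    \<comment> \<open>The invariant provides independence up to \<open>k + 2\<close>, so if it fails
      at \<open>2 * k + 2\<close> there is a last index \<open>r\<close> in between that is attained
      somewhere on \<open>S\<close> while its successor is attained nowhere.\<close>
    have "\<exists>r. k + 2 \<le> r \<and> r < 2 * k + 2 \<and> R r \<and> \<not> R (Suc r)"
    proof (rule ccontr)
      assume no: "\<not> ?thesis"
      have "R (k + 2 + j)" if "j \<le> k" for j using that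
      proof (induct j)
        case 0 then show ?case using R0 by simp
      next
        case (Suc j)
        then have "k + 2 \<le> k + 2 + j" "k + 2 + j < 2 * k + 2" "R (k + 2 + j)" by auto
        then show ?case using no by (metis add_Suc_right)
      qed
      from this[of k] nR show False by (simp add: mult_2)
    qed
    then obtain r where r: "k + 2 \<le> r" "r < 2 * k + 2" "R r" "\<not> R (Suc r)" by blast
    obtain p0 where p0: "p0 \<in> S" "fam_indep (GI r) (?f p0)" using r by (auto simp: R_def)
    have p0M: "p0 \<in> points M" using opn_sub[OF G(1)] p0 by auto
    obtain S1 where S1: "opn S1" "p0 \<in> S1" "\<And>x. x \<in> S1 \<Longrightarrow> fam_indep (GI r) (?f x)"
      by (rule indep_near[OF p0M, of "GI r" "fr Z A \<eta>"]) (use p0 vfr in auto)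
    let ?E = "\<lambda>x. span (?f x ` GI r)"
    have new: "Eps (r + 3) \<notin> GI r" by (auto simp: GI_def)
    \<comment> \<open>Failure at the successor of \<open>r\<close> means dependence at every point
      of \<open>S\<close>, hence on an open set; only so can the relation be written with smooth
      coefficients and bracketed.\<close>
    have top: "adn Z A (Suc r) x \<in> ?E x" if x: "x \<in> S1 \<inter> S" for x
    proof (rule ccontr)
      assume "adn Z A (Suc r) x \<notin> ?E x"
      moreover have "?f x (Eps (r + 3)) = adn Z A (Suc r) x" by simp
      ultimately have "fam_indep (insert (Eps (r + 3)) (GI r)) (?f x)"
        using fam_indep_insert[OF finite_GI new] S1(3) x by (metis (no_types, lifting) IntD1)
      then show False using r(4) x unfolding R_def GI_Suc by auto
    qed
    obtain S2 where S2: "opn S2" "p0 \<in> S2" "S2 \<subseteq> S1 \<inter> S" "comb (GI r) (fr Z A \<eta>) S2 (adn Z A (Suc r))"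
      by (rule span_comb[of "GI r" "fr Z A \<eta>" p0 "adn Z A (Suc r)" "S1 \<inter> S"])
        (use vfr p0 vf_adn[OF G(2,3), of "Suc r"] S1 G(1) top in \<open>auto simp del: adn.simps\<close>)
    obtain c where c: "\<And>g. g \<in> GI r \<Longrightarrow> smooth_fun M (c g)"
      "\<And>x. x \<in> S2 \<Longrightarrow> adn Z A (Suc r) x = (\<Sum>g\<in>GI r. c g x *\<^sub>R fr Z A \<eta> g x)"
      using S2(4) unfolding comb_def by blast
    have bs: "adn Z A i x \<in> ?E x" if "i \<le> r" for i x
      by (rule span_base, rule image_eqI[OF _ Eps_GI(1)[OF that]]) simp
    have be: "\<eta> x \<in> ?E x" "Z x \<in> ?E x" for x
      by (rule span_base, rule image_eqI[OF _ Eps_GI(3)], simp)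
        (rule span_base, rule image_eqI[OF _ Eps_GI(2)], simp)
    have bb: "lie_bracket (adn Z A a) (adn Z A b) x \<in> ?E x" if "a + b \<le> 2 * k + 1" "x \<in> S" for a b x
    proof (cases "a + b \<le> 2 * k")
      case True
      then show ?thesis using good_brackets(1)[OF g that(2)] span_0 by simp
    next
      case False
      then have "a + b = 2 * k + 1" using that by simp
      then show ?thesis using good_brackets(2)[OF g that(2)] be(1) span_scale by metis
    qed
    have ZA: "lie_bracket (adn Z A a) Z x \<in> ?E x" if "a < r" for a x
    proof -
      have "- adn Z A (Suc a) x \<in> ?E x" using bs[of "Suc a" x] that span_neg by (metis Suc_leI)
      then show ?thesis by (subst br_antisym) simp
    qed
    \<comment> \<open>Chosen so that a + r = 2 k + 1: brackets of ad(Z)^a A with all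
      \<open>adn Z A i\<close>, \<open>i \<le> r\<close>, are then multiples of
      \<open>\<eta>\<close>, whereas the one with ad(Z)^(r + 1) A has order 2 k + 2 and is a
      multiple of [Z, \<eta>] with the nonzero factor r - k, up to sign. Since
      \<open>r \<ge> k + 2\<close> one has \<open>a < k\<close>, so the bracket with
      \<open>\<eta>\<close> vanishes.\<close>
    define a where "a = 2 * k + 1 - r"
    have a: "a < k" "a + r = 2 * k + 1" "k + 1 - (r - k) = a" "k + 1 + (r - k) = Suc r" "r - k \<le> k + 1"
      using r by (auto simp: a_def)
    have Zeta: "lie_bracket Z \<eta> x \<in> ?E x" if x: "x \<in> S2" for x
    proof -
      have xS: "x \<in> S" and xp: "x \<in> points M" using x S2(3) opn_sub[OF S2(1)] by auto
      note va = vf_adn[OF G(2,3), of a]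
      have "lie_bracket (adn Z A a) (adn Z A (Suc r)) x =
          (\<Sum>g\<in>GI r. c g x *\<^sub>R lie_bracket (adn Z A a) (fr Z A \<eta> g) x + adn Z A a x (c g) *\<^sub>R fr Z A \<eta> g x)"
        using br_local[OF va va vf_adn[OF G(2,3), of "Suc r"] vf_comb[OF c(1) vfr] S2(1) x refl c(2)]
          br_comb_right[OF va xp finite_GI c(1) vfr] by simp
      also have "\<dots> \<in> ?E x"
      proof (intro span_sum span_add span_scale)
        fix g assume gg: "g \<in> GI r"
        then show "fr Z A \<eta> g x \<in> ?E x" by (auto intro: span_base)
        from gg show "lie_bracket (adn Z A a) (fr Z A \<eta> g) x \<in> ?E x"
        proof (cases rule: GI_cases)
          case 1 then show ?thesis using ZA[of a x] a r by simp
        next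
          case 2 then show ?thesis using G(9)[OF xS a(1)] span_0 by simp
        next
          case (3 i) then show ?thesis using bb[OF _ xS, of a i] a by simp
        qed
      qed
      finally have "((- 1) ^ a * real (r - k)) *\<^sub>R lie_bracket Z \<eta> x \<in> ?E x"
        using good_bracket_next[OF g xS a(5)] unfolding a(3,4) by simp
      then have "(1 / ((- 1) ^ a * real (r - k))) *\<^sub>R (((- 1) ^ a * real (r - k)) *\<^sub>R lie_bracket Z \<eta> x) \<in> ?E x"
        by (rule span_scale)
      then show ?thesis using r by simp
    qed
    have S2S: "x \<in> S2 \<Longrightarrow> x \<in> S" "x \<in> S2 \<Longrightarrow> x \<in> S1" for x using S2(3) by auto
    obtain p where p: "p \<in> S2" "\<forall>v\<in>T p. \<exists>V. liegen Z A V \<and> V p = v"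
      using G(11)[OF S2(1)] S2 by blast
    \<comment> \<open>With [Z, \<eta>] in the span, the brackets of \<open>Z\<close> and
      \<open>A\<close> with all frame fields stay in it, and so does every field generated by
      \<open>Z\<close> and \<open>A\<close>.\<close>
    have VE: "V p \<in> ?E p" if V: "liegen Z A V" for V
    proof -
      have "\<forall>x\<in>S2. V x \<in> ?E x \<and> (\<forall>U. vf U \<longrightarrow> (\<forall>y\<in>S2. U y \<in> ?E y) \<longrightarrow> lie_bracket V U x \<in> ?E x)"
      proof (rule involutive[OF finite_GI vfr S1(3) S2(1) G(2,3) _ _ _ _ V])
        show "x \<in> S2 \<Longrightarrow> x \<in> S1" for x by (rule S2S)
        show "Z x \<in> ?E x" for x by (rule be)
        show "A x \<in> ?E x" for x using bs[of 0 x] by simp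
        fix x g assume x: "x \<in> S2" and gg: "g \<in> GI r"
        from gg show "lie_bracket Z (fr Z A \<eta> g) x \<in> ?E x"
        proof (cases rule: GI_cases)
          case 1 then show ?thesis using br_self[of Z x] span_0 by simp
        next
          case 2 then show ?thesis using Zeta[OF x] by simp
        next
          case (3 i)
          then show ?thesis using bs[of "Suc i" x] top[of x] S2S[OF x] by (cases "i = r") auto
        qed
        from gg show "lie_bracket A (fr Z A \<eta> g) x \<in> ?E x"
        proof (cases rule: GI_cases)
          case 1 then show ?thesis using ZA[of 0 x] r by simp
        next
          case 2 then show ?thesis using G(9)[OF S2S(1)[OF x], of 0] a span_0 by simp
        next
          case (3 i) then show ?thesis using bb[OF _ S2S(1)[OF x], of 0 i] r by simp
        qed
      qed
      then show ?thesis using p by blast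
    qed
    have "T p \<subseteq> ?E p"
    proof
      fix v assume "v \<in> T p"
      then obtain V where "liegen Z A V" "V p = v" using p(2) by blast
      then show "v \<in> ?E p" using VE[of V] by simp
    qed
    \<comment> \<open>The generated fields exhaust the tangent space at \<open>p\<close>, but the
      frame has only r + 3 members, at most 2 k + 4, which is less than the dimension.\<close>
    then have "n \<le> card (GI r)" using span_T_card[OF _ finite_GI, of p "?f p" r] opn_sub[OF S2(1)] p by auto
    then show False using r dimM by (simp add: card_GI)
  qed
  then obtain p0 where p0: "p0 \<in> S" "fam_indep (GI (2 * k + 2)) (?f p0)" by (auto simp: R_def)
  have p0M: "p0 \<in> points M" using opn_sub[OF G(1)] p0 by auto
  obtain S1 where S1: "opn S1" "p0 \<in> S1" "\<And>x. x \<in> S1 \<Longrightarrow> fam_indep (GI (2 * k + 2)) (?f x)"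
    by (rule indep_near[OF p0M, of "GI (2 * k + 2)" "fr Z A \<eta>"]) (use p0 vfr in auto)
  show ?thesis by (rule that[of "S1 \<inter> S"]) (use S1 p0 G(1) in auto)
qed

section \<open>Bounds for the weak derived flag, and the base of the induction\<close>

lemma subspace_flag:
  assumes D: "rank2_distribution M D" and q: "q \<in> points M" shows "subspace (weak_flag M D i q)"
proof -
  consider "i = 0" | "i = Suc 0" | j where "i = Suc (Suc j)" by (metis not0_implies_Suc)
  then show ?thesis
  proof cases
    case 1
    have "subspace ({0} :: 'a tvec set)" by simp
    then show ?thesis using 1 by simp
  next
    case 3
    then show ?thesis by simp
  next
    case i: 2
    obtain S V W where "q \<in> S" "local_frame M D S V W" using D q unfolding rank2_distribution_def by blast
    then have "D q = span {V q, W q}" by (metis local_frameD(1))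
    then show ?thesis using i by simp
  qed
qed

lemma frame_global:
  assumes D: "rank2_distribution M D" and O1: "opn O1" "q \<in> O1"
  obtains S Z A where "opn S" "q \<in> S" "S \<subseteq> O1" "vf Z" "vf A"
    "\<And>p. p \<in> S \<Longrightarrow> D p = span {Z p, A p}" "\<And>p. p \<in> S \<Longrightarrow> dim (D p) = 2"
proof -
  have q: "q \<in> points M" using O1 opn_sub by auto
  obtain S V W where S: "q \<in> S" and lf: "local_frame M D S V W"
    using D q unfolding rank2_distribution_def by blast
  have oS: "opn S" and sf: "smooth_vf_on M S V" "smooth_vf_on M S W" using lf by (auto simp: local_frame_def)
  obtain Z S1 where Z: "vf Z" "opn S1" "q \<in> S1" "S1 \<subseteq> S" "\<And>x. x \<in> S1 \<Longrightarrow> Z x = V x"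
    by (rule globalize[OF sf(1) oS S]) blast
  obtain A S2 where A: "vf A" "opn S2" "q \<in> S2" "S2 \<subseteq> S" "\<And>x. x \<in> S2 \<Longrightarrow> A x = W x"
    by (rule globalize[OF sf(2) oS S]) blast
  show ?thesis
  proof (rule that[of "S1 \<inter> S2 \<inter> O1" Z A])
    fix p assume p: "p \<in> S1 \<inter> S2 \<inter> O1"
    then have pS: "p \<in> S" and e: "Z p = V p" "A p = W p" using Z A by auto
    show "D p = span {Z p, A p}" unfolding e by (rule local_frameD(1)[OF lf pS])
    show "dim (D p) = 2" using lf pS unfolding local_frame_def by blast
  qed (use Z A O1 in auto)
qed

definition PI :: "gen set" where "PI = {gX, Eps 2}"

lemma PI: "finite PI" "(\<lambda>g. fr Z A \<eta> g p) ` PI = {Z p, A p}"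
  by (auto simp: PI_def)

lemma PI_indep:
  assumes "D p = span {Z p, A p}" "dim (D p) = 2" shows "fam_indep PI (\<lambda>g. fr Z A \<eta> g p)"
proof (rule fam_indep_if_dim[OF PI(1)])
  have "card PI = 2" by (simp add: PI_def)
  then show "card PI \<le> dim (span ((\<lambda>g. fr Z A \<eta> g p) ` PI))" unfolding PI(2) assms(1)[symmetric]
    using assms(2) by simp
qed

text \<open>A bound for one member of the flag on an open set gives a bound for the next at a point,
  by checking brackets of the frame fields with \<open>Z\<close> and \<open>A\<close> only. The
  target \<open>X\<close> may be any subspace at \<open>p\<close>.\<close>

lemma flag_step:
  assumes S: "opn S" and I: "finite I" "\<And>i. i \<in> I \<Longrightarrow> vf (F i)" "\<And>x. x \<in> S \<Longrightarrow> fam_indep I (\<lambda>i. F i x)"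
    and Z: "vf Z" "vf A" "\<And>x. x \<in> S \<Longrightarrow> D x = span {Z x, A x}" "\<And>x. x \<in> S \<Longrightarrow> dim (D x) = 2"
    and fl: "\<And>x. x \<in> S \<Longrightarrow> weak_flag M D (Suc i) x \<subseteq> span ((\<lambda>i. F i x) ` I)"
    and X: "p \<in> S" "subspace X" "\<And>i. i \<in> I \<Longrightarrow> F i p \<in> X" "Z p \<in> X" "A p \<in> X"
      "\<And>i. i \<in> I \<Longrightarrow> lie_bracket (F i) Z p \<in> X" "\<And>i. i \<in> I \<Longrightarrow> lie_bracket (F i) A p \<in> X"
  shows "weak_flag M D (Suc (Suc i)) p \<subseteq> X"
  unfolding weak_flag.simps
proof (rule span_minimal[OF _ X(2)], rule Un_least)
  have "span ((\<lambda>i. F i p) ` I) \<subseteq> X" by (rule span_minimal[OF _ X(2)]) (use X(3) in auto)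
  then show "weak_flag M D (Suc i) p \<subseteq> X" using fl[OF X(1)] by (rule subset_trans[rotated])
  show "{lie_bracket V W p |V W. W \<in> sections M D \<and> V \<in> sections M (weak_flag M D (Suc i))} \<subseteq> X"
  proof clarify
    fix V W assume W: "W \<in> sections M D" and V: "V \<in> sections M (weak_flag M D (Suc i))"
    have vV: "vf V" "vf W" using V W by (auto simp: sections_def)
    have Sp: "x \<in> S \<Longrightarrow> x \<in> points M" for x using opn_sub[OF S] by auto
    have PG: "vf (fr Z A Z g)" for g by (rule vf_fr[OF Z(1,2,1)])
    show "lie_bracket V W p \<in> X"
    proof (rule bracket_in_span[OF I(1) PI(1) I(2) PG I(3)[OF X(1)] PI_indep[of D p Z A Z, OF Z(3,4)[OF X(1)]] vV S X(1) _ _ X(2,3)])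
      show "V x \<in> span ((\<lambda>i. F i x) ` I)" if "x \<in> S" for x
        using V fl[OF that] Sp[OF that] by (auto simp: sections_def)
      show "W x \<in> span ((\<lambda>g. fr Z A Z g x) ` PI)" if "x \<in> S" for x
        unfolding PI(2) Z(3)[OF that, symmetric] using W Sp[OF that] by (auto simp: sections_def)
      show "fr Z A Z g p \<in> X" if "g \<in> PI" for g using that X(4,5) by (auto simp: PI_def)
      show "lie_bracket (F i) (fr Z A Z g) p \<in> X" if "i \<in> I" "g \<in> PI" for i g
        using that X(6,7) by (auto simp: PI_def)
    qed
  qed
qed

text \<open>Take the largest number of generated fields that are independent at some point of
  \<open>S\<close>. Near that point they stay independent, and by maximality every generated field
  lies in their span, hence so does the whole flag; bracket generation makes this span the tangent
  space. Constant combinations of generated fields are again generated.\<close>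

lemma dense_generation:
  assumes S: "opn S" and Z: "vf Z" "vf A" "\<And>x. x \<in> S \<Longrightarrow> D x = span {Z x, A x}" "\<And>x. x \<in> S \<Longrightarrow> dim (D x) = 2"
    and bg: "bracket_generating M D" and ne: "S \<noteq> {}"
  shows "\<exists>p\<in>S. \<forall>v\<in>T p. \<exists>V. liegen Z A V \<and> V p = v"
proof -
  define R where "R r \<longleftrightarrow> (\<exists>p\<in>S. \<exists>V. (\<forall>i<r. liegen Z A (V i)) \<and> fam_indep {..<r} (\<lambda>i. V i p))" for r :: nat
  have Sp: "x \<in> S \<Longrightarrow> x \<in> points M" for x using opn_sub[OF S] by auto
  have bound: "r \<le> n" if Rr: "R r" for r
  proof -
    obtain p V where p: "p \<in> S" "\<And>i. i < r \<Longrightarrow> liegen Z A (V i)" "fam_indep {..<r} (\<lambda>i. V i p)"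
      using Rr unfolding R_def by blast
    have "card {..<r} \<le> n"
      by (rule indep_card_le[OF Sp[OF p(1)] _ p(3)]) (use p liegen_vf[OF _ Z(1,2)] vf_T Sp in auto)
    then show ?thesis by simp
  qed
  have R0: "R 0" using ne by (auto simp: R_def fam_indep_def)
  define r where "r = Greatest R"
  have Rr: "R r" unfolding r_def by (rule GreatestI_nat[of R 0 n]) (use R0 bound in auto)
  have max: "s \<le> r" if "R s" for s unfolding r_def by (rule Greatest_le_nat[of R, OF that]) (use bound in auto)
  obtain p0 V where p0: "p0 \<in> S" and V: "\<And>i. i \<in> {..<r} \<Longrightarrow> liegen Z A (V i)" and ind: "fam_indep {..<r} (\<lambda>i. V i p0)"
    using Rr unfolding R_def by auto
  have vV: "vf (V i)" if "i \<in> {..<r}" for i using liegen_vf[OF V[OF that] Z(1,2)] .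
  obtain S0 where S0: "opn S0" "p0 \<in> S0" "\<And>x. x \<in> S0 \<Longrightarrow> fam_indep {..<r} (\<lambda>i. V i x)"
    by (rule indep_near[OF Sp[OF p0], of "{..<r}" V]) (use vV ind in auto)
  define S1 where "S1 = S0 \<inter> S"
  have S1: "opn S1" "p0 \<in> S1" "\<And>x. x \<in> S1 \<Longrightarrow> x \<in> S" "\<And>x. x \<in> S1 \<Longrightarrow> fam_indep {..<r} (\<lambda>i. V i x)"
    using S0 S p0 by (auto simp: S1_def)
  let ?E = "\<lambda>x. span ((\<lambda>i. V i x) ` {..<r})"
  have all: "W x \<in> ?E x" if W: "liegen Z A W" and x: "x \<in> S1" for W x
  proof (rule ccontr)
    assume nW: "W x \<notin> ?E x"
    define V' where "V' = V(r := W)"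
    have "(\<lambda>i. V' i x) ` {..<r} = (\<lambda>i. V i x) ` {..<r}" by (rule image_cong) (auto simp: V'_def)
    moreover have "fam_indep {..<r} (\<lambda>i. V' i x)"
    proof -
      have "(\<Sum>i<r. c i *\<^sub>R V' i x) = (\<Sum>i<r. c i *\<^sub>R V i x)" for c by (rule sum.cong) (auto simp: V'_def)
      then show ?thesis using S1(4)[OF x] by (simp add: fam_indep_def)
    qed
    ultimately have "fam_indep (insert r {..<r}) (\<lambda>i. V' i x)"
      using fam_indep_insert[of "{..<r}" r "\<lambda>i. V' i x"] nW by (simp add: V'_def)
    moreover have "insert r {..<r} = {..<Suc r}" by auto
    moreover have "\<forall>i<Suc r. liegen Z A (V' i)" using V W by (auto simp: V'_def less_Suc_eq)
    ultimately have "R (Suc r)" unfolding R_def using S1(3)[OF x] by metis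
    then show False using max by fastforce
  qed
  have flag: "\<forall>x\<in>S1. weak_flag M D i x \<subseteq> ?E x" for i
  proof (induct i rule: nat_less_induct)
    case (1 i)
    consider "i = 0" | "i = Suc 0" | j where "i = Suc (Suc j)" by (metis not0_implies_Suc)
    then show ?case
    proof cases
      case 1 then show ?thesis by (simp add: span_0)
    next
      case 2
      show ?thesis
      proof
        fix x assume x: "x \<in> S1"
        have "{Z x, A x} \<subseteq> ?E x" using all[OF gen_Z x] all[OF gen_T x] by simp
        from span_minimal[OF this subspace_span] show "weak_flag M D i x \<subseteq> ?E x"
          using 2 Z(3)[OF S1(3)[OF x]] by simp
      qed
    next
      case (3 j)
      have IH: "weak_flag M D (Suc j) x \<subseteq> ?E x" if "x \<in> S1" for x using 1 3 that by auto
      have "weak_flag M D (Suc (Suc j)) x \<subseteq> ?E x" if x: "x \<in> S1" for x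
        by (rule flag_step[OF S1(1) finite_lessThan vV S1(4) Z(1,2) Z(3)[OF S1(3)] Z(4)[OF S1(3)] IH x])
          (auto intro: span_base all[OF _ x] gen_Z gen_T gen_br V)
      then show ?thesis using 3 by simp
    qed
  qed
  obtain \<mu> where "\<forall>q\<in>points M. weak_flag M D \<mu> q = T q" using bg unfolding bracket_generating_def by blast
  then have "T p0 \<subseteq> ?E p0" using flag[of \<mu>] S1(2) Sp[OF p0] by auto
  moreover have "\<exists>W. liegen Z A W \<and> W p0 = v" if v: "v \<in> ?E p0" for v
  proof -
    obtain c where c: "v = (\<Sum>i<r. c i *\<^sub>R V i p0)"
      using v unfolding in_span_image[OF finite_lessThan] by blast
    show ?thesis
      by (rule exI[of _ "\<lambda>x. \<Sum>i<r. c i *\<^sub>R V i x"], intro conjI liegen_sum finite_lessThan V c[symmetric])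
  qed
  ultimately show ?thesis using p0 by blast
qed

text \<open>For \<open>k = 0\<close> the fields indexed by \<open>GI 2\<close> are Z, A, [Z, A], [Z,
  [Z, A]] and [A, [Z, A]]. They span the third member of the flag where Z, A and [Z, A] are
  independent, and its dimension 5 makes them independent.\<close>

lemma good_base:
  assumes D: "rank2_distribution M D" and bg: "bracket_generating M D" and cube: "five_dimensional_cube M D"
    and O1: "opn O1" "O1 \<noteq> {}"
  obtains S Z A \<eta> where "good D 0 S Z A \<eta>" "S \<noteq> {}" "S \<subseteq> O1"
proof -
  obtain q where q: "q \<in> O1" using O1 by blast
  obtain S Z A where S: "opn S" "q \<in> S" "S \<subseteq> O1" and Z: "vf Z" "vf A"
    and DS: "\<And>p. p \<in> S \<Longrightarrow> D p = span {Z p, A p}" "\<And>p. p \<in> S \<Longrightarrow> dim (D p) = 2"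
    by (rule frame_global[OF D O1(1) q]) blast
  have Sp: "x \<in> S \<Longrightarrow> x \<in> points M" for x using opn_sub[OF S(1)] by auto
  define \<eta> where "\<eta> = lie_bracket A (adn Z A 1)"
  have v\<eta>: "vf \<eta>" unfolding \<eta>_def by (intro vf_br vf_adn Z)
  let ?f = "\<lambda>p g. fr Z A \<eta> g p"
  have vfr: "vf (fr Z A \<eta> g)" for g by (rule vf_fr[OF Z v\<eta>])
  have flag3: "dim (weak_flag M D (Suc (Suc (Suc 0))) p) = 5" if "p \<in> points M" for p
    using cube that by (simp add: five_dimensional_cube_def numeral_3_eq_3)
  let ?I3 = "insert (Eps 3) PI"
  have PIi: "fam_indep PI (?f x)" if "x \<in> S" for x by (rule PI_indep[of D x Z A \<eta>, OF DS(1,2)[OF that]])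
  have e3: "Eps 3 \<notin> PI" by (simp add: PI_def)
  \<comment> \<open>If [Z, A] depended on Z and A throughout \<open>S\<close>, the distribution
    would be involutive there, and the cube would have dimension at most 2.\<close>
  have "\<exists>p\<in>S. fam_indep ?I3 (?f p)"
  proof (rule ccontr)
    assume no: "\<not> ?thesis"
    have br: "lie_bracket Z A x \<in> span {Z x, A x}" if x: "x \<in> S" for x
    proof (rule ccontr)
      assume nb: "lie_bracket Z A x \<notin> span {Z x, A x}"
      have e: "?f x (Eps 3) = lie_bracket Z A x" by (simp add: eval_nat_numeral)
      have "?f x (Eps 3) \<notin> span (?f x ` PI)" unfolding PI(2) e by (rule nb)
      then have "fam_indep ?I3 (?f x)" by (rule fam_indep_insert[OF PI(1) e3 PIi[OF x]])
      then show False using no x by blast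
    qed
    have br': "lie_bracket A Z x \<in> span {Z x, A x}" if "x \<in> S" for x
      using span_neg[OF br[OF that]] by (subst br_antisym)
    have step: "weak_flag M D (Suc (Suc i)) x \<subseteq> span {Z x, A x}"
      if "\<And>x. x \<in> S \<Longrightarrow> weak_flag M D (Suc i) x \<subseteq> span {Z x, A x}" "x \<in> S" for i x
    proof (rule flag_step[OF S(1) PI(1) vfr PIi Z DS(1,2), of i x])
      show "weak_flag M D (Suc i) x \<subseteq> span (?f x ` PI)" if "x \<in> S" for x
        unfolding PI(2) by (rule \<open>\<And>x. x \<in> S \<Longrightarrow> weak_flag M D (Suc i) x \<subseteq> span {Z x, A x}\<close>[OF that])
      show "fr Z A \<eta> g x \<in> span {Z x, A x}" if "g \<in> PI" for g
        using that by (auto simp: PI_def intro: span_base)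
      show "lie_bracket (fr Z A \<eta> g) Z x \<in> span {Z x, A x}" "lie_bracket (fr Z A \<eta> g) A x \<in> span {Z x, A x}" if "g \<in> PI" for g
        using that br[OF \<open>x \<in> S\<close>] br'[OF \<open>x \<in> S\<close>] by (auto simp: PI_def br_self span_0)
    qed (use that in \<open>auto intro: span_base\<close>)
    have "weak_flag M D (Suc 0) x \<subseteq> span {Z x, A x}" if "x \<in> S" for x using DS(1)[OF that] by simp
    then have "weak_flag M D (Suc (Suc (Suc 0))) q \<subseteq> span {Z q, A q}"
      by (intro step S(2)) blast+
    then have "dim (weak_flag M D (Suc (Suc (Suc 0))) q) \<le> card {Z q, A q}" by (intro dim_le_card) auto
    also have "\<dots> \<le> 2" by (simp add: card_insert_if)
    finally show False using flag3[OF Sp[OF S(2)]] by simp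
  qed
  then obtain p0 where p0: "p0 \<in> S" "fam_indep ?I3 (?f p0)" by blast
  obtain S0 where S0: "opn S0" "p0 \<in> S0" "\<And>x. x \<in> S0 \<Longrightarrow> fam_indep ?I3 (?f x)"
    by (rule indep_near[OF Sp[OF p0(1)], of ?I3 "fr Z A \<eta>"]) (use vfr p0(2) PI(1) in auto)
  define S1 where "S1 = S0 \<inter> S"
  have S1: "opn S1" "p0 \<in> S1" "\<And>x. x \<in> S1 \<Longrightarrow> x \<in> S" "\<And>x. x \<in> S1 \<Longrightarrow> fam_indep ?I3 (?f x)"
    using S0 S p0 by (auto simp: S1_def)
  have fI: "finite ?I3" using PI(1) by simp
  have b3: "?f x (Eps 3) = lie_bracket Z A x" "?f x (Eps 4) = lie_bracket Z (lie_bracket Z A) x" for x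
    by (simp_all add: eval_nat_numeral)
  have sb: "?f x g \<in> span (?f x ` G)" if "g \<in> G" for x g G using that by (auto intro: span_base)
  have i3: "?I3 = {gX, Eps 2, Eps 3}" by (auto simp: PI_def)
  have g2: "GI 2 = {gX, Eta, Eps 2, Eps 3, Eps 4}"
  proof -
    have "{2..2 + 2 :: nat} = {2, 3, 4}" by auto
    then show ?thesis by (auto simp: GI_def)
  qed
  have fl2: "weak_flag M D (Suc (Suc 0)) x \<subseteq> span (?f x ` ?I3)" if x: "x \<in> S1" for x
  proof (rule flag_step[OF S1(1) PI(1) vfr PIi[OF S1(3)] Z DS(1)[OF S1(3)] DS(2)[OF S1(3)], of 0 x])
    show "weak_flag M D (Suc 0) x \<subseteq> span (?f x ` PI)" if "x \<in> S1" for x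
      unfolding PI(2) using DS(1)[OF S1(3)[OF that]] by simp
    show "fr Z A \<eta> g x \<in> span (?f x ` ?I3)" if "g \<in> PI" for g using that by (intro sb) auto
    show Zx: "Z x \<in> span (?f x ` ?I3)" "A x \<in> span (?f x ` ?I3)"
      using sb[of gX ?I3 x] sb[of "Eps 2" ?I3 x] by (simp_all add: PI_def)
    have b: "lie_bracket Z A x \<in> span (?f x ` ?I3)" using sb[of "Eps 3" ?I3 x] unfolding b3 by simp
    then have b': "lie_bracket A Z x \<in> span (?f x ` ?I3)" using span_neg[OF b] by (subst br_antisym)
    show "lie_bracket (fr Z A \<eta> g) Z x \<in> span (?f x ` ?I3)" "lie_bracket (fr Z A \<eta> g) A x \<in> span (?f x ` ?I3)"
      if "g \<in> PI" for g using that b b' by (auto simp: PI_def br_self span_0)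
  qed (use x in auto)
  have fl3: "weak_flag M D (Suc (Suc (Suc 0))) x \<subseteq> span (?f x ` GI 2)" if x: "x \<in> S1" for x
  proof (rule flag_step[OF S1(1) fI vfr S1(4) Z DS(1)[OF S1(3)] DS(2)[OF S1(3)] fl2 x])
    show "fr Z A \<eta> g x \<in> span (?f x ` GI 2)" if "g \<in> ?I3" for g using that by (intro sb) (auto simp: i3 g2)
    show Zx: "Z x \<in> span (?f x ` GI 2)" "A x \<in> span (?f x ` GI 2)"
      using sb[of gX "GI 2" x] sb[of "Eps 2" "GI 2" x] by (simp_all add: g2)
    have b: "lie_bracket Z A x \<in> span (?f x ` GI 2)" "lie_bracket Z (lie_bracket Z A) x \<in> span (?f x ` GI 2)"
      "lie_bracket A (lie_bracket Z A) x \<in> span (?f x ` GI 2)"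
      using sb[of "Eps 3" "GI 2" x] sb[of "Eps 4" "GI 2" x] sb[of Eta "GI 2" x] unfolding b3
      by (simp_all add: g2 \<eta>_def)
    have b': "lie_bracket A Z x \<in> span (?f x ` GI 2)" "lie_bracket (lie_bracket Z A) Z x \<in> span (?f x ` GI 2)"
      "lie_bracket (lie_bracket Z A) A x \<in> span (?f x ` GI 2)"
      using span_neg[OF b(1)] span_neg[OF b(2)] span_neg[OF b(3)]
      by (simp_all only: br_antisym[of A Z] br_antisym[of "lie_bracket Z A" Z] br_antisym[of "lie_bracket Z A" A])
    have e: "fr Z A \<eta> (Eps 3) = lie_bracket Z A" by (simp add: eval_nat_numeral)
    show "lie_bracket (fr Z A \<eta> g) Z x \<in> span (?f x ` GI 2)" "lie_bracket (fr Z A \<eta> g) A x \<in> span (?f x ` GI 2)"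
      if "g \<in> ?I3" for g
      using that b b' e unfolding i3 by (auto simp: br_self span_0)
  qed (assumption | rule subspace_span)+
  \<comment> \<open>A basis of the 5-dimensional cube lies in the span of the five fields, so these
    are independent by exchange.\<close>
  have ind5: "fam_indep (GI 2) (?f x)" if x: "x \<in> S1" for x
  proof -
    let ?W = "weak_flag M D (Suc (Suc (Suc 0))) x"
    obtain B where B: "B \<subseteq> ?W" "independent B" "?W \<subseteq> span B" "card B = dim ?W"
      using basis_exists[of ?W] by blast
    have cB: "card B = 5" using B(4) flag3[OF Sp[OF S1(3)[OF x]]] by simp
    have fB: "finite B" by (rule card_ge_0_finite) (simp add: cB)
    have "fam_indep B (\<lambda>b. b)"
      by (rule fam_indep_if_dim[OF fB]) (use B(2) in \<open>simp add: dim_eq_card_independent\<close>)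
    moreover have "(\<lambda>b. b) ` B \<subseteq> span (?f x ` GI 2)" using B(1) fl3[OF x] by simp
    ultimately show ?thesis
      by (rule fam_indep_span_trans(1)[OF fB _ _ finite_GI]) (simp add: cB card_GI)
  qed
  have "good D 0 S1 Z A \<eta>"
    unfolding good_def
  proof (intro conjI ballI allI impI)
    show "opn S1" "vf Z" "vf A" "vf \<eta>" by (rule S1 Z v\<eta>)+
    show "D p = span {Z p, A p}" "dim (D p) = 2" if "p \<in> S1" for p using DS[OF S1(3)[OF that]] by auto
    show "lie_bracket A (adn Z A i) p = 0" if "i \<le> 2 * 0" for i p using that br_self by simp
    show "lie_bracket A (adn Z A (2 * 0 + 1)) p = \<eta> p" for p by (simp add: \<eta>_def)
    show "lie_bracket (adn Z A a) \<eta> p = 0" if "a < 0" for a p using that by simp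
    show "fam_indep (GI (0 + 2)) (?f p)" if "p \<in> S1" for p using ind5[OF that] by (simp only: add_0)
    show "\<exists>p\<in>O'. \<forall>v\<in>T p. \<exists>V. liegen Z A V \<and> V p = v" if O': "opn O'" "O' \<subseteq> S1" "O' \<noteq> {}" for O'
    proof (rule dense_generation[OF O'(1) Z _ _ bg O'(3)])
      show "D x = span {Z x, A x}" "dim (D x) = 2" if "x \<in> O'" for x using DS[OF S1(3)] that O'(2) by auto
    qed
  qed
  moreover have "S1 \<subseteq> O1" using S1(3) S(3) by auto
  ultimately show ?thesis using S1(2) that by blast
qed

end

section \<open>The symbol of an adapted frame\<close>

text \<open>The negative of \<open>wght k (k + 5)\<close> on the generators in
  \<open>GI (2 * k + 2)\<close>; the subtraction is harmless because only \<open>Eps i\<close> with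
  \<open>i \<ge> 2\<close> occur there. The default 0 concerns generators outside this set.\<close>

fun gwt :: "nat \<Rightarrow> gen \<Rightarrow> nat" where
  "gwt k gX = 1"
| "gwt k (Eps i) = i - 1"
| "gwt k Eta = 2 * k + 3"
| "gwt k _ = 0"

text \<open>Indexes the part of the frame that will turn out to span the \<open>i\<close>-th member
  of the flag.\<close>

definition GW :: "nat \<Rightarrow> nat \<Rightarrow> gen set" where
  "GW k i = {g \<in> GI (2 * k + 2). gwt k g \<le> i}"

lemma GW_subset: "GW k i \<subseteq> GI (2 * k + 2)" and finite_GW [simp]: "finite (GW k i)"
  and GW_mono: "i \<le> j \<Longrightarrow> GW k i \<subseteq> GW k j"
  by (auto simp: GW_def)

lemma gwt_pos: "g \<in> GI r \<Longrightarrow> 1 \<le> gwt k g"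
  by (auto simp: GI_def)

lemma gwt_le: "g \<in> GI (2 * k + 2) \<Longrightarrow> gwt k g \<le> 2 * k + 3"
  by (auto simp: GI_def)

lemma GI_gens: "GI (2 * k + 2) \<subseteq> gens (k + 5)"
  by (auto simp: GI_def gens_def)

lemma finite_gens [simp]: "finite (gens m)"
  by (simp add: gens_def)

text \<open>The bracket table respects the grading and does not leave the negative part. This is
  checked on all pairs of generators.\<close>

lemma gen_bracket_supp:
  assumes "g \<in> GI (2 * k + 2)" "h \<in> GI (2 * k + 2)" "gen_bracket (k + 5) g h l \<noteq> 0"
  shows "l \<in> GI (2 * k + 2) \<and> gwt k l = gwt k g + gwt k h"
  using assms(1)
proof (cases rule: GI_cases)
  case 1
  from assms(2) show ?thesis
    by (cases rule: GI_cases) (use assms(3) 1 in \<open>auto simp: gv_def GI_def zero_fun_def fun_Compl_def split: if_splits\<close>)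
next
  case 2
  from assms(2) show ?thesis
    by (cases rule: GI_cases) (use assms(3) 2 in \<open>auto simp: gv_def GI_def zero_fun_def fun_Compl_def split: if_splits\<close>)
next
  case (3 i)
  from assms(2) show ?thesis
    by (cases rule: GI_cases) (use assms(3) 3 in \<open>auto simp: gv_def GI_def zero_fun_def fun_Compl_def scaleR_fun_def split: if_splits\<close>)
qed

lemma span_gv:
  assumes "finite B" shows "span (gv ` B) = {f. \<forall>g. f g \<noteq> 0 \<longrightarrow> g \<in> B}"
proof (intro equalityI subsetI)
  fix f :: "gen \<Rightarrow> real" assume "f \<in> span (gv ` B)"
  then obtain c where "f = (\<Sum>g\<in>B. c g *\<^sub>R gv g)" using in_span_image[OF assms] by blast
  then have "f g = (\<Sum>h\<in>B. if h = g then c h else 0)" for g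
    by (simp add: sum_apply fun_arith gv_def) (rule sum.cong, auto)
  then show "f \<in> {f. \<forall>g. f g \<noteq> 0 \<longrightarrow> g \<in> B}" using assms by auto
next
  fix f :: "gen \<Rightarrow> real" assume f: "f \<in> {f. \<forall>g. f g \<noteq> 0 \<longrightarrow> g \<in> B}"
  have "f = (\<Sum>g\<in>B. f g *\<^sub>R gv g)"
  proof
    fix g
    have "(\<Sum>h\<in>B. f h *\<^sub>R gv h) g = (\<Sum>h\<in>B. if h = g then f h else 0)"
      by (simp add: sum_apply fun_arith gv_def) (rule sum.cong, auto)
    then show "f g = (\<Sum>h\<in>B. f h *\<^sub>R gv h) g" using f assms by auto
  qed
  then show "f \<in> span (gv ` B)" by (rule in_spanI)
qed

text \<open>Turns membership in a component into a condition on the support. Positive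
  \<open>i\<close> is needed, since \<open>gH\<close> and \<open>gE\<close> have weight 0 and lie
  outside \<open>GI\<close>.\<close>

lemma s_alg_homog:
  assumes "i \<ge> 1"
  shows "homog (s_alg k (k + 5)) i = {f. \<forall>g. f g \<noteq> 0 \<longrightarrow> g \<in> GI (2 * k + 2) \<and> gwt k g = i}"
proof -
  have "{a \<in> gens (k + 5). wght k (k + 5) a = - int i} = {g \<in> GI (2 * k + 2). gwt k g = i}"
    using assms by (auto simp: gens_def GI_def)
  then have "homog (s_alg k (k + 5)) i = span (gv ` {g \<in> GI (2 * k + 2). gwt k g = i})"
    by (simp only: s_alg_def graded_alg.select_convs)
  moreover have "finite {g \<in> GI (2 * k + 2). gwt k g = i}" by simp
  ultimately show ?thesis by (simp only: span_gv mem_Collect_eq)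
qed

text \<open>The dimension equals the cardinality of \<open>GI (2 * k + 2)\<close>, so independence
  makes the fields a frame of the whole tangent bundle over \<open>S\<close>.\<close>

locale symbol_frame = manifold M for M :: "'a mfd" +
  fixes D :: "'a dist" and k :: nat and S :: "'a set" and Z A \<eta> :: "'a \<Rightarrow> 'a tvec"
  assumes D: "rank2_distribution M D" and good: "good D k S Z A \<eta>" and dimM: "mdim M = 2 * k + 5"
    and ind: "\<And>p. p \<in> S \<Longrightarrow> fam_indep (GI (2 * k + 2)) (\<lambda>g. fr Z A \<eta> g p)"
begin

abbreviation F :: "gen \<Rightarrow> 'a \<Rightarrow> 'a tvec" where "F \<equiv> fr Z A \<eta>"
abbreviation Gm :: "gen set" where "Gm \<equiv> GI (2 * k + 2)"
abbreviation gb :: "gen \<Rightarrow> gen \<Rightarrow> gen \<Rightarrow> real" where "gb \<equiv> gen_bracket (k + 5)"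
abbreviation SpW :: "nat \<Rightarrow> 'a \<Rightarrow> 'a tvec set" where "SpW i p \<equiv> span ((\<lambda>g. F g p) ` GW k i)"

lemmas G = goodD[OF good]

lemma vfF: "vf (F g)"
  by (rule vf_fr[OF G(2-4)])

lemma S_pts: "p \<in> S \<Longrightarrow> p \<in> points M"
  using opn_sub[OF G(1)] by auto

lemma frame_span: "p \<in> S \<Longrightarrow> span ((\<lambda>g. F g p) ` Gm) = T p"
  by (rule indep_spans_T[OF S_pts finite_GI ind]) (auto simp: card_GI dimM intro: vf_T[OF vfF S_pts])

lemma GW_top: "2 * k + 3 \<le> i \<Longrightarrow> GW k i = Gm"
  using gwt_le le_trans unfolding GW_def by blast

lemma SpW_mono: "i \<le> j \<Longrightarrow> SpW i p \<subseteq> SpW j p"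
  by (intro span_mono image_mono GW_mono)

lemma F_SpW: "g \<in> Gm \<Longrightarrow> gwt k g \<le> i \<Longrightarrow> F g p \<in> SpW i p"
  by (rule span_base) (auto simp: GW_def)

lemma sum_gv: "h \<in> Gm \<Longrightarrow> (\<Sum>l\<in>Gm. (c * gv h l) *\<^sub>R F l p) = c *\<^sub>R F h p"
proof -
  assume h: "h \<in> Gm"
  have "(\<Sum>l\<in>Gm. (c * gv h l) *\<^sub>R F l p) = (\<Sum>l\<in>Gm. if l = h then c *\<^sub>R F l p else 0)"
    by (rule sum.cong) (auto simp: gv_def)
  then show ?thesis using h by simp
qed

text \<open>Up to total weight 2 k + 3 the frame satisfies the relations of the algebra exactly, not
  merely modulo lower terms. For two iterated brackets the bound says a + b is at most 2 k + 1, the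
  range of \<open>good_brackets\<close>.\<close>

lemma bracket_gens_aux:
  assumes p: "p \<in> S" and g: "g \<in> Gm" and h: "h \<in> Gm" and lt: "gwt k g + gwt k h \<le> 2 * k + 3"
  shows "lie_bracket (F g) (F h) p = (\<Sum>l\<in>Gm. gb g h l *\<^sub>R F l p)"
proof -
  have one: "(\<Sum>l\<in>Gm. gv h l *\<^sub>R F l p) = F h p" if "h \<in> Gm" for h using sum_gv[OF that, of 1] by simp
  have ZE: "lie_bracket Z (F (Eps (b + 2))) p = (\<Sum>l\<in>Gm. gb gX (Eps (b + 2)) l *\<^sub>R F l p)"
    if "b \<le> 2 * k + 1" for b
  proof -
    have "Eps (b + 1 + 2) \<in> Gm" by (rule Eps_GI) (use that in simp)
    from one[OF this] show ?thesis using that by (simp add: eval_nat_numeral)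
  qed
  from g show ?thesis
  proof (cases rule: GI_cases)
    case g1: 1
    from h show ?thesis
    proof (cases rule: GI_cases)
      case 1 then show ?thesis using g1 by (simp add: br_self fun_arith)
    next
      case 2 then show ?thesis using g1 lt by simp
    next
      case (3 b)
      then have "b \<le> 2 * k + 1" using g1 lt by simp
      from ZE[OF this] show ?thesis using g1 3 by simp
    qed
  next
    case g2: 2
    then show ?thesis using lt gwt_pos[OF h, of k] by simp
  next
    case g3: (3 a)
    from h show ?thesis
    proof (cases rule: GI_cases)
      case 1
      then have "a \<le> 2 * k + 1" using g3 lt by simp
      note ze = ZE[OF this]
      have "lie_bracket (F (Eps (a + 2))) Z p = - (\<Sum>l\<in>Gm. gb gX (Eps (a + 2)) l *\<^sub>R F l p)"
        unfolding br_antisym[of "F (Eps (a + 2))" Z] ze ..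
      also have "\<dots> = (\<Sum>l\<in>Gm. gb (Eps (a + 2)) gX l *\<^sub>R F l p)"
        by (simp add: sum_negf[symmetric] fun_arith)
      finally show ?thesis using g3 1 by simp
    next
      case 2 then show ?thesis using g3 lt by simp
    next
      case (3 b)
      show ?thesis
      proof (cases "a + b \<le> 2 * k")
        case True
        then show ?thesis using good_brackets(1)[OF good p True] g3 3 by (simp add: fun_arith)
      next
        case False
        then have ab: "a + b = 2 * k + 1" using g3 3 lt by simp
        then have "gb (Eps (a + 2)) (Eps (b + 2)) = (- 1) ^ a *\<^sub>R gv Eta" by simp
        moreover have "(\<Sum>l\<in>Gm. ((- 1) ^ a * gv Eta l) *\<^sub>R F l p) = (- 1) ^ a *\<^sub>R F Eta p"
          by (rule sum_gv) (rule Eps_GI)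
        ultimately show ?thesis using good_brackets(2)[OF good p ab] g3 3 by (simp add: fun_arith)
      qed
    qed
  qed
qed

text \<open>Beyond total weight 2 k + 3 the structure constants vanish and the span one step below
  is already the full tangent space, so the entire bracket counts as the error
  \<open>u\<close>.\<close>

lemma bracket_gens:
  assumes p: "p \<in> S" and g: "g \<in> Gm" and h: "h \<in> Gm" and i: "gwt k g + gwt k h \<le> i"
  shows "lie_bracket (F g) (F h) p \<in> SpW i p"
    "\<exists>u\<in>SpW (gwt k g + gwt k h - 1) p. lie_bracket (F g) (F h) p = (\<Sum>l\<in>Gm. gb g h l *\<^sub>R F l p) + u"
proof -
  let ?w = "gwt k g + gwt k h"
  have T: "lie_bracket (F g) (F h) p \<in> T p" by (rule br_T[OF vfF vfF S_pts[OF p]])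
  have "lie_bracket (F g) (F h) p \<in> SpW ?w p \<and>
    (\<exists>u\<in>SpW (?w - 1) p. lie_bracket (F g) (F h) p = (\<Sum>l\<in>Gm. gb g h l *\<^sub>R F l p) + u)"
  proof (cases "?w \<le> 2 * k + 3")
    case True
    note e = bracket_gens_aux[OF p g h True]
    have "(\<Sum>l\<in>Gm. gb g h l *\<^sub>R F l p) \<in> SpW ?w p"
    proof (rule span_sum)
      fix l assume l: "l \<in> Gm"
      show "gb g h l *\<^sub>R F l p \<in> SpW ?w p"
      proof (cases "gb g h l = 0")
        case False
        then show ?thesis using gen_bracket_supp[OF g h False] F_SpW[OF l, of ?w p] by (simp add: span_scale)
      qed (simp add: span_0)
    qed
    then show ?thesis using e by (intro conjI bexI[of _ 0]) (simp_all add: span_0)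
  next
    case False
    then have w: "2 * k + 3 \<le> ?w - 1" "2 * k + 3 \<le> ?w" by linarith+
    note GW_top[OF w(1)] GW_top[OF w(2)]
    moreover have "gb g h l = 0" if "l \<in> Gm" for l
      using gen_bracket_supp[OF g h, of l] gwt_le[of l k] False by fastforce
    ultimately show ?thesis using T frame_span[OF p] by simp
  qed
  then show "lie_bracket (F g) (F h) p \<in> SpW i p"
    "\<exists>u\<in>SpW (gwt k g + gwt k h - 1) p. lie_bracket (F g) (F h) p = (\<Sum>l\<in>Gm. gb g h l *\<^sub>R F l p) + u"
    using SpW_mono[OF i] by blast+
qed

text \<open>Sections must be global and lie in the flag at every point of the manifold, also off
  \<open>S\<close>. Cutting off by a bump achieves this because the members of the flag are linear
  subspaces.\<close>

lemma section_extend: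
  assumes V: "vf V" and p: "p \<in> S" and fl: "\<And>x. x \<in> S \<Longrightarrow> V x \<in> weak_flag M D i x"
  obtains V' W where "V' \<in> sections M (weak_flag M D i)" "opn W" "p \<in> W" "W \<subseteq> S" "\<And>x. x \<in> W \<Longrightarrow> V' x = V x"
proof -
  obtain V' W where V': "vf V'" "opn W" "p \<in> W" "W \<subseteq> S" "\<And>x. x \<in> W \<Longrightarrow> V' x = V x"
    "\<And>x. V' x = 0 \<or> (x \<in> S \<and> (\<exists>c. V' x = c *\<^sub>R V x))"
    by (rule globalize[OF vf_restrict[OF V G(1)] G(1) p]) blast
  have "V' x \<in> weak_flag M D i x" if x: "x \<in> points M" for x
    using V'(6)[of x] fl[of x] subspace_0[OF subspace_flag[OF D x]] subspace_scale[OF subspace_flag[OF D x]] by metis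
  then have "V' \<in> sections M (weak_flag M D i)" using V'(1) by (simp add: sections_def)
  then show ?thesis by (rule that[OF _ V'(2-5)])
qed

lemma sections_flag1: "sections M (weak_flag M D (Suc 0)) = sections M D"
  by simp

lemma GW_1: "GW k (Suc 0) = PI"
  by (auto simp: GW_def GI_def PI_def)

lemma gE: "gX \<in> Gm" "Eps 2 \<in> Gm"
  by (auto simp: GI_def)

text \<open>The upper bound is \<open>flag_step\<close>. For the lower bound, each generator of a
  new weight is, up to sign, the bracket with \<open>Z\<close> or \<open>A\<close> of a frame field
  one weight lower: iterated brackets arise from \<open>Z\<close>, and \<open>\<eta>\<close> arises
  from \<open>A\<close> and ad(Z)^(2 k + 1) A. Cut-off fields supply the global sections.\<close>

lemma flag_eq: "\<forall>p\<in>S. weak_flag M D i p = SpW i p"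
proof (induct i rule: nat_less_induct)
  case (1 i)
  consider "i = 0" | "i = Suc 0" | j where "i = Suc (Suc j)" by (metis not0_implies_Suc)
  then show ?case
  proof cases
    case 1
    have "g \<notin> GW k 0" for g using gwt_pos[of g "2 * k + 2" k] by (auto simp: GW_def)
    then have "GW k 0 = {}" by blast
    then show ?thesis using 1 by simp
  next
    case 2
    have "D p = span {Z p, A p}" if "p \<in> S" for p by (rule G(5)[OF that])
    then show ?thesis using 2 by (simp add: GW_1 PI)
  next
    case (3 j)
    have IH: "weak_flag M D (Suc j) p = SpW (Suc j) p" if "p \<in> S" for p using 1 3 that by auto
    have fl1: "weak_flag M D (Suc 0) p = SpW (Suc 0) p" if "p \<in> S" for p
      using G(5)[OF that] by (simp add: GW_1 PI)
    have "weak_flag M D (Suc (Suc j)) p \<subseteq> SpW (Suc (Suc j)) p" if p: "p \<in> S" for p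
    proof (rule flag_step[OF G(1) finite_GW vfF _ G(2,3,5,6) _ p subspace_span])
      show "fam_indep (GW k (Suc j)) (\<lambda>i. F i x)" if "x \<in> S" for x
        by (rule fam_indep_subset[OF finite_GI GW_subset ind[OF that]])
      show "weak_flag M D (Suc j) x \<subseteq> SpW (Suc j) x" if "x \<in> S" for x using IH[OF that] by simp
      show "F g p \<in> SpW (Suc (Suc j)) p" if "g \<in> GW k (Suc j)" for g
        using that by (intro F_SpW) (auto simp: GW_def)
      show "Z p \<in> SpW (Suc (Suc j)) p" using F_SpW[OF gE(1), of "Suc (Suc j)" p] by simp
      show "A p \<in> SpW (Suc (Suc j)) p" using F_SpW[OF gE(2), of "Suc (Suc j)" p] by simp
      show "lie_bracket (F g) Z p \<in> SpW (Suc (Suc j)) p" if "g \<in> GW k (Suc j)" for g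
        using bracket_gens(1)[OF p _ gE(1), of g "Suc (Suc j)"] that by (simp add: GW_def)
      show "lie_bracket (F g) A p \<in> SpW (Suc (Suc j)) p" if "g \<in> GW k (Suc j)" for g
        using bracket_gens(1)[OF p _ gE(2), of g "Suc (Suc j)"] that by (simp add: GW_def)
    qed
    moreover have "SpW (Suc (Suc j)) p \<subseteq> weak_flag M D (Suc (Suc j)) p" if p: "p \<in> S" for p
    proof (rule span_minimal[OF _ subspace_flag[OF D S_pts[OF p]]], clarify)
      fix g assume g: "g \<in> GW k (Suc (Suc j))"
      have br: "lie_bracket V W p \<in> weak_flag M D (Suc (Suc j)) p"
        if V: "vf V" "\<And>x. x \<in> S \<Longrightarrow> V x \<in> SpW (Suc j) x" and W: "vf W" "\<And>x. x \<in> S \<Longrightarrow> W x \<in> SpW (Suc 0) x" for V W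
      proof -
        obtain V' W1 where V': "V' \<in> sections M (weak_flag M D (Suc j))" "opn W1" "p \<in> W1" "W1 \<subseteq> S"
          "\<And>x. x \<in> W1 \<Longrightarrow> V' x = V x"
          by (rule section_extend[OF V(1) p, of "Suc j"]) (use V(2) IH in auto)
        obtain W' W2 where W': "W' \<in> sections M (weak_flag M D (Suc 0))" "opn W2" "p \<in> W2" "W2 \<subseteq> S"
          "\<And>x. x \<in> W2 \<Longrightarrow> W' x = W x"
          by (rule section_extend[OF W(1) p, of "Suc 0"]) (use W(2) fl1 in auto)
        have "lie_bracket V W p = lie_bracket V' W' p"
          by (rule br_local[of V V' W W' "W1 \<inter> W2"]) (use V V' W W' in \<open>auto simp: sections_def\<close>)
        then show ?thesis using V'(1) W'(1) unfolding weak_flag.simps(3) sections_flag1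
          by (intro span_base) blast
      qed
      have Zs: "Z x \<in> SpW (Suc 0) x" "A x \<in> SpW (Suc 0) x" for x
        using F_SpW[OF gE(1), of "Suc 0" x] F_SpW[OF gE(2), of "Suc 0" x] by auto
      show "F g p \<in> weak_flag M D (Suc (Suc j)) p"
      proof (cases "gwt k g \<le> Suc j")
        case True
        then have "F g p \<in> weak_flag M D (Suc j) p"
          unfolding IH[OF p] using g by (intro F_SpW) (auto simp: GW_def)
        then show ?thesis unfolding weak_flag.simps(3) by (intro span_base) blast
      next
        case False
        then have gw: "gwt k g = Suc (Suc j)" "g \<in> Gm" using g by (auto simp: GW_def)
        from gw(2) show ?thesis
        proof (cases rule: GI_cases)
          case 1 then show ?thesis using gw by simp
        next
          case 2
          have "Eps (2 * k + 1 + 2) \<in> Gm" by (rule Eps_GI) simp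
          then have "F (Eps (2 * k + 1 + 2)) x \<in> SpW (Suc j) x" for x
            by (rule F_SpW) (use gw 2 in simp)
          then have "lie_bracket (F (Eps (2 * k + 1 + 2))) A p \<in> weak_flag M D (Suc (Suc j)) p"
            by (intro br vfF G(3) Zs)
          then have "- lie_bracket (F (Eps (2 * k + 1 + 2))) A p \<in> weak_flag M D (Suc (Suc j)) p"
            by (rule subspace_neg[OF subspace_flag[OF D S_pts[OF p]]])
          then show ?thesis using G(8)[OF p] 2 br_antisym[of A "F (Eps (2 * k + 1 + 2))" p] by simp
        next
          case (3 b)
          then have b: "b = Suc j" using gw by simp
          have "Eps (j + 2) \<in> Gm" using 3 b by (intro Eps_GI) simp
          then have "F (Eps (j + 2)) x \<in> SpW (Suc j) x" for x by (rule F_SpW) simp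
          then have "lie_bracket (F (Eps (j + 2))) Z p \<in> weak_flag M D (Suc (Suc j)) p"
            by (intro br vfF G(2) Zs)
          then have "- lie_bracket (F (Eps (j + 2))) Z p \<in> weak_flag M D (Suc (Suc j)) p"
            by (rule subspace_neg[OF subspace_flag[OF D S_pts[OF p]]])
          then show ?thesis using 3 b br_antisym[of Z "F (Eps (j + 2))" p] by simp
        qed
      qed
    qed
    ultimately show ?thesis using 3 by blast
  qed
qed

definition cof :: "'a \<Rightarrow> 'a tvec \<Rightarrow> gen \<Rightarrow> real" where
  "cof p v = (SOME c. v = (\<Sum>g\<in>Gm. c g *\<^sub>R F g p))"

text \<open>The part of weight \<open>i\<close> of the coordinate vector. On the \<open>i\<close>-th
  member of the flag its kernel is the previous member (\<open>Phi_low\<close>,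
  \<open>Phi_zero\<close>) and it maps onto the component of the algebra (\<open>Phi_onto\<close>),
  so it realises the quotient.\<close>

definition Phi :: "'a \<Rightarrow> nat \<Rightarrow> 'a tvec \<Rightarrow> gen \<Rightarrow> real" where
  "Phi p i v = (\<lambda>g. if g \<in> Gm \<and> gwt k g = i then cof p v g else 0)"

lemma Phi_comb:
  assumes p: "p \<in> S" and v: "v = (\<Sum>g\<in>Gm. c g *\<^sub>R F g p)"
  shows "Phi p i v = (\<lambda>g. if g \<in> Gm \<and> gwt k g = i then c g else 0)"
proof -
  have "v = (\<Sum>g\<in>Gm. cof p v g *\<^sub>R F g p)" unfolding cof_def by (rule someI[of _ c]) (rule v)
  then have "(\<Sum>g\<in>Gm. (cof p v g - c g) *\<^sub>R F g p) = 0"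
    using v by (simp add: scaleR_left_diff_distrib sum_subtractf)
  then have "\<forall>g\<in>Gm. cof p v g - c g = 0"
    by (rule mp[OF spec[OF ind[OF p, unfolded fam_indep_def], where x = "\<lambda>g. cof p v g - c g"]])
  then show ?thesis by (auto simp: Phi_def)
qed

lemma T_comb: "p \<in> S \<Longrightarrow> v \<in> T p \<Longrightarrow> \<exists>c. v = (\<Sum>g\<in>Gm. c g *\<^sub>R F g p)"
  unfolding frame_span[symmetric] in_span_image[OF finite_GI] .

lemma Phi_lin:
  assumes p: "p \<in> S" and v: "v \<in> T p" "w \<in> T p"
  shows "Phi p i (a *\<^sub>R v + b *\<^sub>R w) = a *\<^sub>R Phi p i v + b *\<^sub>R Phi p i w"
proof -
  obtain c d where cd: "v = (\<Sum>g\<in>Gm. c g *\<^sub>R F g p)" "w = (\<Sum>g\<in>Gm. d g *\<^sub>R F g p)"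
    using T_comb[OF p] v by meson
  have "a *\<^sub>R v + b *\<^sub>R w = (\<Sum>g\<in>Gm. (a * c g + b * d g) *\<^sub>R F g p)"
    by (simp add: cd scaleR_sum_right scaleR_left_distrib sum.distrib)
  from Phi_comb[OF p this] Phi_comb[OF p cd(1)] Phi_comb[OF p cd(2)] show ?thesis
    by (auto simp: fun_arith)
qed

lemma Phi_add: "p \<in> S \<Longrightarrow> v \<in> T p \<Longrightarrow> w \<in> T p \<Longrightarrow> Phi p i (v + w) = Phi p i v + Phi p i w"
  using Phi_lin[of p v w i 1 1] by simp

lemma Phi_scale: "p \<in> S \<Longrightarrow> v \<in> T p \<Longrightarrow> Phi p i (a *\<^sub>R v) = a *\<^sub>R Phi p i v"
  using Phi_lin[of p v v i a 0] by simp

lemma Phi_sum: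
  assumes p: "p \<in> S"
  shows "finite X \<Longrightarrow> (\<And>x. x \<in> X \<Longrightarrow> v x \<in> T p) \<Longrightarrow> Phi p i (\<Sum>x\<in>X. c x *\<^sub>R v x) = (\<Sum>x\<in>X. c x *\<^sub>R Phi p i (v x))"
proof (induct X rule: finite_induct)
  case empty
  show ?case using Phi_scale[OF p subspace_0[OF subspace_T], of i 0] by simp
next
  case (insert x X)
  have "(\<Sum>x\<in>X. c x *\<^sub>R v x) \<in> T p"
    using insert.prems by (intro subspace_sum[OF subspace_T] subspace_scale[OF subspace_T]) auto
  moreover have "c x *\<^sub>R v x \<in> T p" "v x \<in> T p" using insert.prems by (auto intro: subspace_scale[OF subspace_T])
  ultimately show ?case
    using insert.hyps(1,2) insert.hyps(3)[OF insert.prems[OF insertI2]] Phi_add[OF p] Phi_scale[OF p] by simp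
qed

lemma SpW_comb:
  assumes "v \<in> SpW i p" shows "\<exists>c. v = (\<Sum>g\<in>Gm. c g *\<^sub>R F g p) \<and> (\<forall>g. i < gwt k g \<longrightarrow> c g = 0)"
proof -
  obtain c where c: "v = (\<Sum>g\<in>GW k i. c g *\<^sub>R F g p)" using assms unfolding in_span_image[OF finite_GW] by blast
  have "(\<Sum>g\<in>Gm. (if g \<in> GW k i then c g else 0) *\<^sub>R F g p) = (\<Sum>g\<in>GW k i. c g *\<^sub>R F g p)"
    by (rule sum.mono_neutral_cong_right) (use GW_subset in auto)
  then show ?thesis using c by (intro exI[of _ "\<lambda>g. if g \<in> GW k i then c g else 0"]) (auto simp: GW_def)
qed

lemma SpW_T: "p \<in> S \<Longrightarrow> SpW i p \<subseteq> T p"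
  unfolding frame_span[symmetric] by (intro span_mono image_mono GW_subset)

lemma Phi_low: "p \<in> S \<Longrightarrow> v \<in> SpW j p \<Longrightarrow> j < i \<Longrightarrow> Phi p i v = 0"
proof -
  assume p: "p \<in> S" and v: "v \<in> SpW j p" and ji: "j < i"
  obtain c where c: "v = (\<Sum>g\<in>Gm. c g *\<^sub>R F g p)" "\<forall>g. j < gwt k g \<longrightarrow> c g = 0" using SpW_comb[OF v] by blast
  show ?thesis unfolding Phi_comb[OF p c(1)] by (rule ext) (use c(2) ji in \<open>simp add: fun_arith\<close>)
qed

lemma Phi_zero: "p \<in> S \<Longrightarrow> v \<in> SpW i p \<Longrightarrow> Phi p i v = 0 \<Longrightarrow> 1 \<le> i \<Longrightarrow> v \<in> SpW (i - 1) p"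
proof -
  assume p: "p \<in> S" and v: "v \<in> SpW i p" and z: "Phi p i v = 0" and i: "1 \<le> i"
  obtain c where c: "v = (\<Sum>g\<in>Gm. c g *\<^sub>R F g p)" "\<forall>g. i < gwt k g \<longrightarrow> c g = 0" using SpW_comb[OF v] by blast
  have c0: "c g = 0" if "g \<in> Gm" "g \<notin> GW k (i - 1)" for g
  proof (cases "gwt k g = i")
    case True
    then show ?thesis using fun_cong[OF z, of g] that(1) unfolding Phi_comb[OF p c(1)] by (simp add: fun_arith)
  next
    case False
    then have "i < gwt k g" using that i by (auto simp: GW_def)
    then show ?thesis using c(2) by simp
  qed
  have "v = (\<Sum>g\<in>GW k (i - 1). c g *\<^sub>R F g p)"
    unfolding c(1) by (rule sum.mono_neutral_right) (use c0 GW_subset in auto)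
  then show ?thesis by (rule in_spanI)
qed

lemma Phi_onto:
  assumes p: "p \<in> S" and f: "\<forall>g. f g \<noteq> 0 \<longrightarrow> g \<in> Gm \<and> gwt k g = i"
  shows "\<exists>v\<in>SpW i p. Phi p i v = f"
proof
  let ?v = "\<Sum>g\<in>Gm. f g *\<^sub>R F g p"
  show "?v \<in> SpW i p"
  proof (rule span_sum)
    fix g assume "g \<in> Gm"
    then show "f g *\<^sub>R F g p \<in> SpW i p"
      using f F_SpW[of g i p] by (cases "f g = 0") (auto intro: span_scale simp: span_0)
  qed
  show "Phi p i ?v = f" unfolding Phi_comb[OF p refl] using f by fastforce
qed

lemma Phi_supp: "\<forall>g. Phi p i v g \<noteq> 0 \<longrightarrow> g \<in> Gm \<and> gwt k g = i"
  by (simp add: Phi_def)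

text \<open>The derivatives of the coefficients multiply frame fields of weight at most
  \<open>i\<close> or \<open>j\<close>, and both are at most \<open>i + j - 1\<close> as
  \<open>i\<close> and \<open>j\<close> are positive. Only the structure constants survive in weight
  \<open>i + j\<close>; in particular the result depends on the two vectors at \<open>p\<close> and
  not on their extensions.\<close>

lemma Phi_bracket:
  assumes p: "p \<in> S" and V: "V \<in> sections M (weak_flag M D i)" and W: "W \<in> sections M (weak_flag M D j)"
    and ij: "1 \<le> i" "1 \<le> j"
  shows "lie_bracket V W p \<in> SpW (i + j) p"
    "Phi p (i + j) (lie_bracket V W p) = gl2_heis_bracket (k + 5) (Phi p i (V p)) (Phi p j (W p))"
proof -
  have vV: "vf V" "vf W" using V W by (auto simp: sections_def)
  have indW: "fam_indep (GW k i) (\<lambda>g. F g p)" for i by (rule fam_indep_subset[OF finite_GI GW_subset ind[OF p]])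
  have Vs: "V x \<in> SpW i x" "W x \<in> SpW j x" if "x \<in> S" for x
    using V W flag_eq that S_pts[OF that] by (auto simp: sections_def)
  obtain S1 where S1: "opn S1" "p \<in> S1" "S1 \<subseteq> S" "comb (GW k i) F S1 V"
    by (rule span_comb[OF finite_GW vfF indW vV(1) G(1) p Vs(1)])
  obtain S2 where S2: "opn S2" "p \<in> S2" "S2 \<subseteq> S" "comb (GW k j) F S2 W"
    by (rule span_comb[OF finite_GW vfF indW vV(2) G(1) p Vs(2)])
  obtain a where a: "\<And>g. g \<in> GW k i \<Longrightarrow> smooth_fun M (a g)" "\<And>x. x \<in> S1 \<Longrightarrow> V x = (\<Sum>g\<in>GW k i. a g x *\<^sub>R F g x)"
    using S1(4) unfolding comb_def by blast
  obtain b where b: "\<And>g. g \<in> GW k j \<Longrightarrow> smooth_fun M (b g)" "\<And>x. x \<in> S2 \<Longrightarrow> W x = (\<Sum>g\<in>GW k j. b g x *\<^sub>R F g x)"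
    using S2(4) unfolding comb_def by blast
  have br: "lie_bracket V W p = (\<Sum>g\<in>GW k i. \<Sum>h\<in>GW k j. (a g p * b h p) *\<^sub>R lie_bracket (F g) (F h) p)
    + (\<Sum>h\<in>GW k j. V p (b h) *\<^sub>R F h p) - (\<Sum>g\<in>GW k i. W p (a g) *\<^sub>R F g p)"
    by (rule bracket_expand[where S = "S1 \<inter> S2", OF finite_GW finite_GW vfF vfF a(1) b(1) vV]) (use S1 S2 a b in auto)
  let ?t = "\<lambda>g h. gwt k g + gwt k h"
  define u where "u = (\<lambda>g h. lie_bracket (F g) (F h) p - (\<Sum>l\<in>Gm. gb g h l *\<^sub>R F l p))"
  have u: "u g h \<in> SpW (?t g h - 1) p" "lie_bracket (F g) (F h) p = (\<Sum>l\<in>Gm. gb g h l *\<^sub>R F l p) + u g h"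
    if gh: "g \<in> Gm" "h \<in> Gm" for g h
  proof -
    obtain w where "w \<in> SpW (?t g h - 1) p" "lie_bracket (F g) (F h) p = (\<Sum>l\<in>Gm. gb g h l *\<^sub>R F l p) + w"
      using bracket_gens(2)[OF p gh order.refl] by blast
    then show "u g h \<in> SpW (?t g h - 1) p" by (simp add: u_def)
  qed (simp add: u_def)
  have GWm: "g \<in> GW k i \<Longrightarrow> g \<in> Gm" "h \<in> GW k j \<Longrightarrow> h \<in> Gm" for g h using GW_subset by auto
  have tij: "?t g h \<le> i + j" "?t g h - 1 \<le> i + j - 1" if "g \<in> GW k i" "h \<in> GW k j" for g h
    using that by (auto simp: GW_def)
  define main where "main = (\<Sum>g\<in>GW k i. \<Sum>h\<in>GW k j. (a g p * b h p) *\<^sub>R (\<Sum>l\<in>Gm. gb g h l *\<^sub>R F l p))"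
  \<comment> \<open>Everything of weight below \<open>i + j\<close>: the errors in the brackets of
    the frame fields and the terms with differentiated coefficients.\<close>
  define rest where "rest = (\<Sum>g\<in>GW k i. \<Sum>h\<in>GW k j. (a g p * b h p) *\<^sub>R u g h)
    + (\<Sum>h\<in>GW k j. V p (b h) *\<^sub>R F h p) - (\<Sum>g\<in>GW k i. W p (a g) *\<^sub>R F g p)"
  have "(\<Sum>g\<in>GW k i. \<Sum>h\<in>GW k j. (a g p * b h p) *\<^sub>R lie_bracket (F g) (F h) p) =
      (\<Sum>g\<in>GW k i. \<Sum>h\<in>GW k j. (a g p * b h p) *\<^sub>R (\<Sum>l\<in>Gm. gb g h l *\<^sub>R F l p) + (a g p * b h p) *\<^sub>R u g h)"
    by (intro sum.cong refl) (simp only: u(2)[OF GWm] scaleR_add_right)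
  then have split: "lie_bracket V W p = main + rest"
    unfolding br main_def rest_def by (simp add: sum.distrib)
  have "rest \<in> SpW (i + j - 1) p"
    unfolding rest_def
  proof (intro span_diff span_add span_sum span_scale)
    fix g h assume gh: "g \<in> GW k i" "h \<in> GW k j"
    show "u g h \<in> SpW (i + j - 1) p" using u(1)[OF GWm(1)[OF gh(1)] GWm(2)[OF gh(2)]] SpW_mono[OF tij(2)[OF gh]] by blast
  next
    fix h assume "h \<in> GW k j"
    then show "F h p \<in> SpW (i + j - 1) p" using ij by (intro F_SpW) (auto simp: GW_def)
  next
    fix g assume "g \<in> GW k i"
    then show "F g p \<in> SpW (i + j - 1) p" using ij by (intro F_SpW) (auto simp: GW_def)
  qed
  note rest = this
  let ?m = "\<lambda>g h. \<Sum>l\<in>Gm. gb g h l *\<^sub>R F l p"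
  have mT: "?m g h \<in> T p" for g h
    unfolding frame_span[OF p, symmetric] by (rule sum_in_span)
  have mS: "?m g h \<in> SpW (i + j) p" if gh: "g \<in> GW k i" "h \<in> GW k j" for g h
  proof (rule span_sum)
    fix l assume l: "l \<in> Gm"
    show "gb g h l *\<^sub>R F l p \<in> SpW (i + j) p"
      using gen_bracket_supp[OF GWm(1)[OF gh(1)] GWm(2)[OF gh(2)], of l] tij(1)[OF gh] F_SpW[OF l, of "i + j" p]
      by (cases "gb g h l = 0") (auto intro: span_scale simp: span_0)
  qed
  have main: "main \<in> SpW (i + j) p" unfolding main_def by (intro span_sum span_scale mS)
  show "lie_bracket V W p \<in> SpW (i + j) p"
    unfolding split using span_add[OF main subsetD[OF SpW_mono rest]] by simp
  have Pm: "Phi p (i + j) (?m g h) = (if gwt k g = i \<and> gwt k h = j then gb g h else 0)"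
    if gh: "g \<in> GW k i" "h \<in> GW k j" for g h
  proof -
    have eq: "?t g h = i + j \<longleftrightarrow> gwt k g = i \<and> gwt k h = j" using gh by (auto simp: GW_def)
    have "(if l \<in> Gm \<and> gwt k l = i + j then gb g h l else 0) = (if ?t g h = i + j then gb g h else 0) l" for l
      using gen_bracket_supp[OF GWm(1)[OF gh(1)] GWm(2)[OF gh(2)], of l]
      by (cases "gb g h l = 0") (auto simp: fun_arith)
    then show ?thesis unfolding Phi_comb[OF p refl] eq by (rule ext)
  qed
  have sT: "(\<Sum>h\<in>GW k j. (a g p * b h p) *\<^sub>R ?m g h) \<in> T p" for g
    by (intro subspace_sum[OF subspace_T] subspace_scale[OF subspace_T] mT)
  have "Phi p (i + j) main = (\<Sum>g\<in>GW k i. Phi p (i + j) (\<Sum>h\<in>GW k j. (a g p * b h p) *\<^sub>R ?m g h))"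
    unfolding main_def
    using Phi_sum[where X = "GW k i" and c = "\<lambda>_. 1" and v = "\<lambda>g. \<Sum>h\<in>GW k j. (a g p * b h p) *\<^sub>R ?m g h" and i = "i + j",
      OF p finite_GW sT] by (simp only: scaleR_one)
  also have "\<dots> = (\<Sum>g\<in>GW k i. \<Sum>h\<in>GW k j. (a g p * b h p) *\<^sub>R Phi p (i + j) (?m g h))"
    by (intro sum.cong refl) (rule Phi_sum[OF p finite_GW mT])
  also have "\<dots> = (\<Sum>g\<in>GW k i. \<Sum>h\<in>GW k j. (a g p * b h p) *\<^sub>R (if gwt k g = i \<and> gwt k h = j then gb g h else 0))"
    by (intro sum.cong refl) (simp only: Pm)
  also have "\<dots> = (\<Sum>g\<in>GW k i. \<Sum>h\<in>GW k j. (Phi p i (V p) g * Phi p j (W p) h) *\<^sub>R gb g h)"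
  proof (intro sum.cong refl)
    have ext: "(\<Sum>g\<in>GW k i. c g *\<^sub>R F g p) = (\<Sum>g\<in>Gm. (if g \<in> GW k i then c g else 0) *\<^sub>R F g p)" for c i
      by (rule sum.mono_neutral_cong_left) (use GW_subset in auto)
    fix g h assume gh: "g \<in> GW k i" "h \<in> GW k j"
    have "Phi p i (V p) g = (if gwt k g = i then a g p else 0)"
      using Phi_comb[OF p trans[OF a(2)[OF S1(2)] ext], of i] gh GWm by simp
    moreover have "Phi p j (W p) h = (if gwt k h = j then b h p else 0)"
      using Phi_comb[OF p trans[OF b(2)[OF S2(2)] ext], of j] gh GWm by simp
    ultimately show "(a g p * b h p) *\<^sub>R (if gwt k g = i \<and> gwt k h = j then gb g h else 0) =
      (Phi p i (V p) g * Phi p j (W p) h) *\<^sub>R gb g h" by simp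
  qed
  also have "\<dots> = (\<Sum>g\<in>gens (k + 5). \<Sum>h\<in>GW k j. (Phi p i (V p) g * Phi p j (W p) h) *\<^sub>R gb g h)"
  proof (rule sum.mono_neutral_left[OF finite_gens])
    show "GW k i \<subseteq> gens (k + 5)" using GW_subset GI_gens by blast
    have "Phi p i (V p) g = 0" if "g \<notin> GW k i" for g using that by (auto simp: Phi_def GW_def)
    then show "\<forall>g\<in>gens (k + 5) - GW k i. (\<Sum>h\<in>GW k j. (Phi p i (V p) g * Phi p j (W p) h) *\<^sub>R gb g h) = 0" by simp
  qed
  also have "\<dots> = gl2_heis_bracket (k + 5) (Phi p i (V p)) (Phi p j (W p))"
    unfolding gl2_heis_bracket_def
  proof (rule sum.cong[OF refl], rule sum.mono_neutral_left[OF finite_gens])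
    show "GW k j \<subseteq> gens (k + 5)" using GW_subset GI_gens by blast
    have "Phi p j (W p) h = 0" if "h \<notin> GW k j" for h using that by (auto simp: Phi_def GW_def)
    then show "\<forall>h\<in>gens (k + 5) - GW k j. (Phi p i (V p) g * Phi p j (W p) h) *\<^sub>R gb g h = 0" for g by simp
  qed
  finally have "Phi p (i + j) main = gl2_heis_bracket (k + 5) (Phi p i (V p)) (Phi p j (W p))" .
  moreover have "Phi p (i + j) rest = 0" by (rule Phi_low[OF p rest]) (use ij in simp)
  ultimately show "Phi p (i + j) (lie_bracket V W p) = gl2_heis_bracket (k + 5) (Phi p i (V p)) (Phi p j (W p))"
    unfolding split using Phi_add[OF p subsetD[OF SpW_T[OF p] main] subsetD[OF SpW_T[OF p] rest]] by simp
qed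

lemma extend_vector:
  assumes p: "p \<in> S" and v: "v \<in> weak_flag M D i p"
  obtains V where "V \<in> sections M (weak_flag M D i)" "V p = v"
proof -
  have v': "v \<in> SpW i p" using flag_eq p v by blast
  obtain c where c: "v = (\<Sum>g\<in>GW k i. c g *\<^sub>R F g p)" using v' unfolding in_span_image[OF finite_GW] by blast
  let ?V = "\<lambda>x. \<Sum>g\<in>GW k i. c g *\<^sub>R F g x"
  have "vf ?V" by (rule vf_comb[OF sm_const vfF])
  moreover have "?V x \<in> weak_flag M D i x" if "x \<in> S" for x
  proof -
    have "?V x \<in> SpW i x" by (rule sum_in_span)
    then show ?thesis using flag_eq that by blast
  qed
  ultimately obtain V' W where "V' \<in> sections M (weak_flag M D i)" "p \<in> W" "\<And>x. x \<in> W \<Longrightarrow> V' x = ?V x"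
    by (rule_tac section_extend[of ?V p i, OF _ p]) auto
  then show ?thesis using that[of V'] c by auto
qed

text \<open>\<open>Phi\<close> is constant on cosets and separates them, so it descends to a
  bijection of each quotient with the corresponding component; \<open>Phi_bracket\<close> makes it
  respect brackets.\<close>

lemma symbol_iso:
  assumes p: "p \<in> S" shows "graded_iso (tanaka_symbol M D p) (s_alg k (k + 5))"
proof -
  let ?fl = "\<lambda>i. weak_flag M D i p"
  have fl: "?fl i = SpW i p" for i using flag_eq p by blast
  have sub: "subspace (?fl i)" for i by (rule subspace_flag[OF D S_pts[OF p]])
  have flT: "v \<in> T p" if "v \<in> ?fl i" for v i using that SpW_T[OF p] unfolding fl by blast
  have mono: "?fl i \<subseteq> ?fl j" if "i \<le> j" for i j unfolding fl by (rule SpW_mono[OF that])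
  define C where "C = (\<lambda>i v. (+) v ` ?fl (i - 1))"
  have inC: "v \<in> C i v" for v i using subspace_0[OF sub] by (force simp: C_def)
  have memC: "w \<in> C i v \<longleftrightarrow> w - v \<in> ?fl (i - 1)" for v w i
  proof
    assume "w \<in> C i v"
    then show "w - v \<in> ?fl (i - 1)" by (auto simp: C_def)
  next
    assume "w - v \<in> ?fl (i - 1)"
    then show "w \<in> C i v" using image_eqI[of w "(+) v" "w - v"] by (simp add: C_def)
  qed
  have Phd: "Phi p i (v - w) = Phi p i v - Phi p i w" if "v \<in> T p" "w \<in> T p" for v w i
    using Phi_lin[OF p that, of i 1 "- 1"] by simp
  have eqPhi: "w - v \<in> ?fl (i - 1) \<longleftrightarrow> Phi p i v = Phi p i w" if "1 \<le> i" "v \<in> ?fl i" "w \<in> ?fl i" for v w i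
  proof
    assume "w - v \<in> ?fl (i - 1)"
    then have "Phi p i (w - v) = 0" unfolding fl by (rule Phi_low[OF p]) (use that in simp)
    then show "Phi p i v = Phi p i w" using Phd[OF flT[OF that(3)] flT[OF that(2)]] by simp
  next
    assume "Phi p i v = Phi p i w"
    then have "Phi p i (w - v) = 0" using Phd[OF flT[OF that(3)] flT[OF that(2)]] by simp
    moreover have "w - v \<in> SpW i p" using subspace_diff[OF sub that(3,2)] unfolding fl .
    ultimately show "w - v \<in> ?fl (i - 1)" unfolding fl by (intro Phi_zero[OF p] that(1))
  qed
  have Ceq: "C i v = C i w" if "w - v \<in> ?fl (i - 1)" for v w i
  proof -
    have "x - w \<in> ?fl (i - 1) \<longleftrightarrow> x - v \<in> ?fl (i - 1)" for x
      using subspace_add[OF sub _ that, of "x - w"] subspace_diff[OF sub _ that, of "x - v"] by auto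
    then show ?thesis by (auto simp: memC)
  qed
  \<comment> \<open>Evaluates \<open>Phi\<close> at an arbitrary representative; the choice is
    immaterial by \<open>eqPhi\<close>.\<close>
  define \<Psi> where "\<Psi> = (\<lambda>i A. Phi p i (SOME v. v \<in> A))"
  have up: "w \<in> ?fl i" if "v \<in> ?fl i" "w \<in> C i v" for v w i
  proof -
    have "w - v \<in> ?fl i" using that(2) mono[of "i - 1" i] unfolding memC by auto
    from subspace_add[OF sub that(1) this] show ?thesis by simp
  qed
  have \<Psi>: "\<Psi> i (C i v) = Phi p i v" if "1 \<le> i" "v \<in> ?fl i" for i v
  proof -
    have s: "(SOME w. w \<in> C i v) \<in> C i v" by (rule someI[of _ v]) (rule inC)
    then have "(SOME w. w \<in> C i v) - v \<in> ?fl (i - 1)" unfolding memC .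
    then show ?thesis unfolding \<Psi>_def using eqPhi[OF that up[OF that(2) s]] by simp
  qed
  let ?G = "tanaka_symbol M D p" and ?H = "s_alg k (k + 5)"
  have hG: "homog ?G i = {C i v | v. v \<in> ?fl i}" for i by (simp add: tanaka_symbol_def C_def)
  have add: "hadd ?G i (C i v) (C i w) = C i (v + w)" for i v w
  proof -
    have "x \<in> hadd ?G i (C i v) (C i w) \<longleftrightarrow> x \<in> C i (v + w)" for x
    proof
      assume "x \<in> hadd ?G i (C i v) (C i w)"
      then obtain a b where ab: "x = a + b" "a - v \<in> ?fl (i - 1)" "b - w \<in> ?fl (i - 1)"
        by (auto simp: tanaka_symbol_def memC)
      from subspace_add[OF sub ab(2,3)] show "x \<in> C i (v + w)" unfolding memC ab(1) by (simp add: algebra_simps)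
    next
      assume "x \<in> C i (v + w)"
      then have "x - w \<in> C i v" unfolding memC by (simp add: algebra_simps)
      then have "\<exists>a b. x = a + b \<and> a \<in> C i v \<and> b \<in> C i w"
        by (intro exI[of _ "x - w"] exI[of _ w]) (simp add: inC)
      then show "x \<in> hadd ?G i (C i v) (C i w)" by (simp add: tanaka_symbol_def)
    qed
    then show ?thesis by blast
  qed
  have scale: "hscale ?G i c (C i v) = C i (c *\<^sub>R v)" for i c v
  proof -
    have "x \<in> hscale ?G i c (C i v) \<longleftrightarrow> x \<in> C i (c *\<^sub>R v)" for x
    proof
      assume "x \<in> hscale ?G i c (C i v)"
      then obtain a u where au: "x = c *\<^sub>R a + u" "a - v \<in> ?fl (i - 1)" "u \<in> ?fl (i - 1)"
        by (auto simp: tanaka_symbol_def memC)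
      from subspace_add[OF sub subspace_scale[OF sub au(2), of c] au(3)] show "x \<in> C i (c *\<^sub>R v)"
        unfolding memC au(1) by (simp add: algebra_simps)
    next
      assume "x \<in> C i (c *\<^sub>R v)"
      then have "x - c *\<^sub>R v \<in> ?fl (i - 1)" unfolding memC .
      then have "\<exists>a u. x = c *\<^sub>R a + u \<and> a \<in> C i v \<and> u \<in> ?fl (i - 1)"
        by (intro exI[of _ v] exI[of _ "x - c *\<^sub>R v"]) (simp add: inC)
      then show "x \<in> hscale ?G i c (C i v)" by (simp add: tanaka_symbol_def)
    qed
    then show ?thesis by blast
  qed
  \<comment> \<open>The bracket of two cosets is defined as a union over all extensions. By
    \<open>Phi_bracket\<close> the brackets of any two choices differ by an element of lower weight,
    so the union is a single coset.\<close>
  have brk: "\<exists>z\<in>?fl (i + j). hbracket ?G i j (C i v) (C j w) = C (i + j) z \<and>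
      Phi p (i + j) z = gl2_heis_bracket (k + 5) (Phi p i v) (Phi p j w)"
    if ij: "1 \<le> i" "1 \<le> j" and v: "v \<in> ?fl i" and w: "w \<in> ?fl j" for i j v w
  proof -
    have PB: "lie_bracket V W p \<in> ?fl (i + j) \<and>
        Phi p (i + j) (lie_bracket V W p) = gl2_heis_bracket (k + 5) (Phi p i v) (Phi p j w)"
      if V: "V \<in> sections M (weak_flag M D i)" "V p \<in> C i v" and W: "W \<in> sections M (weak_flag M D j)" "W p \<in> C j w" for V W
    proof -
      have "Phi p i v = Phi p i (V p)" using eqPhi[OF ij(1) v up[OF v V(2)]] V(2) unfolding memC by blast
      moreover have "Phi p j w = Phi p j (W p)" using eqPhi[OF ij(2) w up[OF w W(2)]] W(2) unfolding memC by blast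
      ultimately show ?thesis using Phi_bracket[OF p V(1) W(1) ij] unfolding fl by simp
    qed
    obtain V0 where V0: "V0 \<in> sections M (weak_flag M D i)" "V0 p = v" by (rule extend_vector[OF p v])
    obtain W0 where W0: "W0 \<in> sections M (weak_flag M D j)" "W0 p = w" by (rule extend_vector[OF p w])
    have P0: "lie_bracket V0 W0 p \<in> ?fl (i + j)"
      "Phi p (i + j) (lie_bracket V0 W0 p) = gl2_heis_bracket (k + 5) (Phi p i v) (Phi p j w)"
      using PB[OF V0(1) _ W0(1)] V0(2) W0(2) inC by auto
    have ij1: "1 \<le> i + j" using ij by simp
    have "x \<in> hbracket ?G i j (C i v) (C j w) \<longleftrightarrow> x \<in> C (i + j) (lie_bracket V0 W0 p)" for x
    proof
      assume "x \<in> hbracket ?G i j (C i v) (C j w)"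
      then obtain V W u where V: "V \<in> sections M (weak_flag M D i)" "V p \<in> C i v"
        and W: "W \<in> sections M (weak_flag M D j)" "W p \<in> C j w" and u: "u \<in> ?fl (i + j - 1)"
        and x: "x = lie_bracket V W p + u" by (auto simp: tanaka_symbol_def)
      have "lie_bracket V W p - lie_bracket V0 W0 p \<in> ?fl (i + j - 1)"
        using eqPhi[OF ij1 P0(1), of "lie_bracket V W p"] PB[OF V W] P0(2) by simp
      from subspace_add[OF sub this u] show "x \<in> C (i + j) (lie_bracket V0 W0 p)"
        unfolding memC x by (simp add: algebra_simps)
    next
      assume "x \<in> C (i + j) (lie_bracket V0 W0 p)"
      then have "x - lie_bracket V0 W0 p \<in> ?fl (i + j - 1)" unfolding memC .
      then have "\<exists>V W u. x = lie_bracket V W p + u \<and> V \<in> sections M (weak_flag M D i) \<and> V p \<in> C i v \<and>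
          W \<in> sections M (weak_flag M D j) \<and> W p \<in> C j w \<and> u \<in> ?fl (i + j - 1)"
        by (intro exI[of _ V0] exI[of _ W0] exI[of _ "x - lie_bracket V0 W0 p"]) (use V0 W0 inC in simp)
      then show "x \<in> hbracket ?G i j (C i v) (C j w)" by (simp add: tanaka_symbol_def)
    qed
    then show ?thesis using P0 by (intro bexI[of _ "lie_bracket V0 W0 p"]) auto
  qed
  have cl: "w + v \<in> ?fl i" "c *\<^sub>R v \<in> ?fl i" if "v \<in> ?fl i" "w \<in> ?fl i" for v w i c
    using subspace_add[OF sub that(2,1)] subspace_scale[OF sub that(1)] by auto
  have hH: "hadd ?H i = (+)" "hscale ?H i = scaleR" "hbracket ?H i j = gl2_heis_bracket (k + 5)" for i j
    by (simp_all add: s_alg_def)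
  show ?thesis
    unfolding graded_iso_def
  proof (intro exI[of _ \<Psi>] conjI allI impI ballI)
    fix i :: nat assume i: "1 \<le> i"
    show "bij_betw (\<Psi> i) (homog ?G i) (homog ?H i)"
      unfolding bij_betw_def
    proof
      show "inj_on (\<Psi> i) (homog ?G i)"
      proof (rule inj_onI)
        fix X Y assume "X \<in> homog ?G i" "Y \<in> homog ?G i" and e: "\<Psi> i X = \<Psi> i Y"
        then obtain v w where vw: "X = C i v" "Y = C i w" "v \<in> ?fl i" "w \<in> ?fl i" unfolding hG by blast
        then have "Phi p i v = Phi p i w" using e \<Psi>[OF i] by simp
        then show "X = Y" unfolding vw using Ceq eqPhi[OF i vw(3,4)] by blast
      qed
      show "\<Psi> i ` homog ?G i = homog ?H i"
      proof (intro equalityI subsetI)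
        fix f assume "f \<in> \<Psi> i ` homog ?G i"
        then obtain v where "v \<in> ?fl i" "f = \<Psi> i (C i v)" unfolding hG by blast
        then show "f \<in> homog ?H i" unfolding s_alg_homog[OF i] using \<Psi>[OF i] Phi_supp by simp
      next
        fix f assume "f \<in> homog ?H i"
        then obtain v where v: "v \<in> ?fl i" "Phi p i v = f"
          using Phi_onto[OF p, of f i] unfolding s_alg_homog[OF i] fl by blast
        then have "f = \<Psi> i (C i v)" using \<Psi>[OF i] by simp
        then show "f \<in> \<Psi> i ` homog ?G i" unfolding hG using v by blast
      qed
    qed
    fix X assume "X \<in> homog ?G i"
    then obtain v where v: "X = C i v" "v \<in> ?fl i" unfolding hG by blast
    show "hscale ?G i c X \<in> homog ?G i" for c unfolding v(1) scale hG using cl(2)[OF v(2,2)] by blast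
    show "\<Psi> i (hscale ?G i c X) = hscale ?H i c (\<Psi> i X)" for c
      unfolding v(1) scale hH \<Psi>[OF i v(2)] \<Psi>[OF i cl(2)[OF v(2,2)]] by (rule Phi_scale[OF p flT[OF v(2)]])
    {
      fix Y assume "Y \<in> homog ?G i"
      then obtain w where w: "Y = C i w" "w \<in> ?fl i" unfolding hG by blast
      show "hadd ?G i X Y \<in> homog ?G i" unfolding v(1) w(1) add hG using cl(1)[OF w(2) v(2)] by blast
      show "\<Psi> i (hadd ?G i X Y) = hadd ?H i (\<Psi> i X) (\<Psi> i Y)"
        unfolding v(1) w(1) add hH \<Psi>[OF i v(2)] \<Psi>[OF i w(2)] \<Psi>[OF i cl(1)[OF w(2) v(2)]]
        by (rule Phi_add[OF p flT[OF v(2)] flT[OF w(2)]])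
    }
    fix j :: nat and Y assume j: "1 \<le> j" and "Y \<in> homog ?G j"
    then obtain w where w: "Y = C j w" "w \<in> ?fl j" unfolding hG by blast
    obtain z where z: "z \<in> ?fl (i + j)" "hbracket ?G i j X Y = C (i + j) z"
      "Phi p (i + j) z = gl2_heis_bracket (k + 5) (Phi p i v) (Phi p j w)"
      using brk[OF i j v(2) w(2)] unfolding v(1) w(1) by blast
    show "hbracket ?G i j X Y \<in> homog ?G (i + j)" unfolding z(2) hG using z(1) by blast
    have ij: "1 \<le> i + j" using i by simp
    have "\<Psi> (i + j) (hbracket ?G i j X Y) = Phi p (i + j) z" unfolding z(2) by (rule \<Psi>[OF ij z(1)])
    also have "\<dots> = hbracket ?H i j (\<Psi> i X) (\<Psi> j Y)"
      unfolding z(3) v(1) w(1) hH \<Psi>[OF i v(2)] \<Psi>[OF j w(2)] ..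
    finally show "\<Psi> (i + j) (hbracket ?G i j X Y) = hbracket ?H i j (\<Psi> i X) (\<Psi> j Y)" .
  qed
qed

end

section \<open>Lifting adapted frames to the prolongation\<close>

context prolongation
begin

lemma push_T:
  assumes v: "v \<in> MN.T x" and x: "x \<in> points N" shows "pushforward M \<pi> v \<in> T (\<pi> x)"
  unfolding tangent_space_def
proof (intro CollectI conjI allI impI)
  fix f g c assume f: "smooth_fun M f"
  show "pushforward M \<pi> v (\<lambda>x. c * f x) = c * pushforward M \<pi> v f"
    using MN.tv_cmult[OF v smooth_pull[OF f], of c] f sm_cmult[OF f, of c] by (simp add: pushforward_def comp_def)
  assume g: "smooth_fun M g"
  note fg = smooth_pull[OF f] smooth_pull[OF g]
  show "pushforward M \<pi> v (\<lambda>x. f x + g x) = pushforward M \<pi> v f + pushforward M \<pi> v g"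
    using MN.tv_add[OF v fg] f g sm_add[OF f g] by (simp add: pushforward_def comp_def)
  show "pushforward M \<pi> v (\<lambda>x. f x * g x) = f (\<pi> x) * pushforward M \<pi> v g + g (\<pi> x) * pushforward M \<pi> v f"
    using MN.tv_mult[OF v fg] f g sm_mult[OF f g] by (simp add: pushforward_def comp_def)
next
  fix f assume "\<not> smooth_fun M f" then show "pushforward M \<pi> v f = 0" by (simp add: pushforward_def)
qed

text \<open>Each fibre over \<open>Q\<close> meets \<open>O1\<close> in at least two points, so one can avoid any given line.\<close>

lemma box_avoiding:
  assumes O1: "PN.opn O1" "x1 \<in> O1"
  obtains Q where "opn Q" "\<pi> x1 \<in> Q" "\<And>q l. q \<in> Q \<Longrightarrow> \<exists>x\<in>O1. \<pi> x = q \<and> lin x \<noteq> l"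
proof -
  have xN: "x1 \<in> points N" using O1 PN.opn_sub by auto
  note px = pt_props(1)[OF xN]
  obtain S V W where S: "\<pi> x1 \<in> S" and lf: "local_frame M D S V W" and nl: "lin x1 \<noteq> span {W (\<pi> x1)}"
    by (rule frame_avoiding[OF px, of "lin x1" "lin x1"]) blast
  obtain U \<phi> where U: "(U, \<phi>) \<in> atlas M" "\<pi> x1 \<in> U" using point_chart px by blast
  let ?d = "dm U S V W" and ?c = "cr \<phi> V W"
  have xd: "x1 \<in> ?d" unfolding dm_iff[OF lf] using xN U S nl by blast
  obtain e where e: "e > 0" "cube (mdim N) (?c x1) e \<subseteq> ?c ` (O1 \<inter> ?d)"
    by (rule PN.opn_cube[OF O1(1) atlas_mem[OF U(1) lf] O1(2) xd]) blast
  have phi: "\<phi> q i = 0" if "q \<in> U" "n \<le> i" for q i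
    using openin_subset[OF chart_open[OF U(1)]] that by (auto simp: topspace_Euclidean_space)
  define Q where "Q = {p \<in> U. \<phi> p \<in> cube n (\<phi> (\<pi> x1)) e} \<inter> S"
  \<comment> \<open>The coordinate cube is a product, so over every base point in \<open>Q\<close>
    each fibre coordinate closer than \<open>e\<close> to that of \<open>x1\<close> is realised
    inside \<open>O1\<close>.\<close>
  have ex: "\<exists>x\<in>O1 \<inter> ?d. \<pi> x = q \<and> ?c x n = t" if q: "q \<in> Q" and t: "\<bar>t - ?c x1 n\<bar> < e" for q t
  proof -
    have qU: "q \<in> U" "\<phi> q \<in> cube n (\<phi> (\<pi> x1)) e" using q by (auto simp: Q_def)
    have "(\<phi> q)(n := t) \<in> cube (mdim N) (?c x1) e"
      unfolding cube_def mdimN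
    proof (intro CollectI conjI allI impI)
      fix i assume "Suc n \<le> i"
      then show "((\<phi> q)(n := t)) i = 0" using phi[OF qU(1), of i] by simp
    next
      fix i assume "i < Suc n"
      then show "\<bar>((\<phi> q)(n := t)) i - ?c x1 i\<bar> < e"
        using t qU(2) by (cases "i = n") (auto simp: cube_def cr_def)
    qed
    from subsetD[OF e(2) this] obtain x where x: "(\<phi> q)(n := t) = ?c x" "x \<in> O1 \<inter> ?d" by (rule imageE)
    have "\<phi> (\<pi> x) = \<phi> q" using cr_zero[OF U(1), of x S V W] x(2) x(1)[symmetric] phi[OF qU(1), of n] by (simp add: fun_upd_idem)
    moreover have "\<pi> x \<in> U" using x(2) by (simp add: dm_def)
    ultimately have "\<pi> x = q" using inj_onD[OF chart_inj[OF U(1)]] qU(1) by blast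
    then show ?thesis using x(2) x(1)[symmetric] by (intro bexI[of _ x]) simp_all
  qed
  show ?thesis
  proof (rule that)
    show "opn Q" unfolding Q_def by (intro openin_Int opn_chart_preimage U(1) openin_cube opn_frame[OF lf])
    show "\<pi> x1 \<in> Q" using S U(2) e(1) cube_self[of n "\<phi> (\<pi> x1)" e] phi[OF U(2)] by (simp add: Q_def)
    fix q l assume q: "q \<in> Q"
    obtain x where x: "x \<in> O1 \<inter> ?d" "\<pi> x = q" "?c x n = ?c x1 n" using ex[OF q, of "?c x1 n"] e(1) by auto
    \<comment> \<open>The shift by half of \<open>e\<close> stays within the cube and yields a
      second line over the same base point; at most one of the two lines can equal
      \<open>l\<close>.\<close>
    obtain y where y: "y \<in> O1 \<inter> ?d" "\<pi> y = q" "?c y n = ?c x1 n + e / 2" using ex[OF q, of "?c x1 n + e / 2"] e(1) by auto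
    have "lin x \<noteq> lin y"
    proof
      assume "lin x = lin y"
      then have "x = y" using pt_inj[of x y] x y by (simp add: dm_def)
      then show False using x y e(1) by simp
    qed
    then show "\<exists>x\<in>O1. \<pi> x = q \<and> lin x \<noteq> l" using x y by blast
  qed
qed

end

text \<open>\<open>s\<close> is the fibre coordinate, \<open>T'\<close> its partial derivative and \<open>L\<close> the horizontal lift for
  which \<open>s\<close> is constant. A tangent vector is determined by its values on \<open>s\<close> and on the functions
  pulled back from \<open>M\<close>, which reduces all bracket computations to \<open>M\<close>.\<close>

locale lifting = prolongation M D N \<pi> lin for M :: "'a mfd" and D N \<pi> lin +
  fixes S :: "'a set" and Z A :: "'a \<Rightarrow> 'a tvec" and O' :: "'a set" and s :: "'a \<Rightarrow> real"
    and T' :: "'a \<Rightarrow> 'a tvec" and L :: "('a \<Rightarrow> 'a tvec) \<Rightarrow> 'a \<Rightarrow> 'a tvec"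
  assumes Z: "vf Z" "vf A"
    and O': "PN.opn O'" "\<And>x. x \<in> O' \<Longrightarrow> \<pi> x \<in> S"
    and s: "smooth_fun N s" and vT: "MN.vf T'" and vL: "\<And>F. vf F \<Longrightarrow> MN.vf (L F)"
    and T_pull: "\<And>x f. x \<in> O' \<Longrightarrow> smooth_fun M f \<Longrightarrow> T' x (\<lambda>z. f (\<pi> z)) = 0"
    and T_s: "\<And>x. x \<in> O' \<Longrightarrow> T' x s = 1"
    and L_pull: "\<And>x F f. x \<in> O' \<Longrightarrow> vf F \<Longrightarrow> smooth_fun M f \<Longrightarrow> L F x (\<lambda>z. f (\<pi> z)) = F (\<pi> x) f"
    and L_s: "\<And>x F. x \<in> O' \<Longrightarrow> vf F \<Longrightarrow> L F x s = 0"
    and det: "\<And>x v v'. x \<in> O' \<Longrightarrow> v \<in> MN.T x \<Longrightarrow> v' \<in> MN.T x \<Longrightarrow> v s = v' s \<Longrightarrow>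
      (\<And>f. smooth_fun M f \<Longrightarrow> v (\<lambda>z. f (\<pi> z)) = v' (\<lambda>z. f (\<pi> z))) \<Longrightarrow> v = v'"
    and lin_eq: "\<And>x. x \<in> O' \<Longrightarrow> lin x = span {Z (\<pi> x) + s x *\<^sub>R A (\<pi> x)}"
begin

abbreviation Z' :: "'a \<Rightarrow> 'a tvec" where "Z' \<equiv> \<lambda>x. L Z x + s x *\<^sub>R L A x"

lemma O_pts: "x \<in> O' \<Longrightarrow> x \<in> points N"
  using PN.opn_sub[OF O'(1)] by auto

lemma L_T: "x \<in> O' \<Longrightarrow> vf F \<Longrightarrow> L F x \<in> MN.T x"
  by (rule MN.vf_T[OF vL O_pts])

lemma T_T: "x \<in> O' \<Longrightarrow> T' x \<in> MN.T x"
  by (rule MN.vf_T[OF vT O_pts])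

lemma vZ': "MN.vf Z'"
  by (intro MN.vf_add MN.vf_scale vL Z s)

lemma L_eqI:
  assumes "x \<in> O'" "v \<in> MN.T x" "vf F" "v s = 0" "\<And>f. smooth_fun M f \<Longrightarrow> v (\<lambda>z. f (\<pi> z)) = F (\<pi> x) f"
  shows "v = L F x"
  by (rule det[OF assms(1,2) L_T[OF assms(1,3)]]) (simp_all add: L_s L_pull assms)

lemma L_zero: "x \<in> O' \<Longrightarrow> vf F \<Longrightarrow> F (\<pi> x) = 0 \<Longrightarrow> L F x = 0"
  by (rule L_eqI[symmetric]) (simp_all add: fun_arith subspace_0[OF MN.subspace_T])

lemma L_lin:
  assumes "x \<in> O'" "vf F" "vf G" "vf H" "H (\<pi> x) = a *\<^sub>R F (\<pi> x) + b *\<^sub>R G (\<pi> x)"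
  shows "L H x = a *\<^sub>R L F x + b *\<^sub>R L G x"
  by (rule L_eqI[symmetric])
    (use assms in \<open>simp_all add: fun_arith L_s L_pull subspace_add[OF MN.subspace_T] subspace_scale[OF MN.subspace_T] L_T\<close>)

lemma L_scale: "x \<in> O' \<Longrightarrow> vf F \<Longrightarrow> vf H \<Longrightarrow> H (\<pi> x) = c *\<^sub>R F (\<pi> x) \<Longrightarrow> L H x = c *\<^sub>R L F x"
  using L_lin[of x F F H c 0] by simp

lemma along:
  assumes "v \<in> MN.T x" "x \<in> O'" "smooth_fun N g" "smooth_fun N h" "\<And>z. z \<in> O' \<Longrightarrow> g z = h z" shows "v g = v h"
  by (rule MN.tv_local[OF assms(1) O'(1) assms(2-5)])

text \<open>Horizontal lifts do not depend on the fibre coordinate. On pulled-back functions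
  \<open>L F\<close> yields pulled-back functions, which \<open>T'\<close> annihilates; on
  \<open>s\<close> both fields have constant values.\<close>

lemma br_T_L:
  assumes x: "x \<in> O'" and F: "vf F" shows "lie_bracket T' (L F) x = 0"
proof (rule det[OF x MN.br_T[OF vT vL[OF F] O_pts[OF x]] subspace_0[OF MN.subspace_T]])
  have "T' x (\<lambda>z. L F z s) = T' x (\<lambda>z. 0)"
    by (rule along[OF T_T[OF x] x MN.vf_smooth[OF vL[OF F] s] MN.sm_const L_s[OF _ F]])
  moreover have "L F x (\<lambda>z. T' z s) = L F x (\<lambda>z. 1)"
    by (rule along[OF L_T[OF x F] x MN.vf_smooth[OF vT s] MN.sm_const T_s])
  ultimately show "lie_bracket T' (L F) x s = 0 s"
    by (simp add: lie_bracket_def fun_arith MN.tv_const[OF T_T[OF x]] MN.tv_const[OF L_T[OF x F]])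
next
  fix f assume f: "smooth_fun M f"
  have "T' x (\<lambda>z. L F z (\<lambda>z. f (\<pi> z))) = T' x (\<lambda>z. F (\<pi> z) f)"
    by (rule along[OF T_T[OF x] x MN.vf_smooth[OF vL[OF F] smooth_pull[OF f]] smooth_pull[OF vf_smooth[OF F f]]
          L_pull[OF _ F f]])
  also have "\<dots> = 0" by (rule T_pull[OF x vf_smooth[OF F f]])
  finally have 1: "T' x (\<lambda>z. L F z (\<lambda>z. f (\<pi> z))) = 0" .
  have "L F x (\<lambda>z. T' z (\<lambda>z. f (\<pi> z))) = L F x (\<lambda>z. 0)"
    by (rule along[OF L_T[OF x F] x MN.vf_smooth[OF vT smooth_pull[OF f]] MN.sm_const T_pull[OF _ f]])
  then show "lie_bracket T' (L F) x (\<lambda>z. f (\<pi> z)) = 0 (\<lambda>z. f (\<pi> z))"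
    using 1 by (simp add: lie_bracket_def fun_arith MN.tv_const[OF L_T[OF x F]])
qed

lemma br_L_L:
  assumes x: "x \<in> O'" and F: "vf F" and G: "vf G" shows "lie_bracket (L F) (L G) x = L (lie_bracket F G) x"
proof (rule L_eqI[OF x MN.br_T[OF vL[OF F] vL[OF G] O_pts[OF x]] vf_br[OF F G]])
  have "L F x (\<lambda>z. L G z s) = 0" if F: "vf F" and G: "vf G" for F G
    using along[OF L_T[OF x F] x MN.vf_smooth[OF vL[OF G] s] MN.sm_const L_s[OF _ G]] MN.tv_const[OF L_T[OF x F]] by simp
  then show "lie_bracket (L F) (L G) x s = 0" using F G by (simp add: lie_bracket_def)
next
  fix f assume f: "smooth_fun M f"
  have "L F x (\<lambda>z. L G z (\<lambda>z. f (\<pi> z))) = F (\<pi> x) (\<lambda>z. G z f)" if F: "vf F" and G: "vf G" for F G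
    using along[OF L_T[OF x F] x MN.vf_smooth[OF vL[OF G] smooth_pull[OF f]] smooth_pull[OF vf_smooth[OF G f]]
          L_pull[OF _ G f]] L_pull[OF x F vf_smooth[OF G f]] by simp
  then show "lie_bracket (L F) (L G) x (\<lambda>z. f (\<pi> z)) = lie_bracket F G (\<pi> x) f"
    using F G by (simp add: lie_bracket_def)
qed

lemma br_T_Z:
  assumes x: "x \<in> O'" shows "lie_bracket T' Z' x = L A x"
  unfolding MN.br_add_right[OF vT vL[OF Z(1)] MN.vf_scale[OF s vL[OF Z(2)]] O_pts[OF x]]
    MN.br_scale_right[OF vT vL[OF Z(2)] s O_pts[OF x]]
  by (simp add: br_T_L[OF x] Z T_s[OF x])

lemma br_Z_T: "x \<in> O' \<Longrightarrow> lie_bracket Z' T' x = (- 1) *\<^sub>R L A x"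
  using br_antisym[of Z' T' x] br_T_Z[of x] by simp

text \<open>No derivative of the coefficient \<open>s\<close> of \<open>Z'\<close> appears, because
  horizontal lifts annihilate \<open>s\<close>.\<close>

lemma br_Z_L:
  assumes x: "x \<in> O'" and F: "vf F"
  shows "lie_bracket Z' (L F) x = L (lie_bracket Z F) x + s x *\<^sub>R L (lie_bracket A F) x"
proof -
  have n: "L (lie_bracket F G) x = - L (lie_bracket G F) x" if "vf G" for G
    using L_scale[OF x vf_br[OF that F] vf_br[OF F that], of "- 1"] br_antisym[of F G] by simp
  have "lie_bracket (L F) Z' x = L (lie_bracket F Z) x + s x *\<^sub>R L (lie_bracket F A) x"
    unfolding MN.br_add_right[OF vL[OF F] vL[OF Z(1)] MN.vf_scale[OF s vL[OF Z(2)]] O_pts[OF x]]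
      MN.br_scale_right[OF vL[OF F] vL[OF Z(2)] s O_pts[OF x]]
    by (simp add: br_L_L[OF x F] Z L_s[OF x F])
  then show ?thesis using br_antisym[of Z' "L F" x] n[OF Z(1)] n[OF Z(2)] by simp
qed

text \<open>The lifts of the two generators are generated upstairs: L A = [T', Z'], and L Z = Z' + s
  [Z', T'] because [Z', T'] = - L A. The remaining operations commute with the lift.\<close>

lemma liegen_lift:
  assumes "liegen Z A V" shows "\<exists>V'. MN.liegen Z' T' V' \<and> (\<forall>x\<in>O'. V' x = L V x)"
  using assms
proof (induct rule: liegen.induct)
  case gen_Z
  have "MN.liegen Z' T' (\<lambda>x. Z' x + s x *\<^sub>R lie_bracket Z' T' x)"
    by (intro MN.gen_add MN.gen_scale MN.gen_br MN.gen_Z MN.gen_T s)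
  then show ?case by (intro exI conjI) (assumption, simp add: br_Z_T)
next
  case gen_T
  have "MN.liegen Z' T' (lie_bracket T' Z')" by (intro MN.gen_br MN.gen_Z MN.gen_T)
  then show ?case using br_T_Z by blast
next
  case (gen_add V W)
  then obtain V' W' where V': "MN.liegen Z' T' V'" "\<forall>x\<in>O'. V' x = L V x" "MN.liegen Z' T' W'" "\<forall>x\<in>O'. W' x = L W x"
    by blast
  note v = liegen_vf[OF gen_add(1) Z] liegen_vf[OF gen_add(3) Z]
  have "V' x + W' x = L (\<lambda>x. V x + W x) x" if "x \<in> O'" for x
    using L_lin[OF that v vf_add[OF v], of 1 1] V'(2,4) that by simp
  then show ?case using MN.gen_add[OF V'(1,3)] by blast
next
  case (gen_scale g V)
  then obtain V' where V': "MN.liegen Z' T' V'" "\<forall>x\<in>O'. V' x = L V x" by blast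
  note v = liegen_vf[OF gen_scale(2) Z]
  have "g (\<pi> x) *\<^sub>R V' x = L (\<lambda>x. g x *\<^sub>R V x) x" if "x \<in> O'" for x
    using L_scale[OF that v vf_scale[OF gen_scale(1) v], of "g (\<pi> x)"] V'(2) that by simp
  then show ?case using MN.gen_scale[OF smooth_pull[OF gen_scale(1)] V'(1)] by blast
next
  case (gen_br V W)
  then obtain V' W' where V': "MN.liegen Z' T' V'" "\<forall>x\<in>O'. V' x = L V x" "MN.liegen Z' T' W'" "\<forall>x\<in>O'. W' x = L W x"
    by blast
  note v = liegen_vf[OF gen_br(1) Z] liegen_vf[OF gen_br(3) Z]
  have "lie_bracket V' W' x = L (lie_bracket V W) x" if x: "x \<in> O'" for x
  proof -
    have "lie_bracket V' W' x = lie_bracket (L V) (L W) x"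
      by (rule MN.br_local[OF MN.liegen_vf[OF V'(1) vZ' vT] vL[OF v(1)] MN.liegen_vf[OF V'(3) vZ' vT] vL[OF v(2)] O'(1) x])
        (use V' in auto)
    then show ?thesis using br_L_L[OF x v] by simp
  qed
  then show ?case using MN.gen_br[OF V'(1,3)] by blast
qed

lemma frame_lifted:
  assumes x: "x \<in> O'" shows "lifted x = span {Z' x, T' x}" "dim (lifted x) = 2"
proof -
  have p: "\<pi> x \<in> points M" by (rule pt_props(1)[OF O_pts[OF x]])
  have Z1: "Z' x (\<lambda>z. f (\<pi> z)) = Z (\<pi> x) f + s x * A (\<pi> x) f" if "smooth_fun M f" for f
    using L_pull[OF x Z(1) that] L_pull[OF x Z(2) that] by (simp add: fun_arith)
  have Z2: "Z' x s = 0" using L_s[OF x Z(1)] L_s[OF x Z(2)] by (simp add: fun_arith)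
  note l = lifted_span[where s = s and V = "Z (\<pi> x)" and W = "A (\<pi> x)" and c = "s x" and A = "Z' x" and B = "T' x",
    OF O_pts[OF x] vf_T[OF Z(1) p] vf_T[OF Z(2) p] MN.vf_T[OF vZ' O_pts[OF x]] Z1 Z2 T_T[OF x]
      T_pull[OF x] T_s[OF x] det[OF x] lin_eq[OF x]]
  show e: "lifted x = span {Z' x, T' x}" by (rule l(1))
  have "dim (span {Z' x, T' x}) = 2" by (rule l(2))
  then show "dim (lifted x) = 2" using e by simp
qed

end

locale good_lifting = lifting +
  fixes k \<eta>
  assumes g: "good D k S Z A \<eta>"
begin

lemmas G = goodD[OF g]

text \<open>The sign comes from [Z', T'] = - L A, which propagates through all iterated
  brackets.\<close>

abbreviation \<eta>' where "\<eta>' \<equiv> \<lambda>x. (- 1) *\<^sub>R L \<eta> x"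

lemma vad: "vf (adn Z A i)" and vad': "MN.vf (adn Z' T' i)" and v\<eta>': "MN.vf \<eta>'"
  by (rule vf_adn[OF Z] MN.vf_adn[OF vZ' vT] MN.vf_scale[OF MN.sm_const vL[OF G(4)]])+

lemma br_scaled_L:
  assumes "MN.vf V" "vf F" "MN.vf W" "x \<in> O'" "\<And>x. x \<in> O' \<Longrightarrow> W x = (- 1) *\<^sub>R L F x"
  shows "lie_bracket V W x = (- 1) *\<^sub>R lie_bracket V (L F) x"
  by (rule MN.br_scaled[OF assms(1,3) vL[OF assms(2)] O'(1) assms(4,5)])

text \<open>Each further bracket with \<open>Z'\<close> would contribute \<open>s\<close> times the
  lift of [A, ad(Z)^i A], which vanishes for \<open>i \<le> 2 * k\<close>. Hence the formula reaches
  exactly \<open>i = 2 * k + 1\<close>.\<close>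

lemma adn_lift: "i \<le> 2 * k + 1 \<Longrightarrow> x \<in> O' \<Longrightarrow> adn Z' T' (Suc i) x = (- 1) *\<^sub>R L (adn Z A i) x"
proof (induct i arbitrary: x)
  case 0
  then show ?case using br_Z_T by simp
next
  case (Suc i)
  have "adn Z' T' (Suc (Suc i)) x = lie_bracket Z' (adn Z' T' (Suc i)) x" by (rule fun_cong[OF adn.simps(2)])
  also have "\<dots> = (- 1) *\<^sub>R lie_bracket Z' (L (adn Z A i)) x"
    by (rule br_scaled_L[OF vZ' vad vad' Suc.prems(2) Suc.hyps]) (use Suc.prems in auto)
  also have "lie_bracket Z' (L (adn Z A i)) x = L (adn Z A (Suc i)) x"
    unfolding br_Z_L[OF Suc.prems(2) vad] adn.simps
    using L_zero[OF Suc.prems(2) vf_br[OF Z(2) vad] G(7)[OF O'(2)[OF Suc.prems(2)]], of i] Suc.prems by simp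
  finally show ?case .
qed

text \<open>The first order at which [A, ad(Z)^i A] is not 0 but \<open>\<eta>\<close>, so that the
  fibre coordinate enters for the first time.\<close>

lemma adn_lift_top:
  assumes x: "x \<in> O'"
  shows "adn Z' T' (2 * k + 3) x = (- 1) *\<^sub>R L (adn Z A (2 * k + 2)) x + (- 1 * s x) *\<^sub>R L \<eta> x"
proof -
  have "adn Z' T' (2 * k + 3) x = lie_bracket Z' (adn Z' T' (Suc (2 * k + 1))) x"
    by (simp add: eval_nat_numeral)
  also have "\<dots> = (- 1) *\<^sub>R lie_bracket Z' (L (adn Z A (2 * k + 1))) x"
    by (rule br_scaled_L[OF vZ' vad vad' x adn_lift]) auto
  also have "lie_bracket Z' (L (adn Z A (2 * k + 1))) x = L (adn Z A (2 * k + 2)) x + s x *\<^sub>R L \<eta> x"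
    unfolding br_Z_L[OF x vad]
    using L_scale[OF x G(4) vf_br[OF Z(2) vad], of "2 * k + 1" 1] G(8)[OF O'(2)[OF x]] by simp
  finally show ?thesis by (simp add: scaleR_add_right)
qed

text \<open>\<open>T'\<close> together with the lifts of the old \<open>k + 5\<close> fields is
  independent, as one sees on \<open>s\<close> and on pulled-back functions. These
  \<open>k + 6\<close> vectors lie in the span of the \<open>k + 6\<close> new ones, so exchange
  applies.\<close>

lemma frame_indep_lift:
  assumes x: "x \<in> O'" shows "fam_indep (GI (Suc k + 2)) (\<lambda>g. fr Z' T' \<eta>' g x)"
proof -
  let ?F = "fr Z A \<eta>" and ?G = "GI (k + 2)" and ?w = "\<lambda>g. fr Z' T' \<eta>' g x"
  \<comment> \<open>The generator \<open>gY\<close> does not belong to \<open>GI\<close> and serves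
    as a spare index for the vertical field.\<close>
  define v where "v g = (if g = gY then T' x else L (?F g) x)" for g
  have vF: "vf (?F g)" for g by (rule vf_fr[OF G(2-4)])
  have p: "\<pi> x \<in> S" "\<pi> x \<in> points M" using O'(2)[OF x] opn_sub[OF G(1)] by auto
  have gY: "gY \<notin> ?G" by (auto simp: GI_def)
  have "fam_indep (insert gY ?G) v"
    unfolding fam_indep_def
  proof (intro allI impI)
    fix c assume "(\<Sum>g\<in>insert gY ?G. c g *\<^sub>R v g) = 0"
    moreover have "(\<Sum>g\<in>?G. c g *\<^sub>R v g) = (\<Sum>g\<in>?G. c g *\<^sub>R L (?F g) x)"
      by (rule sum.cong) (use gY in \<open>auto simp: v_def\<close>)
    ultimately have "c gY *\<^sub>R T' x + (\<Sum>g\<in>?G. c g *\<^sub>R L (?F g) x) = 0" using gY by (simp add: v_def)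
    then have e: "c gY * T' x h + (\<Sum>g\<in>?G. c g * L (?F g) x h) = 0" for h
      by (drule_tac fun_cong[where x = h]) (simp add: fun_arith sum_apply)
    have cY: "c gY = 0" using e[of s] by (simp add: T_s[OF x] L_s[OF x vF])
    have "(\<Sum>g\<in>?G. c g *\<^sub>R ?F g (\<pi> x)) = 0"
    proof (rule tvec_eqI)
      show "(\<Sum>g\<in>?G. c g *\<^sub>R ?F g (\<pi> x)) \<in> T (\<pi> x)"
        by (intro subspace_sum[OF subspace_T] subspace_scale[OF subspace_T] vf_T[OF vF p(2)])
      show "(0 :: 'a tvec) \<in> T (\<pi> x)" by (rule subspace_0[OF subspace_T])
      fix f assume f: "smooth_fun M f"
      show "(\<Sum>g\<in>?G. c g *\<^sub>R ?F g (\<pi> x)) f = 0 f"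
        using e[of "\<lambda>z. f (\<pi> z)"] by (simp add: T_pull[OF x f] L_pull[OF x vF f] fun_arith sum_apply)
    qed
    then show "\<forall>g\<in>insert gY ?G. c g = 0" using G(10)[OF p(1)] cY unfolding fam_indep_def by blast
  qed
  moreover have "v ` insert gY ?G \<subseteq> span (?w ` GI (Suc k + 2))"
  proof clarify
    fix g assume g: "g \<in> insert gY ?G"
    have sb: "?w h \<in> span (?w ` GI (Suc k + 2))" if "h \<in> GI (Suc k + 2)" for h using that by (intro span_base) auto
    have E: "adn Z' T' i x \<in> span (?w ` GI (Suc k + 2))" if "i \<le> k + 3" for i
      using sb[OF Eps_GI(1)[of i "Suc k + 2"]] that by simp
    have e: "L \<eta> x \<in> span (?w ` GI (Suc k + 2))"
      using span_neg[OF sb[OF Eps_GI(3)]] by simp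
    have AL: "L (adn Z A i) x \<in> span (?w ` GI (Suc k + 2))" if i: "i \<le> k + 2" for i
    proof (cases "i \<le> 2 * k + 1")
      case True
      then show ?thesis using span_neg[OF E[of "Suc i"]] adn_lift[OF True x] i by simp
    next
      case False
      \<comment> \<open>Together with \<open>i \<le> k + 2\<close> this case occurs for
        \<open>k = 0\<close> only; the term in \<eta> is then removed with the help of
        \<eta>'.\<close>
      then have i': "i = 2 * k + 2" "2 * k + 3 \<le> k + 3" using i by auto
      have "L (adn Z A i) x = (- 1) *\<^sub>R adn Z' T' (2 * k + 3) x + (- s x) *\<^sub>R L \<eta> x"
        unfolding i'(1) adn_lift_top[OF x] by (simp add: scaleR_add_right)
      then show ?thesis by (simp only:) (intro span_add span_scale E i'(2) e)
    qed
    have zL: "L Z x \<in> span (?w ` GI (Suc k + 2))"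
      using span_diff[OF sb[OF Eps_GI(2)] span_scale[OF AL[of 0], of "s x"]] by simp
    show "v g \<in> span (?w ` GI (Suc k + 2))"
    proof (cases "g = gY")
      case True
      then show ?thesis using E[of 0] by (simp add: v_def)
    next
      case False
      then have "g \<in> ?G" using g by simp
      then show ?thesis
      proof (cases rule: GI_cases)
        case 1 then show ?thesis using zL by (simp add: v_def)
      next
        case 2 then show ?thesis using e by (simp add: v_def)
      next
        case (3 i) then show ?thesis using AL[of i] by (simp add: v_def)
      qed
    qed
  qed
  ultimately show ?thesis
    by (rule fam_indep_span_trans(1)[rotated]) (simp_all only: card_GI finite_GI finite_insert card_insert_disjoint[OF finite_GI gY])
qed

lemma br_T_top:
  assumes x: "x \<in> O'" shows "lie_bracket T' (adn Z' T' (2 * k + 3)) x = (- 1) *\<^sub>R L \<eta> x"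
proof -
  let ?F = "adn Z A (2 * k + 2)"
  note v = MN.vf_scale[OF MN.sm_const[of "- 1"] vL[OF vad]] MN.vf_scale[OF MN.sm_cmult[OF s, of "- 1"] vL[OF G(4)]]
  have "lie_bracket T' (adn Z' T' (2 * k + 3)) x = lie_bracket T' (\<lambda>x. (- 1) *\<^sub>R L ?F x + (- 1 * s x) *\<^sub>R L \<eta> x) x"
    by (rule MN.br_local[OF vT vT vad' MN.vf_add[OF v] O'(1) x refl adn_lift_top])
  also have "\<dots> = (- 1) *\<^sub>R L \<eta> x"
    unfolding MN.br_add_right[OF vT v O_pts[OF x]] MN.br_scale_right[OF vT vL[OF vad] MN.sm_const O_pts[OF x]]
      MN.br_scale_right[OF vT vL[OF G(4)] MN.sm_cmult[OF s] O_pts[OF x]]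
      br_T_L[OF x vad] br_T_L[OF x G(4)]
    by (simp add: MN.tv_const[OF T_T[OF x]] MN.tv_cmult[OF T_T[OF x] s, of "- 1", simplified] T_s[OF x])
  finally show ?thesis .
qed

text \<open>For \<open>a = 0\<close> this is the vanishing of [T', L \<eta>]; for \<open>a\<close> =
  j + 1 it comes from [ad(Z)^j A, \<eta>] = 0 downstairs. The range of this relation therefore grows
  by one with every prolongation.\<close>

lemma br_adn_top:
  assumes x: "x \<in> O'" and a: "a < Suc k" shows "lie_bracket (adn Z' T' a) \<eta>' x = 0"
proof -
  have e: "lie_bracket (adn Z' T' a) \<eta>' x = (- 1) *\<^sub>R lie_bracket (adn Z' T' a) (L \<eta>) x"
    by (rule br_scaled_L[OF vad' G(4) v\<eta>' x refl])
  show ?thesis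
  proof (cases a)
    case 0
    then show ?thesis using e br_T_L[OF x G(4)] by simp
  next
    case (Suc j)
    have "lie_bracket (L \<eta>) (adn Z' T' (Suc j)) x = (- 1) *\<^sub>R lie_bracket (L \<eta>) (L (adn Z A j)) x"
      by (rule br_scaled_L[OF vL[OF G(4)] vad vad' x adn_lift]) (use Suc a in auto)
    also have "lie_bracket (L \<eta>) (L (adn Z A j)) x = L (lie_bracket \<eta> (adn Z A j)) x" by (rule br_L_L[OF x G(4) vad])
    also have "\<dots> = 0"
      by (rule L_zero[OF x vf_br[OF G(4) vad]])
        (use G(9)[OF O'(2)[OF x], of j] br_antisym[of \<eta> "adn Z A j"] Suc a in simp)
    finally show ?thesis using e br_antisym[of "adn Z' T' a" "L \<eta>" x] Suc by simp
  qed
qed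

text \<open>For the density clause, \<open>box\<close> provides an open set downstairs inside the
  projection of \<open>O1\<close>, and thus a point below where all tangent vectors are generated.
  Above it, a vector is the lift of a generated field plus \<open>v s\<close> times
  \<open>T'\<close>, as its values on \<open>s\<close> and on pulled-back functions show.\<close>

lemma good_lift:
  assumes E: "\<And>x. x \<in> points N \<Longrightarrow> D' x = lifted x"
    and box: "\<And>O1. PN.opn O1 \<Longrightarrow> O1 \<noteq> {} \<Longrightarrow> \<exists>Q. opn Q \<and> Q \<noteq> {} \<and> Q \<subseteq> \<pi> ` O1"
  shows "MN.good D' (Suc k) O' Z' T' \<eta>'"
  unfolding MN.good_def
proof (intro conjI ballI allI impI)
  show "PN.opn O'" "MN.vf Z'" "MN.vf T'" "MN.vf \<eta>'" by (rule O'(1) vZ' vT v\<eta>')+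
  fix x assume x: "x \<in> O'"
  show "D' x = span {Z' x, T' x}" "dim (D' x) = 2" unfolding E[OF O_pts[OF x]] by (rule frame_lifted[OF x])+
  show "lie_bracket T' (adn Z' T' i) x = 0" if i: "i \<le> 2 * Suc k" for i
  proof (cases i)
    case 0
    then show ?thesis by (simp add: br_self)
  next
    case (Suc j)
    have "lie_bracket T' (adn Z' T' (Suc j)) x = (- 1) *\<^sub>R lie_bracket T' (L (adn Z A j)) x"
      by (rule br_scaled_L[OF vT vad vad' x adn_lift]) (use Suc i in auto)
    then show ?thesis using br_T_L[OF x vad] Suc by simp
  qed
  show "lie_bracket T' (adn Z' T' (2 * Suc k + 1)) x = (- 1) *\<^sub>R L \<eta> x"
    using br_T_top[OF x] by (simp add: eval_nat_numeral)
  show "lie_bracket (adn Z' T' a) \<eta>' x = 0" if "a < Suc k" for a by (rule br_adn_top[OF x that])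
  show "fam_indep (GI (Suc k + 2)) (\<lambda>g. fr Z' T' \<eta>' g x)" by (rule frame_indep_lift[OF x])
next
  fix O1 assume O1: "PN.opn O1" "O1 \<subseteq> O'" "O1 \<noteq> {}"
  obtain Q where Q: "opn Q" "Q \<noteq> {}" "Q \<subseteq> \<pi> ` O1" using box[OF O1(1,3)] by blast
  have QS: "Q \<subseteq> S"
  proof
    fix q assume "q \<in> Q"
    then obtain x where "x \<in> O1" "q = \<pi> x" using Q(3) by blast
    then show "q \<in> S" using O'(2)[of x] O1(2) by blast
  qed
  obtain p where p: "p \<in> Q" "\<And>v. v \<in> T p \<Longrightarrow> \<exists>V. liegen Z A V \<and> V p = v"
    using G(11)[OF Q(1) QS Q(2)] by blast
  obtain x where x: "x \<in> O1" "\<pi> x = p" using p(1) Q(3) by blast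
  have xO: "x \<in> O'" using x(1) O1(2) by blast
  have "\<exists>V. MN.liegen Z' T' V \<and> V x = v" if v: "v \<in> MN.T x" for v
  proof -
    obtain V where V: "liegen Z A V" "V p = pushforward M \<pi> v" using p(2) push_T[OF v O_pts[OF xO]] x(2) by auto
    note vV = liegen_vf[OF V(1) Z]
    obtain V' where V': "MN.liegen Z' T' V'" "\<forall>x\<in>O'. V' x = L V x" using liegen_lift[OF V(1)] by blast
    have "MN.liegen Z' T' (\<lambda>y. V' y + v s *\<^sub>R T' y)" by (intro MN.gen_add MN.gen_scale V'(1) MN.gen_T MN.sm_const)
    moreover have "V' x + v s *\<^sub>R T' x = v"
    proof (rule det[OF xO _ v])
      show "V' x + v s *\<^sub>R T' x \<in> MN.T x" using V'(2) xO
        by (simp add: subspace_add[OF MN.subspace_T] subspace_scale[OF MN.subspace_T] T_T L_T vV)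
      show "(V' x + v s *\<^sub>R T' x) s = v s" using V'(2) xO by (simp add: fun_arith T_s L_s vV)
      show "(V' x + v s *\<^sub>R T' x) (\<lambda>z. f (\<pi> z)) = v (\<lambda>z. f (\<pi> z))" if f: "smooth_fun M f" for f
        using V'(2) xO L_pull[OF xO vV f] T_pull[OF xO f] V(2) x(2) f by (simp add: fun_arith pushforward_def comp_def)
    qed
    ultimately show ?thesis by (intro exI[of _ "\<lambda>y. V' y + v s *\<^sub>R T' y"]) simp
  qed
  then show "\<exists>p\<in>O1. \<forall>v\<in>MN.T p. \<exists>V. MN.liegen Z' T' V \<and> V p = v" using x(1) by blast
qed

end

section \<open>The induction step, the induction and the conclusion\<close>

context prolongation
begin

lemma lifting_exists:
  assumes "vf Z" "vf A" "opn S" "\<And>p. p \<in> S \<Longrightarrow> D p = span {Z p, A p}" "\<And>p. p \<in> S \<Longrightarrow> dim (D p) = 2"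
    "x0 \<in> points N" "\<pi> x0 \<in> S" "lin x0 \<noteq> span {A (\<pi> x0)}"
  obtains O' s T' L where "lifting M D N \<pi> lin S Z A O' s T' L" "x0 \<in> O'"
proof (rule lift_exists[OF assms], assumption, assumption, goal_cases)
  case (1 O' s T' L)
  have "lifting M D N \<pi> lin S Z A O' s T' L"
    by (rule lifting.intro[OF prolongation_axioms lifting_axioms.intro]) (fact assms(1,2) 1)+
  then show ?case using 1(3) by (rule that)
qed

text \<open>The frame \<open>Z'\<close>, \<open>T'\<close> exists off the line spanned by
  \<open>A\<close>; at that line the roles of \<open>Z\<close> and \<open>A\<close> are
  exchanged.\<close>

lemma rank2_lifted:
  assumes D': "\<And>x. x \<in> points N \<Longrightarrow> D' x = lifted x"
  shows "rank2_distribution N D'"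
  unfolding rank2_distribution_def
proof
  fix x assume x: "x \<in> points N"
  note px = pt_props(1)[OF x]
  have gen: "\<exists>S V W. x \<in> S \<and> local_frame N D' S V W"
    if Z: "vf Z" "vf A" "opn S" "\<And>p. p \<in> S \<Longrightarrow> D p = span {Z p, A p}" "\<And>p. p \<in> S \<Longrightarrow> dim (D p) = 2"
      "\<pi> x \<in> S" "lin x \<noteq> span {A (\<pi> x)}" for S Z A
  proof -
    obtain O' s T' L where l: "lifting M D N \<pi> lin S Z A O' s T' L" and xO: "x \<in> O'"
      by (rule lifting_exists[OF Z(1-5) x Z(6,7)]) blast
    interpret l: lifting M D N \<pi> lin S Z A O' s T' L by (rule l)
    have "local_frame N D' O' l.Z' T'"
      unfolding local_frame_def
      using l.O'(1) MN.vf_restrict[OF l.vZ' l.O'(1)] MN.vf_restrict[OF l.vT l.O'(1)] l.frame_lifted D'[OF l.O_pts] by auto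
    then show ?thesis using xO by blast
  qed
  obtain S Z A where S: "opn S" "\<pi> x \<in> S" and Z: "vf Z" "vf A"
    and DS: "\<And>p. p \<in> S \<Longrightarrow> D p = span {Z p, A p}" "\<And>p. p \<in> S \<Longrightarrow> dim (D p) = 2"
    by (rule frame_global[OF rank2 opn_points px]) blast
  have "span {Z (\<pi> x)} \<noteq> span {A (\<pi> x)}"
    using line_not_second[of "Z (\<pi> x)" "A (\<pi> x)" 1 0] DS[OF S(2)] by simp
  then consider "lin x \<noteq> span {A (\<pi> x)}" | "lin x \<noteq> span {Z (\<pi> x)}" by auto
  then show "\<exists>S V W. x \<in> S \<and> local_frame N D' S V W"
  proof cases
    case 1
    show ?thesis by (rule gen[OF Z S(1) DS S(2) 1])
  next
    case 2
    have "D p = span {A p, Z p}" if "p \<in> S" for p using DS(1)[OF that] by (simp add: insert_commute)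
    then show ?thesis by (rule gen[OF Z(2,1) S(1) _ DS(2) S(2) 2])
  qed
qed

text \<open>A good set below is found inside a set \<open>Q\<close> over which \<open>O1\<close>
  always contains a line other than any prescribed one. Choosing a line different from that of
  \<open>A\<close> makes the lift available at a point of \<open>O1\<close>, and the result is
  restricted to \<open>O1\<close>.\<close>

lemma good_prolong:
  assumes D': "\<And>x. x \<in> points N \<Longrightarrow> D' x = lifted x"
    and dense: "\<And>O1. opn O1 \<Longrightarrow> O1 \<noteq> {} \<Longrightarrow> \<exists>S Z A \<eta>. good D k S Z A \<eta> \<and> S \<noteq> {} \<and> S \<subseteq> O1"
    and O1: "PN.opn O1" "O1 \<noteq> {}"
  shows "\<exists>S Z A \<eta>. MN.good D' (Suc k) S Z A \<eta> \<and> S \<noteq> {} \<and> S \<subseteq> O1"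
proof -
  have box: "\<exists>Q. opn Q \<and> Q \<noteq> {} \<and> Q \<subseteq> \<pi> ` O1" if O1: "PN.opn O1" "O1 \<noteq> {}" for O1
  proof -
    obtain x1 where "x1 \<in> O1" using O1(2) by blast
    then obtain Q where "opn Q" "\<pi> x1 \<in> Q" "\<And>q l. q \<in> Q \<Longrightarrow> \<exists>x\<in>O1. \<pi> x = q \<and> lin x \<noteq> l"
      by (rule box_avoiding[OF O1(1)]) blast
    then show ?thesis by blast
  qed
  obtain x1 where x1: "x1 \<in> O1" using O1(2) by blast
  obtain Q where Q: "opn Q" "\<pi> x1 \<in> Q" "\<And>q l. q \<in> Q \<Longrightarrow> \<exists>x\<in>O1. \<pi> x = q \<and> lin x \<noteq> l"
    by (rule box_avoiding[OF O1(1) x1]) blast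
  obtain S Z A \<eta> where g: "good D k S Z A \<eta>" "S \<noteq> {}" "S \<subseteq> Q" using dense[OF Q(1)] Q(2) by blast
  note G = goodD[OF g(1)]
  obtain q where q: "q \<in> S" using g(2) by blast
  obtain x where x: "x \<in> O1" "\<pi> x = q" "lin x \<noteq> span {A q}" using Q(3)[of q "span {A q}"] q g(3) by blast
  have xN: "x \<in> points N" using x(1) O1(1) PN.opn_sub by auto
  obtain O' s T' L where l: "lifting M D N \<pi> lin S Z A O' s T' L" and xO: "x \<in> O'"
    by (rule lifting_exists[OF G(2,3,1,5,6) xN]) (use x q in auto)
  interpret l: good_lifting M D N \<pi> lin S Z A O' s T' L k \<eta>
    by (rule good_lifting.intro[OF l good_lifting_axioms.intro[OF g(1)]])
  have "MN.good D' (Suc k) O' l.Z' T' l.\<eta>'" by (rule l.good_lift[OF D' box])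
  then have "MN.good D' (Suc k) (O' \<inter> O1) l.Z' T' l.\<eta>'"
    by (rule MN.good_subset) (use openin_Int[OF l.O'(1) O1(1)] in auto)
  then show ?thesis using x(1) xO by blast
qed

end

text \<open>Good frames are only found on small sets, so the induction asserts them inside every
  nonempty open set. The manifold changes at each step, hence the constant \<open>good\<close>
  appears with its manifold as an explicit argument.\<close>

lemma prolonged_invariants:
  assumes M: "smooth_manifold M" "mdim M = n" "n \<ge> 1" and D: "rank2_distribution M D" "bracket_generating M D"
    "five_dimensional_cube M D"
  shows "smooth_manifold (prolonged_mfd k M D) \<and> mdim (prolonged_mfd k M D) = n + k \<and>
    rank2_distribution (prolonged_mfd k M D) (prolonged_dist k M D) \<and>
    (\<forall>O1. openin (mtop (prolonged_mfd k M D)) O1 \<longrightarrow> O1 \<noteq> {} \<longrightarrow>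
      (\<exists>S Z A \<eta>. manifold.good (prolonged_mfd k M D) (prolonged_dist k M D) k S Z A \<eta> \<and> S \<noteq> {} \<and> S \<subseteq> O1))"
proof (induct k)
  case 0
  interpret manifold M using M(1) by (simp add: manifold_iff)
  have "\<exists>S Z A \<eta>. good D 0 S Z A \<eta> \<and> S \<noteq> {} \<and> S \<subseteq> O1" if O1: "opn O1" "O1 \<noteq> {}" for O1
    by (rule good_base[OF D O1]) blast
  then show ?case using M D by (simp add: prolonged_mfd_def prolonged_dist_def)
next
  case (Suc k)
  let ?M = "prolonged_mfd k M D" and ?D = "prolonged_dist k M D"
  let ?N = "prolonged_mfd (Suc k) M D" and ?E = "prolonged_dist (Suc k) M D"
  have NE: "?N = fst (cartan_prolongation (?M, ?D))" "?E = snd (cartan_prolongation (?M, ?D))"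
    by (simp_all add: prolonged_mfd_def prolonged_dist_def)
  have 1: "smooth_manifold ?M" "mdim ?M \<ge> 1" "rank2_distribution ?M ?D" using Suc M(3) by auto
  obtain \<pi> lin where p: "prolongation ?M ?D ?N \<pi> lin"
    "\<And>x. x \<in> points ?N \<Longrightarrow> ?E x = {v \<in> tangent_space ?N x. pushforward ?M \<pi> v \<in> lin x}"
    unfolding NE by (rule copy_cartan[OF 1]) blast
  interpret P: prolongation ?M ?D ?N \<pi> lin by (rule p(1))
  have E: "?E x = P.lifted x" if "x \<in> points ?N" for x using p(2)[OF that] by (simp add: P.lifted_def)
  have "smooth_manifold ?N" using P.MN.manifold_axioms by (simp add: manifold_iff)
  moreover have "mdim ?N = n + Suc k" using P.mdimN Suc by simp
  moreover have "rank2_distribution ?N ?E" by (rule P.rank2_lifted[OF E])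
  moreover have "\<exists>S Z A \<eta>. P.MN.good ?E (Suc k) S Z A \<eta> \<and> S \<noteq> {} \<and> S \<subseteq> O1"
    if O1: "openin (mtop ?N) O1" "O1 \<noteq> {}" for O1
    by (rule P.good_prolong[OF E Suc[THEN conjunct2, THEN conjunct2, THEN conjunct2, rule_format] O1])
  ultimately show ?case by blast
qed

theorem theorem5p1:
  fixes M :: "'a mfd" and D :: "'a dist" and n :: nat
  assumes "n \<ge> 5"
    and "smooth_manifold M" and "mdim M = n"
    and "rank2_distribution M D"
    and "bracket_generating M D"
    and "five_dimensional_cube M D"
  shows "\<exists>S. openin (mtop (prolonged_mfd (n - 5) M D)) S \<and>
    mtop (prolonged_mfd (n - 5) M D) closure_of S = points (prolonged_mfd (n - 5) M D) \<and>
    (\<forall>q\<in>S. graded_iso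
       (tanaka_symbol (prolonged_mfd (n - 5) M D) (prolonged_dist (n - 5) M D) q)
       (s_alg (n - 5) n))"
proof -
  define k where "k = n - 5"
  have n: "n = k + 5" using assms(1) by (simp add: k_def)
  let ?M = "prolonged_mfd k M D" and ?D = "prolonged_dist k M D"
  have I: "smooth_manifold ?M" "mdim ?M = 2 * k + 5" "rank2_distribution ?M ?D"
    "\<And>O1. openin (mtop ?M) O1 \<Longrightarrow> O1 \<noteq> {} \<Longrightarrow>
      \<exists>S Z A \<eta>. manifold.good ?M ?D k S Z A \<eta> \<and> S \<noteq> {} \<and> S \<subseteq> O1"
    using prolonged_invariants[OF assms(2,3) _ assms(4-6), of k] n by auto
  interpret P: manifold ?M using I(1) by (simp add: manifold_iff)
  \<comment> \<open>The union of all domains of full adapted frames: open because each of them is,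
    and with the required symbol at each of its points.\<close>
  define S where "S = \<Union> {S'. \<exists>Z A \<eta>. symbol_frame ?M ?D k S' Z A \<eta>}"
  have "P.opn S'" if "symbol_frame ?M ?D k S' Z A \<eta>" for S' Z A \<eta>
    by (rule P.goodD(1)[OF symbol_frame.good[OF that]])
  then have "P.opn S" unfolding S_def by (intro openin_Union) blast
  moreover have "mtop ?M closure_of S = points ?M"
  proof -
    \<comment> \<open>Every nonempty open set contains a good set, and \<open>generic_frame\<close>
      shrinks it to the domain of a full frame. This is where the dimension \<open>n + k\<close> = 2
      k + 5 is used.\<close>
    have dns: "\<exists>y. y \<in> S \<and> y \<in> O1" if O1: "P.opn O1" "x \<in> O1" for x O1
    proof -
      obtain S1 Z A \<eta> where g: "P.good ?D k S1 Z A \<eta>" "S1 \<noteq> {}" "S1 \<subseteq> O1" using I(4)[OF O1(1)] O1(2) by blast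
      obtain S' where S': "P.opn S'" "S' \<noteq> {}" "S' \<subseteq> S1"
        "\<And>p. p \<in> S' \<Longrightarrow> fam_indep (GI (2 * k + 2)) (\<lambda>g. fr Z A \<eta> g p)"
        by (rule P.generic_frame[OF g(1) I(2) g(2)]) blast
      have "symbol_frame ?M ?D k S' Z A \<eta>"
        by (rule symbol_frame.intro[OF P.manifold_axioms symbol_frame_axioms.intro])
          (fact I(3) P.good_subset[OF g(1) S'(1,3)] I(2) S'(4))+
      then have "S' \<subseteq> S" unfolding S_def by blast
      then show ?thesis using S'(2,3) g(3) by blast
    qed
    show ?thesis unfolding set_eq_iff in_closure_of P.topspace_mtop using dns by blast
  qed
  moreover have "graded_iso (tanaka_symbol ?M ?D q) (s_alg k n)" if q: "q \<in> S" for q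
  proof -
    obtain S' Z A \<eta> where "symbol_frame ?M ?D k S' Z A \<eta>" "q \<in> S'" using q unfolding S_def by blast
    then show ?thesis unfolding n by (rule symbol_frame.symbol_iso)
  qed
  ultimately show ?thesis unfolding k_def by blast
qed

end
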